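(* For generic $a\in\mathfrak h^*$ there exists a representation $r_a$ of the Weyl group $\mathcal W$ on $\mathcal A$ (that is, a family of linear bijections $r_a(w):\mathcal A\to\mathcal A$, $w\in\mathcal W$, defined for generic $a$ and satisfying $r_a(1)=\mathrm{id}$ and $r_a(w'w)=r_{wa}(w')r_a(w)$) such that for any $h,h'\in\mathcal A$ and $w\in\mathcal W$ $$\tilde J^{h\bar h'}_{N,a}(x_1,\dots,x_N)_{k_1\dots k_N}=\tilde J^{(r_a(w)h)\,\overline{(r_{w_*a}(\widetilde w)h')}}_{N,wa}(x_1,\dots,x_N)_{k_1\dots k_N}$$ for all $N\ge0$ and all $k_1,\dots,k_N\in\{1,\dots,L-1\}$.
   Context: Fix an integer $L\ge2$ and an irrational $p\in(0,1)$; $\omega=e^{2\pi i/L}$ and $\omega^c:=e^{2\pi i c/L}$ for $c\in\mathbb C$. $\mathfrak h^*$ is the complex dual Cartan subalgebra of the Lie algebra $A_{L-1}$ with its invariant bilinear form $\langle\cdot,\cdot\rangle$ and simple roots $\alpha_1,\dots,\alpha_{L-1}$, $\langle\alpha_i,\alpha_j\rangle=2\delta_{ij}-\delta_{i,j+1}-\delta_{i,j-1}$. $H_1,\dots,H_L\in\mathfrak h^*$ are the weights of the first fundamental representation: $\langle\alpha_i,H_s\rangle=\delta_{is}-\delta_{i,s-1}$, $\sum_sH_s=0$. For $S\subseteq\{1,\dots,L\}$ put $H_S=\sum_{s\in S}H_s$. The Weyl group $\mathcal W$ is generated by $w_ia=a-\langle a,\alpha_i\rangle\alpha_i$, $i=1,\dots,L-1$.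 $w_*\in\mathcal W$ is the element with $w_*H_s=H_{L+1-s}$ (equivalently $w_*\alpha_i=-\alpha_{L-i}$), and $\widetilde w=w_*ww_*$. "For generic $a$" means: for all $a\in\mathfrak h^*$ outside a countable union of zero sets of entire functions on $\mathfrak h^*$ that are not identically zero; the exceptional set may be taken $\mathcal W$-invariant. **Algebras.** $\mathcal A$ is the free commutative (polynomial) $\mathbb C$-algebra on generators $\alpha_ic_{-n}$, $1\le i\le L-1$, $n\ge1$; $\bar{\mathcal A}$ is a second copy, with generators $\alpha_i\bar c_{-n}$, and $h\mapsto\bar h$ is the canonical isomorphism $\mathcal A\to\bar{\mathcal A}$. **Heisenberg algebra.** Generators $d^{(s)}_n$, $s=1,\dots,L$, $n\in\mathbb Z\setminus\{0\}$, with $$[d^{(s)}_m,d^{(s)}_n]=0,\qquad[d^{(s')}_m,d^{(s)}_n]=m\,\delta_{m+n,0}\,A^{\operatorname{sign}(s'-s)}_m\ (s'\ne s),\qquad A^\pm_n=(\omega^{\mp pn}-\omega^{\mp n})(1-\omega^{\pm pn}).$$ Vacuums $|1\rangle_a$, ${}_a\langle1|$, labelled by $a\in\mathfrak h^*$: $d^{(s)}_n|1\rangle_a=0$, ${}_a\langle1|d^{(s)}_{-n}=0$ for $n>0$, ${}_a\langle1|1\rangle_a=1$. Normal ordering $:\cdots:$ places $d^{(s)}_n$ with $n>0$ to the right of those with $n<0$. Vertex operators: $$\lambda_s(z)=\exp\sum_{n\ne0}\frac{d^{(s)}_n}nz^{-n},\qquad\lambda_{s_1\dots s_k}(z)=\;:\prod_{m=1}^k\lambda_{s_m}\bigl(z\omega^{\frac{k+1-2m}2}\bigr):\quad(s_1<\dots<s_k).$$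 One has $\lambda_s(z')\lambda_s(z)=\,:\lambda_s(z')\lambda_s(z):$ and, for $s'>s$, $\lambda_{s'}(z')\lambda_s(z)=\lambda_s(z)\lambda_{s'}(z')=f(z/z'):\lambda_{s'}(z')\lambda_s(z):$ with $f(z)=\frac{(z-\omega^p)(z-\omega^{1-p})}{(z-1)(z-\omega)}$, after analytic continuation; matrix elements of products of vertex operators are understood as the resulting rational functions. Put, acting in the modules labelled by $a$, $$t_k(z)=\sum_{1\le s_1<\dots<s_k\le L}\omega^{\langle a,H_{\{s_1,\dots,s_k\}}\rangle}\lambda_{s_1\dots s_k}(z).$$ **Functions $\tilde J$.** Define algebra homomorphisms $\pi_R,\pi_L$ from $\mathcal A$ to the universal enveloping algebra of the Heisenberg algebra by $$\pi_R(\alpha_ic_{-n})=\frac{\omega^{-\frac{L+1-2i}2n}}{A^+_n}\bigl(d^{(i)}_n-d^{(i+1)}_n\bigr),\qquad\pi_L(\alpha_ic_{-n})=\frac{\omega^{-\frac{L+1-2i}2n}}{A^+_n}\bigl(d^{(L-i)}_{-n}-d^{(L+1-i)}_{-n}\bigr).$$ For $h,h'\in\mathcal A$, $$\tilde J^{h\bar h'}_{N,a}(x_1,\dots,x_N)_{k_1\dots k_N}={}_a\langle1|\,\pi_R(h)\,t_{k_1}(x_1)\cdots t_{k_N}(x_N)\,\pi_L(h')\,|1\rangle_a,$$ a rational function of $x_1,\dots,x_N$. *)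

theory Defs
  imports "HOL-Analysis.Analysis" "HOL-Library.Poly_Mapping"
begin

section \<open>Weights, roots and the Weyl group of type \<open>A\<close>\<close>

definition omega_pow :: "nat \<Rightarrow> complex \<Rightarrow> complex" where
  "omega_pow L c = exp (2 * of_real pi * \<i> * c / of_nat L)"

text \<open>The dual Cartan subalgebra of rank \<open>L - 1\<close> is realised as the space of vectors
  \<open>(a 1, \<dots>, a L)\<close> of sum zero, with the bilinear (not Hermitian) form \<open>hform\<close>;
  entries with index outside \<open>{1..L}\<close> are \<open>0\<close>.\<close>

definition hdual :: "nat \<Rightarrow> (nat \<Rightarrow> complex) set" where
  "hdual L = {a. (\<forall>s. s \<notin> {1..L} \<longrightarrow> a s = 0) \<and> (\<Sum>s=1..L. a s) = 0}"

definition hform :: "nat \<Rightarrow> (nat \<Rightarrow> complex) \<Rightarrow> (nat \<Rightarrow> complex) \<Rightarrow> complex" where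
  "hform L a b = (\<Sum>s=1..L. a s * b s)"

definition simple_root :: "nat \<Rightarrow> nat \<Rightarrow> complex" where
  "simple_root i s = (if s = i then 1 else if s = Suc i then -1 else 0)"

definition fund_weight :: "nat \<Rightarrow> nat \<Rightarrow> nat \<Rightarrow> complex" where
  "fund_weight L t s = (if s \<in> {1..L} then (if s = t then 1 else 0) - 1 / of_nat L else 0)"

definition weight_of_set :: "nat \<Rightarrow> nat set \<Rightarrow> nat \<Rightarrow> complex" where
  "weight_of_set L S = (\<lambda>s. \<Sum>t\<in>S. fund_weight L t s)"

definition simple_refl :: "nat \<Rightarrow> nat \<Rightarrow> (nat \<Rightarrow> complex) \<Rightarrow> (nat \<Rightarrow> complex)" where
  "simple_refl L i a = (\<lambda>s. a s - hform L a (simple_root i) * simple_root i s)"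

text \<open>The simple reflections are involutions, so closure under composition suffices to generate
  the group.  The maps are defined on all of \<^typ>\<open>nat \<Rightarrow> complex\<close>, where they permute the entries
  \<open>1, \<dots>, L\<close>; for \<open>L \<ge> 2\<close> such a map is determined by its restriction to \<open>hdual L\<close>.\<close>

inductive_set weyl :: "nat \<Rightarrow> ((nat \<Rightarrow> complex) \<Rightarrow> (nat \<Rightarrow> complex)) set" for L where
  weyl_id: "id \<in> weyl L"
| weyl_step: "w \<in> weyl L \<Longrightarrow> i \<in> {1..L-1} \<Longrightarrow> simple_refl L i \<circ> w \<in> weyl L"

definition wstar :: "nat \<Rightarrow> (nat \<Rightarrow> complex) \<Rightarrow> (nat \<Rightarrow> complex)" where
  "wstar L a = (\<lambda>s. if s \<in> {1..L} then a (L + 1 - s) else a s)"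

definition wtilde :: "nat \<Rightarrow> ((nat \<Rightarrow> complex) \<Rightarrow> (nat \<Rightarrow> complex)) \<Rightarrow> (nat \<Rightarrow> complex) \<Rightarrow> (nat \<Rightarrow> complex)" where
  "wtilde L w = wstar L \<circ> w \<circ> wstar L"

lemma hform_simple_roots:
  assumes "i \<in> {1..L-1}" "j \<in> {1..L-1}"
  shows "hform L (simple_root i) (simple_root j) =
    (if i = j then 2 else if i = Suc j \<or> j = Suc i then -1 else 0)"
proof -
  have "hform L (simple_root i) (simple_root j) =
     (\<Sum>s=1..L. (if s = i then simple_root j i else 0) - (if s = Suc i then simple_root j (Suc i) else 0))"
    unfolding hform_def by (rule sum.cong) (auto simp: simple_root_def)
  also have "\<dots> = simple_root j i - simple_root j (Suc i)"
    using assms by (auto simp: sum_subtractf)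
  finally show ?thesis by (auto simp: simple_root_def)
qed

lemma hform_simple_root:
  assumes "i \<in> {1..L-1}"
  shows "hform L a (simple_root i) = a i - a (Suc i)"
proof -
  have "hform L a (simple_root i) =
     (\<Sum>s=1..L. (if s = i then a i else 0) - (if s = Suc i then a (Suc i) else 0))"
    unfolding hform_def by (rule sum.cong) (auto simp: simple_root_def)
  also have "\<dots> = a i - a (Suc i)"
    using assms by (auto simp: sum_subtractf)
  finally show ?thesis .
qed

lemma hform_simple_root_weight:
  assumes "i \<in> {1..L-1}" "s \<in> {1..L}"
  shows "hform L (simple_root i) (fund_weight L s) =
    (if i = s then 1 else 0) - (if Suc i = s then 1 else 0)"
proof -
  have "hform L (simple_root i) (fund_weight L s) = hform L (fund_weight L s) (simple_root i)"
    by (simp add: hform_def mult.commute)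
  then show ?thesis
    using assms by (auto simp: hform_simple_root fund_weight_def)
qed

lemma simple_refl_eq:
  assumes "i \<in> {1..L-1}"
  shows "simple_refl L i a = a \<circ> Transposition.transpose i (Suc i)"
  by (rule ext) (auto simp: simple_refl_def hform_simple_root[OF assms] simple_root_def Transposition.transpose_def)

lemma weyl_comp: "v \<in> weyl L \<Longrightarrow> w \<in> weyl L \<Longrightarrow> v \<circ> w \<in> weyl L"
  by (induction rule: weyl.induct) (auto simp: comp_assoc intro: weyl.intros)

lemma weyl_transpose:
  assumes "1 \<le> i" "i < j" "j \<le> L"
  shows "(\<lambda>a. a \<circ> Transposition.transpose i j) \<in> weyl L"
  using assms(2,3)
proof (induction j)
  case (Suc j)
  have S: "simple_refl L j \<in> weyl L" if "j \<ge> 1"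
    using weyl_step[OF weyl_id, of j L] that Suc.prems by simp
  show ?case
  proof (cases "i = j")
    case True
    have "(\<lambda>a. a \<circ> Transposition.transpose i (Suc j)) = simple_refl L j"
      using True assms Suc.prems by (intro ext) (simp add: simple_refl_eq)
    with S True assms show ?thesis by (metis (no_types, lifting))
  next
    case False
    then have ij: "i < j" using Suc.prems by simp
    let ?t = "\<lambda>a::nat \<Rightarrow> complex. a \<circ> Transposition.transpose i j"
    have T: "?t \<in> weyl L" by (rule Suc.IH[OF ij]) (use Suc.prems in simp)
    have "simple_refl L j \<circ> ?t \<circ> simple_refl L j \<in> weyl L"
      by (intro weyl_comp T S) (use ij assms in simp_all)
    moreover have "simple_refl L j \<circ> ?t \<circ> simple_refl L j = (\<lambda>a. a \<circ> Transposition.transpose i (Suc j))"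
      using ij assms Suc.prems
      by (intro ext) (auto simp: simple_refl_eq Transposition.transpose_def)
    ultimately show ?thesis by (simp only:)
  qed
qed simp

lemma wstar_in_weyl: "wstar L \<in> weyl L"
proof -
  define r where "r m s = (if s \<in> {1..L} \<and> (s \<le> m \<or> L + 1 - s \<le> m) then L + 1 - s else s)" for m s :: nat
  have "(\<lambda>a. a \<circ> r m) \<in> weyl L" if "2 * m \<le> L" for m
    using that
  proof (induction m)
    case 0
    have "r 0 = id" by (intro ext) (auto simp: r_def)
    then have "(\<lambda>a::nat \<Rightarrow> complex. a \<circ> r 0) = id" by auto
    then show ?case by (simp only: weyl_id)
  next
    case (Suc m)
    let ?t = "\<lambda>a::nat \<Rightarrow> complex. a \<circ> Transposition.transpose (Suc m) (L - m)"
    have "?t \<circ> (\<lambda>a. a \<circ> r m) \<in> weyl L"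
      by (intro weyl_comp weyl_transpose Suc.IH) (use Suc.prems in auto)
    moreover have "r m (Transposition.transpose (Suc m) (L - m) s) = r (Suc m) s" for s
      using Suc.prems unfolding r_def Transposition.transpose_def by auto
    then have "?t \<circ> (\<lambda>a. a \<circ> r m) = (\<lambda>a. a \<circ> r (Suc m))"
      by (intro ext) simp
    ultimately show ?case by (simp only:)
  qed
  from this[of "L div 2"] have "(\<lambda>a. a \<circ> r (L div 2)) \<in> weyl L" by simp
  moreover have "(\<lambda>a. a \<circ> r (L div 2)) = wstar L"
  proof (intro ext)
    fix a :: "nat \<Rightarrow> complex" and s
    have "s \<in> {1..L} \<Longrightarrow> \<not> (s \<le> L div 2 \<or> L + 1 - s \<le> L div 2) \<Longrightarrow> L + 1 - s = s"
      by auto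
    then show "(a \<circ> r (L div 2)) s = wstar L a s"
      by (auto simp: r_def wstar_def)
  qed
  ultimately show ?thesis by simp
qed

lemma wstar_fund_weight: "s \<in> {1..L} \<Longrightarrow> wstar L (fund_weight L s) = fund_weight L (L + 1 - s)"
  by (intro ext) (auto simp: wstar_def fund_weight_def)


section \<open>Generic weights\<close>

text \<open>Holomorphy in several variables: continuity (the product topology restricted to the
  finite-dimensional space \<open>hdual L\<close> is its usual topology) and holomorphy along every complex
  line.  Values of \<open>F\<close> outside \<open>hdual L\<close> are irrelevant.\<close>

definition entire_on_hdual :: "nat \<Rightarrow> ((nat \<Rightarrow> complex) \<Rightarrow> complex) \<Rightarrow> bool" where
  "entire_on_hdual L F \<longleftrightarrow> continuous_on (hdual L) F \<and>
     (\<forall>a\<in>hdual L. \<forall>v\<in>hdual L. (\<lambda>z. F (\<lambda>s. a s + z * v s)) holomorphic_on UNIV)"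

definition exceptional_set :: "nat \<Rightarrow> (nat \<Rightarrow> complex) set \<Rightarrow> bool" where
  "exceptional_set L E \<longleftrightarrow> (\<exists>F :: nat \<Rightarrow> (nat \<Rightarrow> complex) \<Rightarrow> complex.
     (\<forall>n. entire_on_hdual L (F n) \<and> (\<exists>a\<in>hdual L. F n a \<noteq> 0)) \<and>
     E = (\<Union>n. {a \<in> hdual L. F n a = 0}))"


section \<open>Polynomial algebras\<close>

type_synonym pol = "((nat \<times> nat) \<Rightarrow>\<^sub>0 nat) \<Rightarrow>\<^sub>0 complex"

definition scal :: "complex \<Rightarrow> pol \<Rightarrow> pol" where
  "scal c u = Poly_Mapping.single 0 c * u"

definition var :: "nat \<times> nat \<Rightarrow> pol" where
  "var v = Poly_Mapping.single (Poly_Mapping.single v 1) 1"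

definition partial_deriv :: "nat \<times> nat \<Rightarrow> pol \<Rightarrow> pol" where
  "partial_deriv v u = (\<Sum>m\<in>Poly_Mapping.keys u.
     Poly_Mapping.single (m - Poly_Mapping.single v 1) (of_nat (Poly_Mapping.lookup m v) * Poly_Mapping.lookup u m))"

lemma lookup_partial_deriv:
  "Poly_Mapping.lookup (partial_deriv v u) m =
     of_nat (Poly_Mapping.lookup m v + 1) * Poly_Mapping.lookup u (m + Poly_Mapping.single v 1)"
proof -
  let ?e = "Poly_Mapping.single v (1::nat)"
  have eq: "Poly_Mapping.lookup (Poly_Mapping.single (k - ?e)
        (of_nat (Poly_Mapping.lookup k v) * Poly_Mapping.lookup u k)) m =
      (if k = m + ?e then of_nat (Poly_Mapping.lookup m v + 1) * Poly_Mapping.lookup u k else 0)" for k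
  proof (cases "Poly_Mapping.lookup k v = 0")
    case True
    then have "k \<noteq> m + ?e" by (auto simp: lookup_add)
    with True show ?thesis by simp
  next
    case False
    have "k = (k - ?e) + ?e"
    proof (rule poly_mapping_eqI)
      fix w show "Poly_Mapping.lookup k w = Poly_Mapping.lookup (k - ?e + ?e) w"
        using False by (cases "w = v") (simp_all add: lookup_add lookup_minus lookup_single)
    qed
    then have "k - ?e = m \<longleftrightarrow> k = m + ?e" by (metis add_diff_cancel_right')
    then show ?thesis by (auto simp: lookup_single lookup_add when_def)
  qed
  have "Poly_Mapping.lookup (partial_deriv v u) m =
     (\<Sum>k\<in>Poly_Mapping.keys u. if k = m + ?e then
        of_nat (Poly_Mapping.lookup m v + 1) * Poly_Mapping.lookup u k else 0)"
    by (simp only: partial_deriv_def lookup_sum eq)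
  also have "\<dots> = of_nat (Poly_Mapping.lookup m v + 1) * Poly_Mapping.lookup u (m + ?e)"
    by (simp add: in_keys_iff)
  finally show ?thesis .
qed

lemma pol_induct [case_names single add]:
  fixes u :: pol
  assumes single: "\<And>m c. P (Poly_Mapping.single m c)"
    and add: "\<And>u v. P u \<Longrightarrow> P v \<Longrightarrow> P (u + v)"
  shows "P u"
proof -
  have "P (\<Sum>m\<in>A. Poly_Mapping.single m (Poly_Mapping.lookup u m))" for A
    using single[of 0 0] by (induction A rule: infinite_finite_induct) (simp_all add: single add)
  moreover have "(\<Sum>m\<in>Poly_Mapping.keys u. Poly_Mapping.single m (Poly_Mapping.lookup u m)) = u"
    by (rule poly_mapping_eqI) (simp add: lookup_sum lookup_single when_def in_keys_iff)
  ultimately show ?thesis by metis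
qed

lemma lookup_single_times:
  fixes u :: pol
  shows "Poly_Mapping.lookup (Poly_Mapping.single k c * u) (k + m) = c * Poly_Mapping.lookup u m"
  by (induction u rule: pol_induct)
     (simp_all add: mult_single lookup_single when_def distrib_left lookup_add)

lemma lookup_scal: "Poly_Mapping.lookup (scal c u) m = c * Poly_Mapping.lookup u m"
  using lookup_single_times[of 0 c u m] by (simp add: scal_def)

lemma lookup_var_times:
  "Poly_Mapping.lookup (var v * u) m = (if Poly_Mapping.lookup m v = 0 then 0
     else Poly_Mapping.lookup u (m - Poly_Mapping.single v 1))"
proof (cases "Poly_Mapping.lookup m v = 0")
  case True
  have "Poly_Mapping.single v 1 + k \<noteq> m" for k
    using True by (auto simp: lookup_add)
  then have "Poly_Mapping.lookup (var v * u) m = 0"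
    by (induction u rule: pol_induct)
       (simp_all add: var_def mult_single lookup_single when_def distrib_left lookup_add)
  with True show ?thesis by simp
next
  case False
  have "m = Poly_Mapping.single v 1 + (m - Poly_Mapping.single v 1)"
  proof (rule poly_mapping_eqI)
    fix w show "Poly_Mapping.lookup m w =
        Poly_Mapping.lookup (Poly_Mapping.single v 1 + (m - Poly_Mapping.single v 1)) w"
      using False by (cases "w = v") (simp_all add: lookup_add lookup_minus lookup_single)
  qed
  then show ?thesis
    using False lookup_single_times[of "Poly_Mapping.single v 1" 1 u "m - Poly_Mapping.single v 1"]
    by (simp add: var_def)
qed

lemma partial_deriv_var:
  "partial_deriv v (var w * u) = (if v = w then u else 0) + var w * partial_deriv v u"
proof (rule poly_mapping_eqI)
  fix m
  have *: "v \<noteq> w \<Longrightarrow> Poly_Mapping.lookup m w \<noteq> 0 \<Longrightarrow>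
      m + Poly_Mapping.single v 1 - Poly_Mapping.single w 1 =
      m - Poly_Mapping.single w 1 + Poly_Mapping.single v (1::nat)"
    by (rule poly_mapping_eqI) (auto simp: lookup_add lookup_minus lookup_single when_def)
  have **: "Poly_Mapping.lookup m w \<noteq> 0 \<Longrightarrow>
      m - Poly_Mapping.single w 1 + Poly_Mapping.single w (1::nat) = m"
    by (rule poly_mapping_eqI) (auto simp: lookup_add lookup_minus lookup_single when_def)
  show "Poly_Mapping.lookup (partial_deriv v (var w * u)) m =
      Poly_Mapping.lookup ((if v = w then u else 0) + var w * partial_deriv v u) m"
    using * ** by (auto simp: lookup_partial_deriv lookup_var_times lookup_add lookup_minus
        lookup_single when_def distrib_right left_diff_distrib of_nat_diff add.commute add.left_commute)
qed

lemma partial_deriv_add: "partial_deriv v (u + u') = partial_deriv v u + partial_deriv v u'"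
  by (rule poly_mapping_eqI) (simp add: lookup_partial_deriv lookup_add algebra_simps)

lemma partial_deriv_scal: "partial_deriv v (scal c u) = scal c (partial_deriv v u)"
  by (rule poly_mapping_eqI) (simp add: lookup_partial_deriv lookup_scal algebra_simps)

lemma partial_deriv_commute:
  "partial_deriv v (partial_deriv w u) = partial_deriv w (partial_deriv v u)"
  by (rule poly_mapping_eqI)
     (cases "v = w"; simp add: lookup_partial_deriv lookup_add lookup_single algebra_simps)

lemma partial_deriv_sum: "partial_deriv v (sum g X) = (\<Sum>x\<in>X. partial_deriv v (g x))"
proof (induction X rule: infinite_finite_induct)
  case empty show ?case by (simp add: partial_deriv_def)
next
  case (infinite A) then show ?case by (simp add: partial_deriv_def)
qed (simp_all add: partial_deriv_add)

text \<open>The algebra \<open>\<A>\<close>: the variable \<open>(i, n)\<close> stands for the generator \<open>\<alpha>\<^sub>i c\<^sub>-\<^sub>n\<close>.  Its second copy is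
  identified with it through \<open>h \<mapsto> h\<close>-bar.\<close>

definition desc_alg :: "nat \<Rightarrow> pol set" where
  "desc_alg L = {h. \<forall>m\<in>Poly_Mapping.keys h. Poly_Mapping.keys m \<subseteq> {1..L-1} \<times> {1..}}"

definition linear_on_desc :: "nat \<Rightarrow> (pol \<Rightarrow> pol) \<Rightarrow> bool" where
  "linear_on_desc L g \<longleftrightarrow>
     (\<forall>h\<in>desc_alg L. \<forall>h'\<in>desc_alg L. g (h + h') = g h + g h') \<and>
     (\<forall>c. \<forall>h\<in>desc_alg L. g (scal c h) = scal c (g h))"


section \<open>Heisenberg algebra and its Fock module\<close>

definition A_coef :: "nat \<Rightarrow> real \<Rightarrow> int \<Rightarrow> int \<Rightarrow> complex" where
  "A_coef L p \<sigma> n =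
     (omega_pow L (- of_int \<sigma> * of_real p * of_int n) - omega_pow L (- of_int \<sigma> * of_int n)) *
     (1 - omega_pow L (of_int \<sigma> * of_real p * of_int n))"

text \<open>The module over the vacuum is the polynomial space in the creation operators, the variable
  \<open>(s, n)\<close> standing for the generator of index \<open>s\<close> and mode \<open>-n\<close>.  It does not depend on \<open>a\<close>,
  which only enters through the coefficients of the currents.  Mode \<open>0\<close> is not a generator
  (\<open>heis\<close> makes it zero).\<close>

definition heis :: "nat \<Rightarrow> real \<Rightarrow> nat \<Rightarrow> int \<Rightarrow> pol \<Rightarrow> pol" where
  "heis L p s n u =
     (if n < 0 then var (s, nat (-n)) * u
      else (\<Sum>s'\<in>{1..L} - {s}.
        scal (of_int n * A_coef L p (sgn (int s - int s')) n) (partial_deriv (s', nat n) u)))"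

lemma A_coef_sym: "A_coef L p (- \<sigma>) (- n) = A_coef L p \<sigma> n"
  by (simp add: A_coef_def)

lemma scal_scal: "scal b (scal c u) = scal (b * c) u"
  by (simp add: scal_def mult.assoc[symmetric] mult_single)

lemma scal_add: "scal c (u + u') = scal c u + scal c u'"
  by (simp add: scal_def distrib_left)

lemma scal_zero: "scal c 0 = 0"
  by (simp add: scal_def)

lemma scal_sum: "scal c (sum g X) = (\<Sum>x\<in>X. scal c (g x))"
  by (simp add: scal_def sum_distrib_left)

lemma scal_mult_right: "u * scal c v = scal c (u * v)"
  by (simp add: scal_def mult.left_commute)

lemma heis_pos_commute:
  assumes "0 \<le> m" "0 \<le> n"
  shows "heis L p s' m (heis L p s n u) = heis L p s n (heis L p s' m u)"
proof -
  have "heis L p s' m (heis L p s n u) = (\<Sum>t'\<in>{1..L} - {s'}. \<Sum>t\<in>{1..L} - {s}.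
      scal ((of_int m * A_coef L p (sgn (int s' - int t')) m) *
            (of_int n * A_coef L p (sgn (int s - int t)) n))
        (partial_deriv (t', nat m) (partial_deriv (t, nat n) u)))"
    if "0 \<le> m" "0 \<le> n" for s s' m n
    using that by (simp add: heis_def partial_deriv_sum partial_deriv_scal scal_sum scal_scal)
  note E = this
  show ?thesis
    unfolding E[OF assms] E[OF assms(2,1)]
    by (subst sum.swap)
       (intro sum.cong refl, subst partial_deriv_commute, simp only: mult.commute)
qed

lemma heis_pos_neg:
  assumes "0 < m" "0 < n" "s \<in> {1..L}"
  shows "heis L p s' m (heis L p s (- n) u) = heis L p s (- n) (heis L p s' m u) +
    (if s' \<noteq> s \<and> m = n then scal (of_int m * A_coef L p (sgn (int s' - int s)) m) u else 0)"
proof -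
  let ?c = "\<lambda>t. of_int m * A_coef L p (sgn (int s' - int t)) m"
  have "heis L p s' m (heis L p s (- n) u) =
     (\<Sum>t\<in>{1..L} - {s'}. (if t = s then (if m = n then scal (?c s) u else 0) else 0) +
        var (s, nat n) * scal (?c t) (partial_deriv (t, nat m) u))"
    unfolding heis_def using assms
    by (simp only: if_False if_True neg_less_0_iff_less not_less_iff_gr_or_eq minus_minus order_less_not_sym)
       (intro sum.cong refl, auto simp: partial_deriv_var scal_add scal_mult_right scal_zero)
  also have "\<dots> = heis L p s (- n) (heis L p s' m u) +
      (if s' \<noteq> s \<and> m = n then scal (?c s) u else 0)"
    using assms by (simp add: heis_def sum.distrib sum_distrib_left)
  finally show ?thesis .
qed

lemma heis_commutator:
  assumes "s \<in> {1..L}" "s' \<in> {1..L}" "m \<noteq> 0" "n \<noteq> 0"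
  shows "heis L p s' m (heis L p s n u) - heis L p s n (heis L p s' m u) =
    (if s' \<noteq> s \<and> m + n = 0 then scal (of_int m * A_coef L p (sgn (int s' - int s)) m) u else 0)"
proof -
  consider "0 < m" "0 < n" | "m < 0" "n < 0" | "0 < m" "n < 0" | "m < 0" "0 < n"
    using assms by linarith
  then show ?thesis
  proof cases
    case 1
    then show ?thesis using heis_pos_commute[of m n L p s' s u] by simp
  next
    case 2
    then show ?thesis by (simp add: heis_def mult.left_commute)
  next
    case 3
    then show ?thesis using heis_pos_neg[of m "-n" s L p s' u] assms by auto
  next
    case 4
    have sg: "sgn (int s - int s') = - sgn (int s' - int s)"
      by (simp add: sgn_if)
    have "scal (- c) u = - scal c u" for c
      by (rule poly_mapping_eqI) (simp add: lookup_scal)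
    then show ?thesis
      using heis_pos_neg[of n "-m" s' L p s u] assms 4 A_coef_sym[of L p "sgn (int s' - int s)" m]
      by (cases "n = - m") (auto simp: sg)
  qed
qed

lemma heis_vacuum: "0 < n \<Longrightarrow> heis L p s n 1 = 0"
  by (simp add: heis_def partial_deriv_def scal_def flip: single_one)

definition vacuum :: pol where "vacuum = 1"

definition covacuum :: "pol \<Rightarrow> complex" where "covacuum u = Poly_Mapping.lookup u 0"

text \<open>Action on \<open>u\<close> of the image of \<open>h\<close> under the algebra homomorphism sending the generator \<open>v\<close>
  to the operator \<open>D v\<close>, for commuting operators \<open>D v\<close>.\<close>

definition hom_act :: "(nat \<times> nat \<Rightarrow> pol \<Rightarrow> pol) \<Rightarrow> pol \<Rightarrow> pol \<Rightarrow> pol" where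
  "hom_act D h u = (\<Sum>m\<in>Poly_Mapping.keys h. scal (Poly_Mapping.lookup h m)
     (Finite_Set.fold (\<lambda>v. D v ^^ Poly_Mapping.lookup m v) u (Poly_Mapping.keys m)))"

definition pi_coef :: "nat \<Rightarrow> real \<Rightarrow> nat \<Rightarrow> nat \<Rightarrow> complex" where
  "pi_coef L p i n =
     omega_pow L (- ((of_nat L + 1 - 2 * of_nat i) / 2) * of_nat n) / A_coef L p 1 (int n)"

definition pi_R :: "nat \<Rightarrow> real \<Rightarrow> pol \<Rightarrow> pol \<Rightarrow> pol" where
  "pi_R L p = hom_act (\<lambda>(i, n) u.
     scal (pi_coef L p i n) (heis L p i (int n) u - heis L p (Suc i) (int n) u))"

definition pi_L :: "nat \<Rightarrow> real \<Rightarrow> pol \<Rightarrow> pol \<Rightarrow> pol" where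
  "pi_L L p = hom_act (\<lambda>(i, n) u.
     scal (pi_coef L p i n) (heis L p (L - i) (- int n) u - heis L p (L + 1 - i) (- int n) u))"


section \<open>Vertex operators and their matrix elements\<close>

definition f_pair :: "nat \<Rightarrow> real \<Rightarrow> complex \<Rightarrow> complex" where
  "f_pair L p z = (z - omega_pow L (of_real p)) * (z - omega_pow L (1 - of_real p)) /
     ((z - 1) * (z - omega_pow L 1))"

text \<open>A list \<open>[(s\<^sub>1, z\<^sub>1), \<dots>]\<close> stands for the normally ordered product of the vertex operators
  \<open>\<lambda>\<close> with these indices and arguments.\<close>

type_synonym vop = "(nat \<times> complex) list"

definition create_part :: "nat \<Rightarrow> real \<Rightarrow> nat \<Rightarrow> vop \<Rightarrow> pol \<Rightarrow> pol" where
  "create_part L p M vs u =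
     (\<Sum>n=1..M. \<Sum>(s, z)\<leftarrow>vs. scal (z ^ n / (- of_nat n)) (heis L p s (- int n) u))"

definition annihil_part :: "nat \<Rightarrow> real \<Rightarrow> nat \<Rightarrow> vop \<Rightarrow> pol \<Rightarrow> pol" where
  "annihil_part L p M vs u =
     (\<Sum>n=1..M. \<Sum>(s, z)\<leftarrow>vs. scal (1 / (z ^ n * of_nat n)) (heis L p s (int n) u))"

definition exp_trunc :: "nat \<Rightarrow> (pol \<Rightarrow> pol) \<Rightarrow> pol \<Rightarrow> pol" where
  "exp_trunc M X u = (\<Sum>k\<le>M. scal (1 / fact k) ((X ^^ k) u))"

text \<open>Modes and exponential series are truncated at \<open>M\<close>; by degree reasons the sequence is
  eventually constant, so that the limit is a purely algebraic one.\<close>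

definition normal_elem :: "nat \<Rightarrow> real \<Rightarrow> pol \<Rightarrow> pol \<Rightarrow> vop \<Rightarrow> complex" where
  "normal_elem L p h h' vs = lim (\<lambda>M.
     covacuum (pi_R L p h
       (exp_trunc M (create_part L p M vs)
         (exp_trunc M (annihil_part L p M vs) (pi_L L p h' vacuum)))))"

fun pair_contr :: "nat \<Rightarrow> real \<Rightarrow> nat \<times> complex \<Rightarrow> nat \<times> complex \<Rightarrow> complex" where
  "pair_contr L p (s', z') (s, z) =
     (if s' = s then 1 else if s' > s then f_pair L p (z / z') else f_pair L p (z' / z))"

definition vop_contr :: "nat \<Rightarrow> real \<Rightarrow> vop \<Rightarrow> vop \<Rightarrow> complex" where
  "vop_contr L p us vs = (\<Prod>u\<leftarrow>us. \<Prod>v\<leftarrow>vs. pair_contr L p u v)"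

text \<open>Matrix element of a product of (individually normally ordered) vertex operators: normal
  ordering of the whole product only contracts factors of different operators.\<close>

definition product_elem :: "nat \<Rightarrow> real \<Rightarrow> pol \<Rightarrow> pol \<Rightarrow> vop list \<Rightarrow> complex" where
  "product_elem L p h h' vss =
     (\<Prod>j<length vss. \<Prod>i<j. vop_contr L p (vss ! i) (vss ! j)) * normal_elem L p h h' (concat vss)"

definition vop_of_set :: "nat \<Rightarrow> nat set \<Rightarrow> complex \<Rightarrow> vop" where
  "vop_of_set L S z = map (\<lambda>m. (sorted_list_of_set S ! (m - 1),
      z * omega_pow L ((of_nat (card S) + 1 - 2 * of_nat m) / 2))) [1..<card S + 1]"

definition k_subsets :: "nat \<Rightarrow> nat \<Rightarrow> nat set set" where
  "k_subsets L k = {S. S \<subseteq> {1..L} \<and> card S = k}"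

text \<open>The function \<open>J\<close>-tilde at the point \<open>xs\<close>: the product of the currents expanded
  multilinearly.\<close>

definition J_tilde ::
  "nat \<Rightarrow> real \<Rightarrow> (nat \<Rightarrow> complex) \<Rightarrow> pol \<Rightarrow> pol \<Rightarrow> nat list \<Rightarrow> complex list \<Rightarrow> complex" where
  "J_tilde L p a h h' ks xs =
     (\<Sum>Ss\<in>listset (map (k_subsets L) ks).
        (\<Prod>S\<leftarrow>Ss. omega_pow L (hform L a (weight_of_set L S))) *
        product_elem L p h h' (map2 (vop_of_set L) Ss xs))"

text \<open>Every factor \<open>f_pair\<close> above is evaluated at \<open>x\<^sub>j / x\<^sub>i\<close> times an integer power of
  \<open>exp (\<pi> \<i> / L)\<close> and hence is regular at the following points.  They are dense, so equality of
  two functions \<open>J_tilde\<close> as rational functions means equality at these points.\<close>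

definition regular_point :: "nat \<Rightarrow> complex list \<Rightarrow> bool" where
  "regular_point L xs \<longleftrightarrow> (\<forall>i<length xs. xs ! i \<noteq> 0) \<and>
     (\<forall>i<length xs. \<forall>j<length xs. i \<noteq> j \<longrightarrow> (xs ! i) ^ (2 * L) \<noteq> (xs ! j) ^ (2 * L))"

end

theory Submission
  imports Defs "HOL-Complex_Analysis.Complex_Analysis" "Jordan_Normal_Form.Determinant"
begin

text \<open>For \<open>h = h' = 1\<close> the function \<open>J\<close>-tilde is invariant under \<open>a \<mapsto> w a\<close>: for a simple reflection
  exchanging the indices \<open>i\<close> and \<open>i + 1\<close> one groups the terms by the currents that contain exactly one
  of the two, and the claim becomes the symmetry in \<open>\<alpha>\<close>, \<open>\<beta>\<close> of
  \<open>\<Sum>I. \<alpha> ^ card I * \<beta> ^ card (X - I) * (\<Prod>i\<in>I. \<Prod>j\<in>X - I. f (z i / z j))\<close>.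

  Descendants arise from primaries by adding currents: if the arguments \<open>y / Z\<close> of the additional
  currents have vanishing inverse power sums in degrees \<open>1, \<dots>, d\<close> (\<open>d\<close>-balanced configurations), the
  coefficient of \<open>Z ^ d\<close> in the expansion at \<open>Z = 0\<close> is \<open>J\<close>-tilde with an explicit \<open>h = g(a)\<close> in the
  homogeneous part of degree \<open>d\<close> of \<open>\<A>\<close>.  Hence
  \<open>J\<close>-tilde is invariant under \<open>a \<mapsto> w a\<close>, \<open>g(a) \<mapsto> g(w a)\<close>; the symmetry \<open>z \<mapsto> 1 / z\<close>,
  \<open>s \<mapsto> L + 1 - s\<close> gives the same for the second chirality, with \<open>w\<^sub>*a\<close> in place of \<open>a\<close>.

  Finally one chooses one configuration for each monomial in such a way that the elements \<open>g(a)\<close> form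
  a basis of \<open>\<A>\<close> for generic \<open>a\<close>.  Along a ray of weights on which the subset \<open>{1..k}\<close> dominates each
  current \<open>k\<close>, \<open>g(a)\<close> tends to a single coherent state after rescaling, and these states span.  The
  determinants of the transition matrices are entire functions of \<open>a\<close>, so they vanish only on an
  exceptional set.  If \<open>G a\<close> maps the monomial \<open>m\<close> to the corresponding \<open>g(a)\<close>, then
  \<open>r a w = G (w a) \<circ> (G a)\<inverse>\<close>.\<close>

section \<open>A symmetry of rational functions\<close>

text \<open>The image of \<open>pi_R\<close> contains the modes d^(s)_n only through differences of
  neighbouring indices. A combination of modes over the arguments of a vertex operator therefore
  comes from \<A> once its coefficients add up to 0: this is the origin of the balance condition.
  The arguments inside a current depend on the number of its indices and not on the indices
  themselves, so one condition on the points covers every term of the expansion. Matrix elements are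
  limits of truncated expressions, and a limit is linear only where it exists. All linear algebra
  with \<open>J_tilde\<close> therefore takes place in the span of the coherent states, where
  truncation is harmless. A single \<lambda>_k(z) is not balanced, and a coincidence of points or a
  ratio at a zero of f would kill the coefficient of the limiting state; both force the elaborate
  shape of the compounds. Irrationality of p enters twice: the A_n do not vanish, and \<omega>^(2Lp)
  is not a root of unity.\<close>

definition rf :: "complex \<Rightarrow> complex \<Rightarrow> complex \<Rightarrow> complex" where
  "rf s t u = (u - s) * (u - t) / ((u - 1) * (u - s * t))"

text \<open>The map u -> st/u exchanges the zeros s, t and exchanges the poles 1, st.\<close>

lemma rf_reflect:
  assumes "s \<noteq> 0" "t \<noteq> 0" "u \<noteq> 0"
  shows "rf s t (s * t / u) = rf s t u"
proof (cases "u = 1 \<or> u = s * t")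
  \<comment> \<open>At the poles both sides are divisions by zero, hence 0, so no pole has to be
    excluded here or in later uses.\<close>
  case True
  then show ?thesis using assms by (auto simp: rf_def)
next
  case False
  have "(s * t / u - s) * (s * t / u - t) * u * u = s * t * ((u - s) * (u - t))"
    "(s * t / u - 1) * (s * t / u - s * t) * u * u = s * t * ((u - 1) * (u - s * t))"
    using assms by (auto simp: field_simps)
  then have "rf s t (s * t / u) = (s * t * ((u - s) * (u - t))) / (s * t * ((u - 1) * (u - s * t)))"
    unfolding rf_def using assms by (metis (no_types, lifting) mult_divide_mult_cancel_right)
  then show ?thesis using assms by (simp add: rf_def)
qed

lemma rf_at_infinity: "(rf s t \<longlongrightarrow> 1) at_infinity"
proof -
  have inv: "((\<lambda>u::complex. c / u) \<longlongrightarrow> 0) at_infinity" for c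
    using tendsto_mult_right_zero[OF tendsto_inverse_0, of c] by (simp add: divide_inverse)
  have "((\<lambda>u. (1 - s / u) * (1 - t / u) / ((1 - 1 / u) * (1 - s * t / u))) \<longlongrightarrow>
        (1 - 0) * (1 - 0) / ((1 - 0) * (1 - 0))) at_infinity"
    by (intro tendsto_intros inv) auto
  moreover have "\<forall>\<^sub>F u in at_infinity.
      (1 - s / u) * (1 - t / u) / ((1 - 1 / u) * (1 - s * t / u)) = rf s t u"
    using eventually_not_equal_at_infinity[of 0]
  proof eventually_elim
    case (elim u)
    have "1 - c / u = (u - c) / u" for c
      using elim by (simp add: diff_divide_distrib)
    then show ?case using elim by (simp add: rf_def)
  qed
  ultimately show ?thesis by (simp add: filterlim_cong)
qed

lemma tendsto_rf:
  assumes "(f \<longlongrightarrow> u) F" "(a \<longlongrightarrow> s) F" "(b \<longlongrightarrow> t) F" "u \<noteq> 1" "u \<noteq> s * t"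
  shows "((\<lambda>x. rf (a x) (b x) (f x)) \<longlongrightarrow> rf s t u) F"
  unfolding rf_def by (intro tendsto_intros assms) (use assms in auto)

text \<open>The coefficient of \<alpha>^k \<beta>^(n-k) in \<open>ruij_sum\<close> is the sum of
  Ruijsenaars' functional equation, the identity behind the commutativity of his difference
  operators. In the application \<alpha> and \<beta> are the weights \<omega>^(a_r) and
  \<omega>^(a_(r+1)), st = \<omega>, and \<open>I\<close> is the set of currents that contain r. The
  parameters stay free because the proof perturbs s alone.\<close>

definition ruij_weight ::
  "complex \<Rightarrow> complex \<Rightarrow> complex \<Rightarrow> complex \<Rightarrow> ('i \<Rightarrow> complex) \<Rightarrow> 'i set \<Rightarrow> 'i set \<Rightarrow> complex" where
  "ruij_weight \<alpha> \<beta> s t z X I =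
     \<alpha> ^ card I * \<beta> ^ card (X - I) * (\<Prod>i\<in>I. \<Prod>j\<in>X - I. rf s t (z i / z j))"

definition ruij_sum ::
  "complex \<Rightarrow> complex \<Rightarrow> complex \<Rightarrow> complex \<Rightarrow> ('i \<Rightarrow> complex) \<Rightarrow> 'i set \<Rightarrow> complex" where
  "ruij_sum \<alpha> \<beta> s t z X = (\<Sum>I\<in>Pow X. ruij_weight \<alpha> \<beta> s t z X I)"

lemma sum_Pow_insert:
  assumes "finite Y" "x \<notin> Y"
  shows "(\<Sum>I\<in>Pow (insert x Y). g I) = (\<Sum>I\<in>Pow Y. g (insert x I) + g I)"
proof -
  have "(\<Sum>I\<in>Pow (insert x Y). g I) = (\<Sum>I\<in>Pow Y. g I) + (\<Sum>I\<in>insert x ` Pow Y. g I)"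
    unfolding Pow_insert using assms by (intro sum.union_disjoint) auto
  also have "(\<Sum>I\<in>insert x ` Pow Y. g I) = (\<Sum>I\<in>Pow Y. g (insert x I))"
    using assms by (subst sum.reindex) (auto simp: inj_on_def)
  finally show ?thesis by (simp add: sum.distrib add.commute)
qed

lemma ruij_weight_insert:
  assumes "finite Y" "x \<notin> Y" "I \<subseteq> Y"
  shows "ruij_weight \<alpha> \<beta> s t z (insert x Y) (insert x I) =
      ruij_weight \<alpha> \<beta> s t z Y I * (\<alpha> * (\<Prod>j\<in>Y - I. rf s t (z x / z j)))"
    and "ruij_weight \<alpha> \<beta> s t z (insert x Y) I =
      ruij_weight \<alpha> \<beta> s t z Y I * (\<beta> * (\<Prod>i\<in>I. rf s t (z i / z x)))"
proof -
  have fin: "finite I" and x: "x \<notin> I" using assms finite_subset by auto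
  have "insert x Y - insert x I = Y - I" using assms by auto
  then show "ruij_weight \<alpha> \<beta> s t z (insert x Y) (insert x I) =
      ruij_weight \<alpha> \<beta> s t z Y I * (\<alpha> * (\<Prod>j\<in>Y - I. rf s t (z x / z j)))"
    using fin x by (simp add: ruij_weight_def)
  have *: "insert x Y - I = insert x (Y - I)" using x by auto
  show "ruij_weight \<alpha> \<beta> s t z (insert x Y) I =
      ruij_weight \<alpha> \<beta> s t z Y I * (\<beta> * (\<Prod>i\<in>I. rf s t (z i / z x)))"
    unfolding ruij_weight_def * using assms
    by (simp add: prod.distrib)
qed

lemma ruij_sum_insert:
  assumes "finite Y" "x \<notin> Y"
  shows "ruij_sum \<alpha> \<beta> s t z (insert x Y) = (\<Sum>I\<in>Pow Y. ruij_weight \<alpha> \<beta> s t z Y I *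
     (\<alpha> * (\<Prod>j\<in>Y - I. rf s t (z x / z j)) + \<beta> * (\<Prod>i\<in>I. rf s t (z i / z x))))"
  unfolding ruij_sum_def sum_Pow_insert[OF assms]
  by (intro sum.cong refl) (simp add: ruij_weight_insert[OF assms] distrib_left)

text \<open>Riemann's theorem on removable singularities, one point at a time. Near each remaining
  point the extension coincides with \<open>f\<close>, so the limit hypothesis survives.\<close>

lemma holomorphic_extend_finite:
  assumes "finite P" "f holomorphic_on - P" "\<And>p. p \<in> P \<Longrightarrow> ((\<lambda>z. (z - p) * f z) \<longlongrightarrow> 0) (at p)"
  shows "\<exists>g. g holomorphic_on UNIV \<and> (\<forall>z\<in>-P. g z = f z)"
  using assms
proof (induction arbitrary: f rule: finite_induct)
  case (insert p P)
  have op: "open (- P)" using insert.hyps by (simp add: finite_imp_closed open_Compl)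
  have "f holomorphic_on (- P) - {p}"
    using insert.prems(1) by (simp add: Compl_insert)
  moreover have "p \<in> interior (- P)" using op insert.hyps by (simp add: interior_open)
  ultimately obtain g where g: "g holomorphic_on - P" "\<forall>z\<in>- P - {p}. g z = f z"
    using holomorphic_on_extend_lim[of f "- P" p] insert.prems(2)[of p] by auto
  have "((\<lambda>z. (z - p') * g z) \<longlongrightarrow> 0) (at p')" if "p' \<in> P" for p'
  proof -
    have "\<forall>\<^sub>F z in at p'. z \<notin> insert p P"
      using islimpt_finite[of "insert p P" p'] insert.hyps
      by (simp add: islimpt_iff_eventually)
    then have "\<forall>\<^sub>F z in at p'. (z - p') * f z = (z - p') * g z"
      by eventually_elim (use g in auto)
    then show ?thesis
      using insert.prems(2)[of p'] that by (auto elim: Lim_transform_eventually)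
  qed
  from insert.IH[OF g(1) this] obtain h where "h holomorphic_on UNIV" "\<forall>z\<in>-P. h z = g z" by auto
  then show ?case using g by (intro exI[of _ h]) auto
qed auto

lemma eventually_zero_of_removable:
  assumes "finite P" "f holomorphic_on - P" "\<And>p. p \<in> P \<Longrightarrow> ((\<lambda>z. (z - p) * f z) \<longlongrightarrow> 0) (at p)"
    and lim: "(f \<longlongrightarrow> 0) at_infinity" and "z \<notin> P"
  shows "f z = 0"
proof -
  obtain g where g: "g holomorphic_on UNIV" "\<forall>z\<in>-P. g z = f z"
    using holomorphic_extend_finite[OF assms(1-3)] by auto
  obtain B where B: "\<forall>p\<in>P. norm p < B"
    using finite_imp_bounded[OF assms(1)] by (meson bounded_pos_less)
  have "\<forall>\<^sub>F z in at_infinity. f z = g z"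
    unfolding eventually_at_infinity by (rule exI[of _ B], use B g in \<open>auto simp: not_less[symmetric]\<close>)
  then have "(g \<longlongrightarrow> 0) at_infinity" using lim by (auto elim: Lim_transform_eventually)
  from Liouville_weak_0[OF g(1) this] g assms(5) show ?thesis by auto
qed

text \<open>The sum as a function of the single argument at \<open>x\<close>, with the factors \<open>rf (z i / u)\<close>
  rewritten by \<open>rf_reflect\<close> so that they are regular at \<open>u = 0\<close>.\<close>

definition ruij_fun ::
  "complex \<Rightarrow> complex \<Rightarrow> complex \<Rightarrow> complex \<Rightarrow> ('i \<Rightarrow> complex) \<Rightarrow> 'i set \<Rightarrow> complex \<Rightarrow> complex" where
  "ruij_fun \<alpha> \<beta> s t z Y u = (\<Sum>I\<in>Pow Y. ruij_weight \<alpha> \<beta> s t z Y I *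
     (\<alpha> * (\<Prod>j\<in>Y - I. rf s t (u / z j)) + \<beta> * (\<Prod>i\<in>I. rf s t (s * t * u / z i))))"

text \<open>Isolates the dependence on z j. In the first two terms the moving point and j lie on
  opposite sides of the partition, and only these have a pole coming from j; in the last two they
  lie on the same side.\<close>

lemma ruij_fun_split:
  assumes "finite Y" "j \<notin> Y"
  shows "ruij_fun \<alpha> \<beta> s t z (insert j Y) u = (\<Sum>I\<in>Pow Y. ruij_weight \<alpha> \<beta> s t z Y I *
     (\<alpha> * \<beta> * rf s t (u / z j) * (\<Prod>i\<in>I. rf s t (z i / z j)) * (\<Prod>l\<in>Y - I. rf s t (u / z l)) +
      \<alpha> * \<beta> * rf s t (s * t * u / z j) * (\<Prod>l\<in>Y - I. rf s t (z j / z l)) * (\<Prod>i\<in>I. rf s t (s * t * u / z i)) +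
      \<beta> * \<beta> * (\<Prod>i\<in>I. rf s t (z i / z j)) * (\<Prod>i\<in>I. rf s t (s * t * u / z i)) +
      \<alpha> * \<alpha> * (\<Prod>l\<in>Y - I. rf s t (z j / z l)) * (\<Prod>l\<in>Y - I. rf s t (u / z l))))"
  unfolding ruij_fun_def sum_Pow_insert[OF assms]
proof (intro sum.cong refl, goal_cases)
  case (1 I)
  have fin: "finite I" and x: "j \<notin> I" and IY: "I \<subseteq> Y" using 1 assms finite_subset by auto
  have a: "insert j Y - insert j I = Y - I" using assms by auto
  have b: "insert j Y - I = insert j (Y - I)" using x by auto
  have c: "j \<notin> Y - I" "finite (Y - I)" using assms by auto
  show ?case
    unfolding ruij_weight_insert[OF assms IY] a b using fin x c
    by (simp add: algebra_simps)
qed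

text \<open>The candidates for poles of \<open>ruij_fun\<close> are z i, st z i and z i / (st).
  Excluding the ratios 1, st and (st)^2, also for st itself, keeps them apart and hence
  simple.\<close>

definition ruij_generic :: "complex \<Rightarrow> complex \<Rightarrow> ('i \<Rightarrow> complex) \<Rightarrow> 'i set \<Rightarrow> bool" where
  "ruij_generic s t z X \<longleftrightarrow> s \<noteq> 0 \<and> t \<noteq> 0 \<and> s * t \<noteq> 1 \<and> (s * t)\<^sup>2 \<noteq> 1 \<and> (\<forall>i\<in>X. z i \<noteq> 0) \<and>
     (\<forall>i\<in>X. \<forall>j\<in>X. i \<noteq> j \<longrightarrow> z i \<noteq> z j \<and> z i \<noteq> s * t * z j \<and> z i \<noteq> (s * t)\<^sup>2 * z j)"

lemma mult_divide_cancel_factor: "b \<noteq> 0 \<Longrightarrow> a * (x / y) = a * b * (x / (b * y))"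
  for a :: complex
  by simp

lemma mult_divide_cancel_factor': "b \<noteq> 0 \<Longrightarrow> a * (x / y) = a * b * (x / (y * b))"
  for a :: complex
  by simp

lemma tendsto_residue_one:
  assumes "s * t \<noteq> 1" "w \<noteq> 0" "c \<noteq> 0"
  shows "((\<lambda>u. (u - w / c) * rf s t (c * u / w)) \<longlongrightarrow> w / c * ((1 - s) * (1 - t) / (1 - s * t))) (at (w / c))"
proof -
  have "((\<lambda>u. w / c * ((c * u / w - s) * (c * u / w - t) / (c * u / w - s * t))) \<longlongrightarrow>
      w / c * ((c * (w / c) / w - s) * (c * (w / c) / w - t) / (c * (w / c) / w - s * t))) (at (w / c))"
    by (intro tendsto_intros) (use assms in auto)
  moreover have "\<forall>\<^sub>F u in at (w / c). w / c * ((c * u / w - s) * (c * u / w - t) / (c * u / w - s * t)) =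
      (u - w / c) * rf s t (c * u / w)"
    using eventually_neq_at_within[of "w / c"]
  proof eventually_elim
    case (elim u)
    have e: "u - w / c = w / c * (c * u / w - 1)" using assms by (simp add: field_simps)
    have "c * u / w - 1 \<noteq> 0" using elim assms by (auto simp: field_simps)
    then show ?case unfolding e rf_def by (rule mult_divide_cancel_factor)
  qed
  ultimately show ?thesis using assms by (auto elim: Lim_transform_eventually)
qed

lemma tendsto_residue_q:
  assumes "s * t \<noteq> 1" "w \<noteq> 0"
  shows "((\<lambda>u. (u - s * t * w) * rf s t (u / w)) \<longlongrightarrow>
     w * ((s * t - s) * (s * t - t) / (s * t - 1))) (at (s * t * w))"
proof -
  have "((\<lambda>u. w * ((u / w - s) * (u / w - t) / (u / w - 1))) \<longlongrightarrow>
      w * ((s * t * w / w - s) * (s * t * w / w - t) / (s * t * w / w - 1))) (at (s * t * w))"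
    by (intro tendsto_intros) (use assms in auto)
  moreover have "\<forall>\<^sub>F u in at (s * t * w). w * ((u / w - s) * (u / w - t) / (u / w - 1)) =
      (u - s * t * w) * rf s t (u / w)"
    using eventually_neq_at_within[of "s * t * w"]
  proof eventually_elim
    case (elim u)
    have e: "u - s * t * w = w * (u / w - s * t)" using assms by (simp add: field_simps)
    have "u / w - s * t \<noteq> 0" using elim assms by (auto simp: field_simps)
    then show ?case unfolding e rf_def by (rule mult_divide_cancel_factor')
  qed
  ultimately show ?thesis using assms by (auto elim: Lim_transform_eventually)
qed

lemma rf_mult_reflect:
  assumes "s \<noteq> 0" "t \<noteq> 0" "a \<noteq> 0" "b \<noteq> 0"
  shows "rf s t (s * t * a / b) = rf s t (b / a)"
proof -
  have "s * t * a / b = s * t / (b / a)" by simp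
  then show ?thesis using rf_reflect[of s t "b / a"] assms by (metis divide_eq_0_iff)
qed

lemma ruij_generic_subset: "ruij_generic s t z X \<Longrightarrow> Y \<subseteq> X \<Longrightarrow> ruij_generic s t z Y"
  unfolding ruij_generic_def using subsetD by (simp add: subset_iff)

lemma residue_distrib:
  "v * (w * (a * b * r * A * B + a * b * r' * B' * A' + b * b * A * A' + a * a * B' * B)) =
   w * (a * b * (v * r) * A * B + a * b * (v * r') * B' * A' + v * b * b * A * A' + v * a * a * B' * B)"
  for v :: complex
  by (simp add: distrib_left)

text \<open>At z j the residues of the two opposite-side terms cancel. At the other two points only
  one of them survives, and \<alpha>, \<beta> enter through \<alpha> \<beta> and through the sum for
  the smaller set \<open>Y\<close>; this is what permits an induction on the set.\<close>

lemma tendsto_ruij_fun: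
  fixes z :: "'i \<Rightarrow> complex"
  assumes Y: "finite Y" "j \<notin> Y" and gen: "ruij_generic s t z (insert j Y)"
  shows "((\<lambda>u. (u - z j) * ruij_fun \<alpha> \<beta> s t z (insert j Y) u) \<longlongrightarrow> 0) (at (z j))"
    and "((\<lambda>u. (u - s * t * z j) * ruij_fun \<alpha> \<beta> s t z (insert j Y) u) \<longlongrightarrow>
       \<alpha> * \<beta> * (z j * ((s * t - s) * (s * t - t) / (s * t - 1))) *
       (\<Prod>i\<in>Y. rf s t (z i / z j)) * ruij_sum \<alpha> \<beta> s t z Y) (at (s * t * z j))"
    and "((\<lambda>u. (u - z j / (s * t)) * ruij_fun \<alpha> \<beta> s t z (insert j Y) u) \<longlongrightarrow>
       \<alpha> * \<beta> * (z j / (s * t) * ((1 - s) * (1 - t) / (1 - s * t))) *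
       (\<Prod>i\<in>Y. rf s t (z j / z i)) * ruij_sum \<alpha> \<beta> s t z Y) (at (z j / (s * t)))"
proof -
  let ?q = "s * t"
  have st: "s \<noteq> 0" "t \<noteq> 0" "?q \<noteq> 1" "?q * ?q \<noteq> 1" and zj: "z j \<noteq> 0"
    and zY: "\<And>i. i \<in> Y \<Longrightarrow> z i \<noteq> 0"
    and ne0: "\<And>i. i \<in> Y \<Longrightarrow> z i \<noteq> z j \<and> z i \<noteq> ?q * z j \<and> z i \<noteq> ?q * ?q * z j"
      "\<And>i. i \<in> Y \<Longrightarrow> z j \<noteq> ?q * z i \<and> z j \<noteq> ?q * ?q * z i"
    using gen Y unfolding ruij_generic_def by (auto simp: power2_eq_square)
  have ne: "z i \<noteq> z j" "z j \<noteq> z i" "z i \<noteq> ?q * z j" "?q * z j \<noteq> z i"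
      "z i \<noteq> ?q * ?q * z j" "?q * ?q * z j \<noteq> z i" "z j \<noteq> ?q * z i" "?q * z i \<noteq> z j"
      "z j \<noteq> ?q * ?q * z i" "?q * ?q * z i \<noteq> z j"
      "?q * (?q * z j) \<noteq> z i" "z i \<noteq> ?q * (?q * z j)" if "i \<in> Y" for i
    using ne0(1)[OF that] ne0(2)[OF that] by (auto simp: mult.assoc)
  have nd: "z j / ?q \<noteq> z i" "z j / ?q \<noteq> ?q * z i" if "i \<in> Y" for i
    using ne(7,9)[OF that] st by (auto simp: divide_eq_eq mult.commute mult.left_commute)
  have qz: "?q * z j \<noteq> z j" "?q * (?q * z j) \<noteq> z j" "z j / ?q \<noteq> z j" "z j / ?q \<noteq> ?q * z j"
    using st zj by (auto simp: divide_eq_eq mult.assoc[symmetric])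
  define A where "A I = (\<Prod>i\<in>I. rf s t (z i / z j))" for I
  define B where "B I u = (\<Prod>l\<in>Y - I. rf s t (u / z l))" for I u
  define A' where "A' I u = (\<Prod>i\<in>I. rf s t (?q * u / z i))" for I u
  define B' where "B' I = (\<Prod>l\<in>Y - I. rf s t (z j / z l))" for I
  let ?wt = "ruij_weight \<alpha> \<beta> s t z Y"
  have R: "(u - p) * ruij_fun \<alpha> \<beta> s t z (insert j Y) u = (\<Sum>I\<in>Pow Y. ?wt I *
     (\<alpha> * \<beta> * ((u - p) * rf s t (u / z j)) * A I * B I u +
      \<alpha> * \<beta> * ((u - p) * rf s t (?q * u / z j)) * B' I * A' I u +
      (u - p) * \<beta> * \<beta> * A I * A' I u + (u - p) * \<alpha> * \<alpha> * B' I * B I u))" for u p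
    unfolding ruij_fun_split[OF Y] sum_distrib_left A_def[symmetric] B'_def[symmetric]
      B_def[symmetric] A'_def[symmetric]
    by (rule sum.cong[OF refl]) (rule residue_distrib)
  have tB: "(B I \<longlongrightarrow> B I p) (at p)" if "\<And>l. l \<in> Y \<Longrightarrow> p \<noteq> z l \<and> p \<noteq> ?q * z l" for I p
    unfolding B_def by (intro tendsto_prod tendsto_rf tendsto_intros) (use that zY in \<open>auto simp: field_simps\<close>)
  have tA': "(A' I \<longlongrightarrow> A' I p) (at p)" if "\<And>i. i \<in> Y \<Longrightarrow> ?q * p \<noteq> z i \<and> ?q * p \<noteq> ?q * z i" "I \<subseteq> Y" for I p
    unfolding A'_def by (intro tendsto_prod tendsto_rf tendsto_intros) (use that zY in \<open>auto simp: field_simps\<close>)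
  have t1: "((\<lambda>u. (u - z j) * rf s t (u / z j)) \<longlongrightarrow> z j * ((1 - s) * (1 - t) / (1 - ?q))) (at (z j))"
    using tendsto_residue_one[of s t "z j" 1] st zj by simp
  \<comment> \<open>Here the argument st u / z j runs into the pole st of \<open>rf\<close>. As (st
    - s)(st - t) = st (1 - s)(1 - t), the residue is the negative of the one in
    \<open>t1\<close>.\<close>
  have t2: "((\<lambda>u. (u - z j) * rf s t (?q * u / z j)) \<longlongrightarrow> - (z j * ((1 - s) * (1 - t) / (1 - ?q)))) (at (z j))"
  proof -
    have "((\<lambda>u. 1 / ?q * ((?q * u - ?q * z j) * rf s t (?q * u / z j))) \<longlongrightarrow>
       1 / ?q * (z j * ((?q - s) * (?q - t) / (?q - 1)))) (at (z j))"
    proof (rule tendsto_mult[OF tendsto_const])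
      have "filterlim (\<lambda>u. ?q * u) (at (?q * z j)) (at (z j))"
        by (rule filterlim_atI) (use st in \<open>auto intro!: tendsto_intros simp: eventually_at_filter\<close>)
      from filterlim_compose[OF tendsto_residue_q[OF st(3) zj] this]
      show "((\<lambda>u. (?q * u - ?q * z j) * rf s t (?q * u / z j)) \<longlongrightarrow>
         z j * ((?q - s) * (?q - t) / (?q - 1))) (at (z j))" .
    qed
    moreover have "1 / ?q * (z j * ((?q - s) * (?q - t) / (?q - 1))) = - (z j * ((1 - s) * (1 - t) / (1 - ?q)))"
      using st by (simp add: divide_simps) (simp add: algebra_simps)
    ultimately show ?thesis using st by (simp add: right_diff_distrib[symmetric] mult.assoc)
  qed
  show "((\<lambda>u. (u - z j) * ruij_fun \<alpha> \<beta> s t z (insert j Y) u) \<longlongrightarrow> 0) (at (z j))"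
  proof -
    let ?r = "z j * ((1 - s) * (1 - t) / (1 - ?q))"
    have "((\<lambda>u. (u - z j) * ruij_fun \<alpha> \<beta> s t z (insert j Y) u) \<longlongrightarrow> (\<Sum>I\<in>Pow Y. ?wt I *
     (\<alpha> * \<beta> * ?r * A I * B I (z j) + \<alpha> * \<beta> * (- ?r) * B' I * A' I (z j) +
      (z j - z j) * \<beta> * \<beta> * A I * A' I (z j) + (z j - z j) * \<alpha> * \<alpha> * B' I * B I (z j)))) (at (z j))"
      unfolding R
      by (intro tendsto_sum tendsto_mult tendsto_add tendsto_diff tendsto_const tendsto_ident_at t1 t2 tB tA')
        (use st in \<open>auto simp: ne\<close>)
    also have "(\<Sum>I\<in>Pow Y. ?wt I *
     (\<alpha> * \<beta> * ?r * A I * B I (z j) + \<alpha> * \<beta> * (- ?r) * B' I * A' I (z j) +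
      (z j - z j) * \<beta> * \<beta> * A I * A' I (z j) + (z j - z j) * \<alpha> * \<alpha> * B' I * B I (z j))) = 0"
    proof (rule sum.neutral, intro ballI)
      fix I assume I: "I \<in> Pow Y"
      have "A' I (z j) = A I" unfolding A_def A'_def
        by (rule prod.cong) (use I zY zj st in \<open>auto intro!: rf_mult_reflect\<close>)
      moreover have "B I (z j) = B' I" unfolding B_def B'_def by simp
      ultimately show "?wt I *
     (\<alpha> * \<beta> * ?r * A I * B I (z j) + \<alpha> * \<beta> * (- ?r) * B' I * A' I (z j) +
      (z j - z j) * \<beta> * \<beta> * A I * A' I (z j) + (z j - z j) * \<alpha> * \<alpha> * B' I * B I (z j)) = 0"
        by simp
    qed
    finally show ?thesis .
  qed
  have vanish: "((\<lambda>u. (u - p) * rf s t (c * u / z j)) \<longlongrightarrow> 0) (at p)"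
    if "c * p \<noteq> z j" "c * p \<noteq> ?q * z j" for p c
  proof -
    have "((\<lambda>u. (u - p) * rf s t (c * u / z j)) \<longlongrightarrow> (p - p) * rf s t (c * p / z j)) (at p)"
      by (intro tendsto_rf tendsto_intros) (use that zj in \<open>auto simp: field_simps\<close>)
    then show ?thesis by simp
  qed
  show "((\<lambda>u. (u - ?q * z j) * ruij_fun \<alpha> \<beta> s t z (insert j Y) u) \<longlongrightarrow>
       \<alpha> * \<beta> * (z j * ((?q - s) * (?q - t) / (?q - 1))) *
       (\<Prod>i\<in>Y. rf s t (z i / z j)) * ruij_sum \<alpha> \<beta> s t z Y) (at (?q * z j))"
  proof -
    let ?r = "z j * ((?q - s) * (?q - t) / (?q - 1))" and ?p = "?q * z j"
    have "((\<lambda>u. (u - ?p) * ruij_fun \<alpha> \<beta> s t z (insert j Y) u) \<longlongrightarrow> (\<Sum>I\<in>Pow Y. ?wt I *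
     (\<alpha> * \<beta> * ?r * A I * B I ?p + \<alpha> * \<beta> * 0 * B' I * A' I ?p +
      (?p - ?p) * \<beta> * \<beta> * A I * A' I ?p + (?p - ?p) * \<alpha> * \<alpha> * B' I * B I ?p))) (at ?p)"
      unfolding R
      by (intro tendsto_sum tendsto_mult tendsto_add tendsto_diff tendsto_const tendsto_ident_at
          tendsto_residue_q vanish tB tA') (use st zj in \<open>auto simp: ne qz\<close>)
    also have "(\<Sum>I\<in>Pow Y. ?wt I *
     (\<alpha> * \<beta> * ?r * A I * B I ?p + \<alpha> * \<beta> * 0 * B' I * A' I ?p +
      (?p - ?p) * \<beta> * \<beta> * A I * A' I ?p + (?p - ?p) * \<alpha> * \<alpha> * B' I * B I ?p)) =
      \<alpha> * \<beta> * ?r * (\<Prod>i\<in>Y. rf s t (z i / z j)) * ruij_sum \<alpha> \<beta> s t z Y"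
      unfolding ruij_sum_def sum_distrib_left
    proof (intro sum.cong refl)
      fix I assume I: "I \<in> Pow Y"
      \<comment> \<open>Reflection turns the factors outside \<open>I\<close> into the shape of
        those inside, so together with \<open>A I\<close> they give a product over all of
        \<open>Y\<close> that no longer depends on \<open>I\<close>.\<close>
      have "B I ?p = (\<Prod>l\<in>Y - I. rf s t (z l / z j))" unfolding B_def
        by (rule prod.cong) (use zY zj st in \<open>auto intro!: rf_mult_reflect\<close>)
      then have "A I * B I ?p = (\<Prod>i\<in>Y. rf s t (z i / z j))"
        unfolding A_def using prod.subset_diff[of I Y "\<lambda>i. rf s t (z i / z j)"] I Y by (simp add: mult.commute)
      then show "?wt I *
     (\<alpha> * \<beta> * ?r * A I * B I ?p + \<alpha> * \<beta> * 0 * B' I * A' I ?p +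
      (?p - ?p) * \<beta> * \<beta> * A I * A' I ?p + (?p - ?p) * \<alpha> * \<alpha> * B' I * B I ?p) =
        \<alpha> * \<beta> * ?r * (\<Prod>i\<in>Y. rf s t (z i / z j)) * ?wt I"
        by (simp add: mult.assoc)
    qed
    finally show ?thesis .
  qed
  show "((\<lambda>u. (u - z j / ?q) * ruij_fun \<alpha> \<beta> s t z (insert j Y) u) \<longlongrightarrow>
       \<alpha> * \<beta> * (z j / ?q * ((1 - s) * (1 - t) / (1 - ?q))) *
       (\<Prod>i\<in>Y. rf s t (z j / z i)) * ruij_sum \<alpha> \<beta> s t z Y) (at (z j / ?q))"
  proof -
    let ?r = "z j / ?q * ((1 - s) * (1 - t) / (1 - ?q))" and ?p = "z j / ?q"
    have v: "((\<lambda>u. (u - ?p) * rf s t (u / z j)) \<longlongrightarrow> 0) (at ?p)"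
      using vanish[of 1 ?p] qz by simp
    have "((\<lambda>u. (u - ?p) * ruij_fun \<alpha> \<beta> s t z (insert j Y) u) \<longlongrightarrow> (\<Sum>I\<in>Pow Y. ?wt I *
     (\<alpha> * \<beta> * 0 * A I * B I ?p + \<alpha> * \<beta> * ?r * B' I * A' I ?p +
      (?p - ?p) * \<beta> * \<beta> * A I * A' I ?p + (?p - ?p) * \<alpha> * \<alpha> * B' I * B I ?p))) (at ?p)"
      unfolding R
      by (intro tendsto_sum tendsto_mult tendsto_add tendsto_diff tendsto_const tendsto_ident_at
          tendsto_residue_one v tB tA') (use st zj in \<open>auto simp: ne nd\<close>)
    also have "(\<Sum>I\<in>Pow Y. ?wt I *
     (\<alpha> * \<beta> * 0 * A I * B I ?p + \<alpha> * \<beta> * ?r * B' I * A' I ?p +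
      (?p - ?p) * \<beta> * \<beta> * A I * A' I ?p + (?p - ?p) * \<alpha> * \<alpha> * B' I * B I ?p)) =
      \<alpha> * \<beta> * ?r * (\<Prod>i\<in>Y. rf s t (z j / z i)) * ruij_sum \<alpha> \<beta> s t z Y"
      unfolding ruij_sum_def sum_distrib_left
    proof (intro sum.cong refl)
      fix I assume I: "I \<in> Pow Y"
      have "A' I ?p = (\<Prod>i\<in>I. rf s t (z j / z i))" unfolding A'_def
        by (rule prod.cong) (use st in auto)
      then have "B' I * A' I ?p = (\<Prod>i\<in>Y. rf s t (z j / z i))"
        unfolding B'_def using prod.subset_diff[of I Y "\<lambda>i. rf s t (z j / z i)"] I Y by simp
      then show "?wt I *
     (\<alpha> * \<beta> * 0 * A I * B I ?p + \<alpha> * \<beta> * ?r * B' I * A' I ?p +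
      (?p - ?p) * \<beta> * \<beta> * A I * A' I ?p + (?p - ?p) * \<alpha> * \<alpha> * B' I * B I ?p) =
        \<alpha> * \<beta> * ?r * (\<Prod>i\<in>Y. rf s t (z j / z i)) * ?wt I"
        by (simp add: mult.assoc)
    qed
    finally show ?thesis .
  qed
qed

lemma holomorphic_ruij_fun:
  assumes "finite Y" "ruij_generic s t z Y"
  shows "ruij_fun \<alpha> \<beta> s t z Y holomorphic_on
    - (z ` Y \<union> (\<lambda>w. s * t * w) ` z ` Y \<union> (\<lambda>w. w / (s * t)) ` z ` Y)"
proof -
  have nz: "z i \<noteq> 0" if "i \<in> Y" for i using assms that by (simp add: ruij_generic_def)
  have st: "s \<noteq> 0" "t \<noteq> 0" using assms by (simp_all add: ruij_generic_def)
  let ?S = "- (z ` Y \<union> (\<lambda>w. s * t * w) ` z ` Y \<union> (\<lambda>w. w / (s * t)) ` z ` Y)"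
  have rf_hol: "(\<lambda>u. rf s t (c * u / w)) holomorphic_on ?S"
    if "\<And>u. u \<in> ?S \<Longrightarrow> c * u / w \<noteq> 1 \<and> c * u / w \<noteq> s * t" for c w
    unfolding rf_def using that by (cases "w = 0") (auto intro!: holomorphic_intros)
  have h1: "(\<lambda>u. rf s t (u / z i)) holomorphic_on ?S" if "i \<in> Y" for i
    using rf_hol[of 1 "z i"] nz[OF that] that by (auto simp: divide_eq_eq)
  have h2: "(\<lambda>u. rf s t (s * t * u / z i)) holomorphic_on ?S" if i: "i \<in> Y" for i
  proof (rule rf_hol)
    fix u assume u: "u \<in> ?S"
    then have "u \<noteq> z i" "u \<noteq> z i / (s * t)" using i by auto
    then show "s * t * u / z i \<noteq> 1 \<and> s * t * u / z i \<noteq> s * t"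
      using nz[OF i] st by (auto simp: divide_eq_eq eq_divide_eq mult.commute)
  qed
  show ?thesis
    unfolding ruij_fun_def[abs_def]
    by (intro holomorphic_on_sum holomorphic_on_mult holomorphic_on_add holomorphic_on_prod
        holomorphic_on_const h1 h2) auto
qed

lemma ruij_fun_at_infinity:
  assumes "finite Y" "ruij_generic s t z Y"
  shows "(ruij_fun \<alpha> \<beta> s t z Y \<longlongrightarrow> (\<alpha> + \<beta>) * ruij_sum \<alpha> \<beta> s t z Y) at_infinity"
proof -
  have lim: "((\<lambda>u. rf s t (c * u)) \<longlongrightarrow> 1) at_infinity" if "c \<noteq> 0" for c
    by (rule filterlim_compose[OF rf_at_infinity])
       (rule tendsto_mult_filterlim_at_infinity[OF tendsto_const that filterlim_ident])
  have lim': "((\<lambda>u. rf s t (u / z i)) \<longlongrightarrow> 1) at_infinity"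
      "((\<lambda>u. rf s t (s * t * u / z i)) \<longlongrightarrow> 1) at_infinity" if "i \<in> Y" for i
    using lim[of "1 / z i"] lim[of "s * t / z i"] assms that by (auto simp: ruij_generic_def)
  have "(ruij_fun \<alpha> \<beta> s t z Y \<longlongrightarrow> (\<Sum>I\<in>Pow Y. ruij_weight \<alpha> \<beta> s t z Y I *
     (\<alpha> * (\<Prod>j\<in>Y - I. 1) + \<beta> * (\<Prod>i\<in>I. 1)))) at_infinity"
    unfolding ruij_fun_def[abs_def]
    by (intro tendsto_sum tendsto_mult tendsto_add tendsto_prod tendsto_const lim') auto
  then show ?thesis by (simp add: ruij_sum_def sum_distrib_left mult.commute)
qed

lemma ruij_fun_eq:
  assumes "finite Y" "x \<notin> Y" "ruij_generic s t z (insert x Y)"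
  shows "ruij_sum \<alpha> \<beta> s t z (insert x Y) = ruij_fun \<alpha> \<beta> s t z Y (z x)"
  unfolding ruij_sum_insert[OF assms(1,2)] ruij_fun_def
proof (intro sum.cong refl arg_cong2[of _ _ _ _ "(*)"] arg_cong2[of _ _ _ _ "(+)"] prod.cong)
  fix I i assume "I \<in> Pow Y" "i \<in> I"
  then have "z i \<noteq> 0" "z x \<noteq> 0" "s \<noteq> 0" "t \<noteq> 0"
    using assms(3) by (auto simp: ruij_generic_def)
  then show "rf s t (z i / z x) = rf s t (s * t * z x / z i)"
    using rf_mult_reflect by simp
qed

text \<open>Both sides are rational functions of \<open>z x\<close> with the same residues, by the induction hypothesis
  for the sets without \<open>x\<close> and one more point, and the same value at infinity.\<close>

lemma ruij_sum_sym_generic: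
  assumes "finite X" "ruij_generic s t z X"
  shows "ruij_sum \<alpha> \<beta> s t z X = ruij_sum \<beta> \<alpha> s t z X"
  using assms
proof (induction X rule: finite_psubset_induct)
  case (psubset X)
  show ?case
  proof (cases "X = {}")
    case True then show ?thesis by (simp add: ruij_sum_def ruij_weight_def)
  next
    case False
    then obtain x Y where X: "X = insert x Y" "x \<notin> Y" by (metis Set.set_insert ex_in_conv)
    have fin: "finite Y" using psubset X by simp
    have gen: "ruij_generic s t z Y" by (rule ruij_generic_subset[OF psubset.prems]) (use X in auto)
    have IH: "ruij_sum \<alpha> \<beta> s t z Y' = ruij_sum \<beta> \<alpha> s t z Y'" if "Y' \<subseteq> Y" for Y'
      using psubset.IH[of Y'] that X ruij_generic_subset[OF gen that] by auto
    define P where "P = z ` Y \<union> (\<lambda>w. s * t * w) ` z ` Y \<union> (\<lambda>w. w / (s * t)) ` z ` Y"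
    define D where "D u = ruij_fun \<alpha> \<beta> s t z Y u - ruij_fun \<beta> \<alpha> s t z Y u" for u
    have "D (z x) = 0"
    proof (rule eventually_zero_of_removable[where f = D and P = P and z = "z x"])
      show "finite P" using fin by (simp add: P_def)
      show "D holomorphic_on - P"
        unfolding D_def[abs_def] P_def by (intro holomorphic_on_diff holomorphic_ruij_fun fin gen)
      have "(D \<longlongrightarrow> (\<alpha> + \<beta>) * ruij_sum \<alpha> \<beta> s t z Y - (\<beta> + \<alpha>) * ruij_sum \<beta> \<alpha> s t z Y) at_infinity"
        unfolding D_def[abs_def] by (intro tendsto_diff ruij_fun_at_infinity fin gen)
      then show "(D \<longlongrightarrow> 0) at_infinity" using IH[of Y] by (simp add: add.commute)
      have st: "s \<noteq> 0" "t \<noteq> 0" using gen by (simp_all add: ruij_generic_def)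
      have n: "z x \<noteq> z j" "z x \<noteq> s * t * z j" "z j \<noteq> s * t * z x" if "j \<in> Y" for j
        using psubset.prems that X unfolding ruij_generic_def by (metis insertCI)+
      have "z x \<noteq> z j / (s * t)" if "j \<in> Y" for j
        using n(3)[OF that] st by (auto simp: eq_divide_eq mult.commute)
      with n show "z x \<notin> P" unfolding P_def by blast
      fix p assume p: "p \<in> P"
      then obtain j where j: "j \<in> Y" "p = z j \<or> p = s * t * z j \<or> p = z j / (s * t)"
        by (auto simp: P_def)
      define Y' where "Y' = Y - {j}"
      have Y': "Y = insert j Y'" "j \<notin> Y'" "finite Y'" using j fin by (auto simp: Y'_def)
      note lims = tendsto_ruij_fun[OF Y'(3,2) gen[unfolded Y'(1)], folded Y'(1)]
      have "((\<lambda>u. (u - p) * ruij_fun \<alpha> \<beta> s t z Y u - (u - p) * ruij_fun \<beta> \<alpha> s t z Y u) \<longlongrightarrow> 0) (at p)"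
        using j(2)
      proof (elim disjE)
        assume "p = z j"
        then show ?thesis using tendsto_diff[OF lims(1)[of \<alpha> \<beta>] lims(1)[of \<beta> \<alpha>]] by simp
      next
        assume "p = s * t * z j"
        then show ?thesis using tendsto_diff[OF lims(2)[of \<alpha> \<beta>] lims(2)[of \<beta> \<alpha>]] IH[of Y'] Y'
          by (simp add: mult.commute[of \<beta> \<alpha>] subset_insertI)
      next
        assume "p = z j / (s * t)"
        then show ?thesis using tendsto_diff[OF lims(3)[of \<alpha> \<beta>] lims(3)[of \<beta> \<alpha>]] IH[of Y'] Y'
          by (simp add: mult.commute[of \<beta> \<alpha>] subset_insertI)
      qed
      then show "((\<lambda>u. (u - p) * D u) \<longlongrightarrow> 0) (at p)"
        by (simp add: D_def right_diff_distrib)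
    qed
    then show ?thesis
      using ruij_fun_eq[OF fin X(2)] psubset.prems X(1) by (simp add: D_def)
  qed
qed

text \<open>Comparing moduli leaves at most one bad value of e when B is nonzero.\<close>

lemma eventually_exp_neq:
  fixes A B :: complex and r :: real
  assumes "r \<noteq> 0" "A \<noteq> 0"
  shows "\<forall>\<^sub>F e in at_right (0::real). exp (of_real (e * r)) * A \<noteq> B"
proof (cases "B = 0")
  case False
  have "exp (of_real (e * r)) * A \<noteq> B" if "e \<noteq> ln (norm B / norm A) / r" for e
  proof
    assume "exp (of_real (e * r)) * A = B"
    then have "exp (e * r) * norm A = norm B"
      by (metis norm_mult norm_exp_eq_Re Re_complex_of_real)
    then have "exp (e * r) = norm B / norm A" using assms by (simp add: field_simps)
    then have "e * r = ln (norm B / norm A)" by (metis ln_exp)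
    then show False using that assms by (simp add: field_simps)
  qed
  then show ?thesis
    by (rule eventually_mono[OF eventually_neq_at_within])
qed (use assms in simp)

text \<open>The genericity assumptions are removed by moving all points and the parameter \<open>s\<close> slightly.\<close>

lemma ruij_sum_sym:
  assumes fin: "finite X" and st: "s \<noteq> 0" "t \<noteq> 0"
    and zX: "\<And>i. i \<in> X \<Longrightarrow> z i \<noteq> 0"
    and zz: "\<And>i j. i \<in> X \<Longrightarrow> j \<in> X \<Longrightarrow> i \<noteq> j \<Longrightarrow> z i \<noteq> z j \<and> z i \<noteq> s * t * z j"
  shows "ruij_sum \<alpha> \<beta> s t z X = ruij_sum \<beta> \<alpha> s t z X"
proof -
  obtain n :: "'a \<Rightarrow> nat" where n: "inj_on n X"
    using finite_imp_inj_to_nat_seg[OF fin] by auto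
  define s' where "s' e = exp (of_real e) * s" for e :: real
  \<comment> \<open>Distinct multiples of 10 cannot differ by k when k is at most 2, and k is the
    power of st in the coincidences to be avoided; so the motion of s never compensates that of the
    points.\<close>
  define z' where "z' e i = exp (of_real (e * (10 * real (n i)))) * z i" for e :: real and i
  have "\<forall>\<^sub>F e in at_right 0. s' e * t \<noteq> 1"
    using eventually_exp_neq[of 1 "s * t" 1] st by (simp add: s'_def mult.assoc)
  moreover have "\<forall>\<^sub>F e in at_right 0. (s' e * t)\<^sup>2 \<noteq> 1"
  proof -
    have "(s' e * t)\<^sup>2 = exp (of_real (e * 2)) * (s * t)\<^sup>2" for e
      using exp_double[of "complex_of_real e"] by (simp add: s'_def power_mult_distrib mult.commute[of _ 2])
    then show ?thesis using eventually_exp_neq[of 2 "(s * t)\<^sup>2" 1] st by simp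
  qed
  moreover have "\<forall>\<^sub>F e in at_right 0. \<forall>i\<in>X. \<forall>j\<in>X. i \<noteq> j \<longrightarrow>
     z' e i \<noteq> z' e j \<and> z' e i \<noteq> s' e * t * z' e j \<and> z' e i \<noteq> (s' e * t)\<^sup>2 * z' e j"
  proof (intro eventually_ball_finite fin ballI)
    fix i j assume ij: "i \<in> X" "j \<in> X"
    have key: "\<forall>\<^sub>F e in at_right 0. i \<noteq> j \<longrightarrow> z' e i \<noteq> (s' e * t) ^ k * z' e j" if k: "k \<le> 2" for k :: nat
    proof (cases "i = j")
      case False
      then have "n i \<noteq> n j" using n ij by (meson inj_onD)
      then have r: "10 * real (n i) - 10 * real (n j) - real k \<noteq> 0" using k
        by (cases "n i < n j") linarith+
      have "z' e i = (s' e * t) ^ k * z' e j \<longleftrightarrow>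
        exp (of_real (e * (10 * real (n i) - 10 * real (n j) - real k))) * z i = (s * t) ^ k * z j" for e
      proof -
        have "s' e ^ k = exp (of_real (e * real k)) * s ^ k"
          using exp_of_nat_mult[of k "complex_of_real e"] by (simp add: s'_def power_mult_distrib mult.commute)
        then have 1: "(s' e * t) ^ k * z' e j =
            exp (of_real (e * real k)) * exp (of_real (e * (10 * real (n j)))) * ((s * t) ^ k * z j)"
          by (simp add: z'_def power_mult_distrib)
        have 2: "exp (complex_of_real (e * (10 * real (n i) - 10 * real (n j) - real k))) =
            exp (of_real (e * (10 * real (n i)))) /
            (exp (of_real (e * real k)) * exp (of_real (e * (10 * real (n j)))))"
          by (simp add: exp_diff[symmetric] exp_add[symmetric] algebra_simps)
        have 3: "E * w = D * W \<longleftrightarrow> E / D * w = W" if "D \<noteq> 0" for E D w W :: complex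
          using that by (auto simp: field_simps)
        show ?thesis unfolding 1 2 unfolding z'_def by (rule 3) simp
      qed
      then show ?thesis using eventually_exp_neq[OF r, of "z i" "(s * t) ^ k * z j"] zX ij by simp
    qed simp
    show "\<forall>\<^sub>F e in at_right 0. i \<noteq> j \<longrightarrow>
     z' e i \<noteq> z' e j \<and> z' e i \<noteq> s' e * t * z' e j \<and> z' e i \<noteq> (s' e * t)\<^sup>2 * z' e j"
      using key[of 0, OF le0] key[of 1, OF one_le_numeral] key[of 2, OF order_refl] by eventually_elim auto
  qed
  ultimately have "\<forall>\<^sub>F e in at_right 0. ruij_generic (s' e) t (z' e) X"
    by eventually_elim (use st zX in \<open>auto simp: ruij_generic_def s'_def z'_def\<close>)
  then have ev: "\<forall>\<^sub>F e in at_right 0. ruij_sum \<alpha> \<beta> (s' e) t (z' e) X = ruij_sum \<beta> \<alpha> (s' e) t (z' e) X"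
    by eventually_elim (rule ruij_sum_sym_generic[OF fin])
  have ts: "(s' \<longlongrightarrow> s) (at_right 0)"
    unfolding s'_def[abs_def] by (auto intro!: tendsto_eq_intros)
  have tz: "((\<lambda>e. z' e i) \<longlongrightarrow> z i) (at_right 0)" for i
    unfolding z'_def[abs_def] by (auto intro!: tendsto_eq_intros)
  have "((\<lambda>e. ruij_sum \<alpha> \<beta> (s' e) t (z' e) X) \<longlongrightarrow> ruij_sum \<alpha> \<beta> s t z X) (at_right 0)" for \<alpha> \<beta>
    unfolding ruij_sum_def ruij_weight_def
  proof (intro tendsto_sum tendsto_mult tendsto_const tendsto_prod tendsto_rf tendsto_divide tz ts)
    fix I i j assume *: "I \<in> Pow X" "i \<in> I" "j \<in> X - I"
    then show "z j \<noteq> 0" "z i / z j \<noteq> 1" "z i / z j \<noteq> s * t"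
      using zX[of j] zz[of i j] by (auto simp: field_simps)
  qed
  from tendsto_unique[OF _ this tendsto_cong[THEN iffD2, OF ev this]] show ?thesis
    by simp
qed

section \<open>Roots of unity and contractions\<close>

lemma omega_pow_add: "omega_pow L (a + b) = omega_pow L a * omega_pow L b"
  by (simp add: omega_pow_def distrib_left add_divide_distrib exp_add)

lemma omega_pow_0 [simp]: "omega_pow L 0 = 1"
  by (simp add: omega_pow_def)

lemma omega_pow_neq_0 [simp]: "omega_pow L c \<noteq> 0"
  by (simp add: omega_pow_def)

lemma omega_pow_diff: "omega_pow L (a - b) = omega_pow L a / omega_pow L b"
  by (simp add: omega_pow_def right_diff_distrib diff_divide_distrib exp_diff)

lemma omega_pow_minus: "omega_pow L (- a) = inverse (omega_pow L a)"
  using omega_pow_diff[of L 0 a] by (simp add: inverse_eq_divide)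

lemma omega_pow_power: "omega_pow L c ^ n = omega_pow L (of_nat n * c)"
  by (simp add: omega_pow_def exp_of_nat_mult[symmetric] algebra_simps)

lemma omega_pow_sum: "finite A \<Longrightarrow> omega_pow L (\<Sum>x\<in>A. g x) = (\<Prod>x\<in>A. omega_pow L (g x))"
  by (induction A rule: finite_induct) (simp_all add: omega_pow_add)

lemma omega_pow_eq_1_iff:
  assumes "L > 0"
  shows "omega_pow L (of_real c) = 1 \<longleftrightarrow> (\<exists>n::int. c = of_int n * of_nat L)"
proof -
  have "2 * of_real pi * \<i> * of_real c / of_nat L = \<i> * of_real (2 * pi * c / L)"
    by simp
  then have "omega_pow L (of_real c) = 1 \<longleftrightarrow> (\<exists>n::int. 2 * pi * c / L = of_int (2 * n) * pi)"
    unfolding omega_pow_def by (simp only: exp_eq_1) simp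
  also have "\<dots> \<longleftrightarrow> (\<exists>n::int. c = of_int n * of_nat L)"
    using assms by (simp add: field_simps)
  finally show ?thesis .
qed

text \<open>The arguments inside a current differ from its point by half-integer powers of \<omega>,
  hence agree with it after raising to the power 2L. This explains the exponent in
  \<open>regular_point\<close>.\<close>

lemma omega_pow_half_power:
  assumes "L > 0"
  shows "omega_pow L (of_int m / 2) ^ (2 * L) = 1"
proof -
  have "omega_pow L (of_int m / 2) ^ (2 * L) = omega_pow L (of_real (real_of_int m * real L))"
    unfolding omega_pow_power by (simp add: mult.commute)
  also have "\<dots> = 1" using assms omega_pow_eq_1_iff by blast
  finally show ?thesis .
qed

lemma f_pair_eq_rf: "f_pair L p = rf (omega_pow L p) (omega_pow L (1 - p))"
  by (rule ext) (simp add: f_pair_def rf_def omega_pow_add[symmetric])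

lemma f_pair_reflect: "u \<noteq> 0 \<Longrightarrow> f_pair L p (omega_pow L 1 / u) = f_pair L p u"
  using rf_reflect[of "omega_pow L p" "omega_pow L (1 - p)" u]
  by (simp add: f_pair_eq_rf omega_pow_add[symmetric])

lemma pair_contr_commute: "pair_contr L p u v = pair_contr L p v u"
  by (cases u; cases v) simp

text \<open>The number of elements of \<open>S\<close> up to \<open>s\<close> is the position of
  \<open>s\<close> in the sorted list. Describing the argument by the element instead of the list
  index makes products over sets possible.\<close>

definition vop_arg :: "nat \<Rightarrow> nat set \<Rightarrow> complex \<Rightarrow> nat \<Rightarrow> complex" where
  "vop_arg L S x s = x * omega_pow L ((of_nat (card S) + 1 - 2 * of_nat (card {t\<in>S. t \<le> s})) / 2)"

lemma card_le_nth_sorted_list: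
  assumes "finite S" "m < card S"
  shows "card {t\<in>S. t \<le> sorted_list_of_set S ! m} = Suc m"
proof -
  let ?l = "sorted_list_of_set S"
  have l: "sorted_wrt (<) ?l" "length ?l = card S" "set ?l = S" "distinct ?l" using assms by auto
  have "{t\<in>S. t \<le> ?l ! m} = (!) ?l ` {..m}"
  proof (intro equalityI subsetI)
    fix t assume "t \<in> {t\<in>S. t \<le> ?l ! m}"
    then obtain k where k: "k < length ?l" "t = ?l ! k" "?l ! k \<le> ?l ! m"
      using l(3) by (metis (mono_tags, lifting) in_set_conv_nth mem_Collect_eq)
    then have "k \<le> m" using sorted_wrt_nth_less[OF l(1), of m k] assms l(2) by (metis leD not_le_imp_less)
    then show "t \<in> (!) ?l ` {..m}" using k by auto
  next
    fix t assume "t \<in> (!) ?l ` {..m}"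
    then obtain k where k: "k \<le> m" "t = ?l ! k" by auto
    then have "?l ! k \<le> ?l ! m" using sorted_wrt_nth_less[OF l(1), of k m] assms l(2)
      by (cases "k = m") auto
    then show "t \<in> {t\<in>S. t \<le> ?l ! m}" using k l assms by (metis (mono_tags, lifting) le_less_trans mem_Collect_eq nth_mem)
  qed
  moreover have "inj_on ((!) ?l) {..m}"
    using l assms by (auto simp: inj_on_def nth_eq_iff_index_eq)
  ultimately show ?thesis by (simp add: card_image)
qed

lemma vop_of_set_eq:
  assumes "finite S"
  shows "vop_of_set L S x = map (\<lambda>s. (s, vop_arg L S x s)) (sorted_list_of_set S)"
proof (rule nth_equalityI)
  show "length (vop_of_set L S x) = length (map (\<lambda>s. (s, vop_arg L S x s)) (sorted_list_of_set S))"
    using assms by (simp add: vop_of_set_def del: upt_Suc)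
next
  fix i assume "i < length (vop_of_set L S x)"
  then have "i < card S" by (simp add: vop_of_set_def del: upt_Suc)
  then show "vop_of_set L S x ! i = map (\<lambda>s. (s, vop_arg L S x s)) (sorted_list_of_set S) ! i"
    using card_le_nth_sorted_list[OF assms, of i] assms
    by (simp add: vop_of_set_def vop_arg_def nth_map del: upt_Suc)
qed

lemma prod_list_map_sorted_list_of_set:
  "finite S \<Longrightarrow> (\<Prod>s\<leftarrow>sorted_list_of_set S. g s) = (\<Prod>s\<in>S. g s)"
  by (metis distinct_sorted_list_of_set prod.distinct_set_conv_list set_sorted_list_of_set)

lemma vop_contr_of_set:
  assumes "finite S" "finite S'"
  shows "vop_contr L p (vop_of_set L S x) (vop_of_set L S' x') =
    (\<Prod>s\<in>S. \<Prod>s'\<in>S'. pair_contr L p (s, vop_arg L S x s) (s', vop_arg L S' x' s'))"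
  using assms by (simp add: vop_contr_def vop_of_set_eq comp_def prod_list_map_sorted_list_of_set)

lemma vop_arg_power:
  assumes "L > 0"
  shows "vop_arg L S x s ^ (2 * L) = x ^ (2 * L)"
proof -
  have "(of_nat (card S) + 1 - 2 * of_nat (card {t\<in>S. t \<le> s})) / 2 =
    (of_int (int (card S) + 1 - 2 * int (card {t\<in>S. t \<le> s})) / 2 :: complex)" by simp
  then show ?thesis unfolding vop_arg_def power_mult_distrib
    by (simp only: omega_pow_half_power[OF assms] mult_1_right)
qed

lemma vop_arg_neq_0: "x \<noteq> 0 \<Longrightarrow> vop_arg L S x s \<noteq> 0"
  by (simp add: vop_arg_def)

section \<open>Invariance of the functions of primary operators\<close>

definition set_contr :: "nat \<Rightarrow> real \<Rightarrow> nat set \<Rightarrow> complex \<Rightarrow> nat set \<Rightarrow> complex \<Rightarrow> complex" where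
  "set_contr L p S x S' x' =
     (\<Prod>s\<in>S. \<Prod>s'\<in>S'. pair_contr L p (s, vop_arg L S x s) (s', vop_arg L S' x' s'))"

lemma set_contr_commute: "set_contr L p S x S' x' = set_contr L p S' x' S x"
  unfolding set_contr_def by (subst prod.swap) (intro prod.cong refl pair_contr_commute)

context
  fixes L r :: nat and \<sigma> :: "nat \<Rightarrow> nat"
  defines "\<sigma> \<equiv> Transposition.transpose r (Suc r)"
begin

lemma sigma_less_iff:
  assumes "\<not> (a \<in> {r, Suc r} \<and> b \<in> {r, Suc r})"
  shows "\<sigma> a < \<sigma> b \<longleftrightarrow> a < b"
  using assms by (auto simp: \<sigma>_def Transposition.transpose_def)

lemma sigma_eq_iff: "\<sigma> a = \<sigma> b \<longleftrightarrow> a = b"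
  unfolding \<sigma>_def by (metis transpose_involutory)

lemma inj_on_sigma: "inj_on \<sigma> A"
  by (simp add: inj_on_def sigma_eq_iff)

text \<open>On a set that contains r but not r + 1 the transposition is increasing, so every factor
  keeps its position and thus its argument.\<close>

lemma vop_arg_sigma:
  assumes "s \<in> S" "r \<in> S" "Suc r \<notin> S"
  shows "vop_arg L (\<sigma> ` S) x (\<sigma> s) = vop_arg L S x s"
proof -
  have "\<sigma> t \<le> \<sigma> s \<longleftrightarrow> t \<le> s" if "t \<in> S" for t
  proof (cases "t = s")
    case False
    then have "\<not> (s \<in> {r, Suc r} \<and> t \<in> {r, Suc r})" using assms that by auto
    from sigma_less_iff[OF this] show ?thesis by (simp add: not_less[symmetric])
  qed simp
  then have "{t \<in> \<sigma> ` S. t \<le> \<sigma> s} = \<sigma> ` {t \<in> S. t \<le> s}" by auto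
  then show ?thesis by (simp add: vop_arg_def card_image[OF inj_on_sigma])
qed

lemma pair_contr_sigma:
  assumes "t \<notin> {r, Suc r}"
  shows "pair_contr L p (r, z) (t, y) = pair_contr L p (Suc r, z) (t, y)"
  using assms by auto

lemma vop_arg_Suc:
  assumes "finite S" "r \<in> S" "Suc r \<in> S"
  shows "vop_arg L S x (Suc r) = vop_arg L S x r / omega_pow L 1"
proof -
  have "{t \<in> S. t \<le> Suc r} = insert (Suc r) {t \<in> S. t \<le> r}" using assms by auto
  then have "card {t \<in> S. t \<le> Suc r} = Suc (card {t \<in> S. t \<le> r})" using assms by simp
  moreover have "(of_nat (card S) + 1 - 2 * of_nat (Suc (card {t \<in> S. t \<le> r}))) / 2 =
     (of_nat (card S) + 1 - 2 * of_nat (card {t \<in> S. t \<le> r})) / 2 - (1 :: complex)" by (simp add: field_simps)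
  ultimately show ?thesis by (simp only: vop_arg_def omega_pow_diff times_divide_eq_right)
qed

text \<open>If the partner has r alone, a pair of equal indices, with contraction 1, becomes a pair
  of different ones and contributes an f. If the partner has both r and r + 1, their arguments
  differ by the factor \<omega>; the factor f moves from one to the other and stays the same because
  f(\<omega>/u) = f(u).\<close>

lemma set_contr_sigma_left:
  assumes fin: "finite S" "finite S'" and S: "r \<in> S" "Suc r \<notin> S" and z: "x \<noteq> 0" "x' \<noteq> 0"
  shows "r \<in> S' \<Longrightarrow> Suc r \<notin> S' \<Longrightarrow> set_contr L p (\<sigma> ` S) x S' x' =
           f_pair L p (vop_arg L S' x' r / vop_arg L S x r) * set_contr L p S x S' x'"
    and "(r \<in> S' \<longleftrightarrow> Suc r \<in> S') \<Longrightarrow> set_contr L p (\<sigma> ` S) x S' x' = set_contr L p S x S' x'"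
proof -
  let ?z = "vop_arg L S x" and ?y = "vop_arg L S' x'"
  define G where "G t = (\<Prod>s'\<in>S'. pair_contr L p (t, ?z r) (s', ?y s'))" for t
  define R where "R = (\<Prod>s\<in>S - {r}. \<Prod>s'\<in>S'. pair_contr L p (s, ?z s) (s', ?y s'))"
  have 1: "set_contr L p S x S' x' = G r * R"
    unfolding set_contr_def G_def R_def using prod.remove[OF fin(1) S(1)] by simp
  have "set_contr L p (\<sigma> ` S) x S' x' = (\<Prod>s\<in>S. \<Prod>s'\<in>S'. pair_contr L p (\<sigma> s, ?z s) (s', ?y s'))"
    unfolding set_contr_def prod.reindex[OF inj_on_sigma] comp_def
    by (intro prod.cong refl) (simp only: vop_arg_sigma S not_False_eq_True)
  also have "\<dots> = G (Suc r) * (\<Prod>s\<in>S - {r}. \<Prod>s'\<in>S'. pair_contr L p (\<sigma> s, ?z s) (s', ?y s'))"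
    unfolding G_def by (subst prod.remove[OF fin(1) S(1)]) (simp add: \<sigma>_def)
  also have "(\<Prod>s\<in>S - {r}. \<Prod>s'\<in>S'. pair_contr L p (\<sigma> s, ?z s) (s', ?y s')) = R"
    unfolding R_def
  proof (intro prod.cong refl)
    fix s s' assume "s \<in> S - {r}"
    then have "\<sigma> s = s" using S by (auto simp: \<sigma>_def Transposition.transpose_def)
    then show "pair_contr L p (\<sigma> s, ?z s) (s', ?y s') = pair_contr L p (s, ?z s) (s', ?y s')" by simp
  qed
  finally have 2: "set_contr L p (\<sigma> ` S) x S' x' = G (Suc r) * R" .
  have rest: "(\<Prod>s'\<in>S' - {r, Suc r}. pair_contr L p (Suc r, ?z r) (s', ?y s')) =
      (\<Prod>s'\<in>S' - {r, Suc r}. pair_contr L p (r, ?z r) (s', ?y s'))"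
    by (intro prod.cong refl pair_contr_sigma[symmetric]) auto
  {
    assume S': "r \<in> S'" "Suc r \<notin> S'"
    have e: "S' - {r} = S' - {r, Suc r}" using S' by auto
    have "G t = pair_contr L p (t, ?z r) (r, ?y r) *
        (\<Prod>s'\<in>S' - {r, Suc r}. pair_contr L p (t, ?z r) (s', ?y s'))" for t
      unfolding G_def by (subst prod.remove[OF fin(2) S'(1)]) (simp only: e)
    then have "G (Suc r) = f_pair L p (?y r / ?z r) * G r"
      using rest by simp
    then show "set_contr L p (\<sigma> ` S) x S' x' = f_pair L p (?y r / ?z r) * set_contr L p S x S' x'"
      using 1 2 by simp
  next
    assume S': "r \<in> S' \<longleftrightarrow> Suc r \<in> S'"
    have "G (Suc r) = G r"
    proof (cases "r \<in> S'")
      case False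
      then have "S' - {r, Suc r} = S'" using S' by auto
      then show ?thesis using rest by (simp add: G_def)
    next
      case True
      have e: "S' - {r} - {Suc r} = S' - {r, Suc r}" and i: "Suc r \<in> S' - {r}" using S' True by auto
      have f: "finite (S' - {r})" using fin by simp
      have "G t = pair_contr L p (t, ?z r) (r, ?y r) * (pair_contr L p (t, ?z r) (Suc r, ?y (Suc r)) *
          (\<Prod>s'\<in>S' - {r, Suc r}. pair_contr L p (t, ?z r) (s', ?y s')))" for t
        unfolding G_def by (subst prod.remove[OF fin(2) True], subst prod.remove[OF f i]) (simp only: e)
      moreover have "f_pair L p (?z r / ?y (Suc r)) = f_pair L p (?y r / ?z r)"
        using f_pair_reflect[of "?y r / ?z r" L p] vop_arg_neq_0 z vop_arg_Suc[OF fin(2), of x'] True S'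
        by (simp add: mult.commute)
      ultimately show ?thesis using rest by simp
    qed
    then show "set_contr L p (\<sigma> ` S) x S' x' = set_contr L p S x S' x'"
      using 1 2 by simp
  }
qed

lemma set_contr_sigma_both:
  assumes S: "r \<in> S" "Suc r \<notin> S" "r \<in> S'" "Suc r \<notin> S'"
  shows "set_contr L p (\<sigma> ` S) x (\<sigma> ` S') x' = set_contr L p S x S' x'"
proof -
  have "set_contr L p (\<sigma> ` S) x (\<sigma> ` S') x' = (\<Prod>s\<in>S. \<Prod>s'\<in>S'.
      pair_contr L p (\<sigma> s, vop_arg L S x s) (\<sigma> s', vop_arg L S' x' s'))"
    unfolding set_contr_def prod.reindex[OF inj_on_sigma] comp_def
    by (intro prod.cong refl) (simp only: vop_arg_sigma S not_False_eq_True)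
  also have "\<dots> = set_contr L p S x S' x'"
    unfolding set_contr_def
  proof (intro prod.cong refl)
    fix s s' assume s: "s \<in> S" "s' \<in> S'"
    show "pair_contr L p (\<sigma> s, vop_arg L S x s) (\<sigma> s', vop_arg L S' x' s') =
        pair_contr L p (s, vop_arg L S x s) (s', vop_arg L S' x' s')"
    proof (cases "s = s'")
      case False
      then have "\<not> (s \<in> {r, Suc r} \<and> s' \<in> {r, Suc r})" "\<not> (s' \<in> {r, Suc r} \<and> s \<in> {r, Suc r})"
        using s S by auto
      from this[THEN sigma_less_iff] show ?thesis by (simp add: sigma_eq_iff)
    qed simp
  qed
  finally show ?thesis .
qed

section \<open>Grouping the terms by the currents that contain exactly one of r and r + 1\<close>

definition unpaired :: "nat set list \<Rightarrow> nat set" where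
  "unpaired C = {j. j < length C \<and> r \<in> C ! j \<and> Suc r \<notin> C ! j}"

text \<open>\<open>I\<close> lists the unpaired currents that keep r; the other unpaired ones
  receive r + 1. Every list of subsets arises exactly once from a canonical list and such an
  \<open>I\<close>, as \<open>swap_sets_bij\<close> and \<open>swap_sets_canon\<close> show.\<close>

definition swap_sets :: "nat set list \<Rightarrow> nat set \<Rightarrow> nat set list" where
  "swap_sets C I = map (\<lambda>j. if j \<in> unpaired C - I then \<sigma> ` (C ! j) else C ! j) [0..<length C]"

definition canonical :: "nat set list \<Rightarrow> bool" where
  "canonical C \<longleftrightarrow> (\<forall>j<length C. Suc r \<in> C ! j \<longrightarrow> r \<in> C ! j)"

definition canon :: "nat set \<Rightarrow> nat set" where
  "canon S = (if Suc r \<in> S \<and> r \<notin> S then \<sigma> ` S else S)"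

lemma sigma_image_mem: "r \<in> \<sigma> ` S \<longleftrightarrow> Suc r \<in> S" "Suc r \<in> \<sigma> ` S \<longleftrightarrow> r \<in> S"
  by (auto simp: \<sigma>_def Transposition.transpose_def image_iff)

lemma sigma_image_sigma: "\<sigma> ` \<sigma> ` S = S"
  by (auto simp: \<sigma>_def image_comp)

lemma canon_swap: "r \<in> S \<Longrightarrow> Suc r \<notin> S \<Longrightarrow> canon (\<sigma> ` S) = S"
  by (simp add: canon_def sigma_image_mem sigma_image_sigma)

lemma swap_sets_bij:
  assumes "canonical C" "I \<subseteq> unpaired C"
  shows "map canon (swap_sets C I) = C" "{j. j < length C \<and> r \<in> swap_sets C I ! j \<and> Suc r \<notin> swap_sets C I ! j} = I"
proof -
  show "map canon (swap_sets C I) = C"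
  proof (rule nth_equalityI)
    fix i assume "i < length (map canon (swap_sets C I))"
    then have i: "i < length C" by (simp add: swap_sets_def)
    show "map canon (swap_sets C I) ! i = C ! i"
    proof (cases "i \<in> unpaired C - I")
      case True
      then have "canon (\<sigma> ` (C ! i)) = C ! i" by (intro canon_swap) (auto simp: unpaired_def)
      then show ?thesis using i True by (simp add: swap_sets_def)
    next
      case False
      then show ?thesis using i assms(1) by (auto simp: swap_sets_def canonical_def canon_def)
    qed
  qed (simp add: swap_sets_def)
  show "{j. j < length C \<and> r \<in> swap_sets C I ! j \<and> Suc r \<notin> swap_sets C I ! j} = I"
    using assms by (auto simp: swap_sets_def canonical_def unpaired_def sigma_image_mem split: if_splits)
qed

lemma swap_sets_canon:
  "canonical (map canon Ss)" "unpaired Ss \<subseteq> unpaired (map canon Ss)"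
  "swap_sets (map canon Ss) (unpaired Ss) = Ss"
proof -
  show "canonical (map canon Ss)"
    by (auto simp: canonical_def canon_def sigma_image_mem)
  show "unpaired Ss \<subseteq> unpaired (map canon Ss)"
    by (auto simp: unpaired_def canon_def)
  show "swap_sets (map canon Ss) (unpaired Ss) = Ss"
    by (rule nth_equalityI)
       (auto simp: swap_sets_def unpaired_def canon_def sigma_image_mem sigma_image_sigma)
qed

lemma prod_sigma_image: "(\<Prod>s\<in>\<sigma> ` S. g s) = (\<Prod>s\<in>S. g (\<sigma> s))"
  by (simp add: prod.reindex[OF inj_on_sigma])

end

lemma in_listset: "xs \<in> listset As \<longleftrightarrow> length xs = length As \<and> (\<forall>i<length As. xs ! i \<in> As ! i)"
proof (induction As arbitrary: xs)
  case (Cons A As)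
  have "xs \<in> listset (A # As) \<longleftrightarrow> (\<exists>y ys. xs = y # ys \<and> y \<in> A \<and> ys \<in> listset As)"
    by (auto simp: set_Cons_def)
  then show ?case unfolding Cons.IH
    by (cases xs) (auto simp: nth_Cons less_Suc_eq_0_disj split: nat.splits)
qed auto

lemma finite_listset: "\<forall>A\<in>set As. finite A \<Longrightarrow> finite (listset As)"
proof (induction As)
  case (Cons A As)
  have "set_Cons A (listset As) = (\<lambda>(y, ys). y # ys) ` (A \<times> listset As)"
    by (auto simp: set_Cons_def)
  with Cons show ?case by simp
qed simp

lemma finite_k_subsets: "finite (k_subsets L k)"
  by (rule finite_subset[of _ "Pow {1..L}"]) (auto simp: k_subsets_def)

lemma prod_ordered_pairs:
  fixes h :: "nat \<Rightarrow> nat \<Rightarrow> complex"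
  assumes "\<And>i. h i i = 1"
  shows "(\<Prod>j<N. \<Prod>i<j. h i j * h j i) = (\<Prod>i<N. \<Prod>j<N. h i j)"
  by (induction N) (simp_all add: prod.distrib assms mult_ac)

text \<open>With free numbers q s in place of \<omega>^(a_s) a simple reflection just transposes two
  values of \<open>q\<close>.\<close>

definition primary_fun ::
  "nat \<Rightarrow> real \<Rightarrow> (nat \<Rightarrow> complex) \<Rightarrow> nat list \<Rightarrow> complex list \<Rightarrow> complex" where
  "primary_fun L p q ks xs = (\<Sum>Ss\<in>listset (map (k_subsets L) ks). (\<Prod>j<length Ss. \<Prod>s\<in>Ss ! j. q s) *
     (\<Prod>j<length Ss. \<Prod>i<j. set_contr L p (Ss ! i) (xs ! i) (Ss ! j) (xs ! j)))"

lemma primary_fun_transpose: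
  assumes L: "L \<ge> 2" and r: "r \<in> {1..L-1}" and reg: "regular_point L xs" and len: "length xs = length ks"
  shows "primary_fun L p (q \<circ> Transposition.transpose r (Suc r)) ks xs = primary_fun L p q ks xs"
proof -
  let ?s = "Transposition.transpose r (Suc r)"
  define N where "N = length ks"
  define LS where "LS = listset (map (k_subsets L) ks)"
  define Can where "Can = {C\<in>LS. canonical r C}"
  define trm where "trm q Ss = (\<Prod>j<length Ss. \<Prod>s\<in>Ss ! j. q s) *
     (\<Prod>j<length Ss. \<Prod>i<j. set_contr L p (Ss ! i) (xs ! i) (Ss ! j) (xs ! j))" for q :: "nat \<Rightarrow> complex" and Ss
  have lenLS: "length Ss = N" if "Ss \<in> LS" for Ss
    using that by (simp add: LS_def in_listset N_def)
  have inLS: "Ss \<in> LS \<longleftrightarrow> length Ss = N \<and> (\<forall>j<N. Ss ! j \<subseteq> {1..L} \<and> card (Ss ! j) = ks ! j)" for Ss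
    by (auto simp: LS_def in_listset N_def k_subsets_def)
  have finLS: "finite LS" unfolding LS_def by (rule finite_listset) (auto simp: finite_k_subsets)
  have sub: "?s ` S \<subseteq> {1..L}" if "S \<subseteq> {1..L}" for S
    using that r by (auto simp: Transposition.transpose_def)
  have crd: "card (?s ` S) = card S" for S
    by (rule card_image[OF inj_on_sigma])
  have swapLS: "swap_sets r C I \<in> LS" if "C \<in> LS" for C I
    using that sub crd by (auto simp: inLS swap_sets_def)
  have canonLS: "map (canon r) Ss \<in> LS" if "Ss \<in> LS" for Ss
    using that sub crd by (auto simp: inLS canon_def)
  have F: "primary_fun L p q ks xs = (\<Sum>C\<in>Can. \<Sum>I\<in>Pow (unpaired r C). trm q (swap_sets r C I))" for q
  proof -
    have "(\<Sum>C\<in>Can. \<Sum>I\<in>Pow (unpaired r C). trm q (swap_sets r C I)) =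
       (\<Sum>(C, I)\<in>(SIGMA C:Can. Pow (unpaired r C)). trm q (swap_sets r C I))"
      by (rule sum.Sigma) (auto simp: Can_def finLS unpaired_def)
    also have "\<dots> = (\<Sum>Ss\<in>LS. trm q Ss)"
    proof (rule sum.reindex_bij_witness[where i = "\<lambda>Ss. (map (canon r) Ss, unpaired r Ss)"
            and j = "\<lambda>(C, I). swap_sets r C I"])
      fix a assume a: "a \<in> (SIGMA C:Can. Pow (unpaired r C))"
      then obtain C I where CI: "a = (C, I)" "C \<in> LS" "canonical r C" "I \<subseteq> unpaired r C"
        by (auto simp: Can_def)
      have "length (swap_sets r C I) = length C" by (simp add: swap_sets_def)
      then show "(map (canon r) (case a of (C, I) \<Rightarrow> swap_sets r C I),
          unpaired r (case a of (C, I) \<Rightarrow> swap_sets r C I)) = a"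
        using swap_sets_bij[OF CI(3,4)] CI(1) by (simp add: unpaired_def)
      show "(case a of (C, I) \<Rightarrow> swap_sets r C I) \<in> LS" using CI swapLS by simp
    next
      fix Ss assume Ss: "Ss \<in> LS"
      show "(case (map (canon r) Ss, unpaired r Ss) of (C, I) \<Rightarrow> swap_sets r C I) = Ss"
        by (simp add: swap_sets_canon)
      show "(map (canon r) Ss, unpaired r Ss) \<in> (SIGMA C:Can. Pow (unpaired r C))"
        using swap_sets_canon[of r Ss] canonLS[OF Ss] by (auto simp: Can_def)
    qed auto
    finally show ?thesis by (simp add: primary_fun_def trm_def LS_def)
  qed
  have x0: "xs ! j \<noteq> 0" if "j < N" for j
    using reg len that by (simp add: regular_point_def N_def)
  have xx: "(xs ! i) ^ (2 * L) \<noteq> (xs ! j) ^ (2 * L)" if "i < N" "j < N" "i \<noteq> j" for i j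
    using reg len that by (simp add: regular_point_def N_def)
  define s where "s = omega_pow L p"
  define t where "t = omega_pow L (1 - p)"
  have st: "s * t = omega_pow L 1" by (simp add: s_def t_def omega_pow_add[symmetric])
  define z where "z C j = vop_arg L (C ! j) (xs ! j) r" for C j
  \<comment> \<open>The factor shared by all terms of the group of \<open>C\<close>. It is unchanged
    when q r and q (r + 1) are exchanged: in paired currents both or none of them occur, and from
    unpaired ones r has been removed.\<close>
  define K where "K q C = (\<Prod>j\<in>{..<N} - unpaired r C. \<Prod>s\<in>C ! j. q s) *
      (\<Prod>j\<in>unpaired r C. \<Prod>s\<in>C ! j - {r}. q s) *
      (\<Prod>j<N. \<Prod>i<j. set_contr L p (C ! i) (xs ! i) (C ! j) (xs ! j))" for q :: "nat \<Rightarrow> complex" and C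
  have T: "trm q (swap_sets r C I) = K q C * ruij_weight (q r) (q (Suc r)) s t (z C) (unpaired r C) I"
    if C: "C \<in> Can" and I: "I \<subseteq> unpaired r C" for q C I
  proof -
    let ?X = "unpaired r C" and ?D = "swap_sets r C I"
    have lenC: "length C = N" using C lenLS by (simp add: Can_def)
    have X: "?X \<subseteq> {..<N}" "finite ?X" using lenC by (auto simp: unpaired_def)
    have finC: "finite (C ! j)" if "j < N" for j
      using C that by (auto simp: Can_def inLS intro: finite_subset)
    have Xr: "r \<in> C ! j" "Suc r \<notin> C ! j" if "j \<in> ?X" for j using that by (auto simp: unpaired_def)
    have nX: "r \<in> C ! j \<longleftrightarrow> Suc r \<in> C ! j" if "j < N" "j \<notin> ?X" for j
      using that C lenC by (auto simp: unpaired_def Can_def canonical_def)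
    have D: "?D ! j = (if j \<in> ?X - I then ?s ` (C ! j) else C ! j)" if "j < N" for j
      using that lenC by (simp add: swap_sets_def)
    have w: "(\<Prod>s\<in>?D ! j. q s) = (\<Prod>s\<in>C ! j - {r}. q s) * (if j \<in> I then q r else q (Suc r))" if "j \<in> ?X" for j
    proof -
      have j: "j < N" using that X by auto
      have 1: "(\<Prod>s\<in>C ! j. g s) = g r * (\<Prod>s\<in>C ! j - {r}. g s)" for g :: "nat \<Rightarrow> complex"
        by (rule prod.remove[OF finC[OF j] Xr(1)[OF that]])
      have "(\<Prod>s\<in>C ! j - {r}. q (?s s)) = (\<Prod>s\<in>C ! j - {r}. q s)"
        by (rule prod.cong) (use Xr[OF that] in \<open>auto simp: Transposition.transpose_def\<close>)
      then show ?thesis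
        unfolding D[OF j] using that I by (auto simp: prod_sigma_image 1)
    qed
    have "(\<Prod>j<N. \<Prod>s\<in>?D ! j. q s) =
       (\<Prod>j\<in>{..<N} - ?X. \<Prod>s\<in>?D ! j. q s) * (\<Prod>j\<in>?X. \<Prod>s\<in>?D ! j. q s)"
      by (rule prod.subset_diff[OF X(1)]) simp
    also have "(\<Prod>j\<in>{..<N} - ?X. \<Prod>s\<in>?D ! j. q s) = (\<Prod>j\<in>{..<N} - ?X. \<Prod>s\<in>C ! j. q s)"
      by (intro prod.cong) (auto simp: D)
    also have "(\<Prod>j\<in>?X. \<Prod>s\<in>?D ! j. q s) = (\<Prod>j\<in>?X. \<Prod>s\<in>C ! j - {r}. q s) *
        (\<Prod>j\<in>?X. if j \<in> I then q r else q (Suc r))"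
      unfolding prod.distrib[symmetric] by (intro prod.cong refl w)
    also have "(\<Prod>j\<in>?X. if j \<in> I then q r else q (Suc r)) = q r ^ card I * q (Suc r) ^ card (?X - I)"
    proof -
      have "?X \<inter> {j. j \<in> I} = I" "?X \<inter> - {j. j \<in> I} = ?X - I" using I by auto
      then show ?thesis using X(2) by (simp add: prod.If_cases)
    qed
    finally have W: "(\<Prod>j<N. \<Prod>s\<in>?D ! j. q s) = (\<Prod>j\<in>{..<N} - ?X. \<Prod>s\<in>C ! j. q s) *
        ((\<Prod>j\<in>?X. \<Prod>s\<in>C ! j - {r}. q s) * (q r ^ card I * q (Suc r) ^ card (?X - I)))" .
    \<comment> \<open>The change of the pair contraction relative to the canonical term. It differs
      from 1 only if one of two unpaired currents keeps r and the other receives r + 1.\<close>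
    define h where "h i j = (if i \<in> I \<and> j \<in> ?X - I then f_pair L p (z C i / z C j) else 1)" for i j
    have hs: "set_contr L p (?D ! i) (xs ! i) (?D ! j) (xs ! j) =
        set_contr L p (C ! i) (xs ! i) (C ! j) (xs ! j) * (h i j * h j i)" if "i < N" "j < N" for i j
    proof -
      note fc = finC[OF that(1)] finC[OF that(2)] and x = x0[OF that(1)] x0[OF that(2)]
      note left = set_contr_sigma_left[OF fc _ _ x] and right = set_contr_sigma_left[OF fc(2,1) _ _ x(2,1)]
      let ?A = "C ! i" and ?B = "C ! j" and ?x = "xs ! i" and ?y = "xs ! j"
      have e1: "set_contr L p (?s ` ?A) ?x ?B ?y = set_contr L p ?A ?x ?B ?y" if "i \<in> ?X" "j \<notin> ?X"
        by (rule left(2)[OF Xr[OF that(1)] nX[OF \<open>j < N\<close> that(2)]])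
      have e2: "set_contr L p ?A ?x (?s ` ?B) ?y = set_contr L p ?A ?x ?B ?y" if "j \<in> ?X" "i \<notin> ?X"
        unfolding set_contr_commute[of L p ?A ?x] by (rule right(2)[OF Xr[OF that(1)] nX[OF \<open>i < N\<close> that(2)]])
      have e3: "set_contr L p (?s ` ?A) ?x ?B ?y = f_pair L p (z C j / z C i) * set_contr L p ?A ?x ?B ?y"
        if "i \<in> ?X" "j \<in> ?X"
        unfolding z_def by (rule left(1)[OF Xr[OF that(1)] Xr[OF that(2)]])
      have e4: "set_contr L p ?A ?x (?s ` ?B) ?y = f_pair L p (z C i / z C j) * set_contr L p ?A ?x ?B ?y"
        if "i \<in> ?X" "j \<in> ?X"
        unfolding z_def set_contr_commute[of L p ?A ?x] by (rule right(1)[OF Xr[OF that(2)] Xr[OF that(1)]])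
      have e5: "set_contr L p (?s ` ?A) ?x (?s ` ?B) ?y = set_contr L p ?A ?x ?B ?y"
        if "i \<in> ?X" "j \<in> ?X"
        by (rule set_contr_sigma_both[OF Xr[OF that(1)] Xr[OF that(2)]])
      have "I \<subseteq> ?X" by (rule I)
      then have iI: "i \<notin> ?X \<Longrightarrow> i \<notin> I" "j \<notin> ?X \<Longrightarrow> j \<notin> I" by auto
      show ?thesis
        unfolding D[OF that(1)] D[OF that(2)]
        by (cases "i \<in> ?X"; cases "j \<in> ?X"; cases "i \<in> I"; cases "j \<in> I")
          (simp_all add: h_def e1 e2 e3 e4 e5 iI)
    qed
    have "(\<Prod>j<N. \<Prod>i<j. set_contr L p (?D ! i) (xs ! i) (?D ! j) (xs ! j)) =
        (\<Prod>j<N. \<Prod>i<j. set_contr L p (C ! i) (xs ! i) (C ! j) (xs ! j)) * (\<Prod>j<N. \<Prod>i<j. h i j * h j i)"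
      unfolding prod.distrib[symmetric] by (intro prod.cong refl) (simp add: hs prod.distrib)
    also have "(\<Prod>j<N. \<Prod>i<j. h i j * h j i) = (\<Prod>i<N. \<Prod>j<N. h i j)"
      by (rule prod_ordered_pairs) (auto simp: h_def)
    also have "\<dots> = (\<Prod>i\<in>I. \<Prod>j<N. h i j)"
      by (rule prod.mono_neutral_right) (use I X in \<open>auto simp: h_def\<close>)
    also have "\<dots> = (\<Prod>i\<in>I. \<Prod>j\<in>?X - I. h i j)"
      by (intro prod.cong refl prod.mono_neutral_right) (use X in \<open>auto simp: h_def\<close>)
    also have "\<dots> = (\<Prod>i\<in>I. \<Prod>j\<in>?X - I. rf s t (z C i / z C j))"
      by (intro prod.cong refl) (simp add: h_def f_pair_eq_rf s_def t_def)
    finally have P: "(\<Prod>j<N. \<Prod>i<j. set_contr L p (?D ! i) (xs ! i) (?D ! j) (xs ! j)) =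
        (\<Prod>j<N. \<Prod>i<j. set_contr L p (C ! i) (xs ! i) (C ! j) (xs ! j)) *
        (\<Prod>i\<in>I. \<Prod>j\<in>?X - I. rf s t (z C i / z C j))" .
    have "length ?D = N" using lenC by (simp add: swap_sets_def)
    then show ?thesis unfolding trm_def K_def ruij_weight_def by (simp add: W P)
  qed
  have Kinv: "K (q \<circ> ?s) C = K q C" if C: "C \<in> Can" for q C
  proof -
    have lenC: "length C = N" using C lenLS by (simp add: Can_def)
    have "(\<Prod>s\<in>C ! j. (q \<circ> ?s) s) = (\<Prod>s\<in>C ! j. q s)" if j: "j \<in> {..<N} - unpaired r C" for j
    proof -
      have "r \<in> C ! j \<longleftrightarrow> Suc r \<in> C ! j"
        using j C lenC by (auto simp: unpaired_def Can_def canonical_def)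
      then have "?s ` (C ! j) = C ! j"
        by (auto simp: Transposition.transpose_def image_iff)
      then show ?thesis using prod_sigma_image[of q r "C ! j"] by simp
    qed
    moreover have "(\<Prod>s\<in>C ! j - {r}. (q \<circ> ?s) s) = (\<Prod>s\<in>C ! j - {r}. q s)" if "j \<in> unpaired r C" for j
      by (rule prod.cong) (use that in \<open>auto simp: Transposition.transpose_def unpaired_def\<close>)
    ultimately show ?thesis by (simp add: K_def)
  qed
  have sym: "ruij_sum \<alpha> \<beta> s t (z C) (unpaired r C) = ruij_sum \<beta> \<alpha> s t (z C) (unpaired r C)" if C: "C \<in> Can" for C \<alpha> \<beta>
  proof (rule ruij_sum_sym)
    have lenC: "length C = N" using C lenLS by (simp add: Can_def)
    then have X: "j < N" if "j \<in> unpaired r C" for j using that by (auto simp: unpaired_def)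
    show "finite (unpaired r C)" by (simp add: unpaired_def)
    show "s \<noteq> 0" "t \<noteq> 0" by (simp_all add: s_def t_def)
    show "z C i \<noteq> 0" if "i \<in> unpaired r C" for i
      using x0[OF X[OF that]] by (simp add: z_def vop_arg_neq_0)
    \<comment> \<open>Different points of a regular tuple have different 2L-th powers, and neither
      the shifts inside a current nor the factor st = \<omega> changes these powers.\<close>
    have pw: "z C j ^ (2 * L) = (xs ! j) ^ (2 * L)" for j
      using L by (simp add: z_def vop_arg_power)
    have w: "omega_pow L 1 ^ (2 * L) = 1" using omega_pow_half_power[of L 2] L by simp
    show "z C i \<noteq> z C j \<and> z C i \<noteq> s * t * z C j"
      if "i \<in> unpaired r C" "j \<in> unpaired r C" "i \<noteq> j" for i j
      using pw[of i] pw[of j] w xx[OF X[OF that(1)] X[OF that(2)] that(3)]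
      by (auto simp: st power_mult_distrib)
  qed
  show ?thesis
    unfolding F
  proof (rule sum.cong[OF refl])
    fix C assume C: "C \<in> Can"
    have *: "(\<Sum>I\<in>Pow (unpaired r C). trm q (swap_sets r C I)) =
        K q C * ruij_sum (q r) (q (Suc r)) s t (z C) (unpaired r C)" for q
      unfolding ruij_sum_def sum_distrib_left by (rule sum.cong) (auto simp: T[OF C])
    show "(\<Sum>I\<in>Pow (unpaired r C). trm (q \<circ> ?s) (swap_sets r C I)) =
        (\<Sum>I\<in>Pow (unpaired r C). trm q (swap_sets r C I))"
      unfolding * using Kinv[OF C] sym[OF C] by simp
  qed
qed

section \<open>Algebra homomorphisms into commuting operators\<close>

lemma scal_add_left: "scal (a + b) u = scal a u + scal b u"
  by (rule poly_mapping_eqI) (simp add: lookup_scal lookup_add distrib_right)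

lemma scal_one [simp]: "scal 1 u = u"
  by (rule poly_mapping_eqI) (simp add: lookup_scal)

lemma scal_zero_left [simp]: "scal 0 u = 0"
  by (rule poly_mapping_eqI) (simp add: lookup_scal)

lemma scal_mult_left: "scal c u * v = scal c (u * v)"
  by (simp add: scal_def mult.assoc)

interpretation pol: vector_space scal
  by unfold_locales (simp_all add: scal_add scal_add_left scal_scal)

interpretation pol2: vector_space_pair scal scal ..

abbreviation pol_linear :: "(pol \<Rightarrow> pol) \<Rightarrow> bool" where
  "pol_linear \<equiv> Vector_Spaces.linear scal scal"

lemma pol_linearI:
  assumes "\<And>u v. T (u + v) = T u + T v" "\<And>c u. T (scal c u) = scal c (T u)"
  shows "pol_linear T"
  by (simp add: linear_iff_module_hom module_hom_iff pol.module_axioms assms)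

lemmas pol_linear_add = pol2.linear_add
  and pol_linear_scal = pol2.linear_scale
  and pol_linear_sum = pol2.linear_sum
  and pol_linear_0 = pol2.linear_0
  and pol_linear_diff = pol2.linear_diff

lemma pol_linear_comp: "pol_linear S \<Longrightarrow> pol_linear T \<Longrightarrow> pol_linear (\<lambda>u. S (T u))"
  using Vector_Spaces.linear_compose[of scal scal T scal S] by (simp add: comp_def)

lemma pol_linear_ident: "pol_linear (\<lambda>u. u)"
  by (rule pol_linearI) auto

lemma pol_linear_mult: "pol_linear (\<lambda>u. v * u)"
  by (rule pol_linearI) (simp_all add: distrib_left scal_mult_right)

lemma pol_linear_funpow: "pol_linear T \<Longrightarrow> pol_linear (T ^^ n)"
  by (induction n) (auto intro: pol_linear_ident pol_linear_comp simp: comp_def id_def)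

lemma pol_linear_sumI: "(\<And>i. i \<in> A \<Longrightarrow> pol_linear (T i)) \<Longrightarrow> pol_linear (\<lambda>u. \<Sum>i\<in>A. T i u)"
  by (rule pol_linearI) (simp_all add: pol_linear_add pol_linear_scal sum.distrib scal_sum)

lemma pol_linear_scalI: "pol_linear T \<Longrightarrow> pol_linear (\<lambda>u. scal c (T u))"
  by (rule pol_linearI) (simp_all add: pol_linear_add pol_linear_scal scal_add scal_scal mult.commute)

lemma pol_linear_diffI: "pol_linear S \<Longrightarrow> pol_linear T \<Longrightarrow> pol_linear (\<lambda>u. S u - T u)"
  by (rule pol_linearI) (simp_all add: pol_linear_add pol_linear_scal pol.scale_right_diff_distrib)

lemma sum_list_map_sum: "(\<Sum>v\<leftarrow>vs. g v) = (\<Sum>i<length vs. g (vs ! i))"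
  by (simp add: sum_list_sum_nth atLeast0LessThan)

text \<open>\<open>hom_act\<close> multiplies operators by \<open>Finite_Set.fold\<close>, which can
  be evaluated for commuting factors; under this assumption it becomes an algebra
  homomorphism.\<close>

locale commuting_ops =
  fixes D :: "nat \<times> nat \<Rightarrow> pol \<Rightarrow> pol"
  assumes linear_D: "pol_linear (D v)" and commute_D: "D v (D w u) = D w (D v u)"
begin

lemma funpow_commute: "(D v ^^ a) ((D w ^^ b) u) = (D w ^^ b) ((D v ^^ a) u)"
proof -
  have 1: "D v ((D w ^^ b) u) = (D w ^^ b) (D v u)" for v u
    by (induction b arbitrary: u) (simp_all add: commute_D[of v w])
  show ?thesis by (induction a arbitrary: u) (simp_all add: 1)
qed

sublocale powers: comp_fun_commute "\<lambda>v. D v ^^ n v" for n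
  by unfold_locales (auto simp: funpow_commute)

definition mono_act :: "(nat \<times> nat \<Rightarrow>\<^sub>0 nat) \<Rightarrow> pol \<Rightarrow> pol" where
  "mono_act m u = Finite_Set.fold (\<lambda>v. D v ^^ Poly_Mapping.lookup m v) u (Poly_Mapping.keys m)"

lemma mono_act_superset:
  assumes "finite K" "Poly_Mapping.keys m \<subseteq> K"
  shows "mono_act m u = Finite_Set.fold (\<lambda>v. D v ^^ Poly_Mapping.lookup m v) u K"
proof -
  have "Finite_Set.fold (\<lambda>v. D v ^^ Poly_Mapping.lookup m v) u (Poly_Mapping.keys m \<union> B) = mono_act m u"
    if "finite B" "B \<inter> Poly_Mapping.keys m = {}" for B
    using that
  proof (induction B rule: finite_induct)
    case (insert x B)
    then have "Poly_Mapping.lookup m x = 0" by (simp add: in_keys_iff)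
    then show ?case using insert by (subst Un_insert_right, subst powers.fold_insert) auto
  qed (simp add: mono_act_def)
  note ext = this[of "K - Poly_Mapping.keys m"]
  have "Poly_Mapping.keys m \<union> (K - Poly_Mapping.keys m) = K" using assms by auto
  moreover have "finite (K - Poly_Mapping.keys m)" "(K - Poly_Mapping.keys m) \<inter> Poly_Mapping.keys m = {}"
    using assms by auto
  ultimately show ?thesis using ext by (simp only:)
qed

lemma fold_add:
  assumes "finite K"
  shows "Finite_Set.fold (\<lambda>v. D v ^^ (n v + n' v)) u K =
    Finite_Set.fold (\<lambda>v. D v ^^ n v) (Finite_Set.fold (\<lambda>v. D v ^^ n' v) u K) K"
  using assms
proof (induction K rule: finite_induct)
  case (insert x K)
  have c: "(D x ^^ a) (Finite_Set.fold (\<lambda>v. D v ^^ n v) u K) = Finite_Set.fold (\<lambda>v. D v ^^ n v) ((D x ^^ a) u) K" for a u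
    using insert.hyps(1) by (induction K rule: finite_induct) (simp_all add: funpow_commute[where v = x])
  show ?case
    unfolding powers.fold_insert[OF insert.hyps] insert.IH
    by (simp only: funpow_add comp_apply c)
qed simp

lemma mono_act_add: "mono_act (m + m') u = mono_act m (mono_act m' u)"
proof -
  let ?K = "Poly_Mapping.keys m \<union> Poly_Mapping.keys m'"
  have "Poly_Mapping.keys (m + m') \<subseteq> ?K" by (rule keys_add)
  then show ?thesis
    by (simp add: mono_act_superset[of ?K] lookup_add fold_add)
qed

lemma mono_act_0: "mono_act 0 u = u"
  by (simp add: mono_act_def)

lemma mono_act_single: "mono_act (Poly_Mapping.single v 1) u = D v u"
  using powers.fold_insert[of "{}" v "\<lambda>w. Poly_Mapping.lookup (Poly_Mapping.single v 1) w" u]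
  by (simp add: mono_act_def)

lemma linear_fold:
  assumes "finite K"
  shows "pol_linear (\<lambda>u. Finite_Set.fold (\<lambda>v. D v ^^ n v) u K)"
  using assms
proof (induction K rule: finite_induct)
  case (insert x K)
  then show ?case using pol_linear_comp[OF pol_linear_funpow[OF linear_D, of "n x" x]] by simp
qed (simp add: pol_linear_ident)

lemma linear_mono_act: "pol_linear (mono_act m)"
  unfolding mono_act_def[abs_def] by (rule linear_fold) simp

lemma hom_act_superset:
  assumes "finite K" "Poly_Mapping.keys h \<subseteq> K"
  shows "hom_act D h u = (\<Sum>m\<in>K. scal (Poly_Mapping.lookup h m) (mono_act m u))"
  unfolding hom_act_def mono_act_def[symmetric]
  by (rule sum.mono_neutral_left) (use assms in \<open>auto simp: in_keys_iff\<close>)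

lemma hom_act_add: "hom_act D (h + h') u = hom_act D h u + hom_act D h' u"
proof -
  let ?K = "Poly_Mapping.keys h \<union> Poly_Mapping.keys h'"
  have "Poly_Mapping.keys (h + h') \<subseteq> ?K" by (rule keys_add)
  then show ?thesis
    by (simp add: hom_act_superset[of ?K] lookup_add scal_add_left sum.distrib)
qed

lemma hom_act_single: "hom_act D (Poly_Mapping.single m c) u = scal c (mono_act m u)"
  by (subst hom_act_superset[of "{m}"]) auto

lemma hom_act_scal: "hom_act D (scal c h) u = scal c (hom_act D h u)"
  by (subst (1 2) hom_act_superset[of "Poly_Mapping.keys h"])
     (auto simp: lookup_scal in_keys_iff scal_sum scal_scal)

lemma linear_hom_act: "pol_linear (hom_act D h)"
  unfolding hom_act_def[abs_def] mono_act_def[symmetric]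
  by (intro pol_linear_sumI pol_linear_scalI linear_mono_act)

lemma linear_hom_act_left: "pol_linear (\<lambda>h. hom_act D h u)"
  by (rule pol_linearI) (simp_all add: hom_act_add hom_act_scal)

lemma hom_act_mult: "hom_act D (h * h') u = hom_act D h (hom_act D h' u)"
proof (induction h rule: pol_induct)
  case (single m c)
  show ?case
  proof (induction h' rule: pol_induct)
    case (single m' c')
    show ?case
      by (simp add: mult_single hom_act_single mono_act_add pol_linear_scal[OF linear_mono_act] scal_scal)
  next
    case (add h h')
    then show ?case by (simp add: distrib_left hom_act_add pol_linear_add[OF linear_hom_act])
  qed
next
  case (add h h'')
  then show ?case by (simp add: distrib_right hom_act_add)
qed

lemma hom_act_var: "hom_act D (var v) u = D v u"
  using mono_act_single by (simp add: var_def hom_act_single)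

lemma hom_act_one: "hom_act D 1 u = u"
  using hom_act_single[of 0 1 u] by (simp add: mono_act_0)

end

lemma linear_heis: "pol_linear (heis L p s n)"
proof (cases "n < 0")
  case True
  then have "heis L p s n = (\<lambda>u. var (s, nat (- n)) * u)" by (auto simp: heis_def)
  then show ?thesis by (simp add: pol_linear_mult)
next
  case False
  have "pol_linear (partial_deriv v)" for v
    by (rule pol_linearI) (simp_all add: partial_deriv_add partial_deriv_scal)
  then have "pol_linear (\<lambda>u. \<Sum>s'\<in>{1..L} - {s}.
        scal (of_int n * A_coef L p (sgn (int s - int s')) n) (partial_deriv (s', nat n) u))"
    by (intro pol_linear_sumI pol_linear_scalI)
  then show ?thesis using False unfolding heis_def[abs_def] by simp
qed

lemma heis_neg_commute:
  assumes "0 \<le> m" "0 \<le> n"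
  shows "heis L p s' (- m) (heis L p s (- n) u) = heis L p s (- n) (heis L p s' (- m) u)"
\<comment> \<open>Mode 0 must be covered because the variables (i, 0) exist as well. There -0 falls
  into the annihilation branch of \<open>heis\<close>, whose factor n makes the operator
  zero.\<close>
proof (cases "m = 0 \<or> n = 0")
  case True
  have "heis L p t 0 v = 0" for t v by (simp add: heis_def)
  then show ?thesis using True by (auto simp: pol_linear_0[OF linear_heis])
next
  case False
  then show ?thesis using assms by (simp add: heis_def mult.left_commute)
qed

context
  fixes L :: nat and p :: real
begin

definition D_R :: "nat \<times> nat \<Rightarrow> pol \<Rightarrow> pol" where
  "D_R = (\<lambda>(i, n) u. scal (pi_coef L p i n) (heis L p i (int n) u - heis L p (Suc i) (int n) u))"

definition D_L :: "nat \<times> nat \<Rightarrow> pol \<Rightarrow> pol" where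
  "D_L = (\<lambda>(i, n) u. scal (pi_coef L p i n) (heis L p (L - i) (- int n) u - heis L p (L + 1 - i) (- int n) u))"

interpretation R: commuting_ops D_R
proof (rule commuting_ops.intro)
  fix v :: "nat \<times> nat"
  show "pol_linear (D_R v)"
    by (cases v) (simp add: D_R_def pol_linear_scalI pol_linear_diffI linear_heis)
next
  fix v w :: "nat \<times> nat" and u
  show "D_R v (D_R w u) = D_R w (D_R v u)"
    by (cases v; cases w)
      (simp add: D_R_def pol_linear_scal[OF linear_heis] pol_linear_diff[OF linear_heis] pol.scale_right_diff_distrib
        scal_scal heis_pos_commute algebra_simps)
qed

interpretation L: commuting_ops D_L
proof (rule commuting_ops.intro)
  fix v :: "nat \<times> nat"
  show "pol_linear (D_L v)"
    by (cases v) (simp add: D_L_def pol_linear_scalI pol_linear_diffI linear_heis)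
next
  fix v w :: "nat \<times> nat" and u
  have c: "heis L p s' (- int m) (heis L p s (- int n) u) = heis L p s (- int n) (heis L p s' (- int m) u)" for s s' m n u
    by (rule heis_neg_commute) auto
  obtain i m where v: "v = (i, m)" by (cases v)
  obtain j n where w: "w = (j, n)" by (cases w)
  show "D_L v (D_L w u) = D_L w (D_L v u)"
    unfolding v w D_L_def
    by (simp add: pol_linear_scal[OF linear_heis] pol_linear_diff[OF linear_heis] pol.scale_right_diff_distrib
        scal_scal mult.commute c[of _ m _ n] diff_diff_eq2 add.commute algebra_simps)
qed

lemma pi_R_eq: "pi_R L p = hom_act D_R"
  by (simp add: pi_R_def D_R_def)

lemma pi_L_eq: "pi_L L p = hom_act D_L"
  by (simp add: pi_L_def D_L_def)

lemmas pi_R_mult = R.hom_act_mult[folded pi_R_eq]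
  and pi_R_one = R.hom_act_one[folded pi_R_eq]
  and pi_R_var = R.hom_act_var[folded pi_R_eq]
  and linear_pi_R = R.linear_hom_act[folded pi_R_eq]
  and linear_pi_R_left = R.linear_hom_act_left[folded pi_R_eq]
  and pi_L_mult = L.hom_act_mult[folded pi_L_eq]
  and pi_L_one = L.hom_act_one[folded pi_L_eq]
  and pi_L_var = L.hom_act_var[folded pi_L_eq]
  and linear_pi_L_left = L.linear_hom_act_left[folded pi_L_eq]

end

section \<open>Coefficients of exponential series\<close>

text \<open>\<open>bell x d\<close> is the coefficient of \<open>Z ^ d\<close> in \<open>exp (\<Sum>n\<ge>1. x n * Z ^ n)\<close>, computed by the
  recursion that comes from differentiating the exponential.\<close>

fun bell :: "(nat \<Rightarrow> pol) \<Rightarrow> nat \<Rightarrow> pol" where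
  "bell x 0 = 1"
| "bell x (Suc d) = scal (1 / of_nat (Suc d)) (\<Sum>i\<le>d. scal (of_nat (Suc i)) (x (Suc i) * bell x (d - i)))"

fun cbell :: "(nat \<Rightarrow> complex) \<Rightarrow> nat \<Rightarrow> complex" where
  "cbell x 0 = 1"
| "cbell x (Suc d) = 1 / of_nat (Suc d) * (\<Sum>i\<le>d. of_nat (Suc i) * x (Suc i) * cbell x (d - i))"

lemma sum_atLeast1_atMost_Suc: "(\<Sum>n=1..Suc d. g n) = (\<Sum>i\<le>d. g (Suc i))"
  by (metis One_nat_def atLeast0AtMost sum.shift_bounds_cl_Suc_ivl)

lemma bell_rec: "scal (of_nat d) (bell x d) = (\<Sum>n=1..d. scal (of_nat n) (x n * bell x (d - n)))"
proof (cases d)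
  case (Suc e)
  show ?thesis unfolding Suc sum_atLeast1_atMost_Suc by (simp add: scal_scal del: of_nat_Suc)
qed simp

lemma cbell_rec: "of_nat d * cbell x d = (\<Sum>n=1..d. of_nat n * x n * cbell x (d - n))"
proof (cases d)
  case (Suc e)
  show ?thesis unfolding Suc sum_atLeast1_atMost_Suc by (simp del: of_nat_Suc)
qed simp

lemma scal_cancel: "scal c u = scal c v \<Longrightarrow> c \<noteq> 0 \<Longrightarrow> u = v"
  by simp

lemma bell_cong:
  assumes "\<And>n. 1 \<le> n \<Longrightarrow> n \<le> d \<Longrightarrow> x n = y n"
  shows "bell x d = bell y d"
  using assms
proof (induction d rule: less_induct)
  case (less d)
  show ?case
  proof (cases d)
    case (Suc e)
    have "bell x (e - i) = bell y (e - i)" for i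
      using less Suc by (meson diff_le_self le_imp_less_Suc le_less_trans less_imp_le order_trans)
    moreover have "(\<Sum>i\<le>e. scal (of_nat (Suc i)) (x (Suc i) * bell y (e - i))) = (\<Sum>i\<le>e. scal (of_nat (Suc i)) (y (Suc i) * bell y (e - i)))"
      by (intro sum.cong refl) (use less.prems Suc in auto)
    ultimately show ?thesis using Suc by (simp del: of_nat_Suc)
  qed simp
qed

definition exponent_fps :: "(nat \<Rightarrow> complex) \<Rightarrow> complex fps" where
  "exponent_fps x = Abs_fps (\<lambda>n. if n = 0 then 0 else x n)"

text \<open>The equation F' = X' F with F(0) = 1 determines F coefficient by coefficient, so that
  product formulas for \<open>cbell\<close> reduce to the Leibniz rule.\<close>

lemma cbell_fps_unique:
  assumes "fps_nth F 0 = 1" "fps_deriv F = fps_deriv (exponent_fps x) * F"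
  shows "F = Abs_fps (cbell x)"
proof -
  have "fps_nth F d = cbell x d" for d
  proof (induction d rule: less_induct)
    case (less d)
    show ?case
    proof (cases d)
      case (Suc e)
      have "of_nat (Suc e) * fps_nth F (Suc e) = fps_nth (fps_deriv (exponent_fps x) * F) e"
        using assms(2) by (metis fps_deriv_nth Suc_eq_plus1)
      also have "\<dots> = (\<Sum>i\<le>e. of_nat (Suc i) * x (Suc i) * fps_nth F (e - i))"
        by (simp add: fps_mult_nth exponent_fps_def atLeast0AtMost)
      also have "\<dots> = (\<Sum>i\<le>e. of_nat (Suc i) * x (Suc i) * cbell x (e - i))"
        by (intro sum.cong refl) (use less Suc in auto)
      finally show ?thesis using Suc by (simp add: field_simps del: of_nat_Suc)
    qed (use assms in simp)
  qed
  then show ?thesis by (simp add: fps_eq_iff)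
qed

lemma fps_deriv_cbell: "fps_deriv (Abs_fps (cbell x)) = fps_deriv (exponent_fps x) * Abs_fps (cbell x)"
proof (rule fps_ext)
  fix e
  have "of_nat (Suc e) * cbell x (Suc e) = (\<Sum>i\<le>e. of_nat (Suc i) * x (Suc i) * cbell x (e - i))"
    by (simp del: of_nat_Suc)
  then show "fps_nth (fps_deriv (Abs_fps (cbell x))) e = fps_nth (fps_deriv (exponent_fps x) * Abs_fps (cbell x)) e"
    by (simp add: fps_mult_nth exponent_fps_def atLeast0AtMost del: cbell.simps)
qed

lemma cbell_eq_fps_exp: "Abs_fps (cbell x) = fps_exp 1 oo exponent_fps x"
  by (rule cbell_fps_unique[symmetric])
    (simp_all add: fps_compose_deriv exponent_fps_def mult.commute)

lemma cbell_add: "Abs_fps (cbell (\<lambda>n. x n + y n)) = Abs_fps (cbell x) * Abs_fps (cbell y)"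
proof (rule cbell_fps_unique[symmetric])
  have "exponent_fps (\<lambda>n. x n + y n) = exponent_fps x + exponent_fps y"
    by (rule fps_ext) (simp add: exponent_fps_def)
  then show "fps_deriv (Abs_fps (cbell x) * Abs_fps (cbell y)) =
      fps_deriv (exponent_fps (\<lambda>n. x n + y n)) * (Abs_fps (cbell x) * Abs_fps (cbell y))"
    by (simp add: fps_deriv_cbell algebra_simps)
qed simp

lemma cbell_cong:
  assumes "\<And>n. 1 \<le> n \<Longrightarrow> n \<le> d \<Longrightarrow> x n = y n"
  shows "cbell x d = cbell y d"
  using assms
proof (induction d rule: less_induct)
  case (less d)
  show ?case
  proof (cases d)
    case (Suc e)
    have "cbell x (e - i) = cbell y (e - i)" for i
      using less Suc by (meson diff_le_self le_imp_less_Suc le_less_trans less_imp_le order_trans)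
    moreover have "(\<Sum>i\<le>e. of_nat (Suc i) * x (Suc i) * cbell y (e - i)) = (\<Sum>i\<le>e. of_nat (Suc i) * y (Suc i) * cbell y (e - i))"
      by (intro sum.cong refl) (use less.prems Suc in auto)
    ultimately show ?thesis using Suc by (simp del: of_nat_Suc)
  qed simp
qed

section \<open>Matrix elements between coherent states\<close>

text \<open>The negative of \<open>A_coef\<close> at the sign of \<open>s - t\<close>, over \<open>n\<close>, is the \<open>n\<close>-th Taylor coefficient of
  the logarithm of the contraction of two vertex operators; \<open>pair_log\<close> sums it over all pairs.\<close>

definition pair_log :: "nat \<Rightarrow> real \<Rightarrow> nat \<Rightarrow> nat \<times> complex \<Rightarrow> nat \<times> complex \<Rightarrow> complex" where
  "pair_log L p n u v = - ((snd v / snd u) ^ n / of_nat n) *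
     (if fst u = fst v then 0 else A_coef L p (sgn (int (fst u) - int (fst v))) (int n))"

definition vop_log :: "nat \<Rightarrow> real \<Rightarrow> vop \<Rightarrow> vop \<Rightarrow> nat \<Rightarrow> complex" where
  "vop_log L p us vs n = (\<Sum>u\<leftarrow>us. \<Sum>v\<leftarrow>vs. pair_log L p n u v)"

text \<open>The reflection that exchanges the two chiralities: the annihilation modes of
  \<open>vs\<close>, pulled back through \<open>pi_R\<close> and then mapped by \<open>pi_L\<close>,
  become the creation modes of \<open>vop_star L vs\<close> (see
  \<open>pi_L_mode_elem\<close>).\<close>

definition vop_star :: "nat \<Rightarrow> vop \<Rightarrow> vop" where
  "vop_star L vs = map (\<lambda>(s, z). (L + 1 - s, 1 / z)) vs"

definition valid_vop :: "nat \<Rightarrow> vop \<Rightarrow> bool" where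
  "valid_vop L vs \<longleftrightarrow> (\<forall>(s, z)\<in>set vs. s \<in> {1..L} \<and> z \<noteq> 0)"

definition annihil_mode :: "nat \<Rightarrow> real \<Rightarrow> nat \<Rightarrow> vop \<Rightarrow> pol \<Rightarrow> pol" where
  "annihil_mode L p n vs u = (\<Sum>(s, z)\<leftarrow>vs. scal (1 / (z ^ n * of_nat n)) (heis L p s (int n) u))"

definition create_mode :: "nat \<Rightarrow> vop \<Rightarrow> pol" where
  "create_mode n vs = (\<Sum>(s, z)\<leftarrow>vs. scal (z ^ n / (- of_nat n)) (var (s, n)))"

lemma linear_annihil_mode: "pol_linear (annihil_mode L p n vs)"
  unfolding annihil_mode_def[abs_def] sum_list_map_sum split_beta
  by (intro pol_linear_sumI pol_linear_scalI linear_heis)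

text \<open>The Heisenberg commutator of two modes is a number, and summed over all factors this
  number is the degree n coefficient of the logarithm of the contraction.\<close>

lemma annihil_mode_create_mode:
  assumes "valid_vop L vs" "1 \<le> n" "1 \<le> m"
  shows "annihil_mode L p n us (create_mode m vs * u) =
    (if n = m then scal (vop_log L p us vs n) u else 0) + create_mode m vs * annihil_mode L p n us u"
proof -
  have h: "heis L p s (int n) (var (t, m) * u) = var (t, m) * heis L p s (int n) u +
      (if s \<noteq> t \<and> n = m then scal (of_nat n * A_coef L p (sgn (int s - int t)) (int n)) u else 0)"
    if "t \<in> {1..L}" for s t
    using heis_pos_neg[of "int n" "int m" t L p s u] assms that by (simp add: heis_def)
  have v: "fst (vs ! j) \<in> {1..L}" "snd (vs ! j) \<noteq> 0" if "j < length vs" for j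
    using assms(1) that nth_mem[OF that] by (fastforce simp: valid_vop_def split_beta)+
  have one: "scal (1 / (z ^ n * of_nat n)) (heis L p s (int n) (create_mode m vs * u)) =
      scal (1 / (z ^ n * of_nat n)) (create_mode m vs * heis L p s (int n) u) +
      (if n = m then scal (\<Sum>j<length vs. pair_log L p n (s, z) (vs ! j)) u else 0)" for s z
  \<comment> \<open>The arguments of \<open>us\<close> may vanish; with 1 / 0 = 0 every term is then
    0.\<close>
  proof (cases "z = 0")
    case True
    then show ?thesis using assms by (simp add: pair_log_def power_0_left)
  next
    case False
    have "heis L p s (int n) (create_mode m vs * u) =
       (\<Sum>j<length vs. scal (snd (vs ! j) ^ m / (- of_nat m)) (heis L p s (int n) (var (fst (vs ! j), m) * u)))"
      unfolding create_mode_def sum_list_map_sum split_beta sum_distrib_right scal_mult_left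
      by (simp only: pol_linear_sum[OF linear_heis] pol_linear_scal[OF linear_heis])
    also have "\<dots> = (\<Sum>j<length vs. scal (snd (vs ! j) ^ m / (- of_nat m)) (var (fst (vs ! j), m) * heis L p s (int n) u) +
       (if n = m then scal (of_nat n * z ^ n * pair_log L p n (s, z) (vs ! j)) u else 0))"
      by (intro sum.cong refl) (use assms v False in \<open>auto simp: h scal_add scal_scal pair_log_def power_divide\<close>)
    also have "\<dots> = create_mode m vs * heis L p s (int n) u +
       (\<Sum>j<length vs. if n = m then scal (of_nat n * z ^ n * pair_log L p n (s, z) (vs ! j)) u else 0)"
      unfolding create_mode_def sum_list_map_sum split_beta sum_distrib_right scal_mult_left sum.distrib ..
    also have "(\<Sum>j<length vs. if n = m then scal (of_nat n * z ^ n * pair_log L p n (s, z) (vs ! j)) u else 0) =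
       (if n = m then scal (of_nat n * z ^ n) (scal (\<Sum>j<length vs. pair_log L p n (s, z) (vs ! j)) u) else 0)"
      by (simp add: pol.scale_sum_left scal_sum scal_scal)
    finally show ?thesis using assms False by (simp add: scal_add scal_scal)
  qed
  show ?thesis
    unfolding annihil_mode_def vop_log_def sum_list_map_sum split_beta one
    by (simp add: sum.distrib sum_distrib_left scal_mult_right pol.scale_sum_left sum_list_map_sum)
qed

lemma annihil_mode_one: "1 \<le> n \<Longrightarrow> annihil_mode L p n us 1 = 0"
  by (simp add: annihil_mode_def heis_vacuum scal_zero sum_list_map_sum split_beta)

text \<open>In generating form, exp(sum of c_m Z^m) applied to the vacuum is an eigenvector of the
  annihilation mode with eigenvalue \<kappa>_n Z^n; this is the coherent state property, read off
  degree by degree.\<close>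

lemma annihil_mode_bell:
  assumes "valid_vop L vs" "1 \<le> n"
  shows "annihil_mode L p n us (bell (\<lambda>m. create_mode m vs) d) =
    (if n \<le> d then scal (vop_log L p us vs n) (bell (\<lambda>m. create_mode m vs) (d - n)) else 0)"
proof (induction d rule: less_induct)
  case (less d)
  let ?c = "\<lambda>m. create_mode m vs" and ?\<delta> = "annihil_mode L p n us" and ?\<kappa> = "vop_log L p us vs n"
  show ?case
  proof (cases "d = 0")
    case True
    then show ?thesis using assms annihil_mode_one by simp
  next
    case False
    have "scal (of_nat d) (?\<delta> (bell ?c d)) = ?\<delta> (\<Sum>i=1..d. scal (of_nat i) (?c i * bell ?c (d - i)))"
      by (simp only: pol_linear_scal[OF linear_annihil_mode, symmetric] bell_rec)
    also have "\<dots> = (\<Sum>i=1..d. scal (of_nat i) (?\<delta> (?c i * bell ?c (d - i))))"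
      by (simp only: pol_linear_sum[OF linear_annihil_mode] pol_linear_scal[OF linear_annihil_mode])
    also have "\<dots> = (\<Sum>i=1..d. (if i = n then scal (of_nat i * ?\<kappa>) (bell ?c (d - i)) else 0) +
        (if n \<le> d - i then scal ?\<kappa> (scal (of_nat i) (?c i * bell ?c (d - n - i))) else 0))"
    proof (intro sum.cong refl)
      fix i assume i: "i \<in> {1..d}"
      then have "?\<delta> (bell ?c (d - i)) = (if n \<le> d - i then scal ?\<kappa> (bell ?c (d - i - n)) else 0)"
        using less.IH[of "d - i"] by simp
      moreover have "d - i - n = d - n - i" by simp
      ultimately show "scal (of_nat i) (?\<delta> (?c i * bell ?c (d - i))) =
        (if i = n then scal (of_nat i * ?\<kappa>) (bell ?c (d - i)) else 0) +
        (if n \<le> d - i then scal ?\<kappa> (scal (of_nat i) (?c i * bell ?c (d - n - i))) else 0)"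
        using i annihil_mode_create_mode[OF assms(1,2), of i p us "bell ?c (d - i)"]
        by (simp add: scal_add scal_scal scal_zero scal_mult_right mult.commute)
    qed
    also have "\<dots> = (if n \<le> d then scal (of_nat n * ?\<kappa>) (bell ?c (d - n)) else 0) +
        (\<Sum>i=1..d. if n \<le> d - i then scal ?\<kappa> (scal (of_nat i) (?c i * bell ?c (d - n - i))) else 0)"
      using assms(2) by (simp add: sum.distrib)
    also have "(\<Sum>i=1..d. if n \<le> d - i then scal ?\<kappa> (scal (of_nat i) (?c i * bell ?c (d - n - i))) else 0) =
        (\<Sum>i=1..d - n. scal ?\<kappa> (scal (of_nat i) (?c i * bell ?c (d - n - i))))"
      by (rule sum.mono_neutral_cong_right) (use assms(2) in auto)
    also have "\<dots> = scal ?\<kappa> (scal (of_nat (d - n)) (bell ?c (d - n)))"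
      by (simp only: scal_sum[symmetric] bell_rec)
    also have "(if n \<le> d then scal (of_nat n * ?\<kappa>) (bell ?c (d - n)) else 0) + \<dots> =
        scal (of_nat d) (if n \<le> d then scal ?\<kappa> (bell ?c (d - n)) else 0)"
    proof (cases "n \<le> d")
      case True
      have "of_nat n * ?\<kappa> + ?\<kappa> * of_nat (d - n) = of_nat d * ?\<kappa>"
        using True by (simp add: of_nat_diff algebra_simps)
      then show ?thesis using True by (simp only: scal_scal scal_add_left[symmetric] if_True)
    qed (simp add: scal_zero)
    finally show ?thesis by (rule scal_cancel) (use False in simp)
  qed
qed

lemma linear_exp_trunc: "pol_linear T \<Longrightarrow> pol_linear (exp_trunc M T)"
  unfolding exp_trunc_def[abs_def]
  by (intro pol_linear_sumI pol_linear_scalI pol_linear_funpow)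

text \<open>Moving an annihilation mode past exp X yields \<kappa> exp X. With the series cut off at
  m the extra term is cut off at m - 1, a shift that has to be tracked because everything is
  computed at finite truncation.\<close>

lemma twisted_derivation_exp_trunc:
  assumes lin: "pol_linear \<delta>" and tw: "\<And>u. \<delta> (X * u) = scal \<kappa> u + X * \<delta> u"
  shows "\<delta> (exp_trunc m ((*) X) u) =
    (if m = 0 then 0 else scal \<kappa> (exp_trunc (m - 1) ((*) X) u)) + exp_trunc m ((*) X) (\<delta> u)"
proof -
  have pw: "\<delta> (((*) X ^^ k) u) = (if k = 0 then 0 else scal (of_nat k * \<kappa>) (((*) X ^^ (k - 1)) u)) + ((*) X ^^ k) (\<delta> u)" for k
  proof (induction k)
    case (Suc k)
    have "X * (if k = 0 then 0 else scal (of_nat k * \<kappa>) (((*) X ^^ (k - 1)) u)) = scal (of_nat k * \<kappa>) (((*) X ^^ k) u)"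
      by (cases k) (simp_all add: scal_mult_right)
    then show ?case by (simp add: tw Suc.IH distrib_left scal_add_left distrib_right)
  qed simp
  have "\<delta> (exp_trunc m ((*) X) u) = (\<Sum>k\<le>m. scal (1 / fact k) (if k = 0 then 0 else scal (of_nat k * \<kappa>) (((*) X ^^ (k - 1)) u))) +
      exp_trunc m ((*) X) (\<delta> u)"
    by (simp add: exp_trunc_def pol_linear_sum[OF lin] pol_linear_scal[OF lin] pw scal_add sum.distrib)
  also have "(\<Sum>k\<le>m. scal (1 / fact k) (if k = 0 then 0 else scal (of_nat k * \<kappa>) (((*) X ^^ (k - 1)) u))) =
      (if m = 0 then 0 else scal \<kappa> (exp_trunc (m - 1) ((*) X) u))"
  proof (cases m)
    case (Suc m')
    have "(\<Sum>k\<le>Suc m'. scal (1 / fact k) (if k = 0 then 0 else scal (of_nat k * \<kappa>) (((*) X ^^ (k - 1)) u))) =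
       (\<Sum>k\<le>m'. scal (1 / fact (Suc k)) (scal (of_nat (Suc k) * \<kappa>) (((*) X ^^ k) u)))"
      by (subst sum.atMost_Suc_shift) (simp add: scal_zero del: of_nat_Suc fact_Suc)
    also have "\<dots> = scal \<kappa> (exp_trunc m' ((*) X) u)"
      by (simp add: exp_trunc_def scal_sum scal_scal fact_Suc field_simps del: of_nat_Suc)
    finally show ?thesis using Suc by simp
  qed (simp add: scal_zero)
  finally show ?thesis .
qed

lemma covacuum_add: "covacuum (u + v) = covacuum u + covacuum v"
  by (simp add: covacuum_def lookup_add)

lemma covacuum_scal: "covacuum (scal c u) = c * covacuum u"
  by (simp add: covacuum_def lookup_scal)

lemma covacuum_sum: "covacuum (\<Sum>i\<in>A. g i) = (\<Sum>i\<in>A. covacuum (g i))"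
  by (simp add: covacuum_def lookup_sum)

lemma covacuum_0 [simp]: "covacuum 0 = 0"
  by (simp add: covacuum_def)

lemma covacuum_1 [simp]: "covacuum 1 = 1"
  by (simp add: covacuum_def)

lemma covacuum_create_mode: "covacuum (create_mode n vs * u) = 0"
  by (simp add: create_mode_def sum_list_map_sum split_beta sum_distrib_right scal_mult_left covacuum_sum
      covacuum_scal) (simp add: covacuum_def lookup_scal lookup_var_times)

lemma covacuum_bell_create: "covacuum (bell (\<lambda>m. create_mode m vs) d) = (if d = 0 then 1 else 0)"
  by (cases d) (simp_all add: covacuum_scal covacuum_sum covacuum_create_mode)

definition create_sum :: "nat \<Rightarrow> vop \<Rightarrow> pol" where
  "create_sum M vs = (\<Sum>n=1..M. create_mode n vs)"

lemma create_part_eq: "create_part L p M vs = (*) (create_sum M vs)"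
proof
  fix u
  show "create_part L p M vs u = create_sum M vs * u"
    by (simp add: create_part_def create_sum_def create_mode_def sum_distrib_right sum_list_map_sum split_beta
        scal_mult_left heis_def)
qed

lemma annihil_part_eq: "annihil_part L p M vs u = (\<Sum>n=1..M. annihil_mode L p n vs u)"
  by (simp add: annihil_part_def annihil_mode_def)

lemma covacuum_exp_create: "covacuum (exp_trunc m ((*) (create_sum M vs)) u) = covacuum u"
proof -
  have "covacuum (((*) (create_sum M vs) ^^ k) u) = (if k = 0 then covacuum u else 0)" for k
    by (cases k) (simp_all add: create_sum_def sum_distrib_right covacuum_sum covacuum_create_mode)
  then have "covacuum (exp_trunc m ((*) (create_sum M vs)) u) = (\<Sum>k\<le>m. 1 / fact k * (if k = 0 then covacuum u else 0))"
    by (simp only: exp_trunc_def covacuum_sum covacuum_scal)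
  also have "\<dots> = covacuum u" by (simp add: if_distrib[of "(*) _"] cong: if_cong)
  finally show ?thesis .
qed

text \<open>One peels modes off the left state by \<open>bell_rec\<close> and moves them to the
  right, where each is absorbed either by the vertex operator (\<kappa>) or by the right state
  (\<mu>). Exactly degree j must go to the right state, so at most d - j orders of the exponential
  are used; this is the bound imposed on m.\<close>

lemma covacuum_bell_exp_create:
  assumes valid: "valid_vop L vs" "valid_vop L ws"
    and x: "\<And>n u. 1 \<le> n \<Longrightarrow> n \<le> d \<Longrightarrow> pi_R L p (x n) u = annihil_mode L p n us u"
    and d: "d \<le> M" and m: "d \<le> m + j"
  shows "covacuum (pi_R L p (bell x d) (exp_trunc m ((*) (create_sum M vs)) (bell (\<lambda>n. create_mode n ws) j))) =
    (if j \<le> d then cbell (vop_log L p us vs) (d - j) * cbell (vop_log L p us ws) j else 0)"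
  using x d m
proof (induction d arbitrary: m j rule: less_induct)
  case (less d)
  let ?X = "create_sum M vs" and ?e = "bell (\<lambda>n. create_mode n ws)"
  let ?\<kappa> = "vop_log L p us vs" and ?\<mu> = "vop_log L p us ws"
  let ?V = "\<lambda>d j. if j \<le> d then cbell ?\<kappa> (d - j) * cbell ?\<mu> j else 0"
  show ?case
  proof (cases "d = 0")
    case True
    then show ?thesis by (simp add: pi_R_one covacuum_exp_create covacuum_bell_create)
  next
    case False
    let ?w = "exp_trunc m ((*) ?X) (?e j)"
    have lin: "pol_linear (pi_R L p h)" for h by (rule linear_pi_R)
    have step: "covacuum (pi_R L p (bell x (d - n)) (pi_R L p (x n) ?w)) =
        ?\<kappa> n * ?V (d - n) j + (if n \<le> j then ?\<mu> n * ?V (d - n) (j - n) else 0)" if n: "n \<in> {1..d}" for n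
    proof -
      have "annihil_mode L p n us (?X * u) = scal (?\<kappa> n) u + ?X * annihil_mode L p n us u" for u
      proof -
        have "annihil_mode L p n us (?X * u) = (\<Sum>k=1..M. annihil_mode L p n us (create_mode k vs * u))"
          by (simp add: create_sum_def sum_distrib_right pol_linear_sum[OF linear_annihil_mode])
        also have "\<dots> = (\<Sum>k=1..M. (if n = k then scal (?\<kappa> n) u else 0) + create_mode k vs * annihil_mode L p n us u)"
          by (intro sum.cong refl) (use n annihil_mode_create_mode[OF valid(1)] in simp)
        also have "\<dots> = scal (?\<kappa> n) u + ?X * annihil_mode L p n us u"
          using n less.prems(2) by (simp add: sum.distrib create_sum_def sum_distrib_right)
        finally show ?thesis .
      qed
      from twisted_derivation_exp_trunc[OF linear_annihil_mode this]
      have "pi_R L p (x n) ?w = (if m = 0 then 0 else scal (?\<kappa> n) (exp_trunc (m - 1) ((*) ?X) (?e j))) +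
          exp_trunc m ((*) ?X) (if n \<le> j then scal (?\<mu> n) (?e (j - n)) else 0)"
        using less.prems(1)[of n ?w] n annihil_mode_bell[OF valid(2), of n p us j] by simp
      moreover have "(if n \<le> j then scal (?\<mu> n) (?e (j - n)) else 0) = scal (if n \<le> j then ?\<mu> n else 0) (?e (j - n))"
        by simp
      ultimately have "pi_R L p (x n) ?w = scal (if m = 0 then 0 else ?\<kappa> n) (exp_trunc (m - 1) ((*) ?X) (?e j)) +
          scal (if n \<le> j then ?\<mu> n else 0) (exp_trunc m ((*) ?X) (?e (j - n)))"
        by (simp only: pol_linear_scal[OF linear_exp_trunc[OF pol_linear_mult]]) simp
      then have 1: "covacuum (pi_R L p (bell x (d - n)) (pi_R L p (x n) ?w)) =
        (if m = 0 then 0 else ?\<kappa> n) * covacuum (pi_R L p (bell x (d - n)) (exp_trunc (m - 1) ((*) ?X) (?e j))) +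
        (if n \<le> j then ?\<mu> n else 0) * covacuum (pi_R L p (bell x (d - n)) (exp_trunc m ((*) ?X) (?e (j - n))))"
        by (simp only: pol_linear_add[OF lin] pol_linear_scal[OF lin] covacuum_add covacuum_scal)
      have 2: "covacuum (pi_R L p (bell x (d - n)) (exp_trunc (m - 1) ((*) ?X) (?e j))) = ?V (d - n) j" if "m \<noteq> 0"
        by (rule less.IH) (use n less.prems that in auto)
      have 3: "covacuum (pi_R L p (bell x (d - n)) (exp_trunc m ((*) ?X) (?e (j - n)))) = ?V (d - n) (j - n)" if "n \<le> j"
        by (rule less.IH) (use n less.prems that in auto)
      \<comment> \<open>For m = 0 the bound gives d at most j, so the target value for d - n is 0,
        matching the missing term of the cut-off exponential.\<close>
      have 4: "?V (d - n) j = 0" if "m = 0" using less.prems(3) n that by auto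
      show ?thesis unfolding 1 using 2 3 4 by auto
    qed
    have "of_nat d * covacuum (pi_R L p (bell x d) ?w) = covacuum (pi_R L p (scal (of_nat d) (bell x d)) ?w)"
      by (simp only: pol_linear_scal[OF linear_pi_R_left] covacuum_scal)
    also have "\<dots> = (\<Sum>n=1..d. of_nat n * covacuum (pi_R L p (x n * bell x (d - n)) ?w))"
      by (simp only: bell_rec pol_linear_sum[OF linear_pi_R_left] pol_linear_scal[OF linear_pi_R_left]
          covacuum_scal covacuum_sum)
    also have "\<dots> = (\<Sum>n=1..d. of_nat n * (?\<kappa> n * ?V (d - n) j + (if n \<le> j then ?\<mu> n * ?V (d - n) (j - n) else 0)))"
      by (intro sum.cong refl) (simp only: mult.commute[of "x _"] pi_R_mult step)
    also have "\<dots> = (\<Sum>n=1..d. of_nat n * ?\<kappa> n * ?V (d - n) j) +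
        (\<Sum>n=1..d. if n \<le> j then of_nat n * ?\<mu> n * ?V (d - n) (j - n) else 0)"
      unfolding sum.distrib[symmetric] by (intro sum.cong refl) (simp add: distrib_left mult.assoc)
    also have "\<dots> = of_nat d * ?V d j"
    proof (cases "j \<le> d")
      case True
      have "(\<Sum>n=1..d. of_nat n * ?\<kappa> n * ?V (d - n) j) =
          (\<Sum>n=1..d - j. of_nat n * ?\<kappa> n * cbell ?\<kappa> (d - j - n)) * cbell ?\<mu> j"
        unfolding sum_distrib_right
        by (rule sum.mono_neutral_cong_right) (use True in \<open>auto simp: mult.assoc diff_right_commute add.commute\<close>)
      moreover have "(\<Sum>n=1..d. if n \<le> j then of_nat n * ?\<mu> n * ?V (d - n) (j - n) else 0) =
          cbell ?\<kappa> (d - j) * (\<Sum>n=1..j. of_nat n * ?\<mu> n * cbell ?\<mu> (j - n))"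
        unfolding sum_distrib_left
        by (rule sum.mono_neutral_cong_right) (use True in \<open>auto simp: mult_ac\<close>)
      ultimately show ?thesis
        using True unfolding cbell_rec[symmetric] by (simp add: of_nat_diff algebra_simps)
    next
      case False
      then have "(\<Sum>n=1..d. of_nat n * ?\<kappa> n * ?V (d - n) j) = 0"
        "(\<Sum>n=1..d. if n \<le> j then of_nat n * ?\<mu> n * ?V (d - n) (j - n) else 0) = 0"
        by (intro sum.neutral; auto)+
      then show ?thesis using False by simp
    qed
    finally show ?thesis using False by simp
  qed
qed

text \<open>On the sequence of coherent states the annihilation part acts as convolution with a
  power series without constant term; its exponential is convolution with the exponential
  series.\<close>

lemma exp_trunc_annihil_bell:
  assumes valid: "valid_vop L ws" and M: "d \<le> M"
  shows "exp_trunc M (annihil_part L p M vs) (bell (\<lambda>n. create_mode n ws) d) =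
    (\<Sum>i\<le>d. scal (cbell (vop_log L p vs ws) i) (bell (\<lambda>n. create_mode n ws) (d - i)))"
proof -
  let ?e = "bell (\<lambda>n. create_mode n ws)" and ?\<kappa> = "vop_log L p vs ws"
  \<comment> \<open>The modes are cut off at M. Only degrees up to d are ever used, and d is at most
    M, so the cutoff does not show in the result.\<close>
  define P where "P = exponent_fps (\<lambda>n. if n \<le> M then ?\<kappa> n else 0)"
  have P0: "fps_nth P 0 = 0" by (simp add: P_def exponent_fps_def)
  have lin: "pol_linear (annihil_part L p M vs)"
    unfolding annihil_part_eq[abs_def] by (intro pol_linear_sumI linear_annihil_mode)
  have A: "annihil_part L p M vs (?e j) = (\<Sum>n\<le>j. scal (fps_nth P n) (?e (j - n)))" for j
  proof -
    have "annihil_part L p M vs (?e j) = (\<Sum>n=1..M. if n \<le> j then scal (?\<kappa> n) (?e (j - n)) else 0)"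
      unfolding annihil_part_eq by (intro sum.cong refl annihil_mode_bell[OF valid]) simp
    also have "\<dots> = (\<Sum>n\<in>{1..M} \<inter> {..j}. scal (?\<kappa> n) (?e (j - n)))"
      by (subst sum.inter_restrict) (auto intro: sum.cong)
    also have "\<dots> = (\<Sum>n\<le>j. scal (fps_nth P n) (?e (j - n)))"
      by (rule sum.mono_neutral_cong_left) (auto simp: P_def exponent_fps_def)
    finally show ?thesis .
  qed
  have Ak: "(annihil_part L p M vs ^^ k) (?e j) = (\<Sum>i\<le>j. scal (fps_nth (P ^ k) i) (?e (j - i)))" for k j
  proof (induction k)
    case 0
    have "(\<Sum>i\<le>j. scal (fps_nth 1 i) (?e (j - i))) = (\<Sum>i\<le>j. if i = 0 then ?e (j - i) else 0)"
      by (intro sum.cong refl) (simp add: fps_one_nth)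
    then show ?case by simp
  next
    case (Suc k)
    have "(annihil_part L p M vs ^^ Suc k) (?e j) =
        (\<Sum>i\<le>j. scal (fps_nth (P ^ k) i) (annihil_part L p M vs (?e (j - i))))"
      by (simp add: Suc.IH pol_linear_sum[OF lin] pol_linear_scal[OF lin])
    also have "\<dots> = (\<Sum>i\<le>j. \<Sum>n\<le>j - i. scal (fps_nth (P ^ k) i * fps_nth P n) (?e (j - (i + n))))"
      by (simp add: A scal_sum scal_scal)
    also have "\<dots> = (\<Sum>(i, n)\<in>{(i, n). i + n \<le> j}. scal (fps_nth (P ^ k) i * fps_nth P n) (?e (j - (i + n))))"
      by (subst sum.Sigma) (auto intro!: sum.cong)
    also have "\<dots> = (\<Sum>l\<le>j. \<Sum>i\<le>l. scal (fps_nth (P ^ k) i * fps_nth P (l - i)) (?e (j - (i + (l - i)))))"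
      by (rule sum.triangle_reindex_eq)
    also have "\<dots> = (\<Sum>l\<le>j. scal (fps_nth (P ^ Suc k) l) (?e (j - l)))"
    proof (intro sum.cong refl)
      fix l
      have "fps_nth (P ^ Suc k) l = (\<Sum>i\<le>l. fps_nth (P ^ k) i * fps_nth P (l - i))"
        by (simp add: power_Suc2 fps_mult_nth atLeast0AtMost del: power_Suc)
      then show "(\<Sum>i\<le>l. scal (fps_nth (P ^ k) i * fps_nth P (l - i)) (?e (j - (i + (l - i))))) =
          scal (fps_nth (P ^ Suc k) l) (?e (j - l))"
        by (simp add: pol.scale_sum_left)
    qed
    finally show ?case .
  qed
  have "exp_trunc M (annihil_part L p M vs) (?e d) =
      (\<Sum>k\<le>M. \<Sum>i\<le>d. scal (1 / fact k * fps_nth (P ^ k) i) (?e (d - i)))"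
    by (simp add: exp_trunc_def Ak scal_sum scal_scal)
  also have "\<dots> = (\<Sum>i\<le>d. scal (\<Sum>k\<le>M. 1 / fact k * fps_nth (P ^ k) i) (?e (d - i)))"
    by (subst sum.swap) (simp add: pol.scale_sum_left)
  also have "\<dots> = (\<Sum>i\<le>d. scal (cbell ?\<kappa> i) (?e (d - i)))"
  proof (intro sum.cong refl arg_cong2[of _ _ _ _ scal])
    fix i assume i: "i \<in> {..d}"
    \<comment> \<open>P has no constant term, so P^k starts in degree k and contributes nothing in
      degree i for k > i.\<close>
    have "(\<Sum>k\<le>M. 1 / fact k * fps_nth (P ^ k) i) = (\<Sum>k=0..i. 1 / fact k * fps_nth (P ^ k) i)"
      by (rule sum.mono_neutral_right) (use i M P0 in \<open>auto simp: startsby_zero_power_prefix\<close>)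
    also have "\<dots> = fps_nth (fps_exp 1 oo P) i"
      by (simp add: fps_compose_nth)
    also have "\<dots> = cbell (\<lambda>n. if n \<le> M then ?\<kappa> n else 0) i"
      unfolding P_def cbell_eq_fps_exp[symmetric] by simp
    also have "\<dots> = cbell ?\<kappa> i" by (rule cbell_cong) (use i M in auto)
    finally show "(\<Sum>k\<le>M. 1 / fact k * fps_nth (P ^ k) i) = cbell ?\<kappa> i" .
  qed
  finally show ?thesis .
qed

text \<open>The element of \<open>\<A>\<close> whose image under \<open>\<pi>\<^sub>R\<close> is the mode \<open>n\<close> of the annihilation part of the
  vertex operator \<open>vs\<close>, provided that the \<open>n\<close>-th power sum of the inverse arguments vanishes.\<close>

definition power_term :: "nat \<Rightarrow> nat \<times> complex \<Rightarrow> complex" where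
  "power_term n v = 1 / (snd v ^ n * of_nat n)"

definition mode_elem :: "nat \<Rightarrow> real \<Rightarrow> vop \<Rightarrow> nat \<Rightarrow> pol" where
  "mode_elem L p vs n = (\<Sum>i=1..L-1.
     scal ((\<Sum>v\<leftarrow>vs. if fst v \<le> i then power_term n v else 0) / pi_coef L p i n) (var (i, n)))"

definition balanced :: "nat \<Rightarrow> vop \<Rightarrow> bool" where
  "balanced d vs \<longleftrightarrow> (\<forall>n. 1 \<le> n \<and> n \<le> d \<longrightarrow> (\<Sum>v\<leftarrow>vs. 1 / snd v ^ n) = 0)"

text \<open>Abel summation; the boundary term at H L carries the total coefficient and disappears by
  the balance hypothesis. What remains are the differences that occur in \<open>pi_R\<close> and
  \<open>pi_L\<close>.\<close>

lemma sum_by_parts: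
  fixes H :: "nat \<Rightarrow> pol"
  assumes c: "(\<Sum>v\<leftarrow>vs. c v) = 0" and vs: "\<And>v. v \<in> set vs \<Longrightarrow> fst v \<in> {1..L}"
  shows "(\<Sum>v\<leftarrow>vs. scal (c v) (H (fst v))) =
    (\<Sum>i=1..L-1. scal (\<Sum>v\<leftarrow>vs. if fst v \<le> i then c v else 0) (H i - H (Suc i)))"
proof -
  have tele: "H s = (\<Sum>i=1..L-1. if s \<le> i then H i - H (Suc i) else 0) + H L" if "s \<in> {1..L}" for s
  proof -
    have "(\<Sum>i=s..<L. (- H (Suc i)) - (- H i)) = (- H L) - (- H s)"
      by (rule sum_Suc_diff') (use that in simp)
    then have "H s = (\<Sum>i=s..<L. H i - H (Suc i)) + H L" by simp
    also have "(\<Sum>i=s..<L. H i - H (Suc i)) = (\<Sum>i=1..L-1. if s \<le> i then H i - H (Suc i) else 0)"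
      by (rule sum.mono_neutral_cong_left) (use that in auto)
    finally show ?thesis .
  qed
  have "(\<Sum>v\<leftarrow>vs. scal (c v) (H (fst v))) =
     (\<Sum>j<length vs. scal (c (vs ! j)) ((\<Sum>i=1..L-1. if fst (vs ! j) \<le> i then H i - H (Suc i) else 0) + H L))"
    unfolding sum_list_map_sum by (intro sum.cong refl arg_cong2[of _ _ _ _ scal] tele vs) simp
  also have "\<dots> = (\<Sum>j<length vs. \<Sum>i=1..L-1. scal (if fst (vs ! j) \<le> i then c (vs ! j) else 0) (H i - H (Suc i))) +
      scal (\<Sum>v\<leftarrow>vs. c v) (H L)"
    unfolding sum_list_map_sum
    by (simp add: scal_add scal_sum sum.distrib pol.scale_sum_left if_distrib[of "scal _"]
        if_distrib[of "\<lambda>c. scal c _"] scal_zero cong: if_cong)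
  finally have E: "(\<Sum>v\<leftarrow>vs. scal (c v) (H (fst v))) = (\<Sum>j<length vs. \<Sum>i=1..L-1.
      scal (if fst (vs ! j) \<le> i then c (vs ! j) else 0) (H i - H (Suc i)))"
    by (simp only: c pol.scale_zero_left add_0_right)
  show ?thesis
    unfolding E by (subst sum.swap) (simp add: sum_list_map_sum pol.scale_sum_left)
qed

text \<open>The factors could vanish only if np or n(p - 1) were an integral multiple of L, which
  irrational p forbids. It makes the division by \<open>pi_coef\<close> legitimate.\<close>

lemma A_coef_neq_0:
  assumes L: "L > 0" and p: "p \<notin> \<rat>" and n: "n > 0"
  shows "A_coef L p 1 (int n) \<noteq> 0"
proof -
  have no: "omega_pow L (of_real (real n * (of_int a + p))) \<noteq> 1" for a :: int
  proof
    assume a: "omega_pow L (of_real (real n * (of_int a + p))) = 1"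
    from a[unfolded omega_pow_eq_1_iff[OF L]]
    obtain k :: int where k: "real n * (of_int a + p) = of_int k * of_nat L" by blast
    then have "p = of_int k * of_nat L / real n - of_int a" using n by (simp add: field_simps)
    also have "\<dots> \<in> \<rat>" by (intro Rats_diff Rats_divide Rats_mult) auto
    finally show False using p by simp
  qed
  have 1: "omega_pow L (of_real p * of_nat n) \<noteq> 1" using no[of 0] by (simp add: mult.commute)
  have "omega_pow L (of_real (real n * (of_int (-1) + p))) = omega_pow L (of_real p * of_nat n) / omega_pow L (of_nat n)"
    by (simp add: omega_pow_diff[symmetric] algebra_simps)
  then have 2: "omega_pow L (of_real p * of_nat n) \<noteq> omega_pow L (of_nat n)" using no[of "-1"] by auto
  show ?thesis using 1 2 by (simp add: A_coef_def omega_pow_minus)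
qed

lemma pi_coef_neq_0: "L > 0 \<Longrightarrow> p \<notin> \<rat> \<Longrightarrow> n > 0 \<Longrightarrow> pi_coef L p i n \<noteq> 0"
  using A_coef_neq_0[of L p n] by (simp add: pi_coef_def)

lemma balanced_power_term:
  "balanced d vs \<Longrightarrow> 1 \<le> n \<Longrightarrow> n \<le> d \<Longrightarrow> (\<Sum>v\<leftarrow>vs. power_term n v) = 0"
  by (simp add: balanced_def power_term_def sum_list_map_sum sum_divide_distrib[symmetric]
      flip: divide_divide_eq_left)

lemma pi_R_mode_elem:
  assumes L: "L > 0" and p: "p \<notin> \<rat>" and n: "1 \<le> n" "n \<le> d" and vs: "valid_vop L vs" "balanced d vs"
  shows "pi_R L p (mode_elem L p vs n) u = annihil_mode L p n vs u"
proof -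
  have nz: "pi_coef L p i n \<noteq> 0" for i using pi_coef_neq_0[OF L p] n by simp
  have "pi_R L p (mode_elem L p vs n) u = (\<Sum>i=1..L-1.
      scal (\<Sum>v\<leftarrow>vs. if fst v \<le> i then power_term n v else 0) (heis L p i (int n) u - heis L p (Suc i) (int n) u))"
    using nz by (simp add: mode_elem_def pol_linear_sum[OF linear_pi_R_left] pol_linear_scal[OF linear_pi_R_left]
        pi_R_var D_R_def scal_scal)
  also have "\<dots> = (\<Sum>v\<leftarrow>vs. scal (power_term n v) (heis L p (fst v) (int n) u))"
    by (rule sum_by_parts[symmetric]) (use vs n balanced_power_term in \<open>auto simp: valid_vop_def\<close>)
  finally show ?thesis unfolding annihil_mode_def power_term_def split_beta .
qed

lemma pi_L_mode_elem:
  assumes L: "L > 0" and p: "p \<notin> \<rat>" and n: "1 \<le> n" "n \<le> d" and vs: "valid_vop L vs" "balanced d vs"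
  shows "pi_L L p (mode_elem L p vs n) u = create_mode n (vop_star L vs) * u"
proof -
  have nz: "pi_coef L p i n \<noteq> 0" for i using pi_coef_neq_0[OF L p] n by simp
  \<comment> \<open>The sign makes the difference in \<open>D_L\<close> equal to H i - H (i + 1),
    and it becomes the minus sign in the exponent of the creation part.\<close>
  define H where "H i = - heis L p (L + 1 - i) (- int n) u" for i
  have "pi_L L p (mode_elem L p vs n) u = (\<Sum>i=1..L-1.
      scal (\<Sum>v\<leftarrow>vs. if fst v \<le> i then power_term n v else 0) (H i - H (Suc i)))"
    using nz by (simp add: mode_elem_def pol_linear_sum[OF linear_pi_L_left] pol_linear_scal[OF linear_pi_L_left]
        pi_L_var D_L_def scal_scal H_def)
  also have "\<dots> = (\<Sum>v\<leftarrow>vs. scal (power_term n v) (H (fst v)))"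
    by (rule sum_by_parts[symmetric]) (use vs n balanced_power_term in \<open>auto simp: valid_vop_def\<close>)
  also have "\<dots> = create_mode n (vop_star L vs) * u"
    using n by (simp add: create_mode_def vop_star_def sum_list_map_sum split_beta sum_distrib_right scal_mult_left
      H_def heis_def power_term_def power_divide)
  finally show ?thesis .
qed

lemma pi_L_bell:
  assumes "\<And>n u. 1 \<le> n \<Longrightarrow> n \<le> d \<Longrightarrow> pi_L L p (x n) u = y n * u"
  shows "pi_L L p (bell x d) vacuum = bell y d"
  using assms
proof (induction d rule: less_induct)
  case (less d)
  show ?case
  proof (cases "d = 0")
    case True then show ?thesis by (simp add: pi_L_one vacuum_def)
  next
    case False
    have "scal (of_nat d) (pi_L L p (bell x d) vacuum) = (\<Sum>n=1..d. scal (of_nat n) (pi_L L p (x n * bell x (d - n)) vacuum))"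
      by (simp only: pol_linear_scal[OF linear_pi_L_left, symmetric] bell_rec)
         (simp only: pol_linear_sum[OF linear_pi_L_left] pol_linear_scal[OF linear_pi_L_left])
    also have "\<dots> = (\<Sum>n=1..d. scal (of_nat n) (y n * bell y (d - n)))"
      by (intro sum.cong refl) (use less in \<open>auto simp: pi_L_mult\<close>)
    also have "\<dots> = scal (of_nat d) (bell y d)" by (simp only: bell_rec)
    finally show ?thesis by (rule scal_cancel) (use False in simp)
  qed
qed

text \<open>The matrix element before the limit in \<open>normal_elem\<close>: bilinearity holds
  here unconditionally and is then carried over to convergent cases.\<close>

definition coherent_elem :: "nat \<Rightarrow> real \<Rightarrow> nat \<Rightarrow> pol \<Rightarrow> pol \<Rightarrow> vop \<Rightarrow> complex" where
  "coherent_elem L p M h h' vs = covacuum (pi_R L p h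
       (exp_trunc M (create_part L p M vs)
         (exp_trunc M (annihil_part L p M vs) (pi_L L p h' vacuum))))"

text \<open>The coefficient of Z^d in the annihilation exponential of \<open>us\<close> with all
  arguments divided by Z, pulled back to \<A>.\<close>

definition coherent_state :: "nat \<Rightarrow> real \<Rightarrow> vop \<Rightarrow> nat \<Rightarrow> pol" where
  "coherent_state L p us d = bell (mode_elem L p us) d"

definition coherent_value :: "nat \<Rightarrow> real \<Rightarrow> vop \<Rightarrow> nat \<Rightarrow> vop \<Rightarrow> nat \<Rightarrow> vop \<Rightarrow> complex" where
  "coherent_value L p us d us' d' vs = (\<Sum>i\<le>d'. cbell (vop_log L p vs (vop_star L us')) i *
     (if d' - i \<le> d then cbell (vop_log L p us vs) (d - (d' - i)) *
        cbell (vop_log L p us (vop_star L us')) (d' - i) else 0))"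

lemma valid_vop_star: "valid_vop L vs \<Longrightarrow> valid_vop L (vop_star L vs)"
  by (auto simp: valid_vop_def vop_star_def)

text \<open>Once M reaches both degrees, the two truncated exponentials already contain every term
  that can contribute, so the value is exact.\<close>

lemma coherent_elem_coherent:
  assumes L: "L > 0" and p: "p \<notin> \<rat>" and M: "d \<le> M" "d' \<le> M"
    and us: "valid_vop L us" "balanced d us" "valid_vop L us'" "balanced d' us'" and vs: "valid_vop L vs"
  shows "coherent_elem L p M (coherent_state L p us d) (coherent_state L p us' d') vs =
    coherent_value L p us d us' d' vs"
proof -
  let ?ws = "vop_star L us'"
  have "pi_L L p (coherent_state L p us' d') vacuum = bell (\<lambda>n. create_mode n ?ws) d'"
    unfolding coherent_state_def by (rule pi_L_bell) (rule pi_L_mode_elem[OF L p _ _ us(3,4)])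
  then have "coherent_elem L p M (coherent_state L p us d) (coherent_state L p us' d') vs =
    covacuum (pi_R L p (coherent_state L p us d) (exp_trunc M ((*) (create_sum M vs))
      (\<Sum>i\<le>d'. scal (cbell (vop_log L p vs ?ws) i) (bell (\<lambda>n. create_mode n ?ws) (d' - i)))))"
    unfolding coherent_elem_def create_part_eq
    by (simp only: exp_trunc_annihil_bell[OF valid_vop_star[OF us(3)] M(2)])
  also have "\<dots> = (\<Sum>i\<le>d'. cbell (vop_log L p vs ?ws) i * covacuum (pi_R L p (coherent_state L p us d)
      (exp_trunc M ((*) (create_sum M vs)) (bell (\<lambda>n. create_mode n ?ws) (d' - i)))))"
    by (simp only: pol_linear_sum[OF linear_exp_trunc[OF pol_linear_mult]] pol_linear_scal[OF linear_exp_trunc[OF pol_linear_mult]]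
        pol_linear_sum[OF linear_pi_R] pol_linear_scal[OF linear_pi_R] covacuum_sum covacuum_scal)
  also have "\<dots> = coherent_value L p us d us' d' vs"
    unfolding coherent_value_def coherent_state_def
    by (intro sum.cong refl arg_cong2[of _ _ _ _ "(*)"] covacuum_bell_exp_create)
       (use M vs us valid_vop_star pi_R_mode_elem[OF L p _ _ us(1,2)] in auto)
  finally show ?thesis .
qed

text \<open>With one operator reflected only the sum of the indices and the product of the points
  enter, which are symmetric. With both reflected the difference and the quotient are reversed, as
  if the operators had been interchanged.\<close>

lemma pair_log_star:
  assumes "fst u \<in> {1..L}" "fst v \<in> {1..L}" "snd u \<noteq> 0" "snd v \<noteq> 0"
  shows "pair_log L p n u (L + 1 - fst v, 1 / snd v) = pair_log L p n v (L + 1 - fst u, 1 / snd u)"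
    and "pair_log L p n (L + 1 - fst u, 1 / snd u) (L + 1 - fst v, 1 / snd v) = pair_log L p n v u"
proof -
  have "int (fst u) - int (L + 1 - fst v) = int (fst v) - int (L + 1 - fst u)"
    "fst u = L + 1 - fst v \<longleftrightarrow> fst v = L + 1 - fst u"
    "int (L + 1 - fst u) - int (L + 1 - fst v) = int (fst v) - int (fst u)"
    "L + 1 - fst u = L + 1 - fst v \<longleftrightarrow> fst v = fst u"
    using assms by auto
  then show "pair_log L p n u (L + 1 - fst v, 1 / snd v) = pair_log L p n v (L + 1 - fst u, 1 / snd u)"
    "pair_log L p n (L + 1 - fst u, 1 / snd u) (L + 1 - fst v, 1 / snd v) = pair_log L p n v u"
    unfolding pair_log_def fst_conv snd_conv by (simp_all only:) (simp_all add: mult.commute)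
qed

lemma vop_log_star_right:
  assumes "valid_vop L us" "valid_vop L vs"
  shows "vop_log L p us (vop_star L vs) = vop_log L p vs (vop_star L us)"
proof
  fix n
  have v: "fst v \<in> {1..L} \<and> snd v \<noteq> 0" if "v \<in> set us \<union> set vs" for v
    using assms that by (auto simp: valid_vop_def)
  have "vop_log L p us (vop_star L vs) n =
     (\<Sum>i<length us. \<Sum>j<length vs. pair_log L p n (us ! i) (L + 1 - fst (vs ! j), 1 / snd (vs ! j)))"
    by (simp add: vop_log_def vop_star_def sum_list_map_sum split_beta)
  also have "\<dots> = (\<Sum>i<length us. \<Sum>j<length vs. pair_log L p n (vs ! j) (L + 1 - fst (us ! i), 1 / snd (us ! i)))"
    by (intro sum.cong refl pair_log_star) (use v in auto)
  also have "\<dots> = vop_log L p vs (vop_star L us) n"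
    by (subst sum.swap) (simp add: vop_log_def vop_star_def sum_list_map_sum split_beta)
  finally show "vop_log L p us (vop_star L vs) n = vop_log L p vs (vop_star L us) n" .
qed

lemma vop_log_star_both:
  assumes "valid_vop L us" "valid_vop L vs"
  shows "vop_log L p (vop_star L us) (vop_star L vs) = vop_log L p vs us"
proof
  fix n
  have v: "fst v \<in> {1..L} \<and> snd v \<noteq> 0" if "v \<in> set us \<union> set vs" for v
    using assms that by (auto simp: valid_vop_def)
  have "vop_log L p (vop_star L us) (vop_star L vs) n =
     (\<Sum>i<length us. \<Sum>j<length vs. pair_log L p n (L + 1 - fst (us ! i), 1 / snd (us ! i)) (L + 1 - fst (vs ! j), 1 / snd (vs ! j)))"
    by (simp add: vop_log_def vop_star_def sum_list_map_sum split_beta)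
  also have "\<dots> = (\<Sum>i<length us. \<Sum>j<length vs. pair_log L p n (vs ! j) (us ! i))"
    by (intro sum.cong refl pair_log_star) (use v in auto)
  also have "\<dots> = vop_log L p vs us n"
    by (subst sum.swap) (simp add: vop_log_def sum_list_map_sum)
  finally show "vop_log L p (vop_star L us) (vop_star L vs) n = vop_log L p vs us n" .
qed

text \<open>Here j is the degree contracted directly between the two outer states; the remaining d -
  j and d' - j are contracted with the vertex operator. In this form the exchange of chiralities is
  visible.\<close>

lemma coherent_value_symmetric_form:
  "coherent_value L p us d us' d' vs = (\<Sum>j\<in>{..d} \<inter> {..d'}. cbell (vop_log L p us vs) (d - j) *
     cbell (vop_log L p us (vop_star L us')) j * cbell (vop_log L p vs (vop_star L us')) (d' - j))"
proof -
  let ?g = "\<lambda>j. cbell (vop_log L p us vs) (d - j) *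
     cbell (vop_log L p us (vop_star L us')) j * cbell (vop_log L p vs (vop_star L us')) (d' - j)"
  have "coherent_value L p us d us' d' vs = (\<Sum>i\<in>{..d'}. if d' - i \<le> d then ?g (d' - i) else 0)"
    unfolding coherent_value_def by (intro sum.cong refl) (simp add: mult_ac)
  also have "\<dots> = (\<Sum>j\<in>{..d'}. if j \<le> d then ?g j else 0)"
    by (rule sum.reindex_bij_witness[of _ "\<lambda>j. d' - j" "\<lambda>j. d' - j"]) auto
  also have "\<dots> = (\<Sum>j\<in>{..d'} \<inter> {..d}. ?g j)"
    by (subst sum.inter_restrict) (auto intro: sum.cong)
  finally show ?thesis by (simp add: Int_commute)
qed

lemma coherent_value_star:
  assumes "valid_vop L us" "valid_vop L us'" "valid_vop L vs"
  shows "coherent_value L p us' d' us d (vop_star L vs) = coherent_value L p us d us' d' vs"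
  unfolding coherent_value_symmetric_form
  by (simp add: vop_log_star_right[OF assms(2,3)] vop_log_star_right[OF assms(2,1)]
      vop_log_star_both[OF assms(3,1)] Int_commute mult_ac)

lemma sum_list_mset_cong:
  "mset vs = mset vs' \<Longrightarrow> (\<Sum>v\<leftarrow>vs. g v) = (\<Sum>v\<leftarrow>vs'. g v)" for g :: "_ \<Rightarrow> complex"
  by (simp add: sum_mset_sum_list[symmetric] mset_map del: sum_mset_sum_list)

lemma vop_log_mset_right: "mset vs = mset vs' \<Longrightarrow> vop_log L p us vs = vop_log L p us vs'"
  unfolding vop_log_def by (simp add: sum_list_mset_cong[of vs vs'])

lemma vop_log_mset_left: "mset vs = mset vs' \<Longrightarrow> vop_log L p vs us = vop_log L p vs' us"
  unfolding vop_log_def by (simp add: sum_list_mset_cong[of vs vs'])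

text \<open>The reflection of indices lists the factors of a current in the opposite order, so
  independence of the order is required.\<close>

lemma coherent_value_mset:
  assumes "mset vs = mset vs'"
  shows "coherent_value L p us d us' d' vs = coherent_value L p us d us' d' vs'"
  unfolding coherent_value_def vop_log_mset_right[OF assms] vop_log_mset_left[OF assms] ..

section \<open>The span of the coherent states\<close>

definition coherent_states :: "nat \<Rightarrow> real \<Rightarrow> pol set" where
  "coherent_states L p = {coherent_state L p us d | us d. valid_vop L us \<and> balanced d us}"

text \<open>The domain on which \<open>normal_elem\<close> is known to be a genuine limit and hence
  bilinear.\<close>

definition coherent_span :: "nat \<Rightarrow> real \<Rightarrow> pol set" where
  "coherent_span L p = pol.span (coherent_states L p)"

lemma coherent_states_subset_span: "coherent_states L p \<subseteq> coherent_span L p"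
  unfolding coherent_span_def by (rule pol.span_superset)

lemma coherent_span_closed:
  "g \<in> coherent_span L p \<Longrightarrow> h \<in> coherent_span L p \<Longrightarrow> g + h \<in> coherent_span L p"
  "g \<in> coherent_span L p \<Longrightarrow> scal c g \<in> coherent_span L p"
  unfolding coherent_span_def by (auto intro: pol.span_add pol.span_scale)

lemma coherent_span_induct [consumes 1, case_names zero step]:
  assumes "h \<in> coherent_span L p" "P 0"
    and "\<And>c g h. g \<in> coherent_states L p \<Longrightarrow> h \<in> coherent_span L p \<Longrightarrow> P h \<Longrightarrow> P (scal c g + h)"
  shows "P h"
proof -
  have "h \<in> coherent_span L p \<and> P h"
    using assms(1) unfolding coherent_span_def
  proof (induction h rule: pol.span_induct_alt)
    case base
    then show ?case using assms(2) by (simp add: pol.span_zero)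
  next
    case (step c g h)
    then show ?case using assms(3)[OF step.hyps(1), of h c] coherent_span_closed coherent_states_subset_span
      unfolding coherent_span_def[symmetric] by blast
  qed
  then show ?thesis ..
qed

lemma one_coherent: "coherent_state L p us 0 = 1"
  by (simp add: coherent_state_def)

lemma one_in_coherent_states: "1 \<in> coherent_states L p"
  unfolding coherent_states_def
  by (rule CollectI, rule exI[of _ "[]"], rule exI[of _ 0]) (simp add: one_coherent valid_vop_def balanced_def)

lemma linear_pi_L_coherent:
  "coherent_elem L p M h (h1 + h2) vs = coherent_elem L p M h h1 vs + coherent_elem L p M h h2 vs"
  "coherent_elem L p M h (scal c h1) vs = c * coherent_elem L p M h h1 vs"
  "coherent_elem L p M (h1 + h2) h vs = coherent_elem L p M h1 h vs + coherent_elem L p M h2 h vs"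
  "coherent_elem L p M (scal c h1) h vs = c * coherent_elem L p M h1 h vs"
proof -
  have lin: "pol_linear (annihil_part L p M vs)"
    unfolding annihil_part_eq[abs_def] by (intro pol_linear_sumI linear_annihil_mode)
  have 1: "pol_linear (\<lambda>h'. pi_R L p h (exp_trunc M (create_part L p M vs)
         (exp_trunc M (annihil_part L p M vs) (pi_L L p h' vacuum))))" for h
    unfolding create_part_eq
    by (intro pol_linear_comp[OF linear_pi_R] pol_linear_comp[OF linear_exp_trunc] pol_linear_mult lin linear_pi_L_left)
  show "coherent_elem L p M h (h1 + h2) vs = coherent_elem L p M h h1 vs + coherent_elem L p M h h2 vs"
    "coherent_elem L p M h (scal c h1) vs = c * coherent_elem L p M h h1 vs"
    unfolding coherent_elem_def pol_linear_add[OF 1] pol_linear_scal[OF 1] by (simp_all add: covacuum_add covacuum_scal)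
  show "coherent_elem L p M (h1 + h2) h vs = coherent_elem L p M h1 h vs + coherent_elem L p M h2 h vs"
    "coherent_elem L p M (scal c h1) h vs = c * coherent_elem L p M h1 h vs"
    unfolding coherent_elem_def pol_linear_add[OF linear_pi_R_left] pol_linear_scal[OF linear_pi_R_left]
    by (simp_all add: covacuum_add covacuum_scal)
qed

lemma coherent_elem_0: "coherent_elem L p M 0 h vs = 0" "coherent_elem L p M h 0 vs = 0"
  using linear_pi_L_coherent(2)[of L p M h 0 0] linear_pi_L_coherent(4)[of L p M 0 0 h] by simp_all

lemma normal_elem_eq_lim: "normal_elem L p h h' vs = lim (\<lambda>M. coherent_elem L p M h h' vs)"
  by (simp add: normal_elem_def coherent_elem_def)

context
  fixes L :: nat and p :: real
  assumes L: "L > 0" and p: "p \<notin> \<rat>"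
begin

lemma coherent_elem_tendsto:
  assumes "valid_vop L us" "balanced d us" "valid_vop L us'" "balanced d' us'" "valid_vop L vs"
  shows "(\<lambda>M. coherent_elem L p M (coherent_state L p us d) (coherent_state L p us' d') vs)
    \<longlonglongrightarrow> coherent_value L p us d us' d' vs"
proof (rule tendsto_eventually)
  show "\<forall>\<^sub>F M in sequentially. coherent_elem L p M (coherent_state L p us d) (coherent_state L p us' d') vs =
     coherent_value L p us d us' d' vs"
    using eventually_ge_at_top[of "max d d'"]
    by eventually_elim (rule coherent_elem_coherent[OF L p _ _ assms], auto)
qed

lemma normal_elem_coherent:
  assumes "valid_vop L us" "balanced d us" "valid_vop L us'" "balanced d' us'" "valid_vop L vs"
  shows "normal_elem L p (coherent_state L p us d) (coherent_state L p us' d') vs =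
    coherent_value L p us d us' d' vs"
  unfolding normal_elem_eq_lim by (rule limI[OF coherent_elem_tendsto[OF assms]])

lemma coherent_elem_convergent:
  assumes vs: "valid_vop L vs" and "h \<in> coherent_span L p" "h' \<in> coherent_span L p"
  shows "convergent (\<lambda>M. coherent_elem L p M h h' vs)"
  using assms(2) 
proof (induction h rule: coherent_span_induct)
  case zero
  then show ?case by (simp add: coherent_elem_0 convergent_const)
next
  case (step c h0 h)
  have "convergent (\<lambda>M. coherent_elem L p M h0 h' vs)"
    using assms(3) 
  proof (induction h' rule: coherent_span_induct)
    case zero
    then show ?case by (simp add: coherent_elem_0 convergent_const)
  next
    case (step c h0' h')
    then have "convergent (\<lambda>M. coherent_elem L p M h0 h0' vs)"
      using \<open>h0 \<in> coherent_states L p\<close> coherent_elem_tendsto vs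
      by (fastforce simp: coherent_states_def convergent_def)
    then show ?case using step
      by (simp add: linear_pi_L_coherent convergent_add convergent_mult convergent_const)
  qed
  then show ?case using step
    by (simp add: linear_pi_L_coherent convergent_add convergent_mult convergent_const)
qed

lemma normal_elem_linear:
  assumes vs: "valid_vop L vs" and h: "h1 \<in> coherent_span L p" "h2 \<in> coherent_span L p" "h \<in> coherent_span L p"
  shows "normal_elem L p (h1 + h2) h vs = normal_elem L p h1 h vs + normal_elem L p h2 h vs"
    "normal_elem L p (scal c h1) h vs = c * normal_elem L p h1 h vs"
    "normal_elem L p h (h1 + h2) vs = normal_elem L p h h1 vs + normal_elem L p h h2 vs"
    "normal_elem L p h (scal c h1) vs = c * normal_elem L p h h1 vs"
proof -
  have t: "(\<lambda>M. coherent_elem L p M g g' vs) \<longlonglongrightarrow> normal_elem L p g g' vs"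
    if "g \<in> coherent_span L p" "g' \<in> coherent_span L p" for g g'
    using coherent_elem_convergent[OF vs that] unfolding normal_elem_eq_lim convergent_LIMSEQ_iff .
  show "normal_elem L p (h1 + h2) h vs = normal_elem L p h1 h vs + normal_elem L p h2 h vs"
    unfolding normal_elem_eq_lim[of L p "h1 + h2"] linear_pi_L_coherent by (intro limI tendsto_add t h)
  show "normal_elem L p (scal c h1) h vs = c * normal_elem L p h1 h vs"
    unfolding normal_elem_eq_lim[of L p "scal c h1"] linear_pi_L_coherent by (intro limI tendsto_mult tendsto_const t h)
  show "normal_elem L p h (h1 + h2) vs = normal_elem L p h h1 vs + normal_elem L p h h2 vs"
    unfolding normal_elem_eq_lim[of L p h "h1 + h2"] linear_pi_L_coherent by (intro limI tendsto_add t h)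
  show "normal_elem L p h (scal c h1) vs = c * normal_elem L p h h1 vs"
    unfolding normal_elem_eq_lim[of L p h "scal c h1"] linear_pi_L_coherent by (intro limI tendsto_mult tendsto_const t h)
qed

lemma normal_elem_0:
  "normal_elem L p 0 h vs = 0" "normal_elem L p h 0 vs = 0"
  unfolding normal_elem_eq_lim by (simp_all add: coherent_elem_0 lim_const)

lemma normal_elem_star:
  assumes vs: "valid_vop L vs" and vs': "mset vs' = mset (vop_star L vs)"
    and "h \<in> coherent_span L p" "h' \<in> coherent_span L p"
  shows "normal_elem L p h' h vs' = normal_elem L p h h' vs"
proof -
  have v': "valid_vop L vs'"
    using valid_vop_star[OF vs] mset_eq_setD[OF vs'] by (simp add: valid_vop_def)
  note base = coherent_states_subset_span[of L p] and sp = coherent_span_closed[of _ L p]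
  have 1: "normal_elem L p g' g vs' = normal_elem L p g g' vs"
    if "g \<in> coherent_states L p" "g' \<in> coherent_states L p" for g g'
  proof -
    from that obtain us d us' d' where g: "g = coherent_state L p us d" "valid_vop L us" "balanced d us"
      "g' = coherent_state L p us' d'" "valid_vop L us'" "balanced d' us'"
      unfolding coherent_states_def by blast
    show ?thesis unfolding g normal_elem_coherent[OF g(2,3,5,6) vs] normal_elem_coherent[OF g(5,6,2,3) v']
      using coherent_value_mset[OF vs'] coherent_value_star[OF g(2,5) vs] by simp
  qed
  have 2: "normal_elem L p g' g vs' = normal_elem L p g g' vs"
    if "g \<in> coherent_states L p" and g': "g' \<in> coherent_span L p" for g g'
    using g' 
  proof (induction g' rule: coherent_span_induct)
    case zero
    then show ?case by (simp add: normal_elem_0)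
  next
    case (step c g1 g2)
    then show ?case using 1[OF that(1) step.hyps(1)] base that sp
      by (simp add: normal_elem_linear vs v' subset_iff)
  qed
  show ?thesis
    using assms(3) 
  proof (induction h rule: coherent_span_induct)
    case zero
    then show ?case by (simp add: normal_elem_0)
  next
    case (step c g1 g2)
    then show ?case using 2[OF step.hyps(1) assms(4)] base assms(4) sp
      by (simp add: normal_elem_linear vs v' subset_iff)
  qed
qed

end

section \<open>The functions \<open>J\<close>\<close>

definition content :: "nat \<Rightarrow> nat set list \<Rightarrow> complex list \<Rightarrow> vop" where
  "content L Ss xs = concat (map2 (vop_of_set L) Ss xs)"

definition weight_factor :: "nat \<Rightarrow> (nat \<Rightarrow> complex) \<Rightarrow> nat set list \<Rightarrow> complex" where
  "weight_factor L a Ss = (\<Prod>S\<leftarrow>Ss. omega_pow L (hform L a (weight_of_set L S)))"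

definition self_contr :: "nat \<Rightarrow> real \<Rightarrow> vop list \<Rightarrow> complex" where
  "self_contr L p vss = (\<Prod>j<length vss. \<Prod>i<j. vop_contr L p (vss ! i) (vss ! j))"

abbreviation k_subset_lists :: "nat \<Rightarrow> nat list \<Rightarrow> nat set list set" where
  "k_subset_lists L ks \<equiv> listset (map (k_subsets L) ks)"

lemma J_tilde_eq: "J_tilde L p a h h' ks xs = (\<Sum>Ss\<in>k_subset_lists L ks.
    weight_factor L a Ss * (self_contr L p (map2 (vop_of_set L) Ss xs) * normal_elem L p h h' (content L Ss xs)))"
  by (simp add: J_tilde_def weight_factor_def product_elem_def self_contr_def content_def)

lemma in_k_subset_lists:
  "Ss \<in> k_subset_lists L ks \<longleftrightarrow> length Ss = length ks \<and> (\<forall>j<length ks. Ss ! j \<subseteq> {1..L} \<and> card (Ss ! j) = ks ! j)"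
  by (auto simp: in_listset k_subsets_def)

lemma valid_vop_of_set:
  assumes "S \<subseteq> {1..L}" "x \<noteq> 0"
  shows "valid_vop L (vop_of_set L S x)"
proof -
  have "finite S" using assms finite_subset by blast
  then show ?thesis using assms by (auto simp: valid_vop_def vop_of_set_eq vop_arg_neq_0)
qed

lemma valid_vop_concat: "valid_vop L (concat vss) \<longleftrightarrow> (\<forall>vs\<in>set vss. valid_vop L vs)"
  by (auto simp: valid_vop_def)

lemma valid_content:
  assumes "Ss \<in> k_subset_lists L ks" "0 \<notin> set xs"
  shows "valid_vop L (content L Ss xs)"
  unfolding content_def valid_vop_concat
proof
  fix vs assume "vs \<in> set (map2 (vop_of_set L) Ss xs)"
  then obtain S x where "vs = vop_of_set L S x" "S \<in> set Ss" "x \<in> set xs"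
    by (auto dest: set_zip_leftD set_zip_rightD)
  moreover from this have "S \<subseteq> {1..L}" using assms(1)
    by (metis in_k_subset_lists in_set_conv_nth)
  ultimately show "valid_vop L vs" using assms(2) by (metis valid_vop_of_set)
qed

lemma regular_point_neq_0: "regular_point L xs \<Longrightarrow> 0 \<notin> set xs"
  by (auto simp: regular_point_def in_set_conv_nth)

lemma J_tilde_linear:
  assumes L: "L > 0" and p: "p \<notin> \<rat>" and xs: "0 \<notin> set xs"
    and h: "h1 \<in> coherent_span L p" "h2 \<in> coherent_span L p" "h \<in> coherent_span L p"
  shows "J_tilde L p a (h1 + h2) h ks xs = J_tilde L p a h1 h ks xs + J_tilde L p a h2 h ks xs"
    "J_tilde L p a (scal c h1) h ks xs = c * J_tilde L p a h1 h ks xs"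
    "J_tilde L p a h (h1 + h2) ks xs = J_tilde L p a h h1 ks xs + J_tilde L p a h h2 ks xs"
    "J_tilde L p a h (scal c h1) ks xs = c * J_tilde L p a h h1 ks xs"
  unfolding J_tilde_eq sum.distrib[symmetric] sum_distrib_left
  by (intro sum.cong refl; simp add: normal_elem_linear[OF L p valid_content[OF _ xs] h] algebra_simps)+

lemma J_tilde_0: "L > 0 \<Longrightarrow> p \<notin> \<rat> \<Longrightarrow> J_tilde L p a 0 h ks xs = 0"
  "L > 0 \<Longrightarrow> p \<notin> \<rat> \<Longrightarrow> J_tilde L p a h 0 ks xs = 0"
  by (simp_all add: J_tilde_eq normal_elem_0)

lemma J_tilde_sum:
  assumes L: "L > 0" and p: "p \<notin> \<rat>" and xs: "0 \<notin> set xs"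
    and h: "\<And>i. i \<in> I \<Longrightarrow> g i \<in> coherent_span L p" "h \<in> coherent_span L p"
  shows "J_tilde L p a (\<Sum>i\<in>I. scal (c i) (g i)) h ks xs = (\<Sum>i\<in>I. c i * J_tilde L p a (g i) h ks xs)"
    and "J_tilde L p a h (\<Sum>i\<in>I. scal (c i) (g i)) ks xs = (\<Sum>i\<in>I. c i * J_tilde L p a h (g i) ks xs)"
proof -
  have z: "0 \<in> coherent_span L p" by (simp add: coherent_span_def pol.span_zero)
  have sp: "(\<Sum>i\<in>A. scal (c i) (g i)) \<in> coherent_span L p" if "A \<subseteq> I" for A
    using that h(1) unfolding coherent_span_def by (intro pol.span_sum pol.span_scale) auto
  have "J_tilde L p a (\<Sum>i\<in>A. scal (c i) (g i)) h ks xs = (\<Sum>i\<in>A. c i * J_tilde L p a (g i) h ks xs) \<and>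
     J_tilde L p a h (\<Sum>i\<in>A. scal (c i) (g i)) ks xs = (\<Sum>i\<in>A. c i * J_tilde L p a h (g i) ks xs)"
    if "A \<subseteq> I" for A
    using that
  proof (induction A rule: infinite_finite_induct)
    case (insert i A)
    then have "g i \<in> coherent_span L p" "(\<Sum>i\<in>A. scal (c i) (g i)) \<in> coherent_span L p" using h(1) sp by auto
    then show ?case using insert h(2) coherent_span_closed(2)
      by (simp add: J_tilde_linear[OF L p xs] z)
  qed (simp_all add: J_tilde_0 L p)
  from this[of I] show "J_tilde L p a (\<Sum>i\<in>I. scal (c i) (g i)) h ks xs = (\<Sum>i\<in>I. c i * J_tilde L p a (g i) h ks xs)"
    "J_tilde L p a h (\<Sum>i\<in>I. scal (c i) (g i)) ks xs = (\<Sum>i\<in>I. c i * J_tilde L p a h (g i) ks xs)" by auto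
qed

text \<open>The common entry -1/L of the fundamental weights drops out because the entries of
  \<open>a\<close> add up to 0.\<close>

lemma omega_pow_weight:
  assumes "a \<in> hdual L" "S \<subseteq> {1..L}"
  shows "omega_pow L (hform L a (weight_of_set L S)) = (\<Prod>s\<in>S. omega_pow L (a s))"
proof -
  have fin: "finite S" using assms finite_subset by blast
  have "hform L a (weight_of_set L S) = (\<Sum>t\<in>S. \<Sum>s=1..L. a s * fund_weight L t s)"
    unfolding hform_def weight_of_set_def sum_distrib_left by (rule sum.swap)
  also have "\<dots> = (\<Sum>t\<in>S. a t)"
  proof (rule sum.cong[OF refl])
    fix t assume "t \<in> S"
    then have t: "t \<in> {1..L}" using assms by auto
    have "(\<Sum>s=1..L. a s * fund_weight L t s) = (\<Sum>s=1..L. (if s = t then a s else 0) - a s / of_nat L)"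
      by (rule sum.cong) (auto simp: fund_weight_def right_diff_distrib)
    also have "\<dots> = a t - (\<Sum>s=1..L. a s) / of_nat L"
      using t by (simp add: sum_subtractf sum_divide_distrib)
    also have "\<dots> = a t" using assms by (simp add: hdual_def)
    finally show "(\<Sum>s=1..L. a s * fund_weight L t s) = a t" .
  qed
  finally show ?thesis using fin by (simp add: omega_pow_sum)
qed

lemma weight_factor_eq:
  assumes "a \<in> hdual L" "Ss \<in> k_subset_lists L ks"
  shows "weight_factor L a Ss = (\<Prod>j<length Ss. \<Prod>s\<in>Ss ! j. omega_pow L (a s))"
proof -
  have "weight_factor L a Ss = (\<Prod>j<length Ss. omega_pow L (hform L a (weight_of_set L (Ss ! j))))"
    by (simp add: weight_factor_def prod.list_conv_set_nth atLeast0LessThan)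
  also have "\<dots> = (\<Prod>j<length Ss. \<Prod>s\<in>Ss ! j. omega_pow L (a s))"
    by (intro prod.cong refl omega_pow_weight[OF assms(1)]) (use assms(2) in \<open>auto simp: in_k_subset_lists\<close>)
  finally show ?thesis .
qed

lemma self_contr_eq:
  assumes "Ss \<in> k_subset_lists L ks" "length xs = length ks"
  shows "self_contr L p (map2 (vop_of_set L) Ss xs) =
    (\<Prod>j<length Ss. \<Prod>i<j. set_contr L p (Ss ! i) (xs ! i) (Ss ! j) (xs ! j))"
proof -
  have "finite (Ss ! j)" if "j < length ks" for j
    using assms that by (auto simp: in_k_subset_lists intro: finite_subset)
  then show ?thesis
    using assms unfolding self_contr_def
    by (intro prod.cong) (auto simp: in_k_subset_lists set_contr_def vop_contr_of_set)
qed

lemma normal_elem_one: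
  assumes "L > 0" "p \<notin> \<rat>" "valid_vop L us" "balanced d us" "valid_vop L vs"
  shows "normal_elem L p 1 (coherent_state L p us d) vs = cbell (vop_log L p vs (vop_star L us)) d"
proof -
  have "normal_elem L p (coherent_state L p [] 0) (coherent_state L p us d) vs = coherent_value L p [] 0 us d vs"
    using assms by (intro normal_elem_coherent) (auto simp: valid_vop_def balanced_def)
  also have "\<dots> = cbell (vop_log L p vs (vop_star L us)) d"
    by (simp add: coherent_value_symmetric_form)
  finally show ?thesis by (simp only: one_coherent)
qed

lemma J_tilde_primary:
  assumes L: "L > 0" and p: "p \<notin> \<rat>" and a: "a \<in> hdual L" and xs: "0 \<notin> set xs" "length xs = length ks"
  shows "J_tilde L p a 1 1 ks xs = primary_fun L p (\<lambda>s. omega_pow L (a s)) ks xs"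
  unfolding J_tilde_eq primary_fun_def
proof (rule sum.cong[OF refl])
  fix Ss assume Ss: "Ss \<in> k_subset_lists L ks"
  have "normal_elem L p 1 1 (content L Ss xs) = 1"
    using normal_elem_one[OF L p _ _ valid_content[OF Ss xs(1)], of "[]" 0]
    by (simp add: one_coherent valid_vop_def balanced_def)
  then show "weight_factor L a Ss * (self_contr L p (map2 (vop_of_set L) Ss xs) * normal_elem L p 1 1 (content L Ss xs)) =
    (\<Prod>j<length Ss. \<Prod>s\<in>Ss ! j. omega_pow L (a s)) *
     (\<Prod>j<length Ss. \<Prod>i<j. set_contr L p (Ss ! i) (xs ! i) (Ss ! j) (xs ! j))"
    by (simp add: weight_factor_eq[OF a Ss] self_contr_eq[OF Ss xs(2)])
qed

lemma simple_refl_hdual: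
  assumes "a \<in> hdual L" "i \<in> {1..L-1}"
  shows "simple_refl L i a \<in> hdual L"
proof -
  let ?s = "Transposition.transpose i (Suc i)"
  have 1: "?s s \<in> {1..L} \<longleftrightarrow> s \<in> {1..L}" for s
    using assms(2) by (auto simp: Transposition.transpose_def)
  have "(\<Sum>s=1..L. a (?s s)) = (\<Sum>s=1..L. a s)"
    by (rule sum.reindex_bij_witness[of _ ?s ?s]) (use 1 in \<open>simp_all del: atLeastAtMost_iff\<close>)
  then show ?thesis using assms(1) 1 unfolding simple_refl_eq[OF assms(2)] hdual_def by auto
qed

lemma weyl_hdual: "w \<in> weyl L \<Longrightarrow> a \<in> hdual L \<Longrightarrow> w a \<in> hdual L"
  by (induction rule: weyl.induct) (auto simp: simple_refl_hdual)

lemma J_tilde_primary_weyl: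
  assumes L: "L \<ge> 2" and p: "p \<notin> \<rat>" and w: "w \<in> weyl L" and a: "a \<in> hdual L"
    and xs: "regular_point L xs" "length xs = length ks"
  shows "J_tilde L p (w a) 1 1 ks xs = J_tilde L p a 1 1 ks xs"
  using w
proof (induction rule: weyl.induct)
  case (weyl_step w i)
  have L0: "L > 0" using L by simp
  have wa: "w a \<in> hdual L" by (rule weyl_hdual[OF weyl_step(1) a])
  have "(\<lambda>s. omega_pow L (simple_refl L i (w a) s)) = (\<lambda>s. omega_pow L (w a s)) \<circ> Transposition.transpose i (Suc i)"
    by (rule ext) (simp add: simple_refl_eq[OF weyl_step(2)])
  then show ?case
    using weyl_step.IH primary_fun_transpose[OF L weyl_step(2) xs, of p "\<lambda>s. omega_pow L (w a s)"]
    by (simp add: J_tilde_primary[OF L0 p _ regular_point_neq_0[OF xs(1)] xs(2)] wa simple_refl_hdual[OF wa weyl_step(2)])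
qed simp

section \<open>Reflection of the indices together with inversion of the points\<close>

definition refl_set :: "nat \<Rightarrow> nat set \<Rightarrow> nat set" where
  "refl_set L S = (\<lambda>s. L + 1 - s) ` S"

lemma inj_on_refl:
  fixes L :: nat
  assumes "S \<subseteq> {1..L}"
  shows "inj_on (\<lambda>s. L + 1 - s) S"
proof (rule inj_onI)
  fix x y assume "x \<in> S" "y \<in> S" "L + 1 - x = L + 1 - y"
  moreover from this have "x \<le> L" "y \<le> L" using assms by auto
  ultimately show "x = y" by linarith
qed

lemma refl_set_subset: "S \<subseteq> {1..L} \<Longrightarrow> refl_set L S \<subseteq> {1..L}"
  by (auto simp: refl_set_def subset_iff)

lemma refl_set_refl_set: "S \<subseteq> {1..L} \<Longrightarrow> refl_set L (refl_set L S) = S"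
  by (force simp: refl_set_def image_iff subset_iff)

lemma card_refl_set: "S \<subseteq> {1..L} \<Longrightarrow> card (refl_set L S) = card S"
  unfolding refl_set_def by (rule card_image[OF inj_on_refl])

text \<open>Position q of s in \<open>S\<close> becomes position card S + 1 - q in the reflected
  set, so the exponent of \<omega> changes its sign.\<close>

lemma vop_arg_refl:
  assumes S: "S \<subseteq> {1..L}" and s: "s \<in> S"
  shows "vop_arg L (refl_set L S) (1 / x) (L + 1 - s) = 1 / vop_arg L S x s"
proof -
  have fin: "finite S" using S finite_subset by blast
  have "{t \<in> refl_set L S. t \<le> L + 1 - s} = (\<lambda>s. L + 1 - s) ` {t \<in> S. s \<le> t}"
    using S s by (force simp: refl_set_def subset_iff image_iff)
  also have "card \<dots> = card {t \<in> S. s \<le> t}"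
    by (rule card_image[OF inj_on_refl]) (use S in auto)
  finally have 1: "card {t \<in> refl_set L S. t \<le> L + 1 - s} = card {t \<in> S. s \<le> t}" .
  have "card {t \<in> S. s \<le> t} + card {t \<in> S. t \<le> s} = card ({t \<in> S. s \<le> t} \<union> {t \<in> S. t \<le> s}) + card ({t \<in> S. s \<le> t} \<inter> {t \<in> S. t \<le> s})"
    by (rule card_Un_Int) (use fin in auto)
  also have "{t \<in> S. s \<le> t} \<union> {t \<in> S. t \<le> s} = S" by auto
  also have "{t \<in> S. s \<le> t} \<inter> {t \<in> S. t \<le> s} = {s}" using s by auto
  finally have 2: "card {t \<in> S. s \<le> t} + card {t \<in> S. t \<le> s} = card S + 1" by simp
  have u: "of_nat (card {t \<in> S. s \<le> t}) = of_nat (card S) + 1 - (of_nat (card {t \<in> S. t \<le> s}) :: complex)"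
    using arg_cong[OF 2, of "of_nat :: nat \<Rightarrow> complex"] by (simp add: eq_diff_eq)
  have "(of_nat (card S) + 1 - 2 * of_nat (card {t \<in> S. s \<le> t})) / 2 =
     - ((of_nat (card S) + 1 - 2 * of_nat (card {t \<in> S. t \<le> s})) / (2 :: complex))"
    unfolding u by (simp add: field_simps)
  then show ?thesis
    unfolding vop_arg_def 1 card_refl_set[OF S] by (simp only: omega_pow_minus) (simp add: field_simps)
qed

lemma mset_vop_of_set_refl:
  assumes S: "S \<subseteq> {1..L}"
  shows "mset (vop_of_set L (refl_set L S) (1 / x)) = mset (vop_star L (vop_of_set L S x))"
proof -
  have fin: "finite S" "finite (refl_set L S)" using S finite_subset by (auto simp: refl_set_def)
  have "mset_set (refl_set L S) = image_mset (\<lambda>s. L + 1 - s) (mset_set S)"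
    unfolding refl_set_def by (rule image_mset_mset_set[OF inj_on_refl[OF S], symmetric])
  then have "mset (vop_of_set L (refl_set L S) (1 / x)) =
     image_mset (\<lambda>s. (L + 1 - s, vop_arg L (refl_set L S) (1 / x) (L + 1 - s))) (mset_set S)"
    unfolding vop_of_set_eq[OF fin(2)] by (simp add: image_mset.compositionality comp_def flip: sorted_list_of_mset_set)
  also have "\<dots> = image_mset (\<lambda>s. (L + 1 - s, 1 / vop_arg L S x s)) (mset_set S)"
    by (rule image_mset_cong) (use vop_arg_refl[OF S] fin in auto)
  also have "\<dots> = mset (vop_star L (vop_of_set L S x))"
    unfolding vop_of_set_eq[OF fin(1)] vop_star_def
    by (simp add: image_mset.compositionality comp_def flip: sorted_list_of_mset_set)
  finally show ?thesis .
qed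

lemma prod_list_mset_cong:
  "mset vs = mset vs' \<Longrightarrow> (\<Prod>v\<leftarrow>vs. g v) = (\<Prod>v\<leftarrow>vs'. g v)" for g :: "_ \<Rightarrow> complex"
  by (simp add: prod_mset_prod_list[symmetric] mset_map del: prod_mset_prod_list)

lemma vop_contr_mset_cong:
  assumes "mset us = mset us'" "mset vs = mset vs'"
  shows "vop_contr L p us vs = vop_contr L p us' vs'"
  unfolding vop_contr_def prod_list_mset_cong[OF assms(1)] prod_list_mset_cong[OF assms(2)] ..

lemma vop_contr_star:
  assumes "valid_vop L us" "valid_vop L vs"
  shows "vop_contr L p (vop_star L us) (vop_star L vs) = vop_contr L p us vs"
proof -
  have "pair_contr L p (L + 1 - fst u, 1 / snd u) (L + 1 - fst v, 1 / snd v) = pair_contr L p u v"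
    if "u \<in> set us" "v \<in> set vs" for u v
  proof -
    have "fst u \<in> {1..L}" "fst v \<in> {1..L}" using assms that by (auto simp: valid_vop_def)
    then have "L + 1 - fst u = L + 1 - fst v \<longleftrightarrow> fst u = fst v" "L + 1 - fst v < L + 1 - fst u \<longleftrightarrow> fst u < fst v"
      by auto
    then show ?thesis by (cases u; cases v) auto
  qed
  then show ?thesis unfolding vop_contr_def vop_star_def
    by (simp add: comp_def split_beta cong: map_cong)
qed

lemma wstar_hdual: "a \<in> hdual L \<Longrightarrow> wstar L a \<in> hdual L"
  by (rule weyl_hdual[OF wstar_in_weyl])

text \<open>Reflecting the subsets permutes the terms. The weights are matched by
  \<open>wstar\<close>, the pair contractions are invariant, and in the matrix element of the
  normally ordered product the two outer states change places.\<close>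

lemma J_tilde_star:
  assumes L: "L > 0" and p: "p \<notin> \<rat>" and a: "a \<in> hdual L" and xs: "0 \<notin> set xs" "length xs = length ks"
    and h: "h \<in> coherent_span L p" "h' \<in> coherent_span L p"
  shows "J_tilde L p (wstar L a) h' h ks (map (\<lambda>x. 1 / x) xs) = J_tilde L p a h h' ks xs"
  unfolding J_tilde_eq
proof (rule sym, rule sum.reindex_bij_witness[of _ "map (refl_set L)" "map (refl_set L)"])
  let ?xs = "map (\<lambda>x. 1 / x) xs"
  fix Ss assume Ss: "Ss \<in> k_subset_lists L ks"
  then have len: "length Ss = length ks" and sub: "\<And>j. j < length ks \<Longrightarrow> Ss ! j \<subseteq> {1..L}"
    by (auto simp: in_k_subset_lists)
  show "map (refl_set L) (map (refl_set L) Ss) = Ss"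
    by (rule nth_equalityI) (use len sub refl_set_refl_set in auto)
  then show "map (refl_set L) (map (refl_set L) Ss) = Ss" .
  show Rs: "map (refl_set L) Ss \<in> k_subset_lists L ks"
    using Ss card_refl_set refl_set_subset by (auto simp: in_k_subset_lists)
  then show "map (refl_set L) Ss \<in> k_subset_lists L ks" .
  have x0: "xs ! j \<noteq> 0" if "j < length ks" for j using that xs by (metis nth_mem)
  have vo: "valid_vop L (vop_of_set L (Ss ! j) (xs ! j))" if "j < length ks" for j
    by (rule valid_vop_of_set[OF sub[OF that] x0[OF that]])
  have ms: "mset (vop_of_set L (refl_set L (Ss ! j)) (1 / (xs ! j))) = mset (vop_star L (vop_of_set L (Ss ! j) (xs ! j)))"
    if "j < length ks" for j
    by (rule mset_vop_of_set_refl[OF sub[OF that]])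
  have W: "weight_factor L (wstar L a) (map (refl_set L) Ss) = weight_factor L a Ss"
    unfolding weight_factor_eq[OF wstar_hdual[OF a] Rs] weight_factor_eq[OF a Ss] length_map
  proof (rule prod.cong[OF refl])
    fix j assume "j \<in> {..<length Ss}"
    then have j: "j < length ks" using len by simp
    have "(\<Prod>s\<in>refl_set L (Ss ! j). omega_pow L (wstar L a s)) = (\<Prod>s\<in>Ss ! j. omega_pow L (wstar L a (L + 1 - s)))"
      unfolding refl_set_def prod.reindex[OF inj_on_refl[OF sub[OF j]]] comp_def ..
    also have "\<dots> = (\<Prod>s\<in>Ss ! j. omega_pow L (a s))"
      by (rule prod.cong) (use sub[OF j] in \<open>auto simp: wstar_def subset_iff\<close>)
    finally show "(\<Prod>s\<in>map (refl_set L) Ss ! j. omega_pow L (wstar L a s)) = (\<Prod>s\<in>Ss ! j. omega_pow L (a s))"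
      using j len by simp
  qed
  have C: "self_contr L p (map2 (vop_of_set L) (map (refl_set L) Ss) ?xs) = self_contr L p (map2 (vop_of_set L) Ss xs)"
    unfolding self_contr_def
  proof (intro prod.cong)
    show "{..<length (map2 (vop_of_set L) (map (refl_set L) Ss) ?xs)} = {..<length (map2 (vop_of_set L) Ss xs)}" by simp
    fix i j assume "j \<in> {..<length (map2 (vop_of_set L) Ss xs)}" "i \<in> {..<j}"
    then have ij: "i < length ks" "j < length ks" using len xs by auto
    then show "vop_contr L p (map2 (vop_of_set L) (map (refl_set L) Ss) ?xs ! i) (map2 (vop_of_set L) (map (refl_set L) Ss) ?xs ! j) =
        vop_contr L p (map2 (vop_of_set L) Ss xs ! i) (map2 (vop_of_set L) Ss xs ! j)"
      using len xs vop_contr_mset_cong[OF ms[OF ij(1)] ms[OF ij(2)]] vop_contr_star[OF vo[OF ij(1)] vo[OF ij(2)]]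
      by simp
  qed simp
  have "mset (content L (map (refl_set L) Ss) ?xs) = mset (vop_star L (content L Ss xs))"
    using sub len xs(2) unfolding content_def
  proof (induction ks arbitrary: Ss xs)
    case (Cons k ks)
    then obtain S Ss' x xs' where e: "Ss = S # Ss'" "xs = x # xs'" by (metis length_Suc_conv)
    have "S \<subseteq> {1..L}" using Cons.prems(1)[of 0] e by simp
    moreover have "Ss' ! j \<subseteq> {1..L}" if "j < length ks" for j using Cons.prems(1)[of "Suc j"] e that by simp
    ultimately show ?case using Cons.IH[of Ss' xs'] Cons.prems e mset_vop_of_set_refl[of S L x]
      by (simp add: vop_star_def)
  qed (simp add: vop_star_def)
  from normal_elem_star[OF L p valid_content[OF Ss xs(1)] this h]
  show "weight_factor L (wstar L a) (map (refl_set L) Ss) * (self_contr L p (map2 (vop_of_set L) (map (refl_set L) Ss) ?xs) *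
      normal_elem L p h' h (content L (map (refl_set L) Ss) ?xs)) = weight_factor L a Ss *
      (self_contr L p (map2 (vop_of_set L) Ss xs) * normal_elem L p h h' (content L Ss xs))"
    by (simp only: W C)
qed

section \<open>Expansion in the positions of some of the currents\<close>

text \<open>At Z = 0 the points y / Z are junk values, so the function is compared with an analytic
  one away from 0 only.\<close>

definition punctured_expansion :: "(complex \<Rightarrow> complex) \<Rightarrow> complex fps \<Rightarrow> bool" where
  "punctured_expansion f F \<longleftrightarrow> (\<exists>g. g has_fps_expansion F \<and> (\<forall>Z. Z \<noteq> 0 \<longrightarrow> f Z = g Z))"

lemma punctured_expansion_mult:
  "punctured_expansion f F \<Longrightarrow> punctured_expansion g G \<Longrightarrow> punctured_expansion (\<lambda>Z. f Z * g Z) (F * G)"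
  unfolding punctured_expansion_def
  by (elim exE conjE, rule exI, rule conjI, erule (1) has_fps_expansion_mult) simp

lemma punctured_expansion_add:
  "punctured_expansion f F \<Longrightarrow> punctured_expansion g G \<Longrightarrow> punctured_expansion (\<lambda>Z. f Z + g Z) (F + G)"
  unfolding punctured_expansion_def
  by (elim exE conjE, rule exI, rule conjI, erule (1) has_fps_expansion_add) simp

lemma punctured_expansion_const: "punctured_expansion (\<lambda>Z. c) (fps_const c)"
  unfolding punctured_expansion_def by (rule exI, rule conjI, rule has_fps_expansion_const) simp

lemma punctured_expansion_power: "punctured_expansion (\<lambda>Z. Z ^ n) (fps_X ^ n)"
  unfolding punctured_expansion_def by (rule exI, rule conjI, rule has_fps_expansion_fps_X_power) simp

lemma punctured_expansion_sum:
  "(\<And>i. i \<in> A \<Longrightarrow> punctured_expansion (f i) (F i)) \<Longrightarrow>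
    punctured_expansion (\<lambda>Z. \<Sum>i\<in>A. f i Z) (\<Sum>i\<in>A. F i)"
  using punctured_expansion_const[of 0]
  by (induction A rule: infinite_finite_induct) (auto intro: punctured_expansion_add)

lemma punctured_expansion_cong:
  "(\<And>Z. Z \<noteq> 0 \<Longrightarrow> f Z = g Z) \<Longrightarrow> punctured_expansion f F \<Longrightarrow> punctured_expansion g F"
  unfolding punctured_expansion_def by metis

lemma punctured_expansion_unique:
  assumes "punctured_expansion f F" "punctured_expansion g G" "\<forall>\<^sub>F Z in at 0. f Z = g Z"
  shows "F = G"
proof -
  have "f has_laurent_expansion fps_to_fls F" if pe: "punctured_expansion f F" for f F
  proof -
    obtain g where g: "g has_fps_expansion F" "\<And>Z. Z \<noteq> 0 \<Longrightarrow> f Z = g Z"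
      using pe unfolding punctured_expansion_def by blast
    have "\<forall>\<^sub>F Z in at 0. f Z = g Z"
      using eventually_neq_at_within[of 0 0] by eventually_elim (rule g(2))
    then show ?thesis using has_laurent_expansion_fps[OF g(1)] has_laurent_expansion_cong by blast
  qed
  note L = this[OF assms(1)] this[OF assms(2)]
  have "f has_laurent_expansion fps_to_fls G"
    using L(2) has_laurent_expansion_cong[OF assms(3) refl] by blast
  from has_laurent_expansion_unique[OF L(1) this] show ?thesis
    by (simp add: fps_to_fls_eq_iff)
qed

section \<open>Power series of the contractions\<close>

lemma fps_left_right_inverse_unique:
  fixes a b c :: "complex fps"
  assumes "a * b = 1" "b * c = 1"
  shows "a = c"
proof -
  have "a = a * (b * c)" by (simp only: assms mult_1_right)
  also have "\<dots> = a * b * c" by (simp only: mult.assoc)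
  finally show ?thesis by (simp only: assms mult_1_left)
qed

text \<open>The exponent is the series of -log(1 - cZ), verified through its differential
  equation.\<close>

lemma cbell_geometric:
  fixes c :: complex
  shows "Abs_fps (cbell (\<lambda>n. c ^ n / of_nat n)) = inverse (1 - fps_const c * fps_X)"
proof (rule cbell_fps_unique[symmetric])
  let ?b = "1 - fps_const c * fps_X"
  let ?F = "inverse ?b" and ?G = "fps_deriv (exponent_fps (\<lambda>n. c ^ n / of_nat n))"
  have inv: "?F * ?b = 1" by (rule inverse_mult_eq_1) simp
  show "fps_nth ?F 0 = 1" by simp
  have "?G * ?b = fps_const c"
  proof (rule fps_ext)
    fix n
    have 1: "fps_nth ?G n = c ^ Suc n" for n
      by (simp add: exponent_fps_def del: of_nat_Suc)
    have "?G * ?b = ?G - fps_const c * (?G * fps_X)" by (simp add: algebra_simps)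
    then show "fps_nth (?G * ?b) n = fps_nth (fps_const c) n"
      by (cases n) (simp_all only: fps_sub_nth fps_mult_left_const_nth fps_X_mult_right_nth 1, auto)
  qed
  have G: "?G = fps_const c * ?F"
  proof -
    have "?G = ?G * (?F * ?b)" by (simp only: inv mult_1_right)
    also have "\<dots> = ?G * ?b * ?F" by (simp only: mult_ac)
    finally show ?thesis by (simp only: \<open>?G * ?b = fps_const c\<close>)
  qed
  have "fps_deriv ?F = - fps_deriv ?b * ?F\<^sup>2" by (rule fps_inverse_deriv) simp
  also have "\<dots> = ?G * ?F" unfolding G by (simp add: power2_eq_square mult.assoc)
  finally show "fps_deriv ?F = ?G * ?F" .
qed

lemma cbell_neg_geometric:
  fixes c :: complex
  shows "Abs_fps (cbell (\<lambda>n. - (c ^ n / of_nat n))) = 1 - fps_const c * fps_X"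
proof -
  have "Abs_fps (cbell (\<lambda>n. 0)) = 1"
    using cbell_fps_unique[of 1 "\<lambda>n. 0"] by (simp add: exponent_fps_def fps_zero_def[symmetric])
  then have "Abs_fps (cbell (\<lambda>n. - (c ^ n / of_nat n))) * inverse (1 - fps_const c * fps_X) = 1"
    using cbell_add[of "\<lambda>n. - (c ^ n / of_nat n)" "\<lambda>n. c ^ n / of_nat n"] by (simp add: cbell_geometric)
  moreover have "inverse (1 - fps_const c * fps_X) * (1 - fps_const c * fps_X) = 1"
    by (rule inverse_mult_eq_1) simp
  ultimately show ?thesis by (rule fps_left_right_inverse_unique)
qed

text \<open>This is f(\<omega>/u) = f(u) at the level of Taylor coefficients; it turns the expansion
  at infinity into one at 0.\<close>

lemma A_coef_minus: "A_coef L p (-1) (int n) = omega_pow L 1 ^ n * A_coef L p 1 (int n)"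
proof -
  define P where "P = omega_pow L (p * n)"
  define W where "W = omega_pow L n"
  have nz: "P \<noteq> 0" "W \<noteq> 0" by (simp_all add: P_def W_def)
  have "A_coef L p (-1) (int n) = (P - W) * (1 - inverse P)" "A_coef L p 1 (int n) = (inverse P - inverse W) * (1 - P)"
    "omega_pow L 1 ^ n = W"
    by (simp_all add: A_coef_def P_def W_def omega_pow_power flip: omega_pow_minus)
  moreover have "(P - W) * (1 - inverse P) = W * ((inverse P - inverse W) * (1 - P))"
  proof -
    have "W * ((inverse P - inverse W) * (1 - P)) = W * inverse P - W * inverse P * P - W * inverse W + W * inverse W * P"
      by (simp add: algebra_simps)
    also have "\<dots> = W * inverse P - W - 1 + P" using nz by (simp add: mult.assoc)
    also have "\<dots> = (P - W) * (1 - inverse P)" using nz by (simp add: algebra_simps)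
    finally show ?thesis by simp
  qed
  ultimately show ?thesis by simp
qed

text \<open>By f(0) = \<omega>^p \<omega>^(1-p) / \<omega> = 1 the function is a product of four
  normalised linear factors or their inverses, so its logarithm is a sum of four logarithmic
  series.\<close>

lemma f_pair_expansion:
  "punctured_expansion (\<lambda>Z. f_pair L p (c * Z)) (Abs_fps (cbell (\<lambda>n. - (c ^ n / of_nat n) * A_coef L p 1 (int n))))"
proof -
  define P where "P = omega_pow L (complex_of_real p)"
  define Q where "Q = omega_pow L (1 - complex_of_real p)"
  define W where "W = omega_pow L 1"
  have nz: "P \<noteq> 0" "Q \<noteq> 0" "W \<noteq> 0" and PQ: "P * Q = W"
    by (simp_all add: P_def Q_def W_def omega_pow_add[symmetric])
  \<comment> \<open>Multiplying out the product that defines A_n gives one power for each zero and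
    each pole of f.\<close>
  have A: "A_coef L p 1 (int n) = inverse P ^ n - 1 - inverse W ^ n + inverse Q ^ n" for n
  proof -
    have "inverse Q = inverse W * P" using nz PQ by (simp add: field_simps)
    then have Q: "inverse Q ^ n = inverse W ^ n * P ^ n" by (simp add: power_mult_distrib)
    have "A_coef L p 1 (int n) = (inverse P ^ n - inverse W ^ n) * (1 - P ^ n)"
      by (simp add: A_coef_def P_def W_def power_inverse omega_pow_power omega_pow_minus[symmetric] mult.commute)
    also have "\<dots> = inverse P ^ n - inverse P ^ n * P ^ n - inverse W ^ n + inverse W ^ n * P ^ n"
      by (simp add: algebra_simps)
    also have "inverse P ^ n * P ^ n = 1" using nz by (simp add: power_mult_distrib[symmetric])
    finally show ?thesis by (simp only: Q)
  qed
  have "(\<lambda>n. - (c ^ n / of_nat n) * A_coef L p 1 (int n)) = (\<lambda>n. (c ^ n / of_nat n + (c / W) ^ n / of_nat n) +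
      (- ((c / P) ^ n / of_nat n) + - ((c / Q) ^ n / of_nat n)))"
    by (rule ext) (simp add: A power_divide divide_inverse power_mult_distrib power_inverse algebra_simps)
  then have F: "Abs_fps (cbell (\<lambda>n. - (c ^ n / of_nat n) * A_coef L p 1 (int n))) =
      inverse (1 - fps_const c * fps_X) * inverse (1 - fps_const (c / W) * fps_X) *
      ((1 - fps_const (c / P) * fps_X) * (1 - fps_const (c / Q) * fps_X))"
    by (simp only: cbell_add cbell_geometric cbell_neg_geometric)
  have "f_pair L p (c * Z) = inverse (1 - c * Z) * inverse (1 - c / W * Z) * ((1 - c / P * Z) * (1 - c / Q * Z))" for Z
  proof -
    have "(c * Z - P) * (c * Z - Q) = W * ((1 - c / P * Z) * (1 - c / Q * Z))"
      unfolding PQ[symmetric] using nz by (simp add: field_simps)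
    moreover have "(c * Z - 1) * (c * Z - W) = W * ((1 - c * Z) * (1 - c / W * Z))"
      using nz by (simp add: field_simps)
    ultimately have "f_pair L p (c * Z) = (W * ((1 - c / P * Z) * (1 - c / Q * Z))) / (W * ((1 - c * Z) * (1 - c / W * Z)))"
      unfolding f_pair_def P_def[symmetric] Q_def[symmetric] W_def[symmetric] by simp
    then show ?thesis using nz by (simp add: divide_inverse mult_ac)
  qed
  moreover have "(\<lambda>Z. inverse (1 - c * Z) * inverse (1 - c / W * Z) * ((1 - c / P * Z) * (1 - c / Q * Z)))
    has_fps_expansion (inverse (1 - fps_const c * fps_X) * inverse (1 - fps_const (c / W) * fps_X) *
      ((1 - fps_const (c / P) * fps_X) * (1 - fps_const (c / Q) * fps_X)))"
    by (intro fps_expansion_intros) auto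
  ultimately show ?thesis unfolding F punctured_expansion_def by auto
qed

definition scale_vop :: "complex \<Rightarrow> vop \<Rightarrow> vop" where
  "scale_vop Z vs = map (\<lambda>(s, z). (s, z / Z)) vs"

text \<open>For s < t the definition evaluates f near infinity; reflecting the argument brings it
  near 0, at the price of the factor \<omega>^n that \<open>A_coef_minus\<close> accounts
  for.\<close>

lemma pair_contr_expansion:
  assumes "z \<noteq> 0" "y \<noteq> 0"
  shows "punctured_expansion (\<lambda>Z. pair_contr L p (s, z / Z) (t, y)) (Abs_fps (cbell (\<lambda>n. pair_log L p n (s, z) (t, y))))"
proof -
  consider "s = t" | "s > t" | "s < t" by linarith
  then show ?thesis
  proof cases
    case 1
    have "Abs_fps (cbell (\<lambda>n. 0)) = 1"
      using cbell_fps_unique[of 1 "\<lambda>n. 0"] by (simp add: exponent_fps_def fps_zero_def[symmetric])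
    then show ?thesis using 1 punctured_expansion_const[of 1] by (simp add: pair_log_def)
  next
    case 2
    have "(\<lambda>n. pair_log L p n (s, z) (t, y)) = (\<lambda>n. - ((y / z) ^ n / of_nat n) * A_coef L p 1 (int n))"
      using 2 by (simp add: pair_log_def)
    then show ?thesis using f_pair_expansion[of L p "y / z"] 2 by (simp add: mult.commute)
  next
    case 3
    have "(\<lambda>n. pair_log L p n (s, z) (t, y)) = (\<lambda>n. - ((omega_pow L 1 * (y / z)) ^ n / of_nat n) * A_coef L p 1 (int n))"
      using 3 A_coef_minus[of L p] by (simp add: pair_log_def power_mult_distrib power_divide fun_eq_iff)
    moreover have "pair_contr L p (s, z / Z) (t, y) = f_pair L p (omega_pow L 1 * (y / z) * Z)" if "Z \<noteq> 0" for Z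
      using 3 f_pair_reflect[of "z / Z / y" L p] assms that by (simp add: ac_simps)
    ultimately show ?thesis
      using punctured_expansion_cong[OF _ f_pair_expansion[of L p "omega_pow L 1 * (y / z)"]] by simp
  qed
qed

lemma cbell_sum_list: "Abs_fps (cbell (\<lambda>n. \<Sum>v\<leftarrow>vs. x v n)) = (\<Prod>v\<leftarrow>vs. Abs_fps (cbell (x v)))"
proof (induction vs)
  case Nil
  show ?case using cbell_fps_unique[of 1 "\<lambda>n. 0"] by (simp add: exponent_fps_def fps_zero_def[symmetric])
next
  case (Cons v vs)
  then show ?case using cbell_add[of "x v" "\<lambda>n. \<Sum>v\<leftarrow>vs. x v n"] by simp
qed

lemma punctured_expansion_prod_list:
  "(\<And>v. v \<in> set vs \<Longrightarrow> punctured_expansion (f v) (F v)) \<Longrightarrow>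
    punctured_expansion (\<lambda>Z. \<Prod>v\<leftarrow>vs. f v Z) (\<Prod>v\<leftarrow>vs. F v)"
  using punctured_expansion_const[of 1]
  by (induction vs) (auto intro: punctured_expansion_mult)

lemma vop_contr_expansion:
  assumes "valid_vop L us" "valid_vop L vs"
  shows "punctured_expansion (\<lambda>Z. vop_contr L p (scale_vop Z us) vs) (Abs_fps (cbell (vop_log L p us vs)))"
proof -
  have nz: "snd v \<noteq> 0" if "v \<in> set us \<union> set vs" for v
    using assms that by (auto simp: valid_vop_def)
  have "vop_log L p us vs = (\<lambda>n. \<Sum>u\<leftarrow>us. \<Sum>v\<leftarrow>vs. pair_log L p n u v)"
    by (rule ext) (simp add: vop_log_def)
  then have F: "Abs_fps (cbell (vop_log L p us vs)) =
      (\<Prod>u\<leftarrow>us. \<Prod>v\<leftarrow>vs. Abs_fps (cbell (\<lambda>n. pair_log L p n u v)))"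
    by (simp only: cbell_sum_list)
  have "punctured_expansion (\<lambda>Z. \<Prod>u\<leftarrow>us. \<Prod>v\<leftarrow>vs. pair_contr L p (fst u, snd u / Z) v)
      (\<Prod>u\<leftarrow>us. \<Prod>v\<leftarrow>vs. Abs_fps (cbell (\<lambda>n. pair_log L p n u v)))"
  proof (intro punctured_expansion_prod_list)
    fix u v assume "u \<in> set us" "v \<in> set vs"
    then show "punctured_expansion (\<lambda>Z. pair_contr L p (fst u, snd u / Z) v) (Abs_fps (cbell (\<lambda>n. pair_log L p n u v)))"
      using pair_contr_expansion[of "snd u" "snd v" L p "fst u" "fst v"] nz by simp
  qed
  then show ?thesis unfolding F by (simp add: vop_contr_def scale_vop_def comp_def split_beta)
qed

lemma sum_listset_Cons:
  "(\<Sum>Ss\<in>listset (A # As). f Ss) = (\<Sum>S\<in>A. \<Sum>Ss\<in>listset As. f (S # Ss))"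
proof -
  have "listset (A # As) = (\<lambda>(S, Ss). S # Ss) ` (A \<times> listset As)"
    by (auto simp: set_Cons_def)
  then have "(\<Sum>Ss\<in>listset (A # As). f Ss) = (\<Sum>(S, Ss)\<in>A \<times> listset As. f (S # Ss))"
    by (simp add: sum.reindex inj_on_def split_beta comp_def)
  then show ?thesis by (simp add: sum.cartesian_product)
qed

lemma sum_listset_append:
  "(\<Sum>Ss\<in>listset (As @ Bs). f Ss) = (\<Sum>S1\<in>listset As. \<Sum>S2\<in>listset Bs. f (S1 @ S2))"
proof (induction As arbitrary: f)
  case (Cons A As)
  show ?case unfolding append_Cons sum_listset_Cons Cons.IH ..
qed simp

lemma self_contr_Cons: "self_contr L p (v # vs) = (\<Prod>u\<leftarrow>vs. vop_contr L p v u) * self_contr L p vs"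
proof -
  have "self_contr L p (v # vs) = (\<Prod>j<length vs. vop_contr L p v (vs ! j) * (\<Prod>i<j. vop_contr L p (vs ! i) (vs ! j)))"
    unfolding self_contr_def by (simp add: prod.lessThan_Suc_shift del: prod.lessThan_Suc)
  then show ?thesis
    by (simp add: prod.distrib self_contr_def prod.list_conv_set_nth atLeast0LessThan)
qed

lemma vop_contr_append_right: "vop_contr L p us (vs @ ws) = vop_contr L p us vs * vop_contr L p us ws"
  by (induction us) (simp_all add: vop_contr_def mult_ac)

lemma vop_contr_append_left: "vop_contr L p (us @ vs) ws = vop_contr L p us ws * vop_contr L p vs ws"
  by (simp add: vop_contr_def)

lemma vop_contr_concat_right: "vop_contr L p us (concat vss) = (\<Prod>vs\<leftarrow>vss. vop_contr L p us vs)"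
proof (induction vss)
  case Nil
  show ?case by (induction us) (simp_all add: vop_contr_def)
qed (simp add: vop_contr_append_right)

lemma self_contr_append:
  "self_contr L p (us @ vs) = self_contr L p us * self_contr L p vs * vop_contr L p (concat us) (concat vs)"
proof (induction us)
  case Nil
  show ?case by (simp add: self_contr_def vop_contr_def)
next
  case (Cons u us)
  have "(\<Prod>v\<leftarrow>vs. f v * g v) = (\<Prod>v\<leftarrow>vs. f v) * (\<Prod>v\<leftarrow>vs. g v)" for f g :: "vop \<Rightarrow> complex"
    by (induction vs) (simp_all add: mult_ac)
  with Cons show ?case
    by (simp add: self_contr_Cons vop_contr_append_left vop_contr_concat_right mult_ac)
qed

lemma vop_of_set_scale: "vop_of_set L S (y / Z) = scale_vop Z (vop_of_set L S y)"
  by (simp add: vop_of_set_def scale_vop_def)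

lemma map2_vop_of_set_scale:
  "map2 (vop_of_set L) Ss (map (\<lambda>y. y / Z) ys) = map (scale_vop Z) (map2 (vop_of_set L) Ss ys)"
  by (simp add: zip_map2 vop_of_set_scale split_beta comp_def)

lemma vop_contr_scale:
  assumes "Z \<noteq> 0"
  shows "vop_contr L p (scale_vop Z us) (scale_vop Z vs) = vop_contr L p us vs"
proof -
  have "pair_contr L p (s, z / Z) (t, y / Z) = pair_contr L p (s, z) (t, y)" for s t z y
    using assms by simp
  then have "pair_contr L p (fst u, snd u / Z) (fst v, snd v / Z) = pair_contr L p u v" for u v
    by (metis prod.collapse)
  then show ?thesis by (simp add: vop_contr_def scale_vop_def comp_def split_beta)
qed

lemma self_contr_scale:
  assumes "Z \<noteq> 0"
  shows "self_contr L p (map (scale_vop Z) vss) = self_contr L p vss"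
  unfolding self_contr_def by (intro prod.cong) (simp_all add: vop_contr_scale[OF assms])

lemma concat_scale: "concat (map (scale_vop Z) vss) = scale_vop Z (concat vss)"
  by (induction vss) (simp_all add: scale_vop_def)

lemma vop_log_scale:
  assumes "Z \<noteq> 0"
  shows "vop_log L p (scale_vop Z us) vs n = Z ^ n * vop_log L p us vs n"
proof -
  have "pair_log L p n (fst u, snd u / Z) v = Z ^ n * pair_log L p n u v" for u v
    using assms by (simp add: pair_log_def power_mult_distrib power_divide)
  then show ?thesis
    by (simp add: vop_log_def scale_vop_def sum_list_map_sum split_beta sum_distrib_left)
qed

lemma valid_scale: "Z \<noteq> 0 \<Longrightarrow> valid_vop L vs \<Longrightarrow> valid_vop L (scale_vop Z vs)"
  by (auto simp: valid_vop_def scale_vop_def)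

lemma cbell_scale: "cbell (\<lambda>n. Z ^ n * x n) d = Z ^ d * cbell x d"
proof (induction d rule: less_induct)
  case (less d)
  show ?case
  proof (cases d)
    case (Suc e)
    have "(\<Sum>i\<le>e. of_nat (Suc i) * (Z ^ Suc i * x (Suc i)) * cbell (\<lambda>n. Z ^ n * x n) (e - i)) =
       (\<Sum>i\<le>e. Z ^ Suc e * (of_nat (Suc i) * x (Suc i) * cbell x (e - i)))"
    proof (rule sum.cong[OF refl])
      fix i assume i: "i \<in> {..e}"
      then have "Z ^ Suc e = Z ^ Suc i * Z ^ (e - i)" by (simp add: power_add[symmetric])
      then show "of_nat (Suc i) * (Z ^ Suc i * x (Suc i)) * cbell (\<lambda>n. Z ^ n * x n) (e - i) =
          Z ^ Suc e * (of_nat (Suc i) * x (Suc i) * cbell x (e - i))"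
        using less.IH[of "e - i"] Suc by (simp del: of_nat_Suc power_Suc)
    qed
    then show ?thesis unfolding Suc cbell.simps(2) by (simp only: sum_distrib_left[symmetric]) simp
  qed simp
qed

text \<open>Only the types and the points occur, not the chosen subsets. Hence all terms of the
  multilinear expansion are balanced at once, as \<open>balanced_content\<close> shows.\<close>

definition config_balanced :: "nat \<Rightarrow> nat \<Rightarrow> nat list \<Rightarrow> complex list \<Rightarrow> bool" where
  "config_balanced L d ks ys \<longleftrightarrow> (\<forall>n. 1 \<le> n \<and> n \<le> d \<longrightarrow>
     (\<Sum>(k, y)\<leftarrow>zip ks ys. \<Sum>m=1..k. 1 / (y * omega_pow L ((of_nat k + 1 - 2 * of_nat m) / 2)) ^ n) = 0)"

lemma sum_list_concat_map: "(\<Sum>v\<leftarrow>concat vss. g v) = (\<Sum>vs\<leftarrow>vss. \<Sum>v\<leftarrow>vs. g v)" for g :: "_ \<Rightarrow> complex"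
  by (induction vss) simp_all

lemma balanced_content:
  assumes Ss: "Ss \<in> k_subset_lists L ks" and len: "length ys = length ks" and bal: "config_balanced L d ks ys"
  shows "balanced d (content L Ss ys)"
  unfolding balanced_def
proof (intro allI impI)
  fix n assume n: "1 \<le> n \<and> n \<le> d"
  let ?g = "\<lambda>k y. \<Sum>m=1..k. 1 / (y * omega_pow L ((of_nat k + 1 - 2 * of_nat m) / 2)) ^ n"
  have 1: "(\<Sum>v\<leftarrow>vop_of_set L S y. 1 / snd v ^ n) = ?g (card S) y" for S y
    unfolding vop_of_set_def
    by (simp add: comp_def interv_sum_list_conv_sum_set_nat atLeastLessThanSuc_atLeastAtMost del: upt_Suc)
  have "(\<Sum>v\<leftarrow>content L Ss ys. 1 / snd v ^ n) = (\<Sum>(S, y)\<leftarrow>zip Ss ys. ?g (card S) y)"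
    unfolding content_def sum_list_concat_map by (simp only: map_map comp_def case_prod_unfold 1)
  also have "\<dots> = (\<Sum>(k, y)\<leftarrow>zip ks ys. ?g k y)"
    unfolding sum_list_map_sum
    by (rule sum.cong) (use Ss len in \<open>auto simp: in_k_subset_lists\<close>)
  also have "\<dots> = 0" using bal n by (simp add: config_balanced_def)
  finally show "(\<Sum>v\<leftarrow>content L Ss ys. 1 / snd v ^ n) = 0" .
qed

text \<open>The coefficient of \<open>Z ^ d\<close> in the left vacuum acted upon by the currents \<open>ks\<close> at the points
  \<open>ys / Z\<close>, as an element of \<open>\<A>\<close>.\<close>

definition config_elem ::
  "nat \<Rightarrow> real \<Rightarrow> (nat \<Rightarrow> complex) \<Rightarrow> nat list \<Rightarrow> complex list \<Rightarrow> nat \<Rightarrow> pol" where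
  "config_elem L p a ks ys d = (\<Sum>Ss\<in>k_subset_lists L ks.
     scal (weight_factor L a Ss * self_contr L p (map2 (vop_of_set L) Ss ys)) (coherent_state L p (content L Ss ys) d))"

lemma config_elem_in_span:
  assumes "0 \<notin> set ys" "length ys = length ks" "config_balanced L d ks ys"
  shows "config_elem L p a ks ys d \<in> coherent_span L p"
  unfolding config_elem_def coherent_span_def
  by (intro pol.span_sum pol.span_scale pol.span_base)
     (use assms valid_content balanced_content in \<open>fastforce simp: coherent_states_def\<close>)

text \<open>Scaling leaves the contractions inside the cluster \<open>ys\<close> unchanged. The
  contractions between the cluster and \<open>xs\<close> expand by
  \<open>vop_contr_expansion\<close>, and the product of this series with the part contracted
  against h' has the matrix element of the coherent state as its coefficient of Z^d.\<close>

lemma config_expansion: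
  assumes L: "L > 0" and p: "p \<notin> \<rat>"
    and ys: "0 \<notin> set ys" "length ys = length ks'" "config_balanced L d ks' ys"
    and xs: "0 \<notin> set xs" "length xs = length ks" and h': "h' \<in> coherent_span L p"
  shows "\<exists>F. punctured_expansion (\<lambda>Z. J_tilde L p a 1 h' (ks' @ ks) (map (\<lambda>y. y / Z) ys @ xs)) F \<and>
    fps_nth F d = J_tilde L p a (config_elem L p a ks' ys d) h' ks xs"
proof -
  have one: "1 \<in> coherent_span L p"
    using one_in_coherent_states coherent_states_subset_span by blast
  have nz: "0 \<notin> set (map (\<lambda>y. y / Z) ys @ xs)" if "Z \<noteq> 0" for Z using ys xs that by auto
  note ce = config_elem_in_span[OF ys, of p a]
  \<comment> \<open>For a coherent h' both sides are explicit; the general case follows by linearity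
    in h'.\<close>
  have base: "\<exists>F. punctured_expansion (\<lambda>Z. J_tilde L p a 1 h' (ks' @ ks) (map (\<lambda>y. y / Z) ys @ xs)) F \<and>
    fps_nth F d = J_tilde L p a (config_elem L p a ks' ys d) h' ks xs" if h': "h' \<in> coherent_states L p" for h'
  proof -
    obtain us d' where h: "h' = coherent_state L p us d'" "valid_vop L us" "balanced d' us"
      using h' by (auto simp: coherent_states_def)
    let ?u = "vop_star L us"
    let ?w = "weight_factor L a" and ?sc = "\<lambda>Ss xs. self_contr L p (map2 (vop_of_set L) Ss xs)"
    define \<kappa> where "\<kappa> S1 S2 = vop_log L p (content L S1 ys) (content L S2 xs)" for S1 S2
    define \<mu> where "\<mu> S1 S2 j = cbell (vop_log L p (content L S1 ys) ?u) j * cbell (vop_log L p (content L S2 xs) ?u) (d' - j)"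
      for S1 S2 j
    define F where "F = (\<Sum>S1\<in>k_subset_lists L ks'. \<Sum>S2\<in>k_subset_lists L ks.
       fps_const (?w S1 * ?w S2 * (?sc S1 ys * ?sc S2 xs)) *
       (Abs_fps (cbell (\<kappa> S1 S2)) * (\<Sum>j\<le>d'. fps_const (\<mu> S1 S2 j) * fps_X ^ j)))"
    have "punctured_expansion (\<lambda>Z. \<Sum>S1\<in>k_subset_lists L ks'. \<Sum>S2\<in>k_subset_lists L ks.
       ?w S1 * ?w S2 * (?sc S1 ys * ?sc S2 xs) *
       (vop_contr L p (scale_vop Z (content L S1 ys)) (content L S2 xs) * (\<Sum>j\<le>d'. \<mu> S1 S2 j * Z ^ j))) F"
      unfolding F_def \<kappa>_def
      by (intro punctured_expansion_sum punctured_expansion_mult punctured_expansion_const punctured_expansion_power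
          vop_contr_expansion valid_content ys xs)
    moreover have "(\<Sum>S1\<in>k_subset_lists L ks'. \<Sum>S2\<in>k_subset_lists L ks.
       ?w S1 * ?w S2 * (?sc S1 ys * ?sc S2 xs) *
       (vop_contr L p (scale_vop Z (content L S1 ys)) (content L S2 xs) * (\<Sum>j\<le>d'. \<mu> S1 S2 j * Z ^ j))) =
       J_tilde L p a 1 h' (ks' @ ks) (map (\<lambda>y. y / Z) ys @ xs)" if Z: "Z \<noteq> 0" for Z
      unfolding J_tilde_eq map_append sum_listset_append
    proof (intro sum.cong refl)
      fix S1 S2 assume S: "S1 \<in> k_subset_lists L ks'" "S2 \<in> k_subset_lists L ks"
      let ?c1 = "content L S1 ys" and ?c2 = "content L S2 xs" and ?ys = "map (\<lambda>y. y / Z) ys"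
      have len: "length S1 = length ys" using S(1) ys(2) by (simp add: in_k_subset_lists)
      have m: "map2 (vop_of_set L) (S1 @ S2) (?ys @ xs) =
         map (scale_vop Z) (map2 (vop_of_set L) S1 ys) @ map2 (vop_of_set L) S2 xs"
      proof -
        have z: "zip (S1 @ S2) (?ys @ xs) = zip S1 ?ys @ zip S2 xs" using len by simp
        show ?thesis unfolding z map_append map2_vop_of_set_scale ..
      qed
      have c: "content L (S1 @ S2) (?ys @ xs) = scale_vop Z ?c1 @ ?c2"
        unfolding content_def m concat_append concat_scale ..
      have v: "valid_vop L (scale_vop Z ?c1 @ ?c2)"
        using valid_scale[OF Z valid_content[OF S(1) ys(1)]] valid_content[OF S(2) xs(1)]
        by (simp add: valid_vop_def ball_Un)
      have "normal_elem L p 1 h' (scale_vop Z ?c1 @ ?c2) = cbell (vop_log L p (scale_vop Z ?c1 @ ?c2) ?u) d'"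
        unfolding h(1) by (rule normal_elem_one[OF L p h(2,3) v])
      \<comment> \<open>Only the cluster carries Z, one power for each unit of degree, so against a
        state of degree d' the matrix element is a polynomial in Z.\<close>
      also have "vop_log L p (scale_vop Z ?c1 @ ?c2) ?u = (\<lambda>n. Z ^ n * vop_log L p ?c1 ?u n + vop_log L p ?c2 ?u n)"
        by (rule ext) (simp add: vop_log_scale[OF Z, symmetric], simp add: vop_log_def)
      also have "cbell \<dots> d' = fps_nth (Abs_fps (cbell (\<lambda>n. Z ^ n * vop_log L p ?c1 ?u n)) * Abs_fps (cbell (vop_log L p ?c2 ?u))) d'"
        by (simp only: cbell_add[symmetric]) simp
      also have "\<dots> = (\<Sum>j\<le>d'. \<mu> S1 S2 j * Z ^ j)"
        unfolding fps_mult_nth atLeast0AtMost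
        by (intro sum.cong refl) (simp add: cbell_scale \<mu>_def mult_ac)
      finally have N: "normal_elem L p 1 h' (scale_vop Z ?c1 @ ?c2) = (\<Sum>j\<le>d'. \<mu> S1 S2 j * Z ^ j)" .
      show "?w S1 * ?w S2 * (?sc S1 ys * ?sc S2 xs) *
       (vop_contr L p (scale_vop Z ?c1) ?c2 * (\<Sum>j\<le>d'. \<mu> S1 S2 j * Z ^ j)) =
        ?w (S1 @ S2) * (?sc (S1 @ S2) (?ys @ xs) * normal_elem L p 1 h' (content L (S1 @ S2) (?ys @ xs)))"
        unfolding c N m self_contr_append self_contr_scale[OF Z] concat_scale
        unfolding content_def[symmetric] by (simp add: weight_factor_def mult_ac)
    qed
    ultimately have "punctured_expansion (\<lambda>Z. J_tilde L p a 1 h' (ks' @ ks) (map (\<lambda>y. y / Z) ys @ xs)) F"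
      by (rule punctured_expansion_cong[rotated])
    moreover have "fps_nth F d = J_tilde L p a (config_elem L p a ks' ys d) h' ks xs"
    proof -
      have "fps_nth F d = (\<Sum>S1\<in>k_subset_lists L ks'. \<Sum>S2\<in>k_subset_lists L ks.
         ?w S1 * ?w S2 * (?sc S1 ys * ?sc S2 xs) * (\<Sum>j\<le>d'. if j \<le> d then cbell (\<kappa> S1 S2) (d - j) * \<mu> S1 S2 j else 0))"
        unfolding F_def fps_sum_nth fps_mult_left_const_nth
      proof (intro sum.cong refl arg_cong2[of _ _ _ _ "(*)"])
        fix S1 S2
        have "fps_nth (Abs_fps (cbell (\<kappa> S1 S2)) * (\<Sum>j\<le>d'. fps_const (\<mu> S1 S2 j) * fps_X ^ j)) d =
           (\<Sum>j\<le>d'. \<mu> S1 S2 j * fps_nth (Abs_fps (cbell (\<kappa> S1 S2)) * fps_X ^ j) d)"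
          by (simp only: sum_distrib_left fps_sum_nth mult.left_commute[of _ "fps_const _"] fps_mult_left_const_nth)
        also have "\<dots> = (\<Sum>j\<le>d'. if j \<le> d then cbell (\<kappa> S1 S2) (d - j) * \<mu> S1 S2 j else 0)"
          by (intro sum.cong refl) (simp add: fps_X_power_mult_right_nth)
        finally show "fps_nth (Abs_fps (cbell (\<kappa> S1 S2)) * (\<Sum>j\<le>d'. fps_const (\<mu> S1 S2 j) * fps_X ^ j)) d =
           (\<Sum>j\<le>d'. if j \<le> d then cbell (\<kappa> S1 S2) (d - j) * \<mu> S1 S2 j else 0)" .
      qed
      also have "\<dots> = (\<Sum>S1\<in>k_subset_lists L ks'. ?w S1 * ?sc S1 ys *
          J_tilde L p a (coherent_state L p (content L S1 ys) d) h' ks xs)"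
        unfolding J_tilde_eq
      proof (rule sum.cong[OF refl], rule trans[OF _ sum_distrib_left[symmetric]], rule sum.cong[OF refl])
        fix S1 S2 assume S: "S1 \<in> k_subset_lists L ks'" "S2 \<in> k_subset_lists L ks"
        have "normal_elem L p (coherent_state L p (content L S1 ys) d) h' (content L S2 xs) =
            coherent_value L p (content L S1 ys) d us d' (content L S2 xs)"
          unfolding h(1) by (rule normal_elem_coherent[OF L p valid_content[OF S(1) ys(1)]
                balanced_content[OF S(1) ys(2,3)] h(2,3) valid_content[OF S(2) xs(1)]])
        also have "\<dots> = (\<Sum>j\<in>{..d'} \<inter> {..d}. cbell (\<kappa> S1 S2) (d - j) * \<mu> S1 S2 j)"
          by (simp add: coherent_value_symmetric_form \<kappa>_def \<mu>_def Int_commute mult.assoc)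
        also have "\<dots> = (\<Sum>j\<le>d'. if j \<le> d then cbell (\<kappa> S1 S2) (d - j) * \<mu> S1 S2 j else 0)"
          by (subst sum.inter_restrict) (auto intro: sum.cong)
        finally show "?w S1 * ?w S2 * (?sc S1 ys * ?sc S2 xs) * (\<Sum>j\<le>d'. if j \<le> d then cbell (\<kappa> S1 S2) (d - j) * \<mu> S1 S2 j else 0) =
          ?w S1 * ?sc S1 ys * (?w S2 * (?sc S2 xs * normal_elem L p (coherent_state L p (content L S1 ys) d) h' (content L S2 xs)))"
          by (simp add: mult_ac)
      qed
      also have "\<dots> = J_tilde L p a (config_elem L p a ks' ys d) h' ks xs"
        unfolding config_elem_def
      proof (rule J_tilde_sum(1)[OF L p xs(1), symmetric])
        show "coherent_state L p (content L S1 ys) d \<in> coherent_span L p" if "S1 \<in> k_subset_lists L ks'" for S1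
          using coherent_states_subset_span valid_content[OF that ys(1)] balanced_content[OF that ys(2,3)]
          by (fastforce simp: coherent_states_def)
        show "h' \<in> coherent_span L p" using coherent_states_subset_span \<open>h' \<in> coherent_states L p\<close> by blast
      qed
      finally show ?thesis .
    qed
    ultimately show ?thesis by blast
  qed
  show ?thesis
    using h'
  proof (induction h' rule: coherent_span_induct)
    case zero
    have "punctured_expansion (\<lambda>Z. 0) 0" using punctured_expansion_const[of 0] by simp
    then show ?case by (intro exI[of _ 0]) (simp add: J_tilde_0 L p)
  next
    case (step c g h)
    obtain F G where F: "punctured_expansion (\<lambda>Z. J_tilde L p a 1 g (ks' @ ks) (map (\<lambda>y. y / Z) ys @ xs)) F"
        "fps_nth F d = J_tilde L p a (config_elem L p a ks' ys d) g ks xs"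
      and G: "punctured_expansion (\<lambda>Z. J_tilde L p a 1 h (ks' @ ks) (map (\<lambda>y. y / Z) ys @ xs)) G"
        "fps_nth G d = J_tilde L p a (config_elem L p a ks' ys d) h ks xs"
      using base[OF step(1)] step(3) by blast
    have g: "g \<in> coherent_span L p" "scal c g \<in> coherent_span L p"
      using step(1) coherent_states_subset_span coherent_span_closed(2) by blast+
    have "punctured_expansion (\<lambda>Z. J_tilde L p a 1 (scal c g + h) (ks' @ ks) (map (\<lambda>y. y / Z) ys @ xs)) (fps_const c * F + G)"
      by (rule punctured_expansion_cong[OF _ punctured_expansion_add[OF punctured_expansion_mult[OF punctured_expansion_const F(1)] G(1)]])
         (simp add: J_tilde_linear(3)[OF L p nz g(2) step(2) one] J_tilde_linear(4)[OF L p nz g(1) g(1) one])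
    moreover have "fps_nth (fps_const c * F + G) d = J_tilde L p a (config_elem L p a ks' ys d) (scal c g + h) ks xs"
      by (simp add: J_tilde_linear(3)[OF L p xs(1) g(2) step(2) ce] J_tilde_linear(4)[OF L p xs(1) g(1) g(1) ce] F G)
    ultimately show ?case by blast
  qed
qed

lemma regular_point_scaled:
  assumes ys: "regular_point L ys" and xs: "regular_point L xs" and L: "L > 0"
  shows "\<forall>\<^sub>F Z in at 0. regular_point L (map (\<lambda>y. y / Z) ys @ xs)"
proof -
  have y: "ys ! i \<noteq> 0" if "i < length ys" for i using ys that by (simp add: regular_point_def)
  have "\<forall>\<^sub>F Z in at 0. \<forall>i\<in>{..<length ys}. \<forall>j\<in>{..<length xs}. (xs ! j) ^ (2 * L) * Z ^ (2 * L) \<noteq> (ys ! i) ^ (2 * L)"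
  proof (intro eventually_ball_finite ballI finite_lessThan)
    fix i j assume i: "i \<in> {..<length ys}"
    have "((\<lambda>Z. (xs ! j) ^ (2 * L) * Z ^ (2 * L)) \<longlongrightarrow> (xs ! j) ^ (2 * L) * 0 ^ (2 * L)) (at 0)"
      by (intro tendsto_intros)
    then show "\<forall>\<^sub>F Z in at 0. (xs ! j) ^ (2 * L) * Z ^ (2 * L) \<noteq> (ys ! i) ^ (2 * L)"
      by (rule tendsto_imp_eventually_ne) (use y[of i] i L in \<open>auto simp: power_0_left\<close>)
  qed
  then show ?thesis
    using eventually_neq_at_within[of 0 0]
  proof eventually_elim
    case (elim Z)
    let ?zs = "map (\<lambda>y. y / Z) ys @ xs"
    have mixed: "(ys ! i / Z) ^ (2 * L) \<noteq> (xs ! j) ^ (2 * L)" if "i < length ys" "j < length xs" for i j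
      using elim(1)[rule_format, of i j] elim(2) that by (auto simp: power_divide divide_eq_eq)
    have yy: "(ys ! i / Z) ^ (2 * L) \<noteq> (ys ! j / Z) ^ (2 * L)" if "i < length ys" "j < length ys" "i \<noteq> j" for i j
      using ys that elim by (simp add: regular_point_def power_divide)
    show ?case
      unfolding regular_point_def
    proof (intro conjI allI impI)
      fix i assume "i < length ?zs"
      then show "?zs ! i \<noteq> 0" using ys xs elim by (auto simp: regular_point_def nth_append)
    next
      fix i j assume ij: "i < length ?zs" "j < length ?zs" "i \<noteq> j"
      have "k - length ys < length xs" if "k < length ?zs" "\<not> k < length ys" for k
        using that by (simp add: less_diff_conv2)
      note this[OF ij(1)] this[OF ij(2)]
      with ij show "?zs ! i ^ (2 * L) \<noteq> ?zs ! j ^ (2 * L)"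
        using xs yy[of i j] mixed[of i "j - length ys"] mixed[of j "i - length ys", THEN not_sym]
        by (cases "i < length ys"; cases "j < length ys") (auto simp: regular_point_def nth_append)
    qed
  qed
qed

text \<open>For Z near 0 the enlarged point is regular, so the assumed equality holds on a punctured
  neighbourhood and the coefficients of the two expansions agree. It adds a descendant on the left
  while the right one is kept.\<close>

lemma config_transfer:
  assumes L: "L > 0" and p: "p \<notin> \<rat>"
    and ys: "regular_point L ys" "length ys = length ks'" "config_balanced L d ks' ys"
    and h: "h1 \<in> coherent_span L p" "h2 \<in> coherent_span L p"
    and inv: "\<And>ks xs. regular_point L xs \<Longrightarrow> length xs = length ks \<Longrightarrow> J_tilde L p a 1 h1 ks xs = J_tilde L p b 1 h2 ks xs"
    and xs: "regular_point L xs" "length xs = length ks"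
  shows "J_tilde L p a (config_elem L p a ks' ys d) h1 ks xs = J_tilde L p b (config_elem L p b ks' ys d) h2 ks xs"
proof -
  note nz = regular_point_neq_0[OF ys(1)] regular_point_neq_0[OF xs(1)]
  obtain F where F: "punctured_expansion (\<lambda>Z. J_tilde L p a 1 h1 (ks' @ ks) (map (\<lambda>y. y / Z) ys @ xs)) F"
      "fps_nth F d = J_tilde L p a (config_elem L p a ks' ys d) h1 ks xs"
    using config_expansion[OF L p nz(1) ys(2,3) nz(2) xs(2) h(1)] by blast
  obtain G where G: "punctured_expansion (\<lambda>Z. J_tilde L p b 1 h2 (ks' @ ks) (map (\<lambda>y. y / Z) ys @ xs)) G"
      "fps_nth G d = J_tilde L p b (config_elem L p b ks' ys d) h2 ks xs"
    using config_expansion[OF L p nz(1) ys(2,3) nz(2) xs(2) h(2)] by blast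
  have "\<forall>\<^sub>F Z in at 0. J_tilde L p a 1 h1 (ks' @ ks) (map (\<lambda>y. y / Z) ys @ xs) =
      J_tilde L p b 1 h2 (ks' @ ks) (map (\<lambda>y. y / Z) ys @ xs)"
    using regular_point_scaled[OF ys(1) xs(1) L] by eventually_elim (rule inv, use ys xs in auto)
  from punctured_expansion_unique[OF F(1) G(1) this] show ?thesis using F(2) G(2) by simp
qed

lemma regular_point_inverse:
  assumes "regular_point L xs"
  shows "regular_point L (map (\<lambda>x. 1 / x) xs)"
  using assms by (auto simp: regular_point_def power_divide)

lemma wstar_wstar: "wstar L (wstar L a) = a"
  by (rule ext) (auto simp: wstar_def)

lemma J_tilde_config_invariant:
  assumes L: "L \<ge> 2" and p: "p \<notin> \<rat>" and w: "w \<in> weyl L" and a: "a \<in> hdual L"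
    and ys: "regular_point L ys" "length ys = length ks1" "config_balanced L d ks1 ys"
    and zs: "regular_point L zs" "length zs = length ks2" "config_balanced L e ks2 zs"
    and xs: "regular_point L xs" "length xs = length ks"
  shows "J_tilde L p a (config_elem L p a ks1 ys d) (config_elem L p (wstar L a) ks2 zs e) ks xs =
    J_tilde L p (w a) (config_elem L p (w a) ks1 ys d) (config_elem L p (wstar L (w a)) ks2 zs e) ks xs"
proof -
  have L0: "L > 0" using L by simp
  let ?A = "wstar L a" and ?B = "wstar L (w a)"
  have A: "?A \<in> hdual L" and wa: "w a \<in> hdual L" and B: "?B \<in> hdual L"
    using weyl_hdual[OF w a] a wstar_hdual by auto
  have one: "1 \<in> coherent_span L p"
    using one_in_coherent_states coherent_states_subset_span by blast
  have wt: "wtilde L w \<in> weyl L"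
    unfolding wtilde_def by (intro weyl_comp wstar_in_weyl w)
  have B_eq: "?B = wtilde L w ?A" by (simp add: wtilde_def wstar_wstar)
  let ?C = "\<lambda>b. config_elem L p b ks2 zs e"
  have C: "?C b \<in> coherent_span L p" for b
    by (rule config_elem_in_span[OF regular_point_neq_0[OF zs(1)] zs(2,3)])
  \<comment> \<open>The right-hand states are first treated as left-hand ones at the weight
    \<open>wstar L a\<close>, where w acts as \<open>wtilde L w\<close>.\<close>
  have 1: "J_tilde L p ?A (?C ?A) 1 ks xs = J_tilde L p ?B (?C ?B) 1 ks xs"
    if "regular_point L xs" "length xs = length ks" for ks xs
    by (rule config_transfer[OF L0 p zs one one _ that])
       (simp add: B_eq J_tilde_primary_weyl[OF L p wt A])
  \<comment> \<open>The reflection symmetry moves them to the right slot; a second transfer then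
    adds the left-hand states.\<close>
  have 2: "J_tilde L p a 1 (?C ?A) ks xs = J_tilde L p (w a) 1 (?C ?B) ks xs"
    if xs: "regular_point L xs" "length xs = length ks" for ks xs
  proof -
    let ?xs = "map (\<lambda>x. 1 / x) xs"
    have r: "regular_point L ?xs" "length ?xs = length ks" using regular_point_inverse xs by auto
    have "J_tilde L p a 1 (?C ?A) ks xs = J_tilde L p ?A (?C ?A) 1 ks ?xs"
      by (rule J_tilde_star[OF L0 p a regular_point_neq_0[OF xs(1)] xs(2) one C, symmetric])
    also have "\<dots> = J_tilde L p ?B (?C ?B) 1 ks ?xs" by (rule 1[OF r])
    also have "\<dots> = J_tilde L p (w a) 1 (?C ?B) ks xs"
      by (rule J_tilde_star[OF L0 p wa regular_point_neq_0[OF xs(1)] xs(2) one C])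
    finally show ?thesis .
  qed
  show ?thesis by (rule config_transfer[OF L0 p ys C C 2 xs])
qed

section \<open>Graded pieces\<close>

definition mono_deg :: "(nat \<times> nat \<Rightarrow>\<^sub>0 nat) \<Rightarrow> nat" where
  "mono_deg m = (\<Sum>v\<in>Poly_Mapping.keys m. Poly_Mapping.lookup m v * snd v)"

definition monom_set :: "nat \<Rightarrow> nat \<Rightarrow> (nat \<times> nat \<Rightarrow>\<^sub>0 nat) set" where
  "monom_set L d = {m. Poly_Mapping.keys m \<subseteq> {1..L-1} \<times> {1..} \<and> mono_deg m = d}"

definition mono_pol :: "(nat \<times> nat \<Rightarrow>\<^sub>0 nat) \<Rightarrow> pol" where
  "mono_pol m = Poly_Mapping.single m 1"

definition graded :: "nat \<Rightarrow> nat \<Rightarrow> pol set" where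
  "graded L d = pol.span (mono_pol ` monom_set L d)"

lemma mono_deg_superset:
  assumes "finite K" "Poly_Mapping.keys m \<subseteq> K"
  shows "mono_deg m = (\<Sum>v\<in>K. Poly_Mapping.lookup m v * snd v)"
  unfolding mono_deg_def by (rule sum.mono_neutral_left) (use assms in \<open>auto simp: in_keys_iff\<close>)

lemma mono_deg_add: "mono_deg (m + m') = mono_deg m + mono_deg m'"
proof -
  let ?K = "Poly_Mapping.keys m \<union> Poly_Mapping.keys m'"
  have "Poly_Mapping.keys (m + m') \<subseteq> ?K" by (rule keys_add)
  then show ?thesis by (simp add: mono_deg_superset[of ?K] lookup_add distrib_right sum.distrib)
qed

lemma monom_set_add: "m \<in> monom_set L d \<Longrightarrow> m' \<in> monom_set L e \<Longrightarrow> m + m' \<in> monom_set L (d + e)"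
  using keys_add[of m m'] by (auto simp: monom_set_def mono_deg_add)

lemma monom_set_0: "0 \<in> monom_set L 0"
  by (simp add: monom_set_def mono_deg_def)

lemma monom_set_single: "i \<in> {1..L-1} \<Longrightarrow> 1 \<le> n \<Longrightarrow> Poly_Mapping.single (i, n) 1 \<in> monom_set L n"
  by (simp add: monom_set_def mono_deg_def)

lemma finite_monom_set: "finite (monom_set L d)"
proof -
  let ?I = "{1..L-1} \<times> {1..d}"
  have sub: "Poly_Mapping.keys m \<subseteq> ?I \<and> (\<forall>v. Poly_Mapping.lookup m v \<le> d)" if m: "m \<in> monom_set L d" for m
  proof -
    have le: "Poly_Mapping.lookup m v * snd v \<le> d" if v: "v \<in> Poly_Mapping.keys m" for v
    proof -
      have "Poly_Mapping.lookup m v * snd v \<le> (\<Sum>v\<in>Poly_Mapping.keys m. Poly_Mapping.lookup m v * snd v)"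
        by (rule member_le_sum) (use v in auto)
      then show ?thesis using m by (simp add: monom_set_def mono_deg_def)
    qed
    have pos: "Poly_Mapping.lookup m v \<ge> 1 \<and> snd v \<ge> 1" if v: "v \<in> Poly_Mapping.keys m" for v
    proof -
      have "v \<in> {1..L-1} \<times> {1..}" using m v unfolding monom_set_def by blast
      moreover have "Poly_Mapping.lookup m v \<noteq> 0" using v by (simp add: in_keys_iff)
      ultimately show ?thesis by (cases v) auto
    qed
    have bound: "snd v \<le> d \<and> Poly_Mapping.lookup m v \<le> d" if v: "v \<in> Poly_Mapping.keys m" for v
    proof -
      have "1 * snd v \<le> Poly_Mapping.lookup m v * snd v" "Poly_Mapping.lookup m v * 1 \<le> Poly_Mapping.lookup m v * snd v"
        using pos[OF v] by (intro mult_le_mono; simp)+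
      then show ?thesis using le[OF v] by linarith
    qed
    have "v \<in> ?I" if v: "v \<in> Poly_Mapping.keys m" for v
    proof -
      have "v \<in> {1..L-1} \<times> {1..}" using m v unfolding monom_set_def by blast
      then show ?thesis using bound[OF v] by (cases v) auto
    qed
    moreover have "Poly_Mapping.lookup m v \<le> d" for v
      using bound[of v] by (cases "v \<in> Poly_Mapping.keys m") (auto simp: in_keys_iff)
    ultimately show ?thesis by blast
  qed
  have "inj_on (\<lambda>m. restrict (Poly_Mapping.lookup m) ?I) (monom_set L d)"
  proof (rule inj_onI)
    fix m m' assume mm: "m \<in> monom_set L d" "m' \<in> monom_set L d"
      and eq: "restrict (Poly_Mapping.lookup m) ?I = restrict (Poly_Mapping.lookup m') ?I"
    show "m = m'"
    proof (rule poly_mapping_eqI)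
      fix v show "Poly_Mapping.lookup m v = Poly_Mapping.lookup m' v"
      proof (cases "v \<in> ?I")
        case True
        then show ?thesis using fun_cong[OF eq, of v] unfolding restrict_def by (simp only: if_True)
      next
        case False
        then have "v \<notin> Poly_Mapping.keys m" "v \<notin> Poly_Mapping.keys m'"
          using sub[OF mm(1)] sub[OF mm(2)] by blast+
        then show ?thesis by (simp add: in_keys_iff)
      qed
    qed
  qed
  moreover have "(\<lambda>m. restrict (Poly_Mapping.lookup m) ?I) ` monom_set L d \<subseteq> PiE ?I (\<lambda>_. {..d})"
  proof (intro image_subsetI PiE_I)
    fix m v assume "m \<in> monom_set L d" "v \<in> ?I"
    then show "restrict (Poly_Mapping.lookup m) ?I v \<in> {..d}" using sub by (simp only: restrict_apply if_True atMost_iff)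
  qed (simp add: restrict_def)
  moreover have "finite (PiE ?I (\<lambda>_. {..d}))" by (rule finite_PiE) auto
  ultimately show ?thesis by (rule inj_on_finite)
qed

lemma mono_pol_mult: "mono_pol m * mono_pol m' = mono_pol (m + m')"
  by (simp add: mono_pol_def mult_single)

lemma mono_pol_0: "mono_pol 0 = 1"
  by (simp add: mono_pol_def)

lemma var_eq_mono_pol: "var v = mono_pol (Poly_Mapping.single v 1)"
  by (simp add: var_def mono_pol_def)

lemma pol_eq_sum_monos: "h = (\<Sum>m\<in>Poly_Mapping.keys h. scal (Poly_Mapping.lookup h m) (mono_pol m))"
  by (rule poly_mapping_eqI) (simp add: lookup_sum lookup_scal mono_pol_def lookup_single when_def in_keys_iff
      if_distrib[of "(*) _"] cong: if_cong)

lemma graded_mult: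
  assumes "u \<in> graded L d" "v \<in> graded L e"
  shows "u * v \<in> graded L (d + e)"
proof -
  have 1: "mono_pol m * v \<in> graded L (d + e)" if m: "m \<in> monom_set L d" for m
    using assms(2) unfolding graded_def
  proof (induction v rule: pol.span_induct_alt)
    case (step c x y)
    then have "mono_pol m * x \<in> pol.span (mono_pol ` monom_set L (d + e))"
      using monom_set_add[OF m] by (auto simp: mono_pol_mult intro: pol.span_base)
    then show ?case using step
      by (simp add: distrib_left scal_mult_right pol.span_add pol.span_scale)
  qed (simp add: pol.span_zero)
  show ?thesis
    using assms(1) unfolding graded_def
  proof (induction u rule: pol.span_induct_alt)
    case (step c x y)
    then show ?case using 1
      by (auto simp: distrib_right scal_mult_left graded_def intro: pol.span_add pol.span_scale)
  qed (simp add: pol.span_zero)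
qed

lemma graded_subspace:
  "u \<in> graded L d \<Longrightarrow> v \<in> graded L d \<Longrightarrow> u + v \<in> graded L d"
  "u \<in> graded L d \<Longrightarrow> scal c u \<in> graded L d" "0 \<in> graded L d"
  "(\<And>i. i \<in> A \<Longrightarrow> g i \<in> graded L d) \<Longrightarrow> sum g A \<in> graded L d"
  unfolding graded_def by (auto intro: pol.span_add pol.span_scale pol.span_zero pol.span_sum)

lemma var_graded: "i \<in> {1..L-1} \<Longrightarrow> 1 \<le> n \<Longrightarrow> var (i, n) \<in> graded L n"
  unfolding var_eq_mono_pol graded_def by (intro pol.span_base imageI monom_set_single)

lemma bell_graded:
  assumes "\<And>n. 1 \<le> n \<Longrightarrow> x n \<in> graded L n"
  shows "bell x d \<in> graded L d"
proof (induction d rule: less_induct)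
  case (less d)
  show ?case
  proof (cases d)
    case 0
    have "mono_pol 0 \<in> graded L 0" unfolding graded_def by (intro pol.span_base imageI monom_set_0)
    then show ?thesis using 0 by (simp add: mono_pol_0)
  next
    case (Suc e)
    have "x (Suc i) * bell x (e - i) \<in> graded L (Suc e)" if "i \<in> {..e}" for i
      using graded_mult[OF assms less.IH, of "Suc i" "e - i"] Suc that by simp
    then show ?thesis unfolding Suc bell.simps
      by (intro graded_subspace(2,4)) auto
  qed
qed

lemma coherent_state_graded: "coherent_state L p us d \<in> graded L d"
  unfolding coherent_state_def mode_elem_def
  by (intro bell_graded graded_subspace(2,4) var_graded) auto

section \<open>Products of the coefficients of exponential series\<close>

lemma of_nat_times_eq_scal: "of_nat n * u = scal (of_nat n) u" for u :: pol
  by (induction n) (simp_all add: distrib_right scal_add_left)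

definition exponent_pol_fps :: "(nat \<Rightarrow> pol) \<Rightarrow> pol fps" where
  "exponent_pol_fps x = Abs_fps (\<lambda>n. if n = 0 then 0 else x n)"

text \<open>The differential equation of \<open>cbell_fps_unique\<close> with coefficients in a
  polynomial ring; integers are cancelled through \<open>scal\<close>.\<close>

lemma bell_fps_unique:
  assumes "fps_nth F 0 = 1" "fps_deriv F = fps_deriv (exponent_pol_fps x) * F"
  shows "F = Abs_fps (bell x)"
proof -
  have "fps_nth F d = bell x d" for d
  proof (induction d rule: less_induct)
    case (less d)
    show ?case
    proof (cases d)
      case (Suc e)
      have "scal (of_nat (Suc e)) (fps_nth F (Suc e)) = fps_nth (fps_deriv F) e"
        by (simp add: of_nat_times_eq_scal[symmetric] del: of_nat_Suc)
      also have "\<dots> = (\<Sum>i\<le>e. scal (of_nat (Suc i)) (x (Suc i) * fps_nth F (e - i)))"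
        unfolding assms(2) fps_mult_nth
        by (simp add: exponent_pol_fps_def atLeast0AtMost of_nat_times_eq_scal[symmetric] mult.assoc del: of_nat_Suc)
      also have "\<dots> = (\<Sum>i\<le>e. scal (of_nat (Suc i)) (x (Suc i) * bell x (e - i)))"
        by (intro sum.cong refl) (use less Suc in auto)
      also have "\<dots> = scal (of_nat (Suc e)) (bell x (Suc e))"
        by (simp add: scal_scal del: of_nat_Suc)
      finally show ?thesis unfolding Suc by (rule scal_cancel) (simp del: of_nat_Suc)
    qed (use assms in simp)
  qed
  then show ?thesis by (simp add: fps_eq_iff)
qed

lemma fps_deriv_bell: "fps_deriv (Abs_fps (bell x)) = fps_deriv (exponent_pol_fps x) * Abs_fps (bell x)"
proof (rule fps_ext)
  fix e
  have "scal (of_nat (Suc e)) (bell x (Suc e)) = (\<Sum>i\<le>e. scal (of_nat (Suc i)) (x (Suc i) * bell x (e - i)))"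
    by (simp add: scal_scal del: of_nat_Suc)
  then show "fps_nth (fps_deriv (Abs_fps (bell x))) e = fps_nth (fps_deriv (exponent_pol_fps x) * Abs_fps (bell x)) e"
    by (simp add: fps_mult_nth exponent_pol_fps_def atLeast0AtMost of_nat_times_eq_scal[symmetric] mult.assoc
        del: bell.simps of_nat_Suc)
qed

lemma bell_add: "bell (\<lambda>n. x n + y n) d = (\<Sum>i\<le>d. bell x i * bell y (d - i))"
proof -
  have "Abs_fps (bell x) * Abs_fps (bell y) = Abs_fps (bell (\<lambda>n. x n + y n))"
  proof (rule bell_fps_unique)
    have "exponent_pol_fps (\<lambda>n. x n + y n) = exponent_pol_fps x + exponent_pol_fps y"
      by (rule fps_ext) (simp add: exponent_pol_fps_def)
    then show "fps_deriv (Abs_fps (bell x) * Abs_fps (bell y)) =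
        fps_deriv (exponent_pol_fps (\<lambda>n. x n + y n)) * (Abs_fps (bell x) * Abs_fps (bell y))"
      by (simp add: fps_deriv_bell algebra_simps)
  qed simp
  from arg_cong[OF this, of "\<lambda>F. fps_nth F d"] show ?thesis
    by (simp add: fps_mult_nth atLeast0AtMost)
qed

lemma bell_scale: "bell (\<lambda>n. scal (t ^ n) (x n)) d = scal (t ^ d) (bell x d)"
proof (induction d rule: less_induct)
  case (less d)
  show ?case
  proof (cases d)
    case (Suc e)
    have "(\<Sum>i\<le>e. scal (of_nat (Suc i)) (scal (t ^ Suc i) (x (Suc i)) * bell (\<lambda>n. scal (t ^ n) (x n)) (e - i))) =
       (\<Sum>i\<le>e. scal (t ^ Suc e) (scal (of_nat (Suc i)) (x (Suc i) * bell x (e - i))))"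
    proof (rule sum.cong[OF refl])
      fix i assume i: "i \<in> {..e}"
      then have t: "t ^ Suc e = t ^ Suc i * t ^ (e - i)" by (simp add: power_add[symmetric])
      have "bell (\<lambda>n. scal (t ^ n) (x n)) (e - i) = scal (t ^ (e - i)) (bell x (e - i))"
        using less.IH[of "e - i"] Suc by simp
      then show "scal (of_nat (Suc i)) (scal (t ^ Suc i) (x (Suc i)) * bell (\<lambda>n. scal (t ^ n) (x n)) (e - i)) =
          scal (t ^ Suc e) (scal (of_nat (Suc i)) (x (Suc i) * bell x (e - i)))"
        unfolding t by (simp add: scal_mult_left scal_mult_right scal_scal mult_ac del: of_nat_Suc power_Suc)
    qed
    also have "\<dots> = scal (t ^ Suc e) (\<Sum>i\<le>e. scal (of_nat (Suc i)) (x (Suc i) * bell x (e - i)))"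
      by (simp only: scal_sum)
    finally show ?thesis unfolding Suc bell.simps(2) by (simp only: scal_scal mult.commute)
  qed simp
qed

text \<open>A Vandermonde argument by divided differences: a vector-valued polynomial with
  infinitely many values in a subspace has all its coefficients there.\<close>

lemma span_coeff_extract:
  fixes v :: "nat \<Rightarrow> pol"
  assumes "infinite T" "\<And>t. t \<in> T \<Longrightarrow> (\<Sum>i\<le>n. scal (t ^ i) (v i)) \<in> pol.span S" "i \<le> n"
  shows "v i \<in> pol.span S"
  using assms
proof (induction n arbitrary: v T i)
  case 0
  then obtain t where "t \<in> T" by (metis ex_in_conv finite.emptyI)
  then show ?case using 0 by fastforce
next
  case (Suc n)
  obtain t0 where t0: "t0 \<in> T" using Suc.prems(1) by (metis ex_in_conv finite.emptyI)
  \<comment> \<open>The coefficients of the quotient of v(t) - v(t0) by t - t0, a polynomial of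
    degree one less.\<close>
  define w where "w j = (\<Sum>i\<in>{j<..Suc n}. scal (t0 ^ (i - Suc j)) (v i))" for j
  have w_in: "w j \<in> pol.span S" if "j \<le> n" for j
  proof (rule Suc.IH[OF _ _ that])
    show "infinite (T - {t0})" using Suc.prems(1) by simp
    fix t assume t: "t \<in> T - {t0}"
    have "(\<Sum>i\<le>Suc n. scal (t ^ i) (v i)) - (\<Sum>i\<le>Suc n. scal (t0 ^ i) (v i)) \<in> pol.span S"
      by (intro pol.span_diff Suc.prems(2)) (use t t0 in auto)
    also have "(\<Sum>i\<le>Suc n. scal (t ^ i) (v i)) - (\<Sum>i\<le>Suc n. scal (t0 ^ i) (v i)) =
        (\<Sum>i\<le>Suc n. scal (t ^ i - t0 ^ i) (v i))"
      by (simp add: sum_subtractf pol.scale_left_diff_distrib)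
    also have "\<dots> = (\<Sum>i\<le>Suc n. \<Sum>j<i. scal ((t - t0) * (t0 ^ (i - Suc j) * t ^ j)) (v i))"
      by (intro sum.cong refl) (simp only: power_diff_sumr2 sum_distrib_left pol.scale_sum_left)
    also have "\<dots> = scal (t - t0) (\<Sum>i\<le>Suc n. \<Sum>j<i. scal (t ^ j) (scal (t0 ^ (i - Suc j)) (v i)))"
      by (simp only: scal_sum scal_scal mult_ac)
    also have "(\<Sum>i\<le>Suc n. \<Sum>j<i. scal (t ^ j) (scal (t0 ^ (i - Suc j)) (v i))) = (\<Sum>j\<le>n. scal (t ^ j) (w j))"
      unfolding w_def scal_sum by (subst (1 2) sum.Sigma)
        (auto intro!: sum.reindex_bij_witness[of _ "\<lambda>(a, b). (b, a)" "\<lambda>(a, b). (b, a)"])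
    finally have "scal (1 / (t - t0)) (scal (t - t0) (\<Sum>j\<le>n. scal (t ^ j) (w j))) \<in> pol.span S"
      by (rule pol.span_scale)
    then show "(\<Sum>j\<le>n. scal (t ^ j) (w j)) \<in> pol.span S" using t by (simp add: scal_scal)
  qed
  have wS: "w (Suc n) = 0" by (simp add: w_def)
  have v_Suc: "v (Suc j) \<in> pol.span S" if j: "j \<le> n" for j
  proof -
    have "{j<..Suc n} = insert (Suc j) {Suc j<..Suc n}" using j by auto
    then have "w j = v (Suc j) + (\<Sum>i\<in>{Suc j<..Suc n}. scal (t0 ^ (i - Suc j)) (v i))"
      by (simp add: w_def)
    also have "(\<Sum>i\<in>{Suc j<..Suc n}. scal (t0 ^ (i - Suc j)) (v i)) = scal t0 (w (Suc j))"
      unfolding w_def scal_sum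
    proof (rule sum.cong[OF refl])
      fix i assume "i \<in> {Suc j<..Suc n}"
      then have "i - Suc j = Suc (i - Suc (Suc j))" by auto
      then show "scal (t0 ^ (i - Suc j)) (v i) = scal t0 (scal (t0 ^ (i - Suc (Suc j))) (v i))"
        by (simp add: scal_scal)
    qed
    finally have "v (Suc j) = w j - scal t0 (w (Suc j))" by simp
    moreover have "w (Suc j) \<in> pol.span S"
      using w_in[of "Suc j"] wS j by (cases "j = n") (auto simp: pol.span_zero)
    ultimately show ?thesis using w_in[OF j] by (simp add: pol.span_diff pol.span_scale)
  qed
  show ?case
  proof (cases i)
    case (Suc j) then show ?thesis using v_Suc Suc.prems(3) by simp
  next
    case 0
    have "(\<Sum>i\<le>Suc n. scal (t0 ^ i) (v i)) = v 0 + (\<Sum>i\<le>n. scal (t0 ^ Suc i) (v (Suc i)))"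
      by (subst sum.atMost_Suc_shift) simp
    then have "v 0 = (\<Sum>i\<le>Suc n. scal (t0 ^ i) (v i)) - (\<Sum>i\<le>n. scal (t0 ^ Suc i) (v (Suc i)))" by simp
    also have "\<dots> \<in> pol.span S"
      by (intro pol.span_diff Suc.prems(2)[OF t0] pol.span_sum pol.span_scale v_Suc) auto
    finally show ?thesis using 0 by simp
  qed
qed

section \<open>Balanced configurations spanning the graded pieces\<close>

text \<open>A compound of type \<open>k\<close> at \<open>z\<close> consists of the current \<open>k\<close>, whose content in the dominant term
  \<open>{1..k}\<close> of the current is cancelled by currents \<open>k - 1\<close> at roots of unity up to one
  \<open>\<lambda>\<^sub>k(z)\<close>, which in turn is balanced by currents \<open>1\<close> at roots of unity.  The two orders are coprime
  to each other and to \<open>2 * L\<close>, which keeps all points in regular position.\<close>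

definition ord1 :: "nat \<Rightarrow> nat \<Rightarrow> nat" where "ord1 L d = 2 * L * (d + 1) + 1"
definition ord2 :: "nat \<Rightarrow> nat \<Rightarrow> nat" where "ord2 L d = 2 * L * (d + 2) + 1"

definition comp_ks :: "nat \<Rightarrow> nat \<Rightarrow> nat \<Rightarrow> nat list" where
  "comp_ks L d k = k # map (\<lambda>_. k - 1) [1..<ord1 L d] @ map (\<lambda>_. 1) [1..<ord2 L d]"

text \<open>The half-integer shifts align the arguments: in the term {1..k} the index m of the
  current k sits at z \<omega>^(k-m), so index k sits at z itself, and in the currents k - 1 it sits
  at the same place times a root of unity. The root 1 is omitted, so the power sums of the remaining
  roots are -1 and cancel what stands at z.\<close>

definition comp_ys :: "nat \<Rightarrow> nat \<Rightarrow> nat \<Rightarrow> complex \<Rightarrow> complex list" where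
  "comp_ys L d k z = z * omega_pow L (of_nat (k - 1) / 2) #
     map (\<lambda>j. z * omega_pow L (of_nat k / 2) * omega_pow (ord1 L d) (of_nat j)) [1..<ord1 L d] @
     map (\<lambda>j. z * omega_pow (ord2 L d) (of_nat j)) [1..<ord2 L d]"

definition config_ks :: "nat \<Rightarrow> nat \<Rightarrow> (nat \<times> complex) list \<Rightarrow> nat list" where
  "config_ks L d C = concat (map (\<lambda>(k, z). comp_ks L d k) C)"

definition config_ys :: "nat \<Rightarrow> nat \<Rightarrow> (nat \<times> complex) list \<Rightarrow> complex list" where
  "config_ys L d C = concat (map (\<lambda>(k, z). comp_ys L d k z) C)"

lemma length_comp: "length (comp_ys L d k z) = length (comp_ks L d k)"
  by (simp add: comp_ys_def comp_ks_def)

lemma length_config: "length (config_ys L d C) = length (config_ks L d C)"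
  by (induction C) (simp_all add: config_ys_def config_ks_def split_beta length_comp)

definition dominant_sum :: "(nat \<Rightarrow> complex \<Rightarrow> complex) \<Rightarrow> nat \<Rightarrow> nat list \<Rightarrow> complex list \<Rightarrow> complex" where
  "dominant_sum g L ks ys = (\<Sum>(k, y)\<leftarrow>zip ks ys.
     \<Sum>m=1..k. g m (y * omega_pow L ((of_nat k + 1 - 2 * of_nat m) / 2)))"

lemma dominant_sum_append:
  "length ks = length ys \<Longrightarrow> dominant_sum g L (ks @ ks') (ys @ ys') = dominant_sum g L ks ys + dominant_sum g L ks' ys'"
  by (simp add: dominant_sum_def)

lemma dominant_sum_config:
  "dominant_sum g L (config_ks L d C) (config_ys L d C) = (\<Sum>(k, z)\<leftarrow>C. dominant_sum g L (comp_ks L d k) (comp_ys L d k z))"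
proof (induction C)
  case Nil
  show ?case by (simp add: dominant_sum_def config_ks_def config_ys_def)
next
  case (Cons c C)
  then show ?case
    by (cases c) (simp add: config_ks_def config_ys_def dominant_sum_append length_comp)
qed

lemma sum_powers_root_of_unity:
  assumes n: "1 \<le> n" "n < N"
  shows "(\<Sum>j=1..<N. 1 / omega_pow N (of_nat j) ^ n) = -1"
proof -
  define \<rho> where "\<rho> = omega_pow N (- of_nat n)"
  have N: "N > 0" using n by simp
  have "omega_pow N (of_real (- real n)) \<noteq> 1"
  proof
    assume "omega_pow N (of_real (- real n)) = 1"
    then obtain k :: int where "- real n = of_int k * of_nat N" using omega_pow_eq_1_iff[OF N] by blast
    then have "- int n = k * int N" by (metis of_int_eq_iff of_int_minus of_int_mult of_int_of_nat_eq)
    then have "int N dvd int n" by (metis dvd_minus_iff dvd_triv_right)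
    then show False using n by (simp add: nat_dvd_not_less)
  qed
  then have 1: "\<rho> \<noteq> 1" by (simp add: \<rho>_def)
  have "omega_pow N (of_real (- (real n * real N))) = 1"
    unfolding omega_pow_eq_1_iff[OF N] by (rule exI[of _ "- int n"]) simp
  then have 2: "\<rho> ^ N = 1" by (simp add: \<rho>_def omega_pow_power mult.commute)
  have "(\<Sum>j<N. \<rho> ^ j) = (1 - \<rho> ^ N) / (1 - \<rho>)" using 1 by (simp add: sum_gp_strict)
  then have "(\<Sum>j<N. \<rho> ^ j) = 0" using 2 by simp
  moreover have "{..<N} = insert 0 {1..<N}" using N by auto
  ultimately have "(\<Sum>j=1..<N. \<rho> ^ j) = -1" by (simp add: eq_neg_iff_add_eq_0 add.commute)
  moreover have "1 / omega_pow N (of_nat j) ^ n = \<rho> ^ j" for j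
    by (simp add: \<rho>_def omega_pow_minus inverse_eq_divide power_one_over omega_pow_power mult.commute)
  ultimately show ?thesis by simp
qed

text \<open>Both orders exceed d, hence the power sums over the nontrivial roots of unity are -1 in
  all degrees concerned. For constant c the result is 0, which is the balance of the compound; for c
  = 1 up to i it measures what remains in the coordinate i.\<close>

lemma dominant_sum_comp:
  assumes k: "2 \<le> k" and n: "1 \<le> n" "n \<le> d" and L: "L > 0"
  shows "dominant_sum (\<lambda>m u. c m / u ^ n) L (comp_ks L d k) (comp_ys L d k z) = (c k - c 1) / z ^ n"
proof -
  have o1: "n < ord1 L d" and o2: "n < ord2 L d"
  proof -
    have "1 * d \<le> 2 * L * d" by (rule mult_le_mono1) (use L in simp)
    moreover have "ord1 L d = 2 * L * d + 2 * L + 1" "ord2 L d = 2 * L * d + 4 * L + 1"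
      by (simp_all add: ord1_def ord2_def distrib_left)
    ultimately show "n < ord1 L d" "n < ord2 L d" using n by linarith+
  qed
  let ?u = "\<lambda>m. omega_pow L (of_nat k - of_nat m)"
  have e1: "z * omega_pow L (of_nat (k - 1) / 2) * omega_pow L ((of_nat k + 1 - 2 * of_nat m) / 2) = z * ?u m" for m
  proof -
    have "of_nat (k - 1) / 2 + (of_nat k + 1 - 2 * of_nat m) / 2 = (of_nat k - of_nat m :: complex)"
      using k by (simp add: of_nat_diff field_simps)
    then show ?thesis by (simp add: mult.assoc omega_pow_add[symmetric])
  qed
  have e2: "z * omega_pow L (of_nat k / 2) * w * omega_pow L ((of_nat (k - 1) + 1 - 2 * of_nat m) / 2) = z * w * ?u m" for m w
  proof -
    have "of_nat k / 2 + (of_nat (k - 1) + 1 - 2 * of_nat m) / 2 = (of_nat k - of_nat m :: complex)"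
      using k by (simp add: of_nat_diff field_simps)
    then have "omega_pow L (of_nat k / 2) * omega_pow L ((of_nat (k - 1) + 1 - 2 * of_nat m) / 2) = ?u m"
      by (simp only: omega_pow_add[symmetric])
    then show ?thesis by (simp add: mult_ac)
  qed
  have e3: "z * w * omega_pow L ((of_nat 1 + 1 - 2 * of_nat 1) / 2) = z * w" for w by simp
  let ?g = "\<lambda>m u. c m / u ^ n"
  have "dominant_sum ?g L (comp_ks L d k) (comp_ys L d k z) =
     (\<Sum>m=1..k. ?g m (z * ?u m)) +
     (\<Sum>j=1..<ord1 L d. \<Sum>m=1..k-1. ?g m (z * omega_pow (ord1 L d) (of_nat j) * ?u m)) +
     (\<Sum>j=1..<ord2 L d. ?g 1 (z * omega_pow (ord2 L d) (of_nat j)))"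
  proof -
    have z: "zip (map f [a..<b]) (map h [a..<b]) = map (\<lambda>j. (f j, h j)) [a..<b]"
      for f :: "nat \<Rightarrow> nat" and h :: "nat \<Rightarrow> complex" and a b
      by (simp add: zip_map_map zip_same_conv_map)
    show ?thesis
      unfolding dominant_sum_def comp_ks_def comp_ys_def
      by (simp only: zip_Cons_Cons zip_append length_map z list.map sum_list.Cons map_append sum_list_append
          map_map comp_def prod.case e1 e2 e3 interv_sum_list_conv_sum_set_nat atLeastAtMost_singleton
          sum.insert sum.empty finite.emptyI empty_iff set_upt add.assoc) simp
  qed
  also have "(\<Sum>j=1..<ord1 L d. \<Sum>m=1..k-1. ?g m (z * omega_pow (ord1 L d) (of_nat j) * ?u m)) =
     (\<Sum>j=1..<ord1 L d. 1 / omega_pow (ord1 L d) (of_nat j) ^ n) * (\<Sum>m=1..k-1. ?g m (z * ?u m))"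
    unfolding sum_product by (intro sum.cong refl) (simp add: power_mult_distrib mult_ac)
  also have "\<dots> = - (\<Sum>m=1..k-1. ?g m (z * ?u m))"
    unfolding sum_powers_root_of_unity[OF n(1) o1] by simp
  also have "(\<Sum>j=1..<ord2 L d. ?g 1 (z * omega_pow (ord2 L d) (of_nat j))) =
     (\<Sum>j=1..<ord2 L d. 1 / omega_pow (ord2 L d) (of_nat j) ^ n) * (c 1 / z ^ n)"
    unfolding sum_distrib_right by (intro sum.cong refl) (simp add: power_mult_distrib)
  also have "\<dots> = - (c 1 / z ^ n)"
    unfolding sum_powers_root_of_unity[OF n(1) o2] by simp
  also have "(\<Sum>m=1..k. ?g m (z * ?u m)) = (\<Sum>m=1..k-1. ?g m (z * ?u m)) + c k / z ^ n"
    using k sum.cl_ivl_Suc[of "\<lambda>m. ?g m (z * ?u m)" 1 "k - 1"] by simp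
  finally show ?thesis by (simp add: diff_divide_distrib)
qed

definition good_config :: "nat \<Rightarrow> (nat \<times> complex) list \<Rightarrow> bool" where
  "good_config L C \<longleftrightarrow> (\<forall>(k, z)\<in>set C. k \<in> {2..L} \<and> z \<noteq> 0) \<and> distinct (map (\<lambda>(k, z). norm z) C)"

lemma config_balanced_config:
  assumes "good_config L C" "L > 0"
  shows "config_balanced L d (config_ks L d C) (config_ys L d C)"
  unfolding config_balanced_def
proof (intro allI impI)
  fix n assume n: "1 \<le> n \<and> n \<le> d"
  have "dominant_sum (\<lambda>m u. 1 / u ^ n) L (config_ks L d C) (config_ys L d C) = (\<Sum>(k, z)\<leftarrow>C. 0)"
    unfolding dominant_sum_config
    by (rule arg_cong[of _ _ sum_list], rule map_cong[OF refl])
       (use assms n dominant_sum_comp[of _ n d L "\<lambda>_. 1"] in \<open>auto simp: good_config_def\<close>)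
  also have "\<dots> = 0" by (simp add: sum_list_map_sum split_beta)
  finally show "(\<Sum>(k, y)\<leftarrow>zip (config_ks L d C) (config_ys L d C).
      \<Sum>m=1..k. 1 / (y * omega_pow L ((of_nat k + 1 - 2 * of_nat m) / 2)) ^ n) = 0"
    by (simp add: dominant_sum_def)
qed

definition dominant_content :: "nat \<Rightarrow> nat list \<Rightarrow> complex list \<Rightarrow> vop" where
  "dominant_content L ks ys = content L (map (\<lambda>k. {1..k}) ks) ys"

lemma sum_dominant_content:
  assumes "length ks = length ys"
  shows "(\<Sum>v\<leftarrow>dominant_content L ks ys. g (fst v) (snd v)) = dominant_sum g L ks ys"
proof -
  have 1: "(\<Sum>v\<leftarrow>vop_of_set L {1..k} y. g (fst v) (snd v)) =
      (\<Sum>m=1..k. g m (y * omega_pow L ((of_nat k + 1 - 2 * of_nat m) / 2)))" for k y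
  proof -
    have s: "sorted_list_of_set {1..k} ! (m - 1) = m" if "m \<in> {1..k}" for m
    proof -
      have "{1..k} = {1..<Suc k}" by auto
      then show ?thesis using that by (auto simp del: upt_Suc)
    qed
    have "(\<Sum>v\<leftarrow>vop_of_set L {1..k} y. g (fst v) (snd v)) =
      (\<Sum>m=1..k. g (sorted_list_of_set {1..k} ! (m - 1)) (y * omega_pow L ((of_nat k + 1 - 2 * of_nat m) / 2)))"
      unfolding vop_of_set_def
      by (simp add: comp_def interv_sum_list_conv_sum_set_nat atLeastLessThanSuc_atLeastAtMost del: upt_Suc)
    also have "\<dots> = (\<Sum>m=1..k. g m (y * omega_pow L ((of_nat k + 1 - 2 * of_nat m) / 2)))"
      by (rule sum.cong[OF refl]) (simp only: s)
    finally show ?thesis .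
  qed
  have "(\<Sum>v\<leftarrow>dominant_content L ks ys. g (fst v) (snd v)) =
      (\<Sum>(k, y)\<leftarrow>zip ks ys. \<Sum>v\<leftarrow>vop_of_set L {1..k} y. g (fst v) (snd v))"
    unfolding dominant_content_def content_def sum_list_concat_map zip_map1 map_map
    by (rule arg_cong[of _ _ sum_list], rule map_cong[OF refl]) (simp add: split_beta)
  then show ?thesis unfolding dominant_sum_def 1 .
qed

text \<open>The contribution of a compound of type k at z = 1: the difference of the indicators of k
  and of 1 in {1..i} is -1 for i < k and 0 otherwise.\<close>

definition basic_mode :: "nat \<Rightarrow> real \<Rightarrow> nat \<Rightarrow> nat \<Rightarrow> pol" where
  "basic_mode L p k n = (\<Sum>i=1..<k. scal (- 1 / (of_nat n * pi_coef L p i n)) (var (i, n)))"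

lemma mode_elem_config:
  assumes C: "good_config L C" and n: "1 \<le> n" "n \<le> d" and L: "L > 0"
  shows "mode_elem L p (dominant_content L (config_ks L d C) (config_ys L d C)) n =
    (\<Sum>(k, z)\<leftarrow>C. scal ((1 / z) ^ n) (basic_mode L p k n))"
proof -
  define q where "q i c = (case c of (k, z) \<Rightarrow> if i < k then - ((1 / z) ^ n / of_nat n) else 0)"
    for i :: nat and c :: "nat \<times> complex"
  have coeff: "(\<Sum>v\<leftarrow>dominant_content L (config_ks L d C) (config_ys L d C). if fst v \<le> i then power_term n v else 0) =
      (\<Sum>c\<leftarrow>C. q i c)" if i: "1 \<le> i" for i
  proof -
    have "(\<Sum>v\<leftarrow>dominant_content L (config_ks L d C) (config_ys L d C). if fst v \<le> i then power_term n v else 0) =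
      (\<Sum>v\<leftarrow>dominant_content L (config_ks L d C) (config_ys L d C).
        (\<lambda>m u. (if m \<le> i then 1 / of_nat n else 0) / u ^ n) (fst v) (snd v))"
      by (rule arg_cong[of _ _ sum_list], rule map_cong[OF refl]) (simp add: power_term_def mult.commute)
    also have "\<dots> = (\<Sum>(k, z)\<leftarrow>C. dominant_sum (\<lambda>m u. (if m \<le> i then 1 / of_nat n else 0) / u ^ n) L (comp_ks L d k) (comp_ys L d k z))"
      by (subst sum_dominant_content) (simp_all add: length_config dominant_sum_config)
    also have "\<dots> = (\<Sum>c\<leftarrow>C. q i c)"
    proof (rule arg_cong[of _ _ sum_list], rule map_cong[OF refl])
      fix c assume "c \<in> set C"
      moreover obtain k z where kz: "c = (k, z)" by (cases c)
      ultimately have c: "c = (k, z)" "(k, z) \<in> set C" by simp_all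
      then have "2 \<le> k" using C by (auto simp: good_config_def)
      note comp = dominant_sum_comp[OF this n L, where c = "\<lambda>m. if m \<le> i then 1 / of_nat n else 0" and z = z]
      have "dominant_sum (\<lambda>m u. (if m \<le> i then 1 / of_nat n else 0) / u ^ n) L (comp_ks L d k) (comp_ys L d k z) = q i (k, z)"
        unfolding comp using i by (auto simp: power_divide q_def)
      then show "(case c of (k, z) \<Rightarrow> dominant_sum (\<lambda>m u. (if m \<le> i then 1 / of_nat n else 0) / u ^ n) L (comp_ks L d k) (comp_ys L d k z)) = q i c"
        by (simp only: c prod.case)
    qed
    finally show ?thesis .
  qed
  have b: "basic_mode L p k n = (\<Sum>i=1..L-1. scal (if i < k then - 1 / (of_nat n * pi_coef L p i n) else 0) (var (i, n)))"
    if "(k, z) \<in> set C" for k z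
  proof -
    have "k \<le> L" using C that by (auto simp: good_config_def)
    then show ?thesis unfolding basic_mode_def
      by (intro sum.mono_neutral_cong_left) auto
  qed
  have "mode_elem L p (dominant_content L (config_ks L d C) (config_ys L d C)) n =
     (\<Sum>i=1..L-1. scal (\<Sum>j<length C. q i (C ! j) / pi_coef L p i n) (var (i, n)))"
    unfolding mode_elem_def
  proof (intro sum.cong refl arg_cong2[of _ _ _ _ scal])
    fix i assume "i \<in> {1..L-1}"
    then have "1 \<le> i" by simp
    from coeff[OF this]
    show "(\<Sum>v\<leftarrow>dominant_content L (config_ks L d C) (config_ys L d C). if fst v \<le> i then power_term n v else 0) / pi_coef L p i n =
        (\<Sum>j<length C. q i (C ! j) / pi_coef L p i n)"
      by (simp only: sum_list_map_sum[of _ C] sum_divide_distrib)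
  qed
  also have "\<dots> = (\<Sum>j<length C. \<Sum>i=1..L-1. scal (q i (C ! j) / pi_coef L p i n) (var (i, n)))"
    unfolding pol.scale_sum_left by (rule sum.swap)
  also have "\<dots> = (\<Sum>j<length C. case C ! j of (k, z) \<Rightarrow> scal ((1 / z) ^ n) (basic_mode L p k n))"
  proof (rule sum.cong[OF refl])
    fix j assume "j \<in> {..<length C}"
    then have j: "C ! j \<in> set C" by simp
    obtain k z where kz: "C ! j = (k, z)" by (cases "C ! j")
    show "(\<Sum>i=1..L-1. scal (q i (C ! j) / pi_coef L p i n) (var (i, n))) =
       (case C ! j of (k, z) \<Rightarrow> scal ((1 / z) ^ n) (basic_mode L p k n))"
      unfolding kz prod.case q_def b[OF j[unfolded kz]] scal_sum scal_scal
      by (intro sum.cong refl arg_cong2[of _ _ _ _ scal]) auto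
  qed
  finally show ?thesis by (simp add: sum_list_map_sum)
qed

text \<open>Applied to 2L-th powers of points with q = \<open>twist L p\<close>. Distinctness avoids
  the poles of f, the condition on q avoids its zeros.\<close>

definition spread :: "complex \<Rightarrow> complex list \<Rightarrow> bool" where
  "spread q ws \<longleftrightarrow> distinct ws \<and> 0 \<notin> set ws \<and> (\<forall>w\<in>set ws. \<forall>w'\<in>set ws. w \<noteq> q * w')"

lemma spread_append:
  assumes "spread q us" "spread q vs" "norm q = 1"
    and "\<And>u v. u \<in> set us \<Longrightarrow> v \<in> set vs \<Longrightarrow> norm u \<noteq> norm v"
  shows "spread q (us @ vs)"
proof -
  have n: "norm (q * v) = norm v" for v by (simp add: norm_mult assms(3))
  have d: "u \<noteq> q * v" "v \<noteq> q * u" "u \<noteq> v" if "u \<in> set us" "v \<in> set vs" for u v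
    using assms(4)[OF that] n[of u] n[of v] by auto
  have "set us \<inter> set vs = {}" using d(3) by auto
  moreover have "\<forall>w\<in>set (us @ vs). \<forall>w'\<in>set (us @ vs). w \<noteq> q * w'"
    using assms(1,2) d(1,2) unfolding spread_def set_append by blast
  ultimately show ?thesis using assms(1,2) by (simp add: spread_def)
qed

text \<open>The 2L-th powers of the points of a compound, divided by that of z, are 2L-th powers of
  roots of unity of order ord1 * ord2; these are their exponents.\<close>

definition comp_exps :: "nat \<Rightarrow> nat \<Rightarrow> nat list" where
  "comp_exps L d = 0 # map (\<lambda>j. ord2 L d * j) [1..<ord1 L d] @ map (\<lambda>j. ord1 L d * j) [1..<ord2 L d]"

lemma ord_pos: "L > 0 \<Longrightarrow> ord1 L d > 1 \<and> ord2 L d > 1"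
  by (simp add: ord1_def ord2_def)

text \<open>Both orders are 1 modulo 2L and they differ by 2L, so a common divisor would also divide
  2L.\<close>

lemma coprime_ords:
  "coprime (2 * L) (ord1 L d)" "coprime (2 * L) (ord2 L d)" "coprime (ord1 L d) (ord2 L d)"
proof -
  show 1: "coprime (2 * L) (ord1 L d)" "coprime (2 * L) (ord2 L d)"
  proof -
    have "coprime a (a * m + 1)" for a m :: nat
    proof (rule coprimeI)
      fix c assume "c dvd a" "c dvd a * m + 1"
      then show "is_unit c" by (metis dvd_add_right_iff dvd_mult2)
    qed
    then show "coprime (2 * L) (ord1 L d)" "coprime (2 * L) (ord2 L d)"
      unfolding ord1_def ord2_def by blast+
  qed
  have "ord2 L d = ord1 L d + 2 * L" by (simp add: ord1_def ord2_def algebra_simps)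
  then show "coprime (ord1 L d) (ord2 L d)" using 1(1) by (simp add: coprime_commute gcd_add2 coprime_iff_gcd_eq_1 gcd.commute)
qed

lemma comp_exps:
  assumes "L > 0"
  shows "distinct (comp_exps L d)" "e \<in> set (comp_exps L d) \<Longrightarrow> e < ord1 L d * ord2 L d"
proof -
  have pos: "ord1 L d > 0" "ord2 L d > 0" using ord_pos[OF assms, of d] by auto
  have "ord2 L d * j \<noteq> ord1 L d * j'" if "1 \<le> j" "j < ord1 L d" for j j'
  proof
    assume "ord2 L d * j = ord1 L d * j'"
    then have "ord1 L d dvd ord2 L d * j" by simp
    then have "ord1 L d dvd j" using coprime_ords(3) by (simp add: coprime_dvd_mult_right_iff)
    then show False using that by (simp add: nat_dvd_not_less)
  qed
  then show "distinct (comp_exps L d)"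
    using pos by (auto simp: comp_exps_def distinct_map inj_on_def)
  show "e < ord1 L d * ord2 L d" if "e \<in> set (comp_exps L d)"
    using that pos by (auto simp: comp_exps_def mult.commute)
qed

lemma omega_pow_quotient:
  assumes "N > 0" "M > 0"
  shows "omega_pow (N * M) (of_nat M * c) = omega_pow N c"
  using assms by (simp add: omega_pow_def mult.assoc)

lemma comp_ys_powers:
  assumes k: "2 \<le> k" and L: "L > 0"
  shows "map (\<lambda>y. y ^ (2 * L)) (comp_ys L d k z) =
    map (\<lambda>e. z ^ (2 * L) * omega_pow (ord1 L d * ord2 L d) (of_nat (2 * L * e))) (comp_exps L d)"
proof -
  have pos: "ord1 L d > 0" "ord2 L d > 0" using ord_pos[OF L, of d] by auto
  have h: "omega_pow L (of_nat m / 2) ^ (2 * L) = 1" for m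
    using omega_pow_half_power[OF L, of "int m"] by simp
  have 1: "omega_pow (ord1 L d) (of_nat j) ^ (2 * L) = omega_pow (ord1 L d * ord2 L d) (of_nat (2 * L * (ord2 L d * j)))" for j
    using omega_pow_quotient[OF pos, of "of_nat (2 * L) * of_nat j"] by (simp add: omega_pow_power mult_ac)
  have 2: "omega_pow (ord2 L d) (of_nat j) ^ (2 * L) = omega_pow (ord1 L d * ord2 L d) (of_nat (2 * L * (ord1 L d * j)))" for j
    using omega_pow_quotient[OF pos(2,1), of "of_nat (2 * L) * of_nat j"] by (simp add: omega_pow_power mult_ac)
  show ?thesis
    unfolding comp_ys_def comp_exps_def list.map map_append map_map comp_def power_mult_distrib h 1 2 by simp
qed

text \<open>The 2L-th power of the zero \<omega>^p of f; the other zero \<omega>^(1-p) has the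
  inverse as its 2L-th power. It has modulus 1, and by irrationality of p it is not a root of
  unity.\<close>

definition twist :: "nat \<Rightarrow> real \<Rightarrow> complex" where
  "twist L p = omega_pow L (of_real p) ^ (2 * L)"

lemma norm_twist: "norm (twist L p) = 1"
  by (simp add: twist_def omega_pow_def norm_power)

lemma twist_power_neq_1:
  assumes L: "L > 0" and p: "p \<notin> \<rat>" and M: "M > 0"
  shows "twist L p ^ M \<noteq> 1"
proof
  assume "twist L p ^ M = 1"
  then have "omega_pow L (of_real (2 * L * M * p)) = 1"
    by (simp add: twist_def omega_pow_power power_mult[symmetric] mult_ac)
  then obtain k :: int where "2 * L * M * p = of_int k * of_nat L" using omega_pow_eq_1_iff[OF L] by blast
  then have "p = of_int k / of_nat (2 * M)" using L M by (simp add: field_simps)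
  then show False using p by (metis Rats_divide Rats_of_int Rats_of_nat)
qed

lemma spread_comp:
  assumes L: "L > 0" and p: "p \<notin> \<rat>" and k: "2 \<le> k" and z: "z \<noteq> 0"
  shows "spread (twist L p) (map (\<lambda>y. y ^ (2 * L)) (comp_ys L d k z))"
proof -
  let ?M = "ord1 L d * ord2 L d"
  have M: "?M > 0" using ord_pos[OF L, of d] by simp
  let ?w = "\<lambda>e. z ^ (2 * L) * omega_pow ?M (of_nat (2 * L * e))"
  have inj: "inj_on ?w (set (comp_exps L d))"
  proof (rule inj_onI)
    fix e e' assume e: "e \<in> set (comp_exps L d)" "e' \<in> set (comp_exps L d)" and eq: "?w e = ?w e'"
    then have "omega_pow ?M (of_nat (2 * L * e)) = omega_pow ?M (of_nat (2 * L * e'))"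
      using z by simp
    then have "omega_pow ?M (of_real (real (2 * L * e) - real (2 * L * e'))) = 1"
      by (simp add: omega_pow_diff)
    then obtain j :: int where "real (2 * L * e) - real (2 * L * e') = of_int j * of_nat ?M"
      using omega_pow_eq_1_iff[OF M] by blast
    then have "real_of_int (int (2 * L) * (int e - int e')) = real_of_int (j * int ?M)"
      by (simp add: right_diff_distrib)
    then have j: "int (2 * L) * (int e - int e') = j * int ?M" by (simp only: of_int_eq_iff)
    \<comment> \<open>Coprimality to 2L means that raising to the power 2L identifies no two of the
      roots of unity used.\<close>
    have "coprime (int ?M) (int (2 * L))"
      using coprime_ords by (simp add: coprime_commute del: of_nat_mult)
    moreover have "int ?M dvd int (2 * L) * (int e - int e')" unfolding j by simp
    ultimately have dv: "int ?M dvd int e - int e'" by (simp add: coprime_dvd_mult_right_iff)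
    have "\<bar>int e - int e'\<bar> < int ?M" using comp_exps(2)[OF L e(1)] comp_exps(2)[OF L e(2)] by linarith
    then have "int e - int e' = 0" using dv zdvd_not_zless by (metis abs_ge_zero dvd_abs_iff abs_0_eq order_le_less)
    then show "e = e'" by simp
  qed
  \<comment> \<open>All these numbers have the same power of exponent ord1 * ord2, so their ratios
    are roots of unity and cannot equal the twist.\<close>
  have pw: "?w e ^ ?M = (z ^ (2 * L)) ^ ?M" for e
  proof -
    have "omega_pow ?M (of_real (real (2 * L * e * ?M))) = 1"
      unfolding omega_pow_eq_1_iff[OF M] by (rule exI[of _ "int (2 * L * e)"]) simp
    then have "omega_pow ?M (of_nat (2 * L * e)) ^ ?M = 1" by (simp add: omega_pow_power mult_ac)
    then show ?thesis by (simp only: power_mult_distrib mult_1_right)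
  qed
  have "?w e \<noteq> twist L p * ?w e'" for e e'
  proof
    assume "?w e = twist L p * ?w e'"
    then have "?w e ^ ?M = twist L p ^ ?M * ?w e' ^ ?M" by (simp only: power_mult_distrib)
    then have "twist L p ^ ?M = 1" using z unfolding pw by simp
    then show False using twist_power_neq_1[OF L p M] by simp
  qed
  then show ?thesis
    unfolding comp_ys_powers[OF k L] spread_def using inj comp_exps(1)[OF L, of d] z
    by (auto simp: distinct_map)
qed

lemma spread_config:
  assumes L: "L > 0" and p: "p \<notin> \<rat>" and C: "good_config L C"
  shows "spread (twist L p) (map (\<lambda>y. y ^ (2 * L)) (config_ys L d C))"
proof -
  have nm: "norm w = norm z ^ (2 * L)" if w: "w \<in> set (map (\<lambda>y. y ^ (2 * L)) (comp_ys L d k z))" and k: "2 \<le> k" for w k z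
  proof -
    obtain e where "w = z ^ (2 * L) * omega_pow (ord1 L d * ord2 L d) (of_nat (2 * L * e))"
      using w unfolding comp_ys_powers[OF k L] by auto
    moreover have "norm (omega_pow M (of_nat e)) = 1" for M e
      by (simp add: omega_pow_def)
    ultimately show ?thesis by (simp only: norm_mult norm_power mult_1_right)
  qed
  show ?thesis
    using C
  proof (induction C)
    case Nil
    show ?case by (simp add: config_ys_def spread_def)
  next
    case (Cons c C)
    obtain k z where c: "c = (k, z)" by (cases c)
    have k: "2 \<le> k" "z \<noteq> 0" and C: "good_config L C" and nz: "norm z \<noteq> norm z'" if "(k', z') \<in> set C" for k' z'
      using Cons.prems that by (auto simp: c good_config_def image_iff)
    have kz: "2 \<le> k" "z \<noteq> 0" and C: "good_config L C"
      using Cons.prems by (auto simp: c good_config_def)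
    have "spread (twist L p) (map (\<lambda>y. y ^ (2 * L)) (comp_ys L d k z) @ map (\<lambda>y. y ^ (2 * L)) (config_ys L d C))"
    proof (rule spread_append[OF spread_comp[OF L p kz] Cons.IH[OF C] norm_twist])
      fix u v assume u: "u \<in> set (map (\<lambda>y. y ^ (2 * L)) (comp_ys L d k z))"
        and v: "v \<in> set (map (\<lambda>y. y ^ (2 * L)) (config_ys L d C))"
      from v obtain k' z' where kz': "(k', z') \<in> set C" "v \<in> set (map (\<lambda>y. y ^ (2 * L)) (comp_ys L d k' z'))"
        by (auto simp: config_ys_def)
      have "2 \<le> k'" using C kz'(1) by (auto simp: good_config_def)
      then have "norm u = norm z ^ (2 * L)" "norm v = norm z' ^ (2 * L)"
        using nm[OF u kz(1)] nm[OF kz'(2)] by auto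
      then show "norm u \<noteq> norm v" using nz[OF kz'(1)] L by (simp add: power_eq_iff_eq_base)
    qed
    then show ?case by (simp add: c config_ys_def)
  qed
qed

lemma regular_config:
  fixes p :: real
  assumes L: "L > 0" and p: "p \<notin> \<rat>" and C: "good_config L C"
  shows "regular_point L (config_ys L d C)"
proof -
  note sp = spread_config[OF L p C, of d]
  have "0 \<notin> set (config_ys L d C)"
  proof
    assume "0 \<in> set (config_ys L d C)"
    then have "0 ^ (2 * L) \<in> set (map (\<lambda>y. y ^ (2 * L)) (config_ys L d C))" by (metis image_eqI list.set_map)
    then show False using sp L by (simp add: spread_def power_0_left)
  qed
  then show ?thesis
    using sp unfolding regular_point_def spread_def distinct_conv_nth by (metis length_map nth_map nth_mem)
qed

lemma f_pair_neq_0: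
  assumes L: "L > 0" and "v \<noteq> 0"
    and "u ^ (2 * L) \<noteq> v ^ (2 * L)" "u ^ (2 * L) \<noteq> twist L p * v ^ (2 * L)" "v ^ (2 * L) \<noteq> twist L p * u ^ (2 * L)"
  shows "f_pair L p (u / v) \<noteq> 0"
proof -
  have w: "omega_pow L 1 ^ (2 * L) = 1" using omega_pow_half_power[OF L, of 2] by simp
  have "omega_pow L (1 - of_real p) * omega_pow L (of_real p) = omega_pow L 1"
    by (simp add: omega_pow_add[symmetric])
  then have q: "omega_pow L (1 - of_real p) ^ (2 * L) * twist L p = 1"
    unfolding twist_def by (simp only: power_mult_distrib[symmetric] w)
  have pw: "u ^ (2 * L) = r ^ (2 * L) * v ^ (2 * L)" if "u / v = r" for r
  proof -
    have "u = r * v" using that assms(2) by auto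
    then show ?thesis by (simp only: power_mult_distrib)
  qed
  have "u / v \<noteq> 1" "u / v \<noteq> omega_pow L 1" "u / v \<noteq> omega_pow L (of_real p)"
    using pw[of 1] pw[of "omega_pow L 1"] pw[of "omega_pow L (of_real p)"] assms(3,4) w by (auto simp: twist_def)
  moreover have "u / v \<noteq> omega_pow L (1 - of_real p)"
  proof
    assume "u / v = omega_pow L (1 - of_real p)"
    then have "twist L p * u ^ (2 * L) = omega_pow L (1 - of_real p) ^ (2 * L) * twist L p * v ^ (2 * L)"
      using pw by simp
    then show False using assms(5) unfolding q by simp
  qed
  ultimately
  show ?thesis by (simp add: f_pair_def)
qed

lemma prod_nonzeroI: "(\<And>x. x \<in> A \<Longrightarrow> f x \<noteq> 0) \<Longrightarrow> prod f A \<noteq> 0" for f :: "_ \<Rightarrow> complex"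
  by (induction A rule: infinite_finite_induct) auto

text \<open>The coefficient of the dominant term is such a product of contractions, so this keeps
  the limiting state from vanishing.\<close>

lemma self_contr_neq_0:
  assumes L: "L > 0" and sp: "spread (twist L p) (map (\<lambda>y. y ^ (2 * L)) ys)"
    and Ss: "\<And>S. S \<in> set Ss \<Longrightarrow> finite S"
  shows "self_contr L p (map2 (vop_of_set L) Ss ys) \<noteq> 0"
proof -
  have sp': "distinct (map (\<lambda>y. y ^ (2 * L)) ys)" "\<And>y. y \<in> set ys \<Longrightarrow> y \<noteq> 0"
    "\<And>y y'. y \<in> set ys \<Longrightarrow> y' \<in> set ys \<Longrightarrow> y ^ (2 * L) \<noteq> twist L p * y' ^ (2 * L)"
    using sp L by (auto simp: spread_def power_0_left)
  show ?thesis
    unfolding self_contr_def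
  proof (intro prod_nonzeroI)
    fix i j assume "j \<in> {..<length (map2 (vop_of_set L) Ss ys)}" "i \<in> {..<j}"
    then have ij: "i < length ys" "j < length ys" "i < length Ss" "j < length Ss" "i \<noteq> j" by auto
    note fin = Ss[OF nth_mem[OF ij(3)]] Ss[OF nth_mem[OF ij(4)]]
    have "(ys ! i) ^ (2 * L) \<noteq> (ys ! j) ^ (2 * L)"
      using sp'(1) ij by (simp add: distinct_conv_nth)
    then have "pair_contr L p (s, vop_arg L (Ss ! i) (ys ! i) s) (t, vop_arg L (Ss ! j) (ys ! j) t) \<noteq> 0" for s t
      using f_pair_neq_0[OF L] sp'(2,3) ij vop_arg_neq_0 by (simp add: vop_arg_power[OF L])
    then show "vop_contr L p (map2 (vop_of_set L) Ss ys ! i) (map2 (vop_of_set L) Ss ys ! j) \<noteq> 0"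
      using ij fin by (simp add: vop_contr_of_set)
  qed
qed

lemma spread_self_contr: "self_contr L p (map2 (vop_of_set L) (map (\<lambda>k. {1..k}) (config_ks L d C)) (config_ys L d C)) \<noteq> 0"
  if "L > 0" "p \<notin> \<rat>" "good_config L C"
  by (rule self_contr_neq_0[OF that(1) spread_config[OF that]]) auto

text \<open>The state of the dominant term alone, freed from its contraction factor; the compounds
  enter additively in the exponent.\<close>

definition config_bell :: "nat \<Rightarrow> real \<Rightarrow> (nat \<times> complex) list \<Rightarrow> nat \<Rightarrow> pol" where
  "config_bell L p C = bell (\<lambda>n. \<Sum>(k, z)\<leftarrow>C. scal ((1 / z) ^ n) (basic_mode L p k n))"

lemma coherent_state_config:
  assumes "good_config L C" "L > 0"
  shows "coherent_state L p (dominant_content L (config_ks L d C) (config_ys L d C)) d = config_bell L p C d"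
  unfolding coherent_state_def config_bell_def by (rule bell_cong) (rule mode_elem_config[OF assms(1) _ _ assms(2)])

lemma config_bell_Nil: "config_bell L p [] 0 = 1"
  by (simp add: config_bell_def)

lemma config_bell_Cons:
  "config_bell L p ((k, z) # C) d = (\<Sum>i\<le>d. scal ((1 / z) ^ i) (bell (basic_mode L p k) i * config_bell L p C (d - i)))"
  by (simp add: config_bell_def bell_add bell_scale scal_mult_left)

text \<open>Adding a compound at \<open>z\<close> and comparing powers of \<open>1 / z\<close> shows that the span of all
  configurations absorbs factors \<open>bell (basic_mode L p k) i\<close>, hence factors \<open>basic_mode L p k n\<close>,
  hence all generators.\<close>

lemma graded_subset_span_config:
  assumes L: "L > 0" and p: "p \<notin> \<rat>"
  shows "graded L d \<subseteq> pol.span {config_bell L p C d |C. good_config L C}"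
proof -
  let ?S = "{config_bell L p C d |C. good_config L C}"
  \<comment> \<open>Here v plays the role of a factor of degree m, and the configuration fills up
    the remaining degree d - m. Taking m = d and no compounds gives membership of v itself.\<close>
  define absorbed where "absorbed m v \<longleftrightarrow> (\<forall>C. good_config L C \<longrightarrow> config_bell L p C (d - m) * v \<in> pol.span ?S)" for m v
  have add: "absorbed m (u + v)" if "absorbed m u" "absorbed m v" for m u v
    using that by (auto simp: absorbed_def distrib_left intro: pol.span_add)
  have scl: "absorbed m (scal c u)" if "absorbed m u" for m u c
    using that by (auto simp: absorbed_def scal_mult_right intro: pol.span_scale)
  have sm: "absorbed m (sum g A)" if "\<And>i. i \<in> A \<Longrightarrow> absorbed m (g i)" for m g and A :: "nat set"
    using that by (auto simp: absorbed_def sum_distrib_left intro: pol.span_sum)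
  have bell: "absorbed (m + i) (bell (basic_mode L p k) i * v)"
    if v: "absorbed m v" and k: "k \<in> {2..L}" and mi: "m + i \<le> d" for m i k v
    unfolding absorbed_def
  proof (intro allI impI)
    fix C assume C: "good_config L C"
    \<comment> \<open>A new compound is placed at 1 / t; its modulus must not occur yet for the
      configuration to stay good.\<close>
    define T where "T = {t :: complex. t \<noteq> 0 \<and> norm (1 / t) \<notin> set (map (\<lambda>(k, z). norm z) C)}"
    have "infinite T"
    proof
      assume fin: "finite T"
      let ?R = "{r :: real. 0 < r \<and> 1 / r \<notin> set (map (\<lambda>(k, z). norm z) C)}"
      have "of_real ` ?R \<subseteq> T" by (auto simp: T_def norm_divide)
      then have "finite (of_real ` ?R :: complex set)" using fin finite_subset by blast
      then have "finite ?R" by (rule finite_imageD) (simp add: inj_on_def)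
      moreover have "{0<..} \<subseteq> ?R \<union> (\<lambda>x. 1 / x) ` set (map (\<lambda>(k, z). norm z) C)"
      proof
        fix r :: real assume r: "r \<in> {0<..}"
        have "r = 1 / (1 / r)" by simp
        then show "r \<in> ?R \<union> (\<lambda>x. 1 / x) ` set (map (\<lambda>(k, z). norm z) C)"
          using r by (cases "1 / r \<in> set (map (\<lambda>(k, z). norm z) C)") (blast, simp)
      qed
      ultimately have "finite {0 :: real <..}" by (meson finite_Un finite_imageI List.finite_set finite_subset)
      then show False using infinite_Ioi by blast
    qed
    then have "bell (basic_mode L p k) i * config_bell L p C (d - m - i) * v \<in> pol.span ?S"
    proof (rule span_coeff_extract[where n = "d - m" and i = i
          and v = "\<lambda>i. bell (basic_mode L p k) i * config_bell L p C (d - m - i) * v"])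
      show "i \<le> d - m" using mi by simp
      fix t assume t: "t \<in> T"
      have "good_config L ((k, 1 / t) # C)" using C k t by (auto simp: good_config_def T_def)
      then have "config_bell L p ((k, 1 / t) # C) (d - m) * v \<in> pol.span ?S"
        using v by (simp add: absorbed_def)
      then show "(\<Sum>i\<le>d - m. scal (t ^ i) (bell (basic_mode L p k) i * config_bell L p C (d - m - i) * v)) \<in> pol.span ?S"
        by (simp add: config_bell_Cons sum_distrib_right scal_mult_left)
    qed
    moreover have "d - (m + i) = d - m - i" by simp
    ultimately show "config_bell L p C (d - (m + i)) * (bell (basic_mode L p k) i * v) \<in> pol.span ?S"
      by (simp only: mult_ac)
  qed
  have mode: "absorbed (m + n) (basic_mode L p k n * v)"
    if "absorbed m v" "k \<in> {2..L}" "m + n \<le> d" "1 \<le> n" for m n k v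
    using that
  proof (induction n arbitrary: m v rule: less_induct)
    case (less n)
    let ?b = "basic_mode L p k"
    \<comment> \<open>The recursion expresses the mode n through the coefficient n of the
      exponential, already absorbed, and products with modes of lower degree.\<close>
    have split: "scal (of_nat n) (bell ?b n) = (\<Sum>i=1..<n. scal (of_nat i) (?b i * bell ?b (n - i))) + scal (of_nat n) (?b n)"
    proof -
      have "{1..n} = insert n {1..<n}" using less.prems(4) by auto
      then show ?thesis unfolding bell_rec by (simp add: add.commute)
    qed
    have s1: "absorbed (m + n) (\<Sum>i=1..<n. scal (of_nat i) (?b i * (bell ?b (n - i) * v)))"
    proof (intro sm scl)
      fix i assume i: "i \<in> {1..<n}"
      have "absorbed (m + (n - i)) (bell ?b (n - i) * v)"
        by (rule bell[OF less.prems(1,2)]) (use less.prems(3) in simp)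
      then have "absorbed (m + (n - i) + i) (?b i * (bell ?b (n - i) * v))"
        using less.IH[of i "m + (n - i)"] i less.prems by auto
      then show "absorbed (m + n) (?b i * (bell ?b (n - i) * v))" using i by simp
    qed
    have s2: "absorbed (m + n) (scal (of_nat n) (bell ?b n * v))"
      using bell less.prems by (intro scl) simp
    have eq: "scal (of_nat n) (?b n * v) = scal (of_nat n) (bell ?b n * v) +
        scal (-1) (\<Sum>i=1..<n. scal (of_nat i) (?b i * (bell ?b (n - i) * v)))"
      using arg_cong[OF split, of "\<lambda>u. u * v"]
      by (simp add: distrib_right sum_distrib_right scal_mult_left mult.assoc)
    have "absorbed (m + n) (scal (of_nat n) (?b n * v))" unfolding eq by (rule add[OF s2 scl[OF s1]])
    then have "absorbed (m + n) (scal (1 / of_nat n) (scal (of_nat n) (?b n * v)))" by (rule scl)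
    then show ?case using less.prems(4) by (simp add: scal_scal)
  qed
  have var: "absorbed (m + n) (var (i, n) * v)"
    if "absorbed m v" "i \<in> {1..L-1}" "m + n \<le> d" "1 \<le> n" for m n i v
  proof -
    define c where "c = - 1 / (of_nat n * pi_coef L p i n)"
    have c: "c \<noteq> 0" using pi_coef_neq_0[OF L p] that(4) by (simp add: c_def)
    have "basic_mode L p (Suc i) n = basic_mode L p i n + scal c (var (i, n))"
      using that(2) by (simp add: basic_mode_def c_def)
    then have eq: "var (i, n) * v = scal (1 / c) (basic_mode L p (Suc i) n * v + scal (-1) (basic_mode L p i n * v))"
      using c by (simp add: distrib_right scal_mult_left scal_scal scal_add)
    have a1: "absorbed (m + n) (basic_mode L p (Suc i) n * v)"
      by (rule mode) (use that in auto)
    have a2: "absorbed (m + n) (basic_mode L p i n * v)"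
    \<comment> \<open>There is no compound of type 1, but its mode is an empty sum.\<close>
    proof (cases "i = 1")
      case True
      then show ?thesis by (simp add: basic_mode_def absorbed_def pol.span_zero)
    next
      case False
      then show ?thesis by (intro mode) (use that in auto)
    qed
    show ?thesis unfolding eq by (intro scl add a1 a2)
  qed
  have mono: "absorbed (mono_deg u) (mono_pol u)"
    if "Poly_Mapping.keys u \<subseteq> {1..L-1} \<times> {1..}" "mono_deg u \<le> d" for u
    using that
  proof (induction "mono_deg u" arbitrary: u rule: less_induct)
    case less
    show ?case
    proof (cases "u = 0")
      case True
      have "absorbed 0 1" by (auto simp: absorbed_def intro: pol.span_base)
      then show ?thesis using True by (simp add: mono_pol_0 mono_deg_def)
    next
      case False
      then have "Poly_Mapping.keys u \<noteq> {}" by simp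
      then obtain v where v: "v \<in> Poly_Mapping.keys u" by blast
      obtain i n where vin: "v = (i, n)" by (cases v)
      have i: "i \<in> {1..L-1}" "1 \<le> n" using v vin less.prems by auto
      define u' where "u' = u - Poly_Mapping.single v 1"
      have "Poly_Mapping.lookup u v \<noteq> 0" using v by (simp add: in_keys_iff)
      then have u: "u = Poly_Mapping.single v 1 + u'"
        by (intro poly_mapping_eqI) (auto simp: u'_def lookup_add lookup_minus lookup_single when_def)
      have deg: "mono_deg u = mono_deg u' + n"
        by (subst u) (simp add: mono_deg_add, simp add: mono_deg_def vin)
      have "Poly_Mapping.keys u' \<subseteq> Poly_Mapping.keys u"
        by (auto simp: u'_def in_keys_iff lookup_minus)
      then have "absorbed (mono_deg u') (mono_pol u')"
        using less.hyps[of u'] less.prems deg i by auto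
      from var[OF this i(1) _ i(2)] have "absorbed (mono_deg u) (var (i, n) * mono_pol u')"
        using deg less.prems by simp
      also have "var (i, n) * mono_pol u' = mono_pol u"
        unfolding var_eq_mono_pol mono_pol_mult vin[symmetric] u[symmetric] ..
      finally show ?thesis .
    qed
  qed
  have "mono_pol u \<in> pol.span ?S" if "u \<in> monom_set L d" for u
  proof -
    have "absorbed d (mono_pol u)" using mono[of u] that by (auto simp: monom_set_def)
    then show ?thesis unfolding absorbed_def
      by (elim allE[of _ "[]"]) (simp add: good_config_def config_bell_Nil)
  qed
  then have "mono_pol ` monom_set L d \<subseteq> pol.span ?S" by auto
  then show ?thesis unfolding graded_def by (rule pol.span_minimal[OF _ pol.subspace_span])
qed

section \<open>Bases of configurations\<close>

lemma inj_mono_pol: "inj_on mono_pol M"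
proof (rule inj_onI)
  fix m m' assume "mono_pol m = mono_pol m'"
  then have "Poly_Mapping.keys (mono_pol m) = Poly_Mapping.keys (mono_pol m')" by simp
  then show "m = m'" by (simp add: mono_pol_def)
qed

lemma independent_monos: "finite M \<Longrightarrow> pol.independent (mono_pol ` M)"
proof (rule pol.independent_if_scalars_zero)
  fix f x assume M: "finite M" and z: "(\<Sum>x\<in>mono_pol ` M. scal (f x) x) = 0" and x: "x \<in> mono_pol ` M"
  obtain m where m: "m \<in> M" "x = mono_pol m" using x by auto
  have "(\<Sum>m'\<in>M. f (mono_pol m') * (if m' = m then 1 else 0)) = Poly_Mapping.lookup (\<Sum>x\<in>mono_pol ` M. scal (f x) x) m"
    unfolding sum.reindex[OF inj_mono_pol] comp_def lookup_sum lookup_scal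
    by (intro sum.cong refl) (simp add: mono_pol_def lookup_single when_def)
  then show "f x = 0" using M m z by (simp add: if_distrib[of "(*) _"] cong: if_cong)
qed simp

lemma card_mono_pol_image: "card (mono_pol ` M) = card M"
  by (rule card_image[OF inj_mono_pol])

lemma config_bell_graded: "good_config L C \<Longrightarrow> L > 0 \<Longrightarrow> config_bell L p C d \<in> graded L d"
  using coherent_state_config[of L C p d] coherent_state_graded by metis

lemma exists_configs:
  assumes L: "L > 0" and p: "p \<notin> \<rat>"
  shows "\<exists>C. (\<forall>m\<in>monom_set L d. good_config L (C m)) \<and> inj_on (\<lambda>m. config_bell L p (C m) d) (monom_set L d) \<and>
     graded L d \<subseteq> pol.span ((\<lambda>m. config_bell L p (C m) d) ` monom_set L d)"
proof -
  let ?S = "{config_bell L p C d |C. good_config L C}" and ?M = "mono_pol ` monom_set L d"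
  have ind: "pol.independent ?M" by (rule independent_monos[OF finite_monom_set])
  have span: "pol.span ?S = pol.span ?M"
  proof
    show "pol.span ?S \<subseteq> pol.span ?M"
      using config_bell_graded[OF _ L] by (intro pol.span_minimal pol.subspace_span) (auto simp: graded_def)
    show "pol.span ?M \<subseteq> pol.span ?S" using graded_subset_span_config[OF L p, of d] by (simp add: graded_def)
  qed
  obtain B where B: "B \<subseteq> ?S" "pol.independent B" "?S \<subseteq> pol.span B" "card B = pol.dim ?S"
    using pol.basis_exists by blast
  have spB: "pol.span B = pol.span ?S"
    using B(1,3) by (intro subset_antisym pol.span_mono pol.span_minimal pol.subspace_span)
  have "B \<subseteq> pol.span ?M" using B(1) span pol.span_superset by blast
  then have finB: "finite B" using pol.independent_span_bound[of ?M B] B(2) finite_monom_set by blast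
  \<comment> \<open>The span is the whole graded piece, so a basis chosen from the states has as
    many elements as there are monomials and can be indexed by them.\<close>
  have "pol.dim ?S = card ?M" by (rule pol.dim_eq_card[OF span[symmetric] ind])
  then have "card B = card (monom_set L d)" using B(4) card_mono_pol_image by simp
  then obtain b where b: "bij_betw b (monom_set L d) B"
    using finite_same_card_bij[OF finite_monom_set finB] by metis
  have "\<forall>m\<in>monom_set L d. \<exists>C. good_config L C \<and> b m = config_bell L p C d"
    using b B(1) by (auto simp: bij_betw_def)
  then obtain C where C: "\<forall>m\<in>monom_set L d. good_config L (C m) \<and> b m = config_bell L p (C m) d"
    by metis
  have "(\<lambda>m. config_bell L p (C m) d) ` monom_set L d = B" "inj_on (\<lambda>m. config_bell L p (C m) d) (monom_set L d)"
    using b C unfolding bij_betw_def by (auto simp: inj_on_def image_def)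
  then show ?thesis using C spB span by (intro exI[of _ C]) (auto simp: graded_def)
qed

section \<open>Linear maps given on monomials and their matrices in each degree\<close>

definition lin_ext :: "((nat \<times> nat \<Rightarrow>\<^sub>0 nat) \<Rightarrow> pol) \<Rightarrow> pol \<Rightarrow> pol" where
  "lin_ext g h = (\<Sum>m\<in>Poly_Mapping.keys h. scal (Poly_Mapping.lookup h m) (g m))"

lemma lin_ext_superset:
  assumes "finite K" "Poly_Mapping.keys h \<subseteq> K"
  shows "lin_ext g h = (\<Sum>m\<in>K. scal (Poly_Mapping.lookup h m) (g m))"
  unfolding lin_ext_def by (rule sum.mono_neutral_left) (use assms in \<open>auto simp: in_keys_iff\<close>)

lemma linear_lin_ext: "pol_linear (lin_ext g)"
proof (rule pol_linearI)
  fix u v :: pol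
  let ?K = "Poly_Mapping.keys u \<union> Poly_Mapping.keys v"
  have "Poly_Mapping.keys (u + v) \<subseteq> ?K" by (rule keys_add)
  then show "lin_ext g (u + v) = lin_ext g u + lin_ext g v"
    by (simp add: lin_ext_superset[of ?K] lookup_add scal_add_left sum.distrib)
next
  fix c and u :: pol
  have "Poly_Mapping.keys (scal c u) \<subseteq> Poly_Mapping.keys u" by (auto simp: in_keys_iff lookup_scal)
  then show "lin_ext g (scal c u) = scal c (lin_ext g u)"
    by (simp add: lin_ext_superset[of "Poly_Mapping.keys u"] lookup_scal scal_sum scal_scal)
qed

lemma lin_ext_mono_pol: "lin_ext g (mono_pol m) = g m"
  by (simp add: lin_ext_def mono_pol_def)

lemma keys_graded:
  assumes "h \<in> graded L d"
  shows "Poly_Mapping.keys h \<subseteq> monom_set L d"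
  using assms unfolding graded_def
proof (induction h rule: pol.span_induct_alt)
  case (step c x y)
  then obtain m where m: "m \<in> monom_set L d" "x = mono_pol m" by auto
  have "Poly_Mapping.keys (scal c x) \<subseteq> {m}" by (auto simp: m in_keys_iff lookup_scal mono_pol_def lookup_single when_def split: if_splits)
  then show ?case using keys_add[of "scal c x" y] step.IH m(1) by blast
qed simp

lemma keys_desc_alg: "h \<in> desc_alg L \<longleftrightarrow> (\<forall>m\<in>Poly_Mapping.keys h. m \<in> monom_set L (mono_deg m))"
  by (auto simp: desc_alg_def monom_set_def)

lemma desc_alg_subspace:
  "0 \<in> desc_alg L" "u \<in> desc_alg L \<Longrightarrow> v \<in> desc_alg L \<Longrightarrow> u + v \<in> desc_alg L" "u \<in> desc_alg L \<Longrightarrow> scal c u \<in> desc_alg L"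
proof -
  show "0 \<in> desc_alg L" by (simp add: desc_alg_def)
  show "u + v \<in> desc_alg L" if "u \<in> desc_alg L" "v \<in> desc_alg L"
    using that keys_add[of u v] unfolding desc_alg_def by blast
  have "Poly_Mapping.keys (scal c u) \<subseteq> Poly_Mapping.keys u" by (auto simp: in_keys_iff lookup_scal)
  then show "scal c u \<in> desc_alg L" if "u \<in> desc_alg L" using that unfolding desc_alg_def by blast
qed

lemma desc_alg_sum: "(\<And>i. i \<in> A \<Longrightarrow> g i \<in> desc_alg L) \<Longrightarrow> sum g A \<in> desc_alg L"
  by (induction A rule: infinite_finite_induct) (auto intro: desc_alg_subspace)

lemma graded_desc_alg: "h \<in> graded L d \<Longrightarrow> h \<in> desc_alg L"
  using keys_graded[of h L d] by (auto simp: keys_desc_alg monom_set_def)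

lemma lin_ext_desc_alg:
  assumes "\<And>m. m \<in> monom_set L (mono_deg m) \<Longrightarrow> g m \<in> graded L (mono_deg m)" "h \<in> desc_alg L"
  shows "lin_ext g h \<in> desc_alg L"
  unfolding lin_ext_def
proof (intro desc_alg_sum desc_alg_subspace(3))
  fix m assume "m \<in> Poly_Mapping.keys h"
  then have "m \<in> monom_set L (mono_deg m)" using assms(2) keys_desc_alg by blast
  then show "g m \<in> desc_alg L" by (rule graded_desc_alg[OF assms(1)])
qed

definition mono_enum :: "nat \<Rightarrow> nat \<Rightarrow> nat \<Rightarrow> (nat \<times> nat \<Rightarrow>\<^sub>0 nat)" where
  "mono_enum L d = (SOME e. bij_betw e {0..<card (monom_set L d)} (monom_set L d))"

lemma bij_mono_enum: "bij_betw (mono_enum L d) {0..<card (monom_set L d)} (monom_set L d)"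
  unfolding mono_enum_def by (rule someI_ex[OF ex_bij_betw_nat_finite[OF finite_monom_set]])

definition graded_mat :: "nat \<Rightarrow> nat \<Rightarrow> ((nat \<times> nat \<Rightarrow>\<^sub>0 nat) \<Rightarrow> pol) \<Rightarrow> complex Matrix.mat" where
  "graded_mat L d g = Matrix.mat (card (monom_set L d)) (card (monom_set L d))
     (\<lambda>(i, j). Poly_Mapping.lookup (g (mono_enum L d j)) (mono_enum L d i))"

lemma graded_mat_carrier: "graded_mat L d g \<in> carrier_mat (card (monom_set L d)) (card (monom_set L d))"
  by (simp add: graded_mat_def)

lemma graded_sum:
  assumes "h \<in> graded L d"
  shows "lin_ext g h = (\<Sum>i<card (monom_set L d). scal (Poly_Mapping.lookup h (mono_enum L d i)) (g (mono_enum L d i)))"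
    and "h = (\<Sum>i<card (monom_set L d). scal (Poly_Mapping.lookup h (mono_enum L d i)) (mono_pol (mono_enum L d i)))"
proof -
  show 1: "lin_ext g h = (\<Sum>i<card (monom_set L d). scal (Poly_Mapping.lookup h (mono_enum L d i)) (g (mono_enum L d i)))" for g
    unfolding lin_ext_superset[OF finite_monom_set keys_graded[OF assms]]
    by (rule sum.reindex_bij_betw[OF bij_mono_enum, symmetric, unfolded atLeast0LessThan])
  show "h = (\<Sum>i<card (monom_set L d). scal (Poly_Mapping.lookup h (mono_enum L d i)) (mono_pol (mono_enum L d i)))"
    using 1[of mono_pol] pol_eq_sum_monos[of h] by (simp add: lin_ext_def)
qed

text \<open>The map respects the grading and each graded piece has finite dimension, so inverting
  the matrix block of every degree gives the inverse map.\<close>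

lemma lin_ext_bij:
  assumes g: "\<And>m. m \<in> monom_set L (mono_deg m) \<Longrightarrow> g m \<in> graded L (mono_deg m)"
    and det: "\<And>d. Determinant.det (graded_mat L d g) \<noteq> 0"
  shows "bij_betw (lin_ext g) (desc_alg L) (desc_alg L)"
proof -
  have "\<exists>B. B \<in> carrier_mat (card (monom_set L d)) (card (monom_set L d)) \<and>
      graded_mat L d g * B = 1\<^sub>m (card (monom_set L d)) \<and> B * graded_mat L d g = 1\<^sub>m (card (monom_set L d))" for d
    using det_non_zero_imp_unit[OF graded_mat_carrier det, where b = "()"]
    by (auto simp: Units_def ring_mat_def)
  then obtain B where B: "\<And>d. B d \<in> carrier_mat (card (monom_set L d)) (card (monom_set L d))"
    "\<And>d. graded_mat L d g * B d = 1\<^sub>m (card (monom_set L d))" "\<And>d. B d * graded_mat L d g = 1\<^sub>m (card (monom_set L d))"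
    by metis
  define idx where "idx m = the_inv_into {0..<card (monom_set L (mono_deg m))} (mono_enum L (mono_deg m)) m" for m
  define ginv where "ginv m = (\<Sum>j<card (monom_set L (mono_deg m)). scal (B (mono_deg m) $$ (j, idx m)) (mono_pol (mono_enum L (mono_deg m) j)))" for m
  have key: "lin_ext g (ginv m) = mono_pol m \<and> lin_ext ginv (g m) = mono_pol m \<and> ginv m \<in> graded L (mono_deg m)"
    if m: "m \<in> monom_set L (mono_deg m)" for m
  proof -
    define d where "d = mono_deg m"
    let ?n = "card (monom_set L d)" and ?e = "mono_enum L d"
    have e: "bij_betw ?e {0..<?n} (monom_set L d)" by (rule bij_mono_enum)
    have em: "?e i \<in> monom_set L d" "mono_deg (?e i) = d" if "i < ?n" for i
    proof -
      show "?e i \<in> monom_set L d" using bij_betw_apply[OF e] that by simp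
      then show "mono_deg (?e i) = d" by (simp add: monom_set_def)
    qed
    have idx: "idx (?e i) = i" if "i < ?n" for i
      using the_inv_into_f_f[of ?e "{0..<?n}" i] e that em(2)[OF that] by (simp add: idx_def bij_betw_def)
    have "m \<in> ?e ` {0..<?n}" using m bij_betw_imp_surj_on[OF e] unfolding d_def by (simp only:)
    then obtain k where k: "k < ?n" "m = ?e k" by auto
    have ginv: "ginv (?e l) = (\<Sum>j<?n. scal (B d $$ (j, l)) (mono_pol (?e j)))" if "l < ?n" for l
      unfolding ginv_def em(2)[OF that] idx[OF that] ..
    have dim: "dim_row (graded_mat L d g) = ?n" "dim_col (graded_mat L d g) = ?n" "dim_row (B d) = ?n" "dim_col (B d) = ?n"
      using B(1)[of d] graded_mat_carrier[of L d g] by auto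
    have AB: "(\<Sum>j<?n. Poly_Mapping.lookup (g (?e j)) (?e i) * B d $$ (j, l)) = (if i = l then 1 else 0)" if "i < ?n" "l < ?n" for i l
    proof -
      have "(graded_mat L d g * B d) $$ (i, l) = (\<Sum>j<?n. graded_mat L d g $$ (i, j) * B d $$ (j, l))"
        using that dim by (simp add: scalar_prod_def atLeast0LessThan)
      also have "\<dots> = (\<Sum>j<?n. Poly_Mapping.lookup (g (?e j)) (?e i) * B d $$ (j, l))"
        by (intro sum.cong refl) (use that in \<open>simp add: graded_mat_def\<close>)
      finally show ?thesis using that by (simp add: B(2))
    qed
    have BA: "(\<Sum>j<?n. B d $$ (i, j) * Poly_Mapping.lookup (g (?e l)) (?e j)) = (if i = l then 1 else 0)" if "i < ?n" "l < ?n" for i l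
    proof -
      have "(B d * graded_mat L d g) $$ (i, l) = (\<Sum>j<?n. B d $$ (i, j) * graded_mat L d g $$ (j, l))"
        using that dim by (simp add: scalar_prod_def atLeast0LessThan)
      also have "\<dots> = (\<Sum>j<?n. B d $$ (i, j) * Poly_Mapping.lookup (g (?e l)) (?e j))"
        by (intro sum.cong refl) (use that in \<open>simp add: graded_mat_def\<close>)
      finally show ?thesis using that by (simp add: B(3))
    qed
    have ge: "g (?e j) \<in> graded L d" if "j < ?n" for j
      using g[of "?e j"] em[OF that] by simp
    have delta: "(\<Sum>i<?n. scal (if i = k then 1 else 0) (mono_pol (?e i))) = mono_pol m"
      using k by (simp add: if_distrib[of "\<lambda>c. scal c _"] cong: if_cong)
    have "lin_ext g (ginv m) = (\<Sum>j<?n. scal (B d $$ (j, k)) (g (?e j)))"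
      unfolding k(2) ginv[OF k(1)]
      by (simp add: pol_linear_sum[OF linear_lin_ext] pol_linear_scal[OF linear_lin_ext] lin_ext_mono_pol)
    also have "\<dots> = (\<Sum>j<?n. \<Sum>i<?n. scal (Poly_Mapping.lookup (g (?e j)) (?e i) * B d $$ (j, k)) (mono_pol (?e i)))"
    proof (rule sum.cong[OF refl])
      fix j assume "j \<in> {..<?n}"
      then have "g (?e j) = (\<Sum>i<?n. scal (Poly_Mapping.lookup (g (?e j)) (?e i)) (mono_pol (?e i)))"
        using graded_sum(2)[OF ge] by simp
      then have "scal (B d $$ (j, k)) (g (?e j)) = scal (B d $$ (j, k)) (\<Sum>i<?n. scal (Poly_Mapping.lookup (g (?e j)) (?e i)) (mono_pol (?e i)))"
        by (rule arg_cong)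
      then show "scal (B d $$ (j, k)) (g (?e j)) = (\<Sum>i<?n. scal (Poly_Mapping.lookup (g (?e j)) (?e i) * B d $$ (j, k)) (mono_pol (?e i)))"
        by (simp only: scal_sum scal_scal mult.commute)
    qed
    also have "\<dots> = (\<Sum>i<?n. scal (if i = k then 1 else 0) (mono_pol (?e i)))"
      by (subst sum.swap) (intro sum.cong refl, simp add: pol.scale_sum_left[symmetric] AB k(1))
    finally have 1: "lin_ext g (ginv m) = mono_pol m" unfolding delta .
    have "lin_ext ginv (g m) = (\<Sum>j<?n. scal (Poly_Mapping.lookup (g m) (?e j)) (ginv (?e j)))"
      by (rule graded_sum(1)) (simp add: k ge)
    also have "\<dots> = (\<Sum>j<?n. \<Sum>i<?n. scal (B d $$ (i, j) * Poly_Mapping.lookup (g (?e k)) (?e j)) (mono_pol (?e i)))"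
      by (intro sum.cong refl) (simp add: ginv k(2) scal_sum scal_scal mult.commute)
    also have "\<dots> = (\<Sum>i<?n. scal (if i = k then 1 else 0) (mono_pol (?e i)))"
      by (subst sum.swap) (intro sum.cong refl, simp add: pol.scale_sum_left[symmetric] BA k(1))
    finally have 2: "lin_ext ginv (g m) = mono_pol m" unfolding delta .
    have "ginv m \<in> graded L d"
      unfolding k(2) ginv[OF k(1)] graded_def
      by (intro pol.span_sum pol.span_scale pol.span_base imageI) (use em in auto)
    with 1 2 show ?thesis by (simp add: d_def)
  qed
  have inv: "lin_ext f1 (lin_ext f2 h) = h"
    if "\<And>m. m \<in> monom_set L (mono_deg m) \<Longrightarrow> lin_ext f1 (f2 m) = mono_pol m" "h \<in> desc_alg L" for f1 f2 h
  proof -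
    have "lin_ext f1 (lin_ext f2 h) = (\<Sum>m\<in>Poly_Mapping.keys h. scal (Poly_Mapping.lookup h m) (lin_ext f1 (f2 m)))"
      by (simp add: lin_ext_def[of f2] pol_linear_sum[OF linear_lin_ext] pol_linear_scal[OF linear_lin_ext])
    also have "\<dots> = (\<Sum>m\<in>Poly_Mapping.keys h. scal (Poly_Mapping.lookup h m) (mono_pol m))"
      by (intro sum.cong refl) (use that keys_desc_alg in auto)
    finally show ?thesis using pol_eq_sum_monos[of h] by simp
  qed
  show ?thesis
  proof (rule bij_betwI[where g = "lin_ext ginv"])
    show "lin_ext g \<in> desc_alg L \<rightarrow> desc_alg L" using lin_ext_desc_alg[OF g] by auto
    show "lin_ext ginv \<in> desc_alg L \<rightarrow> desc_alg L" using lin_ext_desc_alg[of L ginv] key by auto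
    show "lin_ext ginv (lin_ext g h) = h" if "h \<in> desc_alg L" for h by (rule inv[OF _ that]) (use key in blast)
    show "lin_ext g (lin_ext ginv h) = h" if "h \<in> desc_alg L" for h by (rule inv[OF _ that]) (use key in blast)
  qed
qed

section \<open>Non-degeneracy at a dominant weight\<close>

text \<open>The Leibniz expansion lets limits and holomorphy of the determinant be checked term by
  term.\<close>

lemma det_graded_mat:
  "Determinant.det (graded_mat L d g) = (\<Sum>q\<in>{q. q permutes {0..<card (monom_set L d)}}. signof q *
     (\<Prod>i=0..<card (monom_set L d). Poly_Mapping.lookup (g (mono_enum L d (q i))) (mono_enum L d i)))"
proof -
  have "q i < card (monom_set L d)" if "q permutes {0..<card (monom_set L d)}" "i < card (monom_set L d)" for q i
    using permutes_in_image[OF that(1), of i] that(2) by simp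
  then show ?thesis
    unfolding det_def'[OF graded_mat_carrier]
    by (intro sum.cong refl arg_cong2[of _ _ _ _ "(*)"] prod.cong) (auto simp: graded_mat_def)
qed

lemma det_graded_mat_scal:
  "Determinant.det (graded_mat L d (\<lambda>m. scal (c m) (g m))) =
     (\<Prod>i=0..<card (monom_set L d). c (mono_enum L d i)) * Determinant.det (graded_mat L d g)"
  unfolding det_graded_mat sum_distrib_left
proof (intro sum.cong refl)
  let ?n = "card (monom_set L d)" and ?e = "mono_enum L d"
  fix q assume "q \<in> {q. q permutes {0..<?n}}"
  then have "(\<Prod>i=0..<?n. c (?e (q i))) = (\<Prod>i=0..<?n. c (?e i))"
    using prod.permute[of q "{0..<?n}" "\<lambda>i. c (?e i)"] by (simp add: comp_def)
  then show "signof q * (\<Prod>i=0..<?n. Poly_Mapping.lookup (scal (c (?e (q i))) (g (?e (q i)))) (?e i)) =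
      (\<Prod>i=0..<?n. c (?e i)) * (signof q * (\<Prod>i=0..<?n. Poly_Mapping.lookup (g (?e (q i))) (?e i)))"
    by (simp add: lookup_scal prod.distrib mult_ac)
qed

text \<open>Expressing the monomials through the spanning family gives a right inverse of the
  matrix.\<close>

lemma det_graded_mat_neq_0:
  assumes b: "\<And>m. m \<in> monom_set L d \<Longrightarrow> b m \<in> graded L d" and inj: "inj_on b (monom_set L d)"
    and sp: "graded L d \<subseteq> pol.span (b ` monom_set L d)"
  shows "Determinant.det (graded_mat L d b) \<noteq> 0"
proof -
  let ?n = "card (monom_set L d)" and ?e = "mono_enum L d"
  have e: "bij_betw ?e {..<?n} (monom_set L d)" using bij_mono_enum[of L d] by (simp add: atLeast0LessThan)
  have em: "?e i \<in> monom_set L d" if "i < ?n" for i using bij_betw_apply[OF e] that by simp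
  have "\<exists>u. mono_pol (?e k) = (\<Sum>j<?n. scal (u j) (b (?e j)))" if k: "k < ?n" for k
  proof -
    have "mono_pol (?e k) \<in> graded L d"
      unfolding graded_def by (intro pol.span_base imageI em k)
    then have "mono_pol (?e k) \<in> pol.span (b ` monom_set L d)" using sp by blast
    then obtain u where "mono_pol (?e k) = (\<Sum>v\<in>b ` monom_set L d. scal (u v) v)"
      using pol.span_finite[of "b ` monom_set L d"] finite_monom_set by auto
    also have "\<dots> = (\<Sum>m\<in>monom_set L d. scal (u (b m)) (b m))" by (simp add: sum.reindex[OF inj])
    also have "\<dots> = (\<Sum>j<?n. scal (u (b (?e j))) (b (?e j)))" by (rule sum.reindex_bij_betw[OF e, symmetric])
    finally show ?thesis by (intro exI[of _ "\<lambda>j. u (b (?e j))"])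
  qed
  then obtain u where u: "\<And>k. k < ?n \<Longrightarrow> mono_pol (?e k) = (\<Sum>j<?n. scal (u k j) (b (?e j)))"
    by metis
  define B where "B = Matrix.mat ?n ?n (\<lambda>(j, k). u k j)"
  have "graded_mat L d b * B = 1\<^sub>m ?n"
  proof (rule eq_matI)
    fix i k assume ik: "i < dim_row (1\<^sub>m ?n :: complex Matrix.mat)" "k < dim_col (1\<^sub>m ?n :: complex Matrix.mat)"
    have "(graded_mat L d b * B) $$ (i, k) = (\<Sum>j<?n. graded_mat L d b $$ (i, j) * B $$ (j, k))"
      using ik by (simp add: scalar_prod_def atLeast0LessThan graded_mat_def B_def)
    also have "\<dots> = Poly_Mapping.lookup (\<Sum>j<?n. scal (u k j) (b (?e j))) (?e i)"
      unfolding lookup_sum lookup_scal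
      by (intro sum.cong refl) (use ik in \<open>simp add: graded_mat_def B_def mult.commute\<close>)
    also have "\<dots> = (if ?e k = ?e i then 1 else 0)"
      using ik by (simp add: u[symmetric] mono_pol_def lookup_single when_def)
    also have "?e k = ?e i \<longleftrightarrow> i = k"
      using e ik unfolding bij_betw_def inj_on_def by auto
    finally show "(graded_mat L d b * B) $$ (i, k) = 1\<^sub>m ?n $$ (i, k)" using ik by simp
  qed (simp_all add: graded_mat_def B_def)
  then have "Determinant.det (graded_mat L d b) * Determinant.det B = 1"
    using det_mult[OF graded_mat_carrier, of B L d b] by (simp add: B_def)
  then show ?thesis by auto
qed

text \<open>The Weyl vector times -i t. The weights \<omega>^(a_s) become positive reals that
  decrease in s for t > 0, so smaller indices dominate.\<close>

definition ray :: "nat \<Rightarrow> real \<Rightarrow> nat \<Rightarrow> complex" where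
  "ray L t s = (if s \<in> {1..L} then - \<i> * of_real (t * ((real L + 1) / 2 - real s)) else 0)"

lemma ray_hdual: "ray L t \<in> hdual L"
proof -
  have "(\<Sum>s=1..L. real s) = real L * (real L + 1) / 2"
    by (induction L) (simp_all add: field_simps)
  then have "(\<Sum>s=1..L. (real L + 1) / 2 - real s) = 0"
    by (simp add: sum_subtractf)
  moreover have "(\<Sum>s=1..L. ray L t s) = - \<i> * of_real (t * (\<Sum>s=1..L. (real L + 1) / 2 - real s))"
    unfolding of_real_mult of_real_sum sum_distrib_left by (intro sum.cong refl) (simp add: ray_def)
  ultimately show ?thesis by (simp add: hdual_def ray_def)
qed

text \<open>Elements of \<open>S\<close> outside {1..k} are at least k + 1, while equally many
  elements of {1..k} that they replace are at most k. The gain of 1 for each makes the dominance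
  strict.\<close>

lemma sum_ge_initial:
  fixes S :: "nat set"
  assumes S: "S \<subseteq> {1..L}" and k: "card S = k"
  shows "(\<Sum>s=1..k. s) + card (S - {1..k}) \<le> (\<Sum>s\<in>S. s)"
proof -
  have fin: "finite S" using S finite_subset by blast
  let ?K = "{1..k}"
  have c: "card (S - ?K) = card (?K - S)"
    using card_Int_Diff[of S ?K] card_Int_Diff[of ?K S] fin k by (simp add: Int_commute)
  have "(\<Sum>s\<in>?K. s) = (\<Sum>s\<in>?K \<inter> S. s) + (\<Sum>s\<in>?K - S. s)" "(\<Sum>s\<in>S. s) = (\<Sum>s\<in>S \<inter> ?K. s) + (\<Sum>s\<in>S - ?K. s)"
    using sum.Int_Diff[of ?K "\<lambda>s. s" S] sum.Int_Diff[of S "\<lambda>s. s" ?K] fin by auto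
  moreover have "(\<Sum>s\<in>?K - S. s) \<le> card (?K - S) * k"
    using sum_bounded_above[of "?K - S" "\<lambda>s. s" k] by simp
  moreover have "card (S - ?K) * (k + 1) \<le> (\<Sum>s\<in>S - ?K. s)"
  proof -
    have "k + 1 \<le> s" if "s \<in> S - ?K" for s using that S by auto
    then show ?thesis using sum_bounded_below[of "S - ?K" "k + 1" "\<lambda>s. s"] by simp
  qed
  ultimately show ?thesis using c by (simp add: Int_commute)
qed

definition level :: "nat set list \<Rightarrow> real" where
  "level Ss = (\<Sum>j<length Ss. \<Sum>s\<in>Ss ! j. real s)"

lemma level_dominant:
  assumes Ss: "Ss \<in> k_subset_lists L ks" and ne: "Ss \<noteq> map (\<lambda>k. {1..k}) ks"
  shows "level (map (\<lambda>k. {1..k}) ks) < level Ss"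
proof -
  have len: "length Ss = length ks" using Ss by (simp add: in_k_subset_lists)
  have ge: "(\<Sum>s\<in>{1..ks ! j}. s) + card (Ss ! j - {1..ks ! j}) \<le> (\<Sum>s\<in>Ss ! j. s)" if "j < length ks" for j
    by (rule sum_ge_initial) (use Ss that in \<open>auto simp: in_k_subset_lists\<close>)
  have "\<exists>j<length ks. Ss ! j \<noteq> {1..ks ! j}"
    using ne len by (auto simp: list_eq_iff_nth_eq)
  then obtain j where j: "j < length ks" "Ss ! j \<noteq> {1..ks ! j}" by blast
  have "finite (Ss ! j)" "card (Ss ! j) = card {1..ks ! j}"
    using Ss j(1) by (auto simp: in_k_subset_lists intro: finite_subset)
  then have "Ss ! j - {1..ks ! j} \<noteq> {}" using j(2) by (metis Diff_eq_empty_iff card_subset_eq finite_atLeastAtMost)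
  then have "card (Ss ! j - {1..ks ! j}) > 0" using \<open>finite (Ss ! j)\<close> by (simp add: card_gt_0_iff)
  then have lt: "(\<Sum>s\<in>{1..ks ! j}. s) < (\<Sum>s\<in>Ss ! j. s)" using ge[OF j(1)] by linarith
  have "(\<Sum>j<length ks. \<Sum>s\<in>{1..ks ! j}. s) < (\<Sum>j<length ks. \<Sum>s\<in>Ss ! j. s)"
  proof (rule sum_strict_mono_ex1)
    show "\<forall>j\<in>{..<length ks}. (\<Sum>s\<in>{1..ks ! j}. s) \<le> (\<Sum>s\<in>Ss ! j. s)" using ge by force
    show "\<exists>j\<in>{..<length ks}. (\<Sum>s\<in>{1..ks ! j}. s) < (\<Sum>s\<in>Ss ! j. s)" using lt j by blast
  qed simp
  then have "real (\<Sum>j<length ks. \<Sum>s\<in>{1..ks ! j}. s) < real (\<Sum>j<length ks. \<Sum>s\<in>Ss ! j. s)"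
    by (simp only: of_nat_less_iff)
  then show ?thesis using len by (simp add: level_def)
qed

lemma weight_factor_ray:
  assumes L: "L > 0" and Ss: "Ss \<in> k_subset_lists L ks" and Ts: "Ts \<in> k_subset_lists L ks"
  shows "weight_factor L (ray L t) Ss / weight_factor L (ray L t) Ts = of_real (exp (t * (2 * pi / L * (level Ts - level Ss))))"
proof -
  define K where "K = (\<Sum>j<length ks. real (ks ! j)) * ((real L + 1) / 2)"
  have W: "weight_factor L (ray L t) Us = of_real (exp (t * (2 * pi / L * (K - level Us))))"
    if Us: "Us \<in> k_subset_lists L ks" for Us
  proof -
    have len: "length Us = length ks" using Us by (simp add: in_k_subset_lists)
    let ?r = "\<lambda>s. t * (2 * pi / L * ((real L + 1) / 2 - real s))"
    have r: "omega_pow L (ray L t s) = of_real (exp (?r s))" if "s \<in> {1..L}" for s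
      using that by (simp add: omega_pow_def ray_def exp_of_real[symmetric] field_simps)
    have "weight_factor L (ray L t) Us = (\<Prod>j<length ks. \<Prod>s\<in>Us ! j. of_real (exp (?r s)))"
      unfolding weight_factor_eq[OF ray_hdual Us] len
    proof (intro prod.cong refl r)
      fix j s assume "j \<in> {..<length ks}" "s \<in> Us ! j"
      then show "s \<in> {1..L}" using Us unfolding in_k_subset_lists by blast
    qed
    also have "\<dots> = of_real (exp (\<Sum>j<length ks. \<Sum>s\<in>Us ! j. ?r s))"
    proof -
      have "finite (Us ! j)" if "j < length ks" for j
        using Us that by (auto simp: in_k_subset_lists intro: finite_subset)
      then show ?thesis by (simp add: exp_sum)
    qed
    also have "(\<Sum>j<length ks. \<Sum>s\<in>Us ! j. ?r s) = t * (2 * pi / L * (K - level Us))"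
    proof -
      have "(\<Sum>j<length ks. \<Sum>s\<in>Us ! j. (real L + 1) / 2 - real s) = K - level Us"
        unfolding K_def level_def len sum_subtractf sum_distrib_right
        by (intro arg_cong2[of _ _ _ _ "(-)"] sum.cong refl) (use Us in \<open>simp add: in_k_subset_lists\<close>)
      then show ?thesis by (simp only: sum_distrib_left[symmetric])
    qed
    finally show ?thesis .
  qed
  have "t * (2 * pi / L * (K - level Ss)) - t * (2 * pi / L * (K - level Ts)) =
      t * (2 * pi / L * (level Ts - level Ss))"
    by (simp only: right_diff_distrib)
  then show ?thesis unfolding W[OF Ss] W[OF Ts] of_real_divide[symmetric] exp_diff[symmetric] by simp
qed

lemma config_ks_range: "good_config L C \<Longrightarrow> k \<in> set (config_ks L d C) \<Longrightarrow> k \<in> {1..L}"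
  by (auto simp: good_config_def config_ks_def comp_ks_def)

text \<open>Dividing each state by its dominant weight changes the determinant only by a factor. By
  strict dominance the rescaled determinant tends along the ray to that of the limiting states times
  their contraction factors, which is nonzero.\<close>

lemma exists_det_neq_0:
  assumes L: "L > 0" and p: "p \<notin> \<rat>"
    and C: "\<And>m. m \<in> monom_set L d \<Longrightarrow> good_config L (C m)"
      "inj_on (\<lambda>m. config_bell L p (C m) d) (monom_set L d)"
      "graded L d \<subseteq> pol.span ((\<lambda>m. config_bell L p (C m) d) ` monom_set L d)"
  shows "\<exists>a\<in>hdual L. Determinant.det (graded_mat L d
     (\<lambda>m. config_elem L p a (config_ks L d (C m)) (config_ys L d (C m)) d)) \<noteq> 0"
proof -
  let ?n = "card (monom_set L d)" and ?e = "mono_enum L d"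
  let ?ks = "\<lambda>m. config_ks L d (C m)" and ?ys = "\<lambda>m. config_ys L d (C m)"
  let ?dom = "\<lambda>m. map (\<lambda>k. {1..k}) (?ks m)"
  let ?sc = "\<lambda>m Ss. self_contr L p (map2 (vop_of_set L) Ss (?ys m))"
  define g where "g t m = config_elem L p (ray L t) (?ks m) (?ys m) d" for t m
  define c where "c t m = 1 / weight_factor L (ray L t) (?dom m)" for t m
  have em: "?e i \<in> monom_set L d" if "i < ?n" for i using bij_betw_apply[OF bij_mono_enum] that by simp
  have dom: "?dom m \<in> k_subset_lists L (?ks m)" if "m \<in> monom_set L d" for m
  proof -
    have "?ks m ! j \<in> {1..L}" if "j < length (?ks m)" for j
      using config_ks_range[OF C(1)[OF \<open>m \<in> monom_set L d\<close>] nth_mem[OF that]] .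
    then show ?thesis by (auto simp: in_k_subset_lists)
  qed
  have lim: "((\<lambda>t. Poly_Mapping.lookup (scal (c t m) (g t m)) u) \<longlongrightarrow>
      Poly_Mapping.lookup (scal (?sc m (?dom m)) (config_bell L p (C m) d)) u) at_top" if m: "m \<in> monom_set L d" for m u
  proof -
    let ?f = "\<lambda>Ss. ?sc m Ss * Poly_Mapping.lookup (coherent_state L p (content L Ss (?ys m)) d) u"
    have fin: "finite (k_subset_lists L (?ks m))" by (rule finite_listset) (auto simp: finite_k_subsets)
    have eq: "Poly_Mapping.lookup (scal (c t m) (g t m)) u = (\<Sum>Ss\<in>k_subset_lists L (?ks m).
       of_real (exp (t * (2 * pi / L * (level (?dom m) - level Ss)))) * ?f Ss)" for t
    proof -
      have "Poly_Mapping.lookup (scal (c t m) (g t m)) u = (\<Sum>Ss\<in>k_subset_lists L (?ks m).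
         weight_factor L (ray L t) Ss / weight_factor L (ray L t) (?dom m) * ?f Ss)"
        by (simp add: g_def c_def config_elem_def lookup_scal lookup_sum sum_distrib_left mult_ac)
      also have "\<dots> = (\<Sum>Ss\<in>k_subset_lists L (?ks m).
         of_real (exp (t * (2 * pi / L * (level (?dom m) - level Ss)))) * ?f Ss)"
        by (intro sum.cong refl arg_cong2[of _ _ _ _ "(*)"] weight_factor_ray[OF L _ dom[OF m]])
      finally show ?thesis .
    qed
    have "((\<lambda>t. \<Sum>Ss\<in>k_subset_lists L (?ks m). of_real (exp (t * (2 * pi / L * (level (?dom m) - level Ss)))) * ?f Ss)
       \<longlongrightarrow> (\<Sum>Ss\<in>k_subset_lists L (?ks m). (if Ss = ?dom m then 1 else 0) * ?f Ss)) at_top"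
    proof (intro tendsto_sum tendsto_mult tendsto_const)
      fix Ss assume Ss: "Ss \<in> k_subset_lists L (?ks m)"
      show "((\<lambda>t. complex_of_real (exp (t * (2 * pi / L * (level (?dom m) - level Ss))))) \<longlongrightarrow> (if Ss = ?dom m then 1 else 0)) at_top"
      proof (cases "Ss = ?dom m")
        case False
        have neg: "2 * pi / L * (level (?dom m) - level Ss) < 0"
          by (rule mult_pos_neg) (use level_dominant[OF Ss False] L in simp_all)
        have "filterlim (\<lambda>t. t * (2 * pi / L * (level (?dom m) - level Ss))) at_bot at_top"
          using filterlim_tendsto_neg_mult_at_bot[OF tendsto_const neg filterlim_ident]
          by (simp only: mult.commute[of _ "2 * pi / L * (level (?dom m) - level Ss)"])
        then have "((\<lambda>t. exp (t * (2 * pi / L * (level (?dom m) - level Ss)))) \<longlongrightarrow> 0) at_top"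
          by (rule filterlim_compose[OF exp_at_bot])
        then show ?thesis using False tendsto_of_real[where 'a = complex] by fastforce
      qed simp
    qed
    also have "(\<Sum>Ss\<in>k_subset_lists L (?ks m). (if Ss = ?dom m then 1 else 0) * ?f Ss) = ?f (?dom m)"
      using fin dom[OF m] by (simp add: if_distrib[of "\<lambda>c. c * _"] cong: if_cong)
    also have "?f (?dom m) = Poly_Mapping.lookup (scal (?sc m (?dom m)) (config_bell L p (C m) d)) u"
      using coherent_state_config[OF C(1)[OF m] L, of p d] by (simp add: dominant_content_def lookup_scal)
    finally show ?thesis unfolding eq .
  qed
  let ?h = "\<lambda>m. scal (?sc m (?dom m)) (config_bell L p (C m) d)"
  have "((\<lambda>t. Determinant.det (graded_mat L d (\<lambda>m. scal (c t m) (g t m)))) \<longlongrightarrow> Determinant.det (graded_mat L d ?h)) at_top"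
    unfolding det_graded_mat
  proof (intro tendsto_sum tendsto_mult tendsto_const tendsto_prod lim)
    fix q i assume "q \<in> {q. q permutes {0..<?n}}" "i \<in> {0..<?n}"
    then show "?e (q i) \<in> monom_set L d" using permutes_in_image[of q "{0..<?n}" i] by (intro em) simp
  qed
  moreover have "Determinant.det (graded_mat L d ?h) \<noteq> 0"
  proof -
    have "Determinant.det (graded_mat L d (\<lambda>m. config_bell L p (C m) d)) \<noteq> 0"
      by (rule det_graded_mat_neq_0[OF _ C(2,3)]) (use config_bell_graded[OF C(1) L] in auto)
    moreover have "(\<Prod>i=0..<?n. ?sc (?e i) (?dom (?e i))) \<noteq> 0"
      by (rule prod_nonzeroI) (use spread_self_contr[OF L p C(1)] em in auto)
    ultimately show ?thesis unfolding det_graded_mat_scal by simp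
  qed
  ultimately have "\<forall>\<^sub>F t in at_top. Determinant.det (graded_mat L d (\<lambda>m. scal (c t m) (g t m))) \<noteq> 0"
    by (rule tendsto_imp_eventually_ne)
  then obtain t where "Determinant.det (graded_mat L d (\<lambda>m. scal (c t m) (g t m))) \<noteq> 0"
    using eventually_happens'[OF trivial_limit_at_top_linorder] by blast
  then have "Determinant.det (graded_mat L d (g t)) \<noteq> 0" unfolding det_graded_mat_scal by auto
  then show ?thesis using ray_hdual[of L t] unfolding g_def by blast
qed

section \<open>Exceptional weights\<close>

lemma entire_const: "entire_on_hdual L (\<lambda>a. c)"
  by (simp add: entire_on_hdual_def)

lemma entire_mult: "entire_on_hdual L F \<Longrightarrow> entire_on_hdual L G \<Longrightarrow> entire_on_hdual L (\<lambda>a. F a * G a)"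
  by (auto simp: entire_on_hdual_def intro!: continuous_on_mult holomorphic_on_mult)

lemma entire_add: "entire_on_hdual L F \<Longrightarrow> entire_on_hdual L G \<Longrightarrow> entire_on_hdual L (\<lambda>a. F a + G a)"
  by (auto simp: entire_on_hdual_def intro!: continuous_on_add holomorphic_on_add)

lemma entire_sum: "(\<And>i. i \<in> A \<Longrightarrow> entire_on_hdual L (F i)) \<Longrightarrow> entire_on_hdual L (\<lambda>a. \<Sum>i\<in>A. F i a)"
  by (induction A rule: infinite_finite_induct) (auto intro: entire_const entire_add)

lemma entire_prod: "(\<And>i. i \<in> A \<Longrightarrow> entire_on_hdual L (F i)) \<Longrightarrow> entire_on_hdual L (\<lambda>a. \<Prod>i\<in>A. F i a)"
  by (induction A rule: infinite_finite_induct) (auto intro: entire_const entire_mult)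

lemma entire_prod_list: "(\<And>i. i \<in> set xs \<Longrightarrow> entire_on_hdual L (F i)) \<Longrightarrow> entire_on_hdual L (\<lambda>a. \<Prod>i\<leftarrow>xs. F i a)"
  by (induction xs) (auto intro: entire_const entire_mult)

lemma entire_omega_pow: "entire_on_hdual L (\<lambda>a. omega_pow L (hform L a b))"
  unfolding entire_on_hdual_def
proof (intro conjI ballI)
  have "continuous_on (hdual L) (\<lambda>a::nat \<Rightarrow> complex. a s)" for s
    by (rule continuous_on_subset[OF continuous_on_product_coordinates]) simp
  then show "continuous_on (hdual L) (\<lambda>a. omega_pow L (hform L a b))"
    unfolding omega_pow_def hform_def divide_inverse by (intro continuous_intros)
  show "(\<lambda>z. omega_pow L (hform L (\<lambda>s. a s + z * v s) b)) holomorphic_on UNIV" for a v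
    unfolding omega_pow_def hform_def divide_inverse by (intro holomorphic_intros)
qed

lemma entire_det:
  "entire_on_hdual L (\<lambda>a. Determinant.det (graded_mat L d (\<lambda>m. config_elem L p a (ks m) (ys m) d)))"
proof -
  have w: "entire_on_hdual L (\<lambda>a. weight_factor L a Ss)" for Ss
    unfolding weight_factor_def by (intro entire_prod_list entire_omega_pow)
  show ?thesis
    unfolding det_graded_mat config_elem_def lookup_sum lookup_scal
    by (intro entire_sum entire_mult entire_prod entire_const w)
qed

section \<open>The action of the Weyl group on entire functions and on exceptional sets\<close>

lemma simple_refl_involution: "i \<in> {1..L-1} \<Longrightarrow> simple_refl L i (simple_refl L i a) = a"
  by (simp add: simple_refl_eq comp_assoc)

lemma simple_refl_in_weyl: "i \<in> {1..L-1} \<Longrightarrow> simple_refl L i \<in> weyl L"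
  using weyl_step[OF weyl_id] by simp

lemma weyl_inverse: "w \<in> weyl L \<Longrightarrow> \<exists>w'\<in>weyl L. (\<forall>a. w' (w a) = a) \<and> (\<forall>a. w (w' a) = a)"
proof (induction rule: weyl.induct)
  case weyl_id
  show ?case by (rule bexI[of _ id]) (simp_all add: weyl.weyl_id)
next
  case (weyl_step w i)
  then obtain w' where w': "w' \<in> weyl L" "\<forall>a. w' (w a) = a" "\<forall>a. w (w' a) = a" by blast
  show ?case
    by (rule bexI[OF _ weyl_comp[OF w'(1) simple_refl_in_weyl[OF weyl_step(2)]]])
       (simp add: simple_refl_involution[OF weyl_step(2)] w')
qed

lemma entire_simple_refl:
  assumes F: "entire_on_hdual L F" and i: "i \<in> {1..L-1}"
  shows "entire_on_hdual L (\<lambda>a. F (simple_refl L i a))"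
  unfolding entire_on_hdual_def
proof (intro conjI ballI)
  have "continuous_on (hdual L) (simple_refl L i)"
    unfolding simple_refl_eq[OF i, abs_def] comp_def
    by (intro continuous_on_coordinatewise_then_product continuous_on_subset[OF continuous_on_product_coordinates])
      simp
  then show "continuous_on (hdual L) (\<lambda>a. F (simple_refl L i a))"
    using F simple_refl_hdual[OF _ i] unfolding entire_on_hdual_def
    by (intro continuous_on_compose2[of "hdual L" F "hdual L" "simple_refl L i"]) auto
  fix a v assume av: "a \<in> hdual L" "v \<in> hdual L"
  have "simple_refl L i (\<lambda>s. a s + z * v s) = (\<lambda>s. simple_refl L i a s + z * simple_refl L i v s)" for z
    by (simp add: simple_refl_eq[OF i] comp_def)
  then show "(\<lambda>z. F (simple_refl L i (\<lambda>s. a s + z * v s))) holomorphic_on UNIV"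
    using F simple_refl_hdual[OF av(1) i] simple_refl_hdual[OF av(2) i] by (simp add: entire_on_hdual_def)
qed

lemma entire_weyl: "w \<in> weyl L \<Longrightarrow> entire_on_hdual L F \<Longrightarrow> entire_on_hdual L (\<lambda>a. F (w a))"
proof (induction arbitrary: F rule: weyl.induct)
  case (weyl_step w i)
  from weyl_step.IH[OF entire_simple_refl[OF weyl_step.prems weyl_step.hyps(2)]] show ?case by simp
qed simp

text \<open>Group elements come from finite words in the simple reflections; countability suffices
  to enumerate the zero sets.\<close>

lemma countable_weyl: "countable (weyl L)"
proof -
  have "w \<in> range (\<lambda>l. foldr (\<lambda>i w. simple_refl L i \<circ> w) l id)" if "w \<in> weyl L" for w
    using that
  proof (induction rule: weyl.induct)
    case weyl_id
    show ?case by (rule range_eqI[of _ _ "[]"]) simp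
  next
    case (weyl_step w i)
    then obtain l where "w = foldr (\<lambda>i w. simple_refl L i \<circ> w) l id" by blast
    then have "simple_refl L i \<circ> w = foldr (\<lambda>i w. simple_refl L i \<circ> w) (i # l) id"
      by (simp only: foldr.simps comp_apply)
    then show ?case by (rule range_eqI)
  qed
  then have "weyl L \<subseteq> range (\<lambda>l. foldr (\<lambda>i w. simple_refl L i \<circ> w) l id)" by blast
  then show ?thesis by (rule countable_subset) simp
qed

text \<open>Composing each D d with all group elements keeps the functions entire and makes the
  union of zero sets invariant; the pairs of a degree and a group element are enumerated by
  \<open>prod_decode\<close>.\<close>

lemma exceptional_orbit_set:
  fixes D :: "nat \<Rightarrow> (nat \<Rightarrow> complex) \<Rightarrow> complex"
  assumes D: "\<And>d. entire_on_hdual L (D d)" "\<And>d. \<exists>a\<in>hdual L. D d a \<noteq> 0"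
  defines "E \<equiv> {a \<in> hdual L. \<exists>w\<in>weyl L. \<exists>d. D d (w a) = 0}"
  shows "exceptional_set L E" "w \<in> weyl L \<Longrightarrow> w ` E = E"
proof -
  define W where "W n = from_nat_into (weyl L) n" for n
  have W: "range W = weyl L"
    unfolding W_def by (rule range_from_nat_into[OF _ countable_weyl]) (use weyl_id in auto)
  define F where "F n a = D (fst (prod_decode n)) (W (snd (prod_decode n)) a)" for n a
  have inW: "W n \<in> weyl L" for n using W by auto
  have "E = (\<Union>n. {a \<in> hdual L. F n a = 0})"
  proof (intro equalityI subsetI)
    fix a assume "a \<in> E"
    then obtain w d where a: "a \<in> hdual L" "w \<in> weyl L" "D d (w a) = 0" by (auto simp: E_def)
    obtain n where "w = W n" using a(2) W by (metis rangeE)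
    then have "F (prod_encode (d, n)) a = 0" using a by (simp add: F_def)
    then show "a \<in> (\<Union>n. {a \<in> hdual L. F n a = 0})" using a by blast
  next
    fix a assume "a \<in> (\<Union>n. {a \<in> hdual L. F n a = 0})"
    then show "a \<in> E" using inW by (auto simp: E_def F_def)
  qed
  moreover have "entire_on_hdual L (F n)" for n
    unfolding F_def[abs_def] by (rule entire_weyl[OF inW D(1)])
  \<comment> \<open>A point where D d does not vanish is moved by the inverse group element.\<close>
  moreover have "\<exists>a\<in>hdual L. F n a \<noteq> 0" for n
  proof -
    obtain a where a: "a \<in> hdual L" "D (fst (prod_decode n)) a \<noteq> 0" using D(2) by blast
    obtain w' where w': "w' \<in> weyl L" "\<forall>a. W (snd (prod_decode n)) (w' a) = a" using weyl_inverse[OF inW] by blast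
    show ?thesis by (rule bexI[OF _ weyl_hdual[OF w'(1) a(1)]]) (simp add: F_def w' a)
  qed
  ultimately show "exceptional_set L E"
    unfolding exceptional_set_def by (intro exI[of _ F] conjI allI)
  have closed: "w a \<in> E" if w: "w \<in> weyl L" and a: "a \<in> E" for w a
  proof -
    obtain v d where v: "a \<in> hdual L" "v \<in> weyl L" "D d (v a) = 0" using a by (auto simp: E_def)
    obtain w' where w': "w' \<in> weyl L" "\<forall>a. w' (w a) = a" using weyl_inverse[OF w] by blast
    have "D d ((v \<circ> w') (w a)) = 0" using v w' by simp
    moreover have "w a \<in> hdual L" by (rule weyl_hdual[OF w v(1)])
    ultimately show ?thesis
      using weyl_comp[OF v(2) w'(1)] unfolding E_def
      by (intro CollectI conjI bexI[of _ "v \<circ> w'"] exI[of _ d])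
  qed
  show "w ` E = E" if w: "w \<in> weyl L"
  proof
    show "w ` E \<subseteq> E" using closed[OF w] by blast
    obtain w' where w': "w' \<in> weyl L" "\<forall>a. w (w' a) = a" using weyl_inverse[OF w] by blast
    show "E \<subseteq> w ` E"
    proof
      fix a assume "a \<in> E"
      then show "a \<in> w ` E" using closed[OF w'(1)] w'(2) by (metis image_eqI)
    qed
  qed
qed

lemma inv_into_linear_desc:
  assumes g: "bij_betw g (desc_alg L) (desc_alg L)" and lin: "pol_linear g"
    and h: "h \<in> desc_alg L" "h' \<in> desc_alg L"
  shows "inv_into (desc_alg L) g (h + h') = inv_into (desc_alg L) g h + inv_into (desc_alg L) g h'"
    and "inv_into (desc_alg L) g (scal c h) = scal c (inv_into (desc_alg L) g h)"
proof -
  let ?i = "inv_into (desc_alg L) g"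
  have i: "?i u \<in> desc_alg L" "g (?i u) = u" if "u \<in> desc_alg L" for u
    using g that bij_betw_imp_surj_on[OF g] by (auto simp: inv_into_into f_inv_into_f)
  have inj: "?i (g u) = u" if "u \<in> desc_alg L" for u
    using that g by (auto simp: bij_betw_def)
  have "?i (g (?i h + ?i h')) = ?i h + ?i h'" "?i (g (scal c (?i h))) = scal c (?i h)"
    by (intro inj desc_alg_subspace i h)+
  then show "?i (h + h') = ?i h + ?i h'" "?i (scal c h) = scal c (?i h)"
    by (simp_all only: pol_linear_add[OF lin] pol_linear_scal[OF lin] i h)
qed

theorem theorem4:
  fixes L :: nat and p :: real
  assumes "L \<ge> 2" and "0 < p" and "p < 1" and "p \<notin> \<rat>"
  shows "\<exists>(E :: (nat \<Rightarrow> complex) set)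
            (r :: (nat \<Rightarrow> complex) \<Rightarrow> ((nat \<Rightarrow> complex) \<Rightarrow> (nat \<Rightarrow> complex)) \<Rightarrow> pol \<Rightarrow> pol).
    exceptional_set L E \<and> (\<forall>w\<in>weyl L. w ` E = E) \<and>
    (\<forall>a\<in>hdual L - E.
       (\<forall>w\<in>weyl L. linear_on_desc L (r a w) \<and> bij_betw (r a w) (desc_alg L) (desc_alg L)) \<and>
       (\<forall>h\<in>desc_alg L. r a id h = h) \<and>
       (\<forall>w\<in>weyl L. \<forall>w'\<in>weyl L. \<forall>h\<in>desc_alg L. r a (w' \<circ> w) h = r (w a) w' (r a w h)) \<and>
       (\<forall>w\<in>weyl L. \<forall>h\<in>desc_alg L. \<forall>h'\<in>desc_alg L. \<forall>N. \<forall>ks xs.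
          length ks = N \<and> set ks \<subseteq> {1..L-1} \<and> length xs = N \<and> regular_point L xs \<longrightarrow>
          J_tilde L p a h h' ks xs =
          J_tilde L p (w a) (r a w h) (r (wstar L a) (wtilde L w) h') ks xs))"
proof -
  have L: "L > 0" using assms(1) by simp
  note p = assms(4)
  let ?A = "desc_alg L"
  \<comment> \<open>The configurations do not depend on \<open>a\<close>: invariance compares the
    states of one and the same configuration at the weights a and w a.\<close>
  obtain C where C: "\<And>d. (\<forall>m\<in>monom_set L d. good_config L (C d m)) \<and>
      inj_on (\<lambda>m. config_bell L p (C d m) d) (monom_set L d) \<and>
      graded L d \<subseteq> pol.span ((\<lambda>m. config_bell L p (C d m) d) ` monom_set L d)"
    using exists_configs[OF L p] by metis
  define ks where "ks m = config_ks L (mono_deg m) (C (mono_deg m) m)" for m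
  define ys where "ys m = config_ys L (mono_deg m) (C (mono_deg m) m)" for m
  define g where "g a m = config_elem L p a (ks m) (ys m) (mono_deg m)" for a m
  define D where "D d a = Determinant.det (graded_mat L d
     (\<lambda>m. config_elem L p a (config_ks L d (C d m)) (config_ys L d (C d m)) d))" for d a
  have D_eq: "Determinant.det (graded_mat L d (g a)) = D d a" for d a
    unfolding D_def
  proof (rule arg_cong[of _ _ Determinant.det])
    have "mono_deg (mono_enum L d j) = d" if "j < card (monom_set L d)" for j
      using bij_betw_apply[OF bij_mono_enum, of j L d] that by (simp add: monom_set_def)
    then show "graded_mat L d (g a) = graded_mat L d
       (\<lambda>m. config_elem L p a (config_ks L d (C d m)) (config_ys L d (C d m)) d)"
      unfolding graded_mat_def by (intro cong_mat) (simp_all add: g_def ks_def ys_def)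
  qed
  have D_entire: "entire_on_hdual L (D d)" for d
    unfolding D_def[abs_def] by (rule entire_det)
  have D_nonzero: "\<exists>a\<in>hdual L. D d a \<noteq> 0" for d
    unfolding D_def by (rule exists_det_neq_0[OF L p]) (use C in auto)
  \<comment> \<open>One set for all degrees, closed under the group, so that G is invertible along
    the whole orbit of a weight outside it.\<close>
  define E where "E = {a \<in> hdual L. \<exists>w\<in>weyl L. \<exists>d. D d (w a) = 0}"
  have E: "exceptional_set L E" "\<And>w. w \<in> weyl L \<Longrightarrow> w ` E = E"
    unfolding E_def using exceptional_orbit_set[OF D_entire D_nonzero] by auto
  define G where "G a = lin_ext (g a)" for a
  \<comment> \<open>In this form linearity, bijectivity and the cocycle rule are formal; only the
    equality of the functions uses the analysis above.\<close>
  define r where "r a w h = G (w a) (inv_into ?A (G a) h)"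
    for a and w :: "(nat \<Rightarrow> complex) \<Rightarrow> (nat \<Rightarrow> complex)" and h
  have ok: "w a \<in> hdual L - E" if a: "a \<in> hdual L - E" and w: "w \<in> weyl L" for a w
  proof -
    have "w a \<notin> E"
    proof
      assume "w a \<in> E"
      then obtain v d where v: "v \<in> weyl L" "D d (v (w a)) = 0" unfolding E_def by blast
      have "v \<circ> w \<in> weyl L" by (rule weyl_comp[OF v(1) w])
      moreover have "D d ((v \<circ> w) a) = 0" using v(2) by simp
      ultimately have "a \<in> E" using a unfolding E_def by blast
      then show False using a by blast
    qed
    then show ?thesis using weyl_hdual[OF w, of a] a by simp
  qed
  have bij: "bij_betw (G a) ?A ?A" if a: "a \<in> hdual L - E" for a
    unfolding G_def
  proof (rule lin_ext_bij)
    show "g a m \<in> graded L (mono_deg m)" for m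
      unfolding g_def config_elem_def
      by (intro graded_subspace coherent_state_graded)
    have "D d (id a) \<noteq> 0" for d using a weyl_id unfolding E_def by blast
    then show "Determinant.det (graded_mat L d (g a)) \<noteq> 0" for d by (simp add: D_eq)
  qed
  have lin: "pol_linear (G a)" for a unfolding G_def by (rule linear_lin_ext)
  have Ginv: "inv_into ?A (G a) h \<in> ?A" "G a (inv_into ?A (G a) h) = h"
    if "a \<in> hdual L - E" "h \<in> ?A" for a h
    using bij_betw_imp_surj_on[OF bij[OF that(1)]] that(2) by (auto simp: inv_into_into f_inv_into_f)
  have invG: "inv_into ?A (G a) (G a h) = h" if "a \<in> hdual L - E" "h \<in> ?A" for a h
    using bij[OF that(1)] that(2) by (auto simp: bij_betw_def)
  have linear: "linear_on_desc L (r a w)" if a: "a \<in> hdual L - E" for a w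
    unfolding linear_on_desc_def r_def
    by (simp add: inv_into_linear_desc[OF bij[OF a] lin] pol_linear_add[OF lin] pol_linear_scal[OF lin])
  have bij_r: "bij_betw (r a w) ?A ?A" if a: "a \<in> hdual L - E" and w: "w \<in> weyl L" for a w
    using bij_betw_trans[OF bij_betw_inv_into[OF bij[OF a]] bij[OF ok[OF a w]]]
    by (simp add: r_def[abs_def] comp_def)
  have r_id: "r a id h = h" if "a \<in> hdual L - E" "h \<in> ?A" for a h
    using Ginv[OF that] by (simp add: r_def)
  have cocycle: "r a (w' \<circ> w) h = r (w a) w' (r a w h)"
    if "a \<in> hdual L - E" "w \<in> weyl L" "h \<in> ?A" for a w w' h
    using invG[OF ok[OF that(1,2)] Ginv(1)[OF that(1,3)]] by (simp add: r_def)
  have star: "wstar L a \<in> hdual L - E" if "a \<in> hdual L - E" for a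
    by (rule ok[OF that wstar_in_weyl])
  have J: "J_tilde L p a h h' qs xs = J_tilde L p (w a) (r a w h) (r (wstar L a) (wtilde L w) h') qs xs"
    if a: "a \<in> hdual L - E" and w: "w \<in> weyl L" and h: "h \<in> ?A" "h' \<in> ?A"
      and xs: "length xs = length qs" "regular_point L xs" for a w h h' qs xs
  proof -
    define u where "u = inv_into ?A (G a) h"
    define v where "v = inv_into ?A (G (wstar L a)) h'"
    have u: "u \<in> ?A" "h = G a u" using Ginv[OF a h(1)] by (simp_all add: u_def)
    have v: "v \<in> ?A" "h' = G (wstar L a) v" using Ginv[OF star[OF a] h(2)] by (simp_all add: v_def)
    have ru: "r a w h = G (w a) u" by (simp add: r_def u_def)
    \<comment> \<open>As \<open>wstar\<close> is an involution, \<open>wtilde L w\<close> sends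
      wstar a to wstar (w a), the weight required for the second chirality.\<close>
    have rv: "r (wstar L a) (wtilde L w) h' = G (wstar L (w a)) v"
      by (simp add: r_def v_def wtilde_def wstar_wstar)
    have good: "good_config L (C (mono_deg m) m)" if "m \<in> Poly_Mapping.keys f" "f \<in> ?A" for m f
      using that keys_desc_alg[of f L] C by blast
    have x0: "0 \<notin> set xs" by (rule regular_point_neq_0[OF xs(2)])
    have ys: "regular_point L (ys m)" "length (ys m) = length (ks m)" "config_balanced L (mono_deg m) (ks m) (ys m)"
      if m: "m \<in> Poly_Mapping.keys f" "f \<in> ?A" for m f
      unfolding ys_def ks_def using good[OF m]
      by (simp_all add: regular_config[OF L p] length_config config_balanced_config[OF _ L])
    have span: "g b m \<in> coherent_span L p" if m: "m \<in> Poly_Mapping.keys f" "f \<in> ?A" for b m f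
      unfolding g_def by (rule config_elem_in_span[OF regular_point_neq_0[OF ys(1)[OF m]] ys(2,3)[OF m]])
    have spanG: "G b f \<in> coherent_span L p" if f: "f \<in> ?A" for b f
      unfolding G_def lin_ext_def coherent_span_def
      by (intro pol.span_sum pol.span_scale) (use span[OF _ f] in \<open>simp add: coherent_span_def\<close>)
    have expand: "J_tilde L p b (G c u) (G c' v) qs xs = (\<Sum>m\<in>Poly_Mapping.keys u. Poly_Mapping.lookup u m *
       (\<Sum>m'\<in>Poly_Mapping.keys v. Poly_Mapping.lookup v m' * J_tilde L p b (g c m) (g c' m') qs xs))" for b c c'
    proof -
      have "J_tilde L p b (G c u) (G c' v) qs xs = (\<Sum>m\<in>Poly_Mapping.keys u.
         Poly_Mapping.lookup u m * J_tilde L p b (g c m) (G c' v) qs xs)"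
        unfolding G_def[of c] lin_ext_def
        by (rule J_tilde_sum(1)[OF L p x0 span[OF _ u(1)] spanG[OF v(1)]])
      also have "\<dots> = (\<Sum>m\<in>Poly_Mapping.keys u. Poly_Mapping.lookup u m *
         (\<Sum>m'\<in>Poly_Mapping.keys v. Poly_Mapping.lookup v m' * J_tilde L p b (g c m) (g c' m') qs xs))"
        unfolding G_def lin_ext_def
        by (intro sum.cong refl arg_cong2[of _ _ _ _ "(*)"] J_tilde_sum(2)[OF L p x0 span[OF _ v(1)] span[OF _ u(1)]])
      finally show ?thesis .
    qed
    \<comment> \<open>In the expansion the coordinates of h and h' do not change under w; only the
      basis vectors move with the weight, so invariance of configurations is all that is
      left.\<close>
    have inv: "J_tilde L p a (g a m) (g (wstar L a) m') qs xs =
        J_tilde L p (w a) (g (w a) m) (g (wstar L (w a)) m') qs xs"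
      if m: "m \<in> Poly_Mapping.keys u" "m' \<in> Poly_Mapping.keys v" for m m'
      unfolding g_def
      by (rule J_tilde_config_invariant[OF assms(1) p w _ ys[OF m(1) u(1)] ys[OF m(2) v(1)] xs(2,1)])
        (use a in simp)
    show ?thesis
      unfolding ru rv unfolding u(2) v(2) expand
      by (intro sum.cong refl arg_cong2[of _ _ _ _ "(*)"] inv)
  qed
  show ?thesis
    by (intro exI[of _ E] exI[of _ r] conjI ballI allI impI E linear bij_r r_id cocycle J) auto
qed

end
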